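(* Let $p$ be a prime, let $G$ be a finite quasisimple group with simple quotient $S=G/Z(G)$, and let $\mathbf{B}$ be a $p$-block of $kG$ with a non-trivial cyclic defect group $D$. If $S$ is the alternating group $\mathfrak{A}_n$ with $n\geq 5$, then $W(\mathbf{B})\cong k$, the trivial $kD$-module.
   Context: $k$ is an algebraically closed field of characteristic $p$. Modules are finitely generated left modules. Endo-permutation modules: for a finite $p$-group $P$, a $kP$-module $W$ is endo-permutation if $\mathrm{End}_k(W)$ with the conjugation action of $P$ is a permutation $kP$-module; it is capped if it has an indecomposable direct summand with vertex $P$. Definition of $W(\mathbf{B})$: let $D_1$ be the subgroup of $D$ of order $p$ and let $\mathbf{b}$ be the Brauer correspondent of $\mathbf{B}$ in $N_G(D_1)$. The simple $\mathbf{b}$-modules have a common $kD$-source, denoted $W(\mathbf{B})$; it is an indecomposable capped endo-permutation $kD$-module on which $D_1$ acts trivially. *)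

theory Defs
  imports "HOL-Algebra.Algebra" "HOL-Computational_Algebra.Polynomial"
begin

section \<open>Groups\<close>

definition center :: "('g, 'x) monoid_scheme \<Rightarrow> 'g set" where
  "center G = {z \<in> carrier G. \<forall>x\<in>carrier G. z \<otimes>\<^bsub>G\<^esub> x = x \<otimes>\<^bsub>G\<^esub> z}"

definition centralizer :: "('g, 'x) monoid_scheme \<Rightarrow> 'g set \<Rightarrow> 'g set" where
  "centralizer G Q = {x \<in> carrier G. \<forall>q\<in>Q. x \<otimes>\<^bsub>G\<^esub> q = q \<otimes>\<^bsub>G\<^esub> x}"

definition quasisimple :: "('g, 'x) monoid_scheme \<Rightarrow> bool" where
  "quasisimple G \<longleftrightarrow>
     group G \<and> derived G (carrier G) = carrier G \<and> simple_group (G Mod center G)"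

definition p_subgroup :: "nat \<Rightarrow> 'g set \<Rightarrow> ('g, 'x) monoid_scheme \<Rightarrow> bool" where
  "p_subgroup p Q G \<longleftrightarrow> subgroup Q G \<and> (\<exists>n. card Q = p ^ n)"


section \<open>Left modules over a ring that need not be commutative\<close>

text \<open>The locale \<^locale>\<open>module\<close> of the library requires a commutative ring. Its record type,
  and the locale \<^locale>\<open>submodule\<close>, make sense over any ring and are used here.\<close>

locale left_module = R?: ring R + M?: abelian_group M
  for R :: "('a, 'x) ring_scheme" (structure) and M :: "('a, 'm, 'y) module_scheme" (structure) +
  assumes smult_closed:
      "\<lbrakk>a \<in> carrier R; x \<in> carrier M\<rbrakk> \<Longrightarrow> a \<odot>\<^bsub>M\<^esub> x \<in> carrier M"
    and smult_l_distr:
      "\<lbrakk>a \<in> carrier R; b \<in> carrier R; x \<in> carrier M\<rbrakk> \<Longrightarrow>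
       (a \<oplus>\<^bsub>R\<^esub> b) \<odot>\<^bsub>M\<^esub> x = a \<odot>\<^bsub>M\<^esub> x \<oplus>\<^bsub>M\<^esub> b \<odot>\<^bsub>M\<^esub> x"
    and smult_r_distr:
      "\<lbrakk>a \<in> carrier R; x \<in> carrier M; y \<in> carrier M\<rbrakk> \<Longrightarrow>
       a \<odot>\<^bsub>M\<^esub> (x \<oplus>\<^bsub>M\<^esub> y) = a \<odot>\<^bsub>M\<^esub> x \<oplus>\<^bsub>M\<^esub> a \<odot>\<^bsub>M\<^esub> y"
    and smult_assoc:
      "\<lbrakk>a \<in> carrier R; b \<in> carrier R; x \<in> carrier M\<rbrakk> \<Longrightarrow>
       (a \<otimes>\<^bsub>R\<^esub> b) \<odot>\<^bsub>M\<^esub> x = a \<odot>\<^bsub>M\<^esub> (b \<odot>\<^bsub>M\<^esub> x)"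
    and smult_one: "x \<in> carrier M \<Longrightarrow> \<one>\<^bsub>R\<^esub> \<odot>\<^bsub>M\<^esub> x = x"

definition fg_module :: "('a, 'x) ring_scheme \<Rightarrow> ('a, 'm, 'y) module_scheme \<Rightarrow> bool" where
  "fg_module R M \<longleftrightarrow> left_module R M \<and>
     (\<exists>S. finite S \<and> S \<subseteq> carrier M \<and> (\<forall>U. submodule U R M \<and> S \<subseteq> U \<longrightarrow> U = carrier M))"

definition module_iso ::
    "('a, 'x) ring_scheme \<Rightarrow> ('a, 'm, 'y) module_scheme \<Rightarrow> ('a, 'n, 'z) module_scheme \<Rightarrow> bool" where
  "module_iso R M N \<longleftrightarrow> (\<exists>f \<in> iso (add_monoid M) (add_monoid N).
     \<forall>a\<in>carrier R. \<forall>x\<in>carrier M. f (a \<odot>\<^bsub>M\<^esub> x) = a \<odot>\<^bsub>N\<^esub> f x)"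

definition direct_decomposition ::
    "('a, 'x) ring_scheme \<Rightarrow> ('a, 'm, 'y) module_scheme \<Rightarrow> 'm set \<Rightarrow> 'm set \<Rightarrow> bool" where
  "direct_decomposition R M U V \<longleftrightarrow>
     submodule U R M \<and> submodule V R M \<and> U \<inter> V = {\<zero>\<^bsub>M\<^esub>} \<and> U <+>\<^bsub>M\<^esub> V = carrier M"

definition iso_direct_summand ::
    "('a, 'x) ring_scheme \<Rightarrow> ('a, 'm, 'y) module_scheme \<Rightarrow> ('a, 'n, 'z) module_scheme \<Rightarrow> bool" where
  "iso_direct_summand R M N \<longleftrightarrow>
     (\<exists>U V. direct_decomposition R N U V \<and> module_iso R M (N\<lparr>carrier := U\<rparr>))"

definition indecomposable_module ::
    "('a, 'x) ring_scheme \<Rightarrow> ('a, 'm, 'y) module_scheme \<Rightarrow> bool" where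
  "indecomposable_module R M \<longleftrightarrow> left_module R M \<and> carrier M \<noteq> {\<zero>\<^bsub>M\<^esub>} \<and>
     (\<forall>U V. direct_decomposition R M U V \<longrightarrow> U = {\<zero>\<^bsub>M\<^esub>} \<or> V = {\<zero>\<^bsub>M\<^esub>})"

definition simple_module :: "('a, 'x) ring_scheme \<Rightarrow> ('a, 'm, 'y) module_scheme \<Rightarrow> bool" where
  "simple_module R M \<longleftrightarrow> left_module R M \<and> carrier M \<noteq> {\<zero>\<^bsub>M\<^esub>} \<and>
     (\<forall>U. submodule U R M \<longrightarrow> U = {\<zero>\<^bsub>M\<^esub>} \<or> U = carrier M)"


section \<open>Group algebras and their modules\<close>

definition delta :: "'g \<Rightarrow> 'k \<Rightarrow> 'g \<Rightarrow> 'k::zero" where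
  "delta x c = (\<lambda>y. if y = x then c else 0)"

text \<open>For a finite group \<open>G\<close>. Elements are coefficient functions that vanish outside \<open>G\<close>, so that
  for a subgroup \<open>H\<close> the carrier of \<open>kH\<close> is a subset of the carrier of \<open>kG\<close>.\<close>

definition group_algebra :: "('g, 'x) monoid_scheme \<Rightarrow> ('g \<Rightarrow> 'k::field) ring" where
  "group_algebra G = \<lparr>
     carrier = {a. \<forall>x. x \<notin> carrier G \<longrightarrow> a x = 0},
     monoid.mult = (\<lambda>a b x. if x \<in> carrier G
        then (\<Sum>y\<in>carrier G. a y * b (inv\<^bsub>G\<^esub> y \<otimes>\<^bsub>G\<^esub> x)) else 0),
     monoid.one = delta \<one>\<^bsub>G\<^esub> 1,
     ring.zero = (\<lambda>_. 0),
     ring.add = (\<lambda>a b x. a x + b x)\<rparr>"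

text \<open>A type in which module variables range. For finite \<open>G\<close> every finitely generated
  \<open>kG\<close>-module is a finite-dimensional vector space over \<open>k\<close>, hence isomorphic to one whose
  carrier is the set of sequences with support in \<open>{..<n}\<close> for some \<open>n\<close>. The operations on the
  carrier are given by the record; they need not be the pointwise ones.\<close>

type_synonym ('g, 'k) kmod = "('g \<Rightarrow> 'k, nat \<Rightarrow> 'k) module"

definition trivial_module :: "('g, 'x) monoid_scheme \<Rightarrow> ('g \<Rightarrow> 'k::field, 'k) module" where
  "trivial_module G = \<lparr>
     carrier = UNIV, monoid.mult = (*), monoid.one = 1, ring.zero = 0, ring.add = (+),
     module.smult = (\<lambda>a v. (\<Sum>g\<in>carrier G. a g) * v)\<rparr>"

text \<open>The module \<open>kG \<otimes>\<^bsub>kH\<^esub> L\<close> for a subgroup \<open>H\<close> of the finite group \<open>G\<close> and a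
  \<open>kH\<close>-module \<open>L\<close>, realised on functions: \<open>f\<close> stands for the sum of the tensors \<open>x \<otimes> f x\<close>
  where \<open>x\<close> runs over representatives of the left cosets \<open>xH\<close>. The condition on \<open>f\<close> says
  that \<open>x \<otimes> f x\<close> depends only on the coset, and \<open>delta \<one> c \<odot> v\<close> is the scalar
  multiple of \<open>v\<close> by \<open>c\<close>.\<close>

definition induced_module ::
    "('g, 'x) monoid_scheme \<Rightarrow> 'g set \<Rightarrow> ('g \<Rightarrow> 'k::field, 'm, 'y) module_scheme \<Rightarrow>
     ('g \<Rightarrow> 'k, 'g \<Rightarrow> 'm) module" where
  "induced_module G H L = \<lparr>
     carrier = {f \<in> carrier G \<rightarrow>\<^sub>E carrier L. \<forall>x\<in>carrier G. \<forall>h\<in>H.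
        f (x \<otimes>\<^bsub>G\<^esub> h) = delta (inv\<^bsub>G\<^esub> h) 1 \<odot>\<^bsub>L\<^esub> f x},
     monoid.mult = undefined,
     monoid.one = undefined,
     ring.zero = (\<lambda>x\<in>carrier G. \<zero>\<^bsub>L\<^esub>),
     ring.add = (\<lambda>f f'. \<lambda>x\<in>carrier G. f x \<oplus>\<^bsub>L\<^esub> f' x),
     module.smult = (\<lambda>a f. \<lambda>x\<in>carrier G.
        (\<Oplus>\<^bsub>L\<^esub>y\<in>carrier G. delta \<one>\<^bsub>G\<^esub> (a y) \<odot>\<^bsub>L\<^esub> f (inv\<^bsub>G\<^esub> y \<otimes>\<^bsub>G\<^esub> x)))\<rparr>"

definition relatively_projective ::
    "('g, 'x) monoid_scheme \<Rightarrow> 'g set \<Rightarrow> ('g, 'k::field) kmod \<Rightarrow> bool" where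
  "relatively_projective G H M \<longleftrightarrow> (\<exists>L :: ('g, 'k) kmod.
     fg_module (group_algebra (G\<lparr>carrier := H\<rparr>)) L \<and>
     iso_direct_summand (group_algebra G) M (induced_module G H L))"

definition is_vertex ::
    "('g, 'x) monoid_scheme \<Rightarrow> ('g, 'k::field) kmod \<Rightarrow> 'g set \<Rightarrow> bool" where
  "is_vertex G M Q \<longleftrightarrow>
     fg_module (group_algebra G) M \<and> indecomposable_module (group_algebra G) M \<and>
     subgroup Q G \<and> relatively_projective G Q M \<and>
     (\<forall>R. subgroup R G \<and> R \<subset> Q \<longrightarrow> \<not> relatively_projective G R M)"

text \<open>\<open>W\<close> is a \<open>kQ\<close>-source of \<open>M\<close>, where \<open>Q\<close> is a vertex of \<open>M\<close>.\<close>

definition is_source ::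
    "('g, 'x) monoid_scheme \<Rightarrow> ('g, 'k::field) kmod \<Rightarrow> 'g set \<Rightarrow> ('g, 'k) kmod \<Rightarrow> bool" where
  "is_source G M Q W \<longleftrightarrow> is_vertex G M Q \<and>
     fg_module (group_algebra (G\<lparr>carrier := Q\<rparr>)) W \<and>
     indecomposable_module (group_algebra (G\<lparr>carrier := Q\<rparr>)) W \<and>
     iso_direct_summand (group_algebra G) M (induced_module G Q W)"


section \<open>Blocks\<close>

definition central_idempotent :: "('a, 'x) ring_scheme \<Rightarrow> 'a \<Rightarrow> bool" where
  "central_idempotent A e \<longleftrightarrow>
     e \<in> carrier A \<and> e \<otimes>\<^bsub>A\<^esub> e = e \<and> (\<forall>a\<in>carrier A. e \<otimes>\<^bsub>A\<^esub> a = a \<otimes>\<^bsub>A\<^esub> e)"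

text \<open>A block of \<open>kG\<close> is represented by its identity element, a primitive idempotent of the
  centre of \<open>kG\<close>; the block as an algebra is the ideal it generates.\<close>

definition is_block :: "('g, 'x) monoid_scheme \<Rightarrow> ('g \<Rightarrow> 'k::field) \<Rightarrow> bool" where
  "is_block G B \<longleftrightarrow> (let A = group_algebra G in
     central_idempotent A B \<and> B \<noteq> \<zero>\<^bsub>A\<^esub> \<and>
     (\<forall>e f. central_idempotent A e \<and> central_idempotent A f \<and>
        e \<otimes>\<^bsub>A\<^esub> f = \<zero>\<^bsub>A\<^esub> \<and> B = e \<oplus>\<^bsub>A\<^esub> f \<longrightarrow> e = \<zero>\<^bsub>A\<^esub> \<or> f = \<zero>\<^bsub>A\<^esub>))"

definition in_block :: "('g \<Rightarrow> 'k::field) \<Rightarrow> ('g \<Rightarrow> 'k, 'm, 'y) module_scheme \<Rightarrow> bool" where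
  "in_block B M \<longleftrightarrow> (\<forall>x\<in>carrier M. B \<odot>\<^bsub>M\<^esub> x = x)"

text \<open>The Brauer homomorphism from the \<open>Q\<close>-fixed points of \<open>kG\<close> to the group algebra of the
  centralizer of \<open>Q\<close>: truncation of the coefficients.\<close>

definition brauer_hom ::
    "('g, 'x) monoid_scheme \<Rightarrow> 'g set \<Rightarrow> ('g \<Rightarrow> 'k::field) \<Rightarrow> 'g \<Rightarrow> 'k" where
  "brauer_hom G Q a = (\<lambda>x. if x \<in> centralizer G Q then a x else 0)"

definition is_defect_group ::
    "('g, 'x) monoid_scheme \<Rightarrow> ('g \<Rightarrow> 'k::field) \<Rightarrow> 'g set \<Rightarrow> bool" where
  "is_defect_group G B D \<longleftrightarrow>
     p_subgroup CHAR('k) D G \<and> brauer_hom G D B \<noteq> (\<lambda>_. 0) \<and>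
     (\<forall>Q. p_subgroup CHAR('k) Q G \<and> D \<subset> Q \<longrightarrow> brauer_hom G Q B = (\<lambda>_. 0))"

text \<open>For a block \<open>B\<close> of \<open>kG\<close> with defect group \<open>D\<close> and a subgroup \<open>H\<close> containing the
  normalizer of \<open>D\<close>, Brauer's first main theorem (in its extended form) says that there is
  exactly one block of \<open>kH\<close> as described here.\<close>

definition brauer_correspondent ::
    "('g, 'x) monoid_scheme \<Rightarrow> 'g set \<Rightarrow> 'g set \<Rightarrow> ('g \<Rightarrow> 'k::field) \<Rightarrow> 'g \<Rightarrow> 'k" where
  "brauer_correspondent G H D B = (THE b.
     is_block (G\<lparr>carrier := H\<rparr>) b \<and> is_defect_group (G\<lparr>carrier := H\<rparr>) b D \<and>
     brauer_hom (G\<lparr>carrier := H\<rparr>) D b = brauer_hom G D B)"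


section \<open>The module attached to a block with a cyclic defect group\<close>

definition order_p_subgroup :: "('g, 'x) monoid_scheme \<Rightarrow> nat \<Rightarrow> 'g set \<Rightarrow> 'g set" where
  "order_p_subgroup G p D = (THE Q. subgroup Q G \<and> Q \<subseteq> D \<and> card Q = p)"

definition is_common_source ::
    "('g, 'x) monoid_scheme \<Rightarrow> ('g \<Rightarrow> 'k::field) \<Rightarrow> 'g set \<Rightarrow> ('g, 'k) kmod \<Rightarrow> bool" where
  "is_common_source H b D W \<longleftrightarrow> (\<forall>M :: ('g, 'k) kmod.
     simple_module (group_algebra H) M \<and> in_block b M \<longrightarrow> is_source H M D W)"

text \<open>For a block \<open>B\<close> of \<open>kG\<close> with non-trivial cyclic defect group \<open>D\<close> this is
  determined up to isomorphism of \<open>kD\<close>-modules.\<close>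

definition W_module ::
    "('g, 'x) monoid_scheme \<Rightarrow> ('g \<Rightarrow> 'k::field) \<Rightarrow> 'g set \<Rightarrow> ('g, 'k) kmod" where
  "W_module G B D = (let
       N = normalizer G (order_p_subgroup G CHAR('k) D);
       b = brauer_correspondent G N D B
     in SOME W. is_common_source (G\<lparr>carrier := N\<rparr>) b D W)"

end

theory Submission
  imports Defs
begin

text \<open>Write \<open>D\<^sub>1\<close> for the subgroup of order \<open>p\<close> of \<open>D\<close>. If \<open>N\<^sub>G(D\<^sub>1) = N\<^sub>G(D)\<close>, then \<open>D\<close> is normal
  in \<open>N = N\<^sub>G(D\<^sub>1)\<close> and hence acts trivially on every simple \<open>kN\<close>-module. A simple module in the Brauer
  correspondent of the block is relatively \<open>D\<close>-projective by Higman's criterion, so it is a summand of a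
  module induced from the trivial \<open>kD\<close>-module, and no proper subgroup of \<open>D\<close> can serve as a vertex.
  Hence the common source is trivial.

  The equality \<open>N\<^sub>G(D\<^sub>1) = N\<^sub>G(D)\<close> needs no classification of the blocks of the alternating groups and
  their covers. A defect group is radical: it contains every \<open>p\<close>-subgroup between \<open>D\<close> and
  \<open>N\<^sub>G(D)\<close> that is normal in \<open>N\<^sub>G(D)\<close>. Modulo the center, \<open>D\<close> becomes a cyclic radical
  \<open>p\<close>-subgroup \<open>\<langle>s\<rangle>\<close> of \<open>A\<^sub>n\<close>. The elements that normalize \<open>\<langle>s\<rangle>\<close>, act trivially on it modulo
  \<open>p\<close>-th powers and stabilize the orbits of \<open>s\<close> form such a \<open>p\<close>-subgroup. It is too large
  unless \<open>s\<close> is trivial, or \<open>p\<close> is odd and \<open>s\<close> is a \<open>p\<close>-cycle, or \<open>p = 2\<close> and \<open>s\<close> is a product of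
  two transpositions; in the last case the even permutations of the support of \<open>s\<close> that commute with \<open>s\<close>
  form a larger one. If \<open>s\<close> is trivial, then \<open>D\<close> is central. If \<open>s\<close> is a \<open>p\<close>-cycle, then it is conjugate to
  another power of itself, which forces \<open>D\<close> to meet the center trivially, so that \<open>D\<^sub>1 = D\<close>.\<close>

section \<open>Actions of finite \<open>p\<close>-groups and Sylow subgroups\<close>

text \<open>The obstacle is that the Brauer correspondent is given by \<open>THE\<close> and
  \<open>W_module\<close> by \<open>SOME\<close>. So the correspondent must be identified uniquely,
  the trivial module must be shown to be a common source, and every common source must be shown to
  be trivial; without a simple module in the block every module would be a common source, so one is
  constructed. One fact about a normal \<open>p\<close>-subgroup \<open>H\<close> of
  \<open>N\<close> drives most of this: a central idempotent of \<open>kN\<close> is supported on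
  the centralizer of \<open>H\<close>. For \<open>H = D\<close> it shows that the correspondent is
  just the truncation of \<open>B\<close>, leaving only primitivity to prove; for a larger
  \<open>H\<close> it gives the radicality of \<open>D\<close>. Passing to the alternating group
  loses no information although \<open>p\<close> may divide the order of the center: a radical
  subgroup contains every central \<open>p\<close>-element. Module carriers are arbitrary sets, so
  linear algebra is reduced to dual bases, which turn vanishing statements into sums in
  \<open>k\<close> to which the counting of fixed points modulo \<open>p\<close> applies.\<close>

lemma prime_power_dvd_cases:
  fixes p :: nat
  assumes "Factorial_Ring.prime p" "d dvd p ^ n" "d \<noteq> 1"
  shows "p dvd d"
proof -
  obtain i where "d = p ^ i" using assms divides_primepow_nat by blast
  with assms(3) show ?thesis by (cases i) auto
qed

text \<open>Orbit lengths divide \<open>p ^ n\<close>, and a length 1 would be a fixed point. The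
  action is a bare function \<open>act\<close>, so that callers need not work with permutations
  restricted to \<open>S\<close>; the homomorphism to \<open>BijGroup S\<close> is built only
  here.\<close>

lemma p_dvd_card_if_no_fixed_point:
  fixes P (structure)
  assumes "group P" "card (carrier P) = p ^ n" "Factorial_Ring.prime p" "finite S"
    and closed: "\<And>g s. g \<in> carrier P \<Longrightarrow> s \<in> S \<Longrightarrow> act g s \<in> S"
    and one: "\<And>s. s \<in> S \<Longrightarrow> act \<one> s = s"
    and mult: "\<And>g h s. g \<in> carrier P \<Longrightarrow> h \<in> carrier P \<Longrightarrow> s \<in> S \<Longrightarrow>
      act (g \<otimes> h) s = act g (act h s)"
    and nofix: "\<And>s. s \<in> S \<Longrightarrow> \<exists>g\<in>carrier P. act g s \<noteq> s"
  shows "p dvd card S"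
proof -
  interpret group P by fact
  define \<phi> where "\<phi> = (\<lambda>g. \<lambda>s\<in>S. act g s)"
  have bij: "\<phi> g \<in> Bij S" if g: "g \<in> carrier P" for g
  proof -
    have "bij_betw (act g) S S"
      by (rule bij_betw_byWitness[where f' = "act (inv g)"])
        (use g in \<open>auto simp: closed one simp flip: mult\<close>)
    then show ?thesis
      unfolding Bij_def \<phi>_def by (simp add: bij_betw_restrict_eq)
  qed
  have "\<phi> \<in> hom P (BijGroup S)"
  proof (rule homI)
    fix g h assume gh: "g \<in> carrier P" "h \<in> carrier P"
    have "\<phi> (g \<otimes> h) = compose S (\<phi> g) (\<phi> h)"
      using gh by (auto simp: \<phi>_def compose_def mult closed)
    then show "\<phi> (g \<otimes> h) = \<phi> g \<otimes>\<^bsub>BijGroup S\<^esub> \<phi> h"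
      using bij gh by (simp add: BijGroup_def)
  qed (simp add: BijGroup_def bij)
  then interpret group_action P S \<phi>
    by (intro group_action.intro group_hom.intro group_hom_axioms.intro assms group_BijGroup)
  have "p dvd card orb" if "orb \<in> orbits P S \<phi>" for orb
  proof -
    obtain s where s: "s \<in> S" "orb = orbit P \<phi> s"
      using \<open>orb \<in> orbits P S \<phi>\<close> unfolding orbits_def by auto
    have "card orb * card (stabilizer P \<phi> s) = p ^ n"
      using orbit_stabilizer_theorem[OF s(1)] assms(2) s(2) by (simp add: Coset.order_def)
    then have "card orb dvd p ^ n" by (metis dvd_triv_left)
    moreover have "card orb \<noteq> 1"
    proof
      assume "card orb = 1"
      then obtain t where t: "orb = {t}" by (auto simp: card_1_singleton_iff)
      obtain g where g: "g \<in> carrier P" "act g s \<noteq> s" using nofix s(1) by blast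
      have "s \<in> orb" "act g s \<in> orb"
        using s g orbit_refl by (auto simp: orbit_def \<phi>_def intro!: exI[of _ g])
      with t g show False by auto
    qed
    ultimately show ?thesis using assms(3) prime_power_dvd_cases by blast
  qed
  then have "p dvd (\<Sum>orb\<in>orbits P S \<phi>. \<Sum>x\<in>orb. 1)"
    by - (rule dvd_sum, simp only: card_eq_sum)
  also have "\<dots> = card S"
    using disjoint_sum[OF assms(4), of "\<lambda>_. 1::nat"] by simp
  finally show ?thesis .
qed

text \<open>Moved points stay moved: if \<open>act g s\<close> is fixed, then applying
  \<open>inv g\<close> shows that it equals \<open>s\<close>. So the group acts on the complement of
  the fixed points, and does so without fixed points.\<close>

lemma card_fixed_points_mod:
  fixes P (structure)
  assumes "group P" "card (carrier P) = p ^ n" "Factorial_Ring.prime p" "finite S"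
    and closed: "\<And>g s. g \<in> carrier P \<Longrightarrow> s \<in> S \<Longrightarrow> act g s \<in> S"
    and one: "\<And>s. s \<in> S \<Longrightarrow> act \<one> s = s"
    and mult: "\<And>g h s. g \<in> carrier P \<Longrightarrow> h \<in> carrier P \<Longrightarrow> s \<in> S \<Longrightarrow>
      act (g \<otimes> h) s = act g (act h s)"
  shows "card S mod p = card {s \<in> S. \<forall>g\<in>carrier P. act g s = s} mod p"
proof -
  interpret group P by fact
  define F where "F = {s \<in> S. \<forall>g\<in>carrier P. act g s = s}"
  have "act g s \<in> S - F" if g: "g \<in> carrier P" and s: "s \<in> S - F" for g s
  proof -
    have "act g s \<notin> F"
    proof
      assume F: "act g s \<in> F"
      have "act (inv g) (act g s) = s"
        using g s by (simp flip: mult add: one)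
      moreover have "act (inv g) (act g s) = act g s"
        using F g by (simp add: F_def)
      ultimately show False using F s by simp
    qed
    then show ?thesis using closed g s by simp
  qed
  then have "p dvd card (S - F)"
    by (intro p_dvd_card_if_no_fixed_point[OF assms(1-3), where act = act])
      (use assms(4) one mult in \<open>auto simp: F_def\<close>)
  moreover have "card S = card (S - F) + card F"
    using assms(4) by (subst card_Diff_subset) (auto simp: F_def card_mono finite_subset)
  ultimately show ?thesis unfolding F_def[symmetric] by (auto elim!: dvdE)
qed

text \<open>Apply the counting lemma to the level sets of the summand.\<close>

lemma sum_fixed_points:
  fixes P (structure) and f :: "'s \<Rightarrow> 'k::field"
  assumes "group P" "card (carrier P) = p ^ n" "Factorial_Ring.prime p" "CHAR('k) = p"
    and "finite S"
    and closed: "\<And>g s. g \<in> carrier P \<Longrightarrow> s \<in> S \<Longrightarrow> act g s \<in> S"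
    and one: "\<And>s. s \<in> S \<Longrightarrow> act \<one> s = s"
    and mult: "\<And>g h s. g \<in> carrier P \<Longrightarrow> h \<in> carrier P \<Longrightarrow> s \<in> S \<Longrightarrow>
      act (g \<otimes> h) s = act g (act h s)"
    and inv: "\<And>g s. g \<in> carrier P \<Longrightarrow> s \<in> S \<Longrightarrow> f (act g s) = f s"
  shows "sum f S = sum f {s \<in> S. \<forall>g\<in>carrier P. act g s = s}"
proof -
  define F where "F = {s \<in> S. \<forall>g\<in>carrier P. act g s = s}"
  have fF: "finite F" "F \<subseteq> S" using assms(5) by (auto simp: F_def)
  have level: "sum f T = (\<Sum>c\<in>f ` S. of_nat (card {s \<in> T. f s = c}) * c)" if "T \<subseteq> S" for T
  proof -
    have fT: "finite T" using that assms(5) finite_subset by auto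
    have "sum f T = (\<Sum>c\<in>f ` S. sum f {s \<in> T. f s = c})"
      by (rule sum.group[symmetric]) (use fT that assms(5) in auto)
    also have "\<dots> = (\<Sum>c\<in>f ` S. of_nat (card {s \<in> T. f s = c}) * c)"
      by (rule sum.cong) (auto simp: sum.If_cases)
    finally show ?thesis .
  qed
  have "(of_nat (card {s \<in> S. f s = c}) :: 'k) = of_nat (card {s \<in> F. f s = c})" for c
  proof -
    have "card {s \<in> S. f s = c} mod p
        = card {s \<in> {s \<in> S. f s = c}. \<forall>g\<in>carrier P. act g s = s} mod p"
      by (rule card_fixed_points_mod[OF assms(1-3)]) (use assms(5) closed one mult inv in auto)
    also have "{s \<in> {s \<in> S. f s = c}. \<forall>g\<in>carrier P. act g s = s} = {s \<in> F. f s = c}"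
      by (auto simp: F_def)
    finally have eq: "card {s \<in> S. f s = c} mod p = card {s \<in> F. f s = c} mod p" .
    have of_nat_mod: "(of_nat (m mod p) :: 'k) = of_nat m" for m
    proof -
      have "(of_nat m :: 'k) = of_nat (p * (m div p) + m mod p)" by simp
      also have "\<dots> = of_nat (m mod p)"
        unfolding of_nat_add of_nat_mult by (simp flip: assms(4))
      finally show ?thesis by simp
    qed
    show ?thesis using eq of_nat_mod by metis
  qed
  then show ?thesis
    unfolding F_def[symmetric] using level[of S] level[OF fF(2)] by simp
qed

section \<open>Cosets and Sylow subgroups inside a given subgroup\<close>

context group
begin

lemma inv_mult_cancel [simp]:
  assumes "x \<in> carrier G" "y \<in> carrier G"
  shows "inv x \<otimes> (x \<otimes> y) = y" "x \<otimes> (inv x \<otimes> y) = y"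
  using assms by (simp_all flip: m_assoc)

lemma subgroup_conj_closed:
  assumes "subgroup H G" "g \<in> carrier G"
  shows "subgroup ((\<lambda>h. g \<otimes> h \<otimes> inv g) ` H) G"
proof (rule subgroupI)
  interpret H: subgroup H G by fact
  show "(\<lambda>h. g \<otimes> h \<otimes> inv g) ` H \<subseteq> carrier G" using assms H.subset by auto
  show "(\<lambda>h. g \<otimes> h \<otimes> inv g) ` H \<noteq> {}" using H.one_closed by blast
  fix a assume "a \<in> (\<lambda>h. g \<otimes> h \<otimes> inv g) ` H"
  then obtain h where h: "h \<in> H" "a = g \<otimes> h \<otimes> inv g" by blast
  have hc: "h \<in> carrier G" using h H.subset by auto
  have "inv a = g \<otimes> inv h \<otimes> inv g"
    using h hc assms(2) by (simp add: inv_mult_group m_assoc)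
  then show "inv a \<in> (\<lambda>h. g \<otimes> h \<otimes> inv g) ` H"
    using H.m_inv_closed h by blast
  fix b assume "b \<in> (\<lambda>h. g \<otimes> h \<otimes> inv g) ` H"
  then obtain h' where h': "h' \<in> H" "b = g \<otimes> h' \<otimes> inv g" by blast
  have hc': "h' \<in> carrier G" using h' H.subset by auto
  have "a \<otimes> b = g \<otimes> (h \<otimes> h') \<otimes> inv g" using h h' hc hc' assms(2) by (simp add: m_assoc)
  then show "a \<otimes> b \<in> (\<lambda>h. g \<otimes> h \<otimes> inv g) ` H"
    using H.m_closed h h' by blast
qed

lemma conj_conj:
  assumes "g \<in> carrier G" "h \<in> carrier G" "x \<in> carrier G"
  shows "g \<otimes> (h \<otimes> x \<otimes> inv h) \<otimes> inv g = (g \<otimes> h) \<otimes> x \<otimes> inv (g \<otimes> h)"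
  using assms by (simp add: inv_mult_group m_assoc)

lemma conj_inv_conj:
  assumes "g \<in> carrier G" "x \<in> carrier G"
  shows "inv g \<otimes> (g \<otimes> x \<otimes> inv g) \<otimes> g = x"
  using assms by (simp add: m_assoc)

lemma conj_eq_iff:
  assumes "g \<in> carrier G" "x \<in> carrier G" "y \<in> carrier G"
  shows "g \<otimes> x \<otimes> inv g = g \<otimes> y \<otimes> inv g \<longleftrightarrow> x = y"
  using conj_inv_conj assms by metis

lemma card_conj:
  assumes "H \<subseteq> carrier G" "g \<in> carrier G"
  shows "card ((\<lambda>h. g \<otimes> h \<otimes> inv g) ` H) = card H"
  using assms by (intro card_image inj_onI) (simp add: conj_eq_iff subset_iff)

text \<open>The exponent in Sylow's theorem is taken to be the full multiplicity of \<open>p\<close>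
  in the order of \<open>Y\<close>, so that the cofactor is prime to \<open>p\<close>.\<close>

lemma subgroup_sylow_exists:
  assumes "finite (carrier G)" "subgroup Y G" "Factorial_Ring.prime p"
  obtains P where "subgroup P G" "P \<subseteq> Y" "\<exists>n. card P = p ^ n" "card P dvd card Y"
    "\<not> p dvd card Y div card P"
proof -
  interpret Y: subgroup Y G by fact
  interpret YG: group "G\<lparr>carrier := Y\<rparr>" using subgroup_imp_group[OF assms(2)] .
  have fY: "finite Y" using Y.subset assms(1) finite_subset by blast
  then have "card Y \<noteq> 0" using Y.one_closed by (metis card_0_eq empty_iff)
  then obtain m where m: "card Y = p ^ multiplicity p (card Y) * m" "\<not> p dvd m"
    using assms(3) multiplicity_decompose'[of "card Y" p] not_prime_unit by metis
  obtain P where P: "subgroup P (G\<lparr>carrier := Y\<rparr>)" "card P = p ^ multiplicity p (card Y)"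
    using sylow_thm[OF assms(3) YG.group_axioms, of "multiplicity p (card Y)" m] m(1) fY
    by (auto simp: Coset.order_def)
  have "subgroup P G" using incl_subgroup[OF assms(2) P(1)] .
  moreover have "P \<subseteq> Y" using P(1) subgroup.subset by fastforce
  moreover have "card Y div card P = m"
    using m(1) P(2) assms(3) by (metis nonzero_mult_div_cancel_left not_prime_0 power_not_zero)
  ultimately show ?thesis using that[of P] P(2) m by (metis dvd_triv_left)
qed

lemma lcoset_eq_iff:
  assumes "subgroup H G" "x \<in> carrier G" "y \<in> carrier G"
  shows "x <# H = y <# H \<longleftrightarrow> inv x \<otimes> y \<in> H"
proof
  interpret H: subgroup H G by fact
  assume "x <# H = y <# H"
  then have "y \<in> x <# H" using assms H.one_closed unfolding l_coset_def by force
  then obtain h where "h \<in> H" "y = x \<otimes> h" unfolding l_coset_def by auto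
  then show "inv x \<otimes> y \<in> H" using assms H.subset by (auto simp: subset_iff simp flip: m_assoc)
next
  assume "inv x \<otimes> y \<in> H"
  then have "y \<in> x <# H"
    using subgroup.lcos_module_rev[OF assms(1) group_axioms assms(2,3)] by blast
  then show "x <# H = y <# H" using l_repr_independence assms by blast
qed

lemma card_lcosets:
  assumes "finite (carrier G)" "subgroup Y G" "subgroup P G" "P \<subseteq> Y"
  shows "card ((\<lambda>y. y <# P) ` Y) * card P = card Y"
proof -
  interpret Y: subgroup Y G by fact
  interpret P: subgroup P G by fact
  let ?S = "(\<lambda>y. y <# P) ` Y"
  have fY: "finite Y" using Y.subset assms(1) finite_subset by blast
  have sub: "y <# P \<subseteq> Y" if "y \<in> Y" for y
    using that assms(4) Y.m_closed unfolding l_coset_def by blast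
  have mem: "y \<in> y <# P" if "y \<in> Y" for y
    using that Y.subset P.one_closed unfolding l_coset_def by force
  have un: "\<Union> ?S = Y" using sub mem by blast
  have "card P * card ?S = card (\<Union> ?S)"
  proof (rule card_partition)
    show "finite ?S" "finite (\<Union> ?S)" using fY un by auto
    show "card c = card P" if c: "c \<in> ?S" for c
    proof -
      obtain y where y: "y \<in> Y" "c = y <# P" using c by auto
      have "c = (\<lambda>h. y \<otimes> h) ` P" using y unfolding l_coset_def by auto
      moreover have "inj_on (\<lambda>h. y \<otimes> h) P"
        using y Y.subset P.subset by (intro inj_onI) (auto simp: subset_iff)
      ultimately show ?thesis by (simp add: card_image)
    qed
    show "c1 \<inter> c2 = {}" if c: "c1 \<in> ?S" "c2 \<in> ?S" "c1 \<noteq> c2" for c1 c2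
    proof (rule ccontr)
      assume "c1 \<inter> c2 \<noteq> {}"
      then obtain z where z: "z \<in> c1" "z \<in> c2" by blast
      obtain y1 y2 where y: "y1 \<in> Y" "c1 = y1 <# P" "y2 \<in> Y" "c2 = y2 <# P" using c by blast
      then have "y1 \<in> carrier G" "y2 \<in> carrier G" using Y.subset by auto
      then have "c1 = z <# P" "c2 = z <# P"
        using l_repr_independence[OF _ _ assms(3)] y z by metis+
      with c show False by simp
    qed
  qed
  with un show ?thesis by (simp add: mult.commute)
qed

lemma l_coset_mult:
  assumes "subgroup P G" "r \<in> carrier G" "y \<in> carrier G"
  shows "r <# (y <# P) = (r \<otimes> y) <# P"
  using lcos_m_assoc[of P r y] subgroup.subset[OF assms(1)] assms by blast

text \<open>\<open>R\<close> acts by left multiplication on the cosets of \<open>P\<close> in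
  \<open>Y\<close>, and the condition on \<open>y\<close> says that its coset is fixed. The fixed
  cosets are kept explicit because they serve twice: a nonzero number of them gives conjugacy, and
  for \<open>R = P = D\<close> they are the cosets of \<open>D\<close> in the part of
  \<open>Y\<close> that normalizes \<open>D\<close>.\<close>

lemma card_fixed_lcosets_mod:
  assumes "finite (carrier G)" "subgroup Y G" "subgroup P G" "P \<subseteq> Y"
    and "subgroup R G" "R \<subseteq> Y" "card R = p ^ n" "Factorial_Ring.prime p"
  shows "(card Y div card P) mod p
    = card ((\<lambda>y. y <# P) ` {y \<in> Y. \<forall>r\<in>R. inv y \<otimes> r \<otimes> y \<in> P}) mod p"
proof -
  interpret Y: subgroup Y G by fact
  interpret P: subgroup P G by fact
  interpret R: subgroup R G by fact
  let ?S = "(\<lambda>y. y <# P) ` Y"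
  have fY: "finite Y" using Y.subset assms(1) finite_subset by blast
  have "finite P" using fY assms(4) finite_subset by blast
  then have cP: "card P > 0" using P.one_closed by (metis card_gt_0_iff empty_iff)
  interpret RG: group "G\<lparr>carrier := R\<rparr>" using subgroup_imp_group[OF assms(5)] .
  have "card ?S mod p = card {s \<in> ?S. \<forall>g\<in>carrier (G\<lparr>carrier := R\<rparr>). g <# s = s} mod p"
  proof (rule card_fixed_points_mod[of _ p n ?S])
    show "group (G\<lparr>carrier := R\<rparr>)" by (rule RG.group_axioms)
    show "card (carrier (G\<lparr>carrier := R\<rparr>)) = p ^ n" "Factorial_Ring.prime p" using assms by auto
    show "finite ?S" using fY by simp
    show "\<one>\<^bsub>G\<lparr>carrier := R\<rparr>\<^esub> <# s = s" if "s \<in> ?S" for s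
      using that Y.subset l_coset_mult[OF assms(3), of \<one>] by (auto simp: subset_iff)
    fix g s assume g: "g \<in> carrier (G\<lparr>carrier := R\<rparr>)" and s: "s \<in> ?S"
    obtain y where y: "y \<in> Y" "s = y <# P" using s by auto
    have gY: "g \<in> Y" using g assms(6) by auto
    show "g <# s \<in> ?S"
      using y gY Y.subset l_coset_mult[OF assms(3), of g y] by (auto simp: subset_iff)
    fix h assume h: "h \<in> carrier (G\<lparr>carrier := R\<rparr>)"
    have hY: "h \<in> Y" using h assms(6) by auto
    show "(g \<otimes>\<^bsub>G\<lparr>carrier := R\<rparr>\<^esub> h) <# s = g <# (h <# s)"
      using y gY hY Y.subset by (simp add: l_coset_mult[OF assms(3)] subset_iff m_assoc)
  qed
  moreover have "{s \<in> ?S. \<forall>g\<in>carrier (G\<lparr>carrier := R\<rparr>). g <# s = s}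
      = (\<lambda>y. y <# P) ` {y \<in> Y. \<forall>r\<in>R. inv y \<otimes> r \<otimes> y \<in> P}"
  proof -
    have "(r <# (y <# P) = y <# P) = (inv y \<otimes> r \<otimes> y \<in> P)" if "y \<in> Y" "r \<in> R" for y r
      using that assms(6) Y.subset lcoset_eq_iff[OF assms(3), of y "r \<otimes> y"]
      by (auto simp: l_coset_mult[OF assms(3)] subset_iff m_assoc)
    then show ?thesis by auto
  qed
  moreover have "card ?S = card Y div card P"
    using card_lcosets[OF assms(1-4)] cP by (metis nonzero_mult_div_cancel_right not_gr_zero)
  ultimately show ?thesis by simp
qed

text \<open>An index prime to \<open>p\<close> leaves a number of fixed cosets that is nonzero
  modulo \<open>p\<close>; a representative of a fixed coset is the conjugating element.\<close>

lemma sylow_conj: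
  assumes "finite (carrier G)" "subgroup Y G" "subgroup P G" "P \<subseteq> Y"
    and "subgroup R G" "R \<subseteq> Y" "card R = p ^ n" "Factorial_Ring.prime p"
    and "\<not> p dvd card Y div card P"
  obtains y where "y \<in> Y" "\<And>r. r \<in> R \<Longrightarrow> inv y \<otimes> r \<otimes> y \<in> P"
proof -
  have "card ((\<lambda>y. y <# P) ` {y \<in> Y. \<forall>r\<in>R. inv y \<otimes> r \<otimes> y \<in> P}) mod p \<noteq> 0"
    using card_fixed_lcosets_mod[OF assms(1-8)] assms(9) by (auto simp: dvd_eq_mod_eq_0)
  then have "{y \<in> Y. \<forall>r\<in>R. inv y \<otimes> r \<otimes> y \<in> P} \<noteq> {}" by fastforce
  then show ?thesis using that by blast
qed

lemma sylow_conj_eq: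
  assumes "finite (carrier G)" "subgroup Y G" "subgroup P G" "P \<subseteq> Y"
    and "subgroup R G" "R \<subseteq> Y" "card R = card P" "card P = p ^ n" "Factorial_Ring.prime p"
    and "\<not> p dvd card Y div card P"
  obtains y where "y \<in> Y" "(\<lambda>h. y \<otimes> h \<otimes> inv y) ` P = R"
proof -
  have fin: "finite P" "P \<subseteq> carrier G" "R \<subseteq> carrier G" "finite R"
    using assms(1,3,5) subgroup.subset finite_subset by blast+
  obtain y where y: "y \<in> Y" "\<And>r. r \<in> R \<Longrightarrow> inv y \<otimes> r \<otimes> y \<in> P"
    using sylow_conj[OF assms(1-6) _ assms(9,10)] assms(7,8) by metis
  have yc: "y \<in> carrier G" using y assms(2) subgroup.subset by blast
  have "R \<subseteq> (\<lambda>h. y \<otimes> h \<otimes> inv y) ` P"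
  proof
    fix r assume r: "r \<in> R"
    have "r = y \<otimes> (inv y \<otimes> r \<otimes> y) \<otimes> inv y"
      using conj_inv_conj[of "inv y" r] yc r fin by auto
    then show "r \<in> (\<lambda>h. y \<otimes> h \<otimes> inv y) ` P" using y(2)[OF r] by blast
  qed
  then have "R = (\<lambda>h. y \<otimes> h \<otimes> inv y) ` P"
    using fin card_conj[OF fin(2) yc] assms(7) by (intro card_subset_eq) auto
  then show ?thesis using that y by blast
qed

end

section \<open>Group algebras and class functions\<close>

locale finite_group = group +
  assumes finite_carrier [simp]: "finite (carrier G)"
begin

lemma finite_subgroup: "subgroup H G \<Longrightarrow> finite H"
  using finite_carrier finite_subset subgroup.subset by blast

lemma card_subgroup_pos: "subgroup H G \<Longrightarrow> card H > 0"
  using finite_subgroup subgroup.one_closed card_gt_0_iff by (metis empty_iff)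

lemma subgroup_finite_group:
  assumes "subgroup H G"
  shows "finite_group (G\<lparr>carrier := H\<rparr>)"
  using subgroup_imp_group[OF assms] finite_subgroup[OF assms]
  by (simp add: finite_group_def finite_group_axioms_def)

lemma sum_left_mult:
  assumes "z \<in> carrier G"
  shows "(\<Sum>y\<in>carrier G. f (z \<otimes> y)) = (\<Sum>y\<in>carrier G. f y)"
  by (rule sum.reindex_bij_witness[of _ "\<lambda>y. inv z \<otimes> y" "\<lambda>y. z \<otimes> y"]) (use assms in auto)

lemma sum_inverse: "(\<Sum>y\<in>carrier G. f (inv y)) = (\<Sum>y\<in>carrier G. f y)"
  by (rule sum.reindex_bij_witness[of _ "\<lambda>y. inv y" "\<lambda>y. inv y"]) auto

lemma sum_right_mult:
  assumes "z \<in> carrier G"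
  shows "(\<Sum>y\<in>carrier G. f (y \<otimes> z)) = (\<Sum>y\<in>carrier G. f y)"
  by (rule sum.reindex_bij_witness[of _ "\<lambda>y. y \<otimes> inv z" "\<lambda>y. y \<otimes> z"]) (use assms in \<open>auto simp: m_assoc\<close>)

end

lemma group_algebra_simps [simp]:
  "a \<in> carrier (group_algebra G) \<longleftrightarrow> (\<forall>x. x \<notin> carrier G \<longrightarrow> a x = 0)"
  "\<one>\<^bsub>group_algebra G\<^esub> = delta \<one>\<^bsub>G\<^esub> 1"
  "\<zero>\<^bsub>group_algebra G\<^esub> = (\<lambda>_. 0)"
  "a \<oplus>\<^bsub>group_algebra G\<^esub> b = (\<lambda>x. a x + b x)"
  by (simp_all add: group_algebra_def)

lemma group_algebra_mult:
  "(a \<otimes>\<^bsub>group_algebra G\<^esub> b) x =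
     (if x \<in> carrier G then (\<Sum>y\<in>carrier G. a y * b (inv\<^bsub>G\<^esub> y \<otimes>\<^bsub>G\<^esub> x)) else 0)"
  by (simp add: group_algebra_def)

definition class_function :: "('g, 'x) monoid_scheme \<Rightarrow> ('g \<Rightarrow> 'k::field) \<Rightarrow> bool" where
  "class_function G a \<longleftrightarrow> a \<in> carrier (group_algebra G) \<and>
     (\<forall>g\<in>carrier G. \<forall>x\<in>carrier G. a (g \<otimes>\<^bsub>G\<^esub> x \<otimes>\<^bsub>G\<^esub> inv\<^bsub>G\<^esub> g) = a x)"

context finite_group
begin

lemma sum_delta_left:
  fixes f :: "'a \<Rightarrow> 'k::field"
  assumes "g \<in> carrier G"
  shows "(\<Sum>y\<in>carrier G. delta g c y * f y) = c * f g"
proof -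
  have "(\<Sum>y\<in>carrier G. delta g c y * f y) = (\<Sum>y\<in>carrier G. if y = g then c * f y else 0)"
    by (rule sum.cong) (auto simp: delta_def)
  then show ?thesis using assms by (simp add: sum.delta')
qed

lemma delta_mult:
  assumes "g \<in> carrier G" "x \<in> carrier G"
  shows "(delta g c \<otimes>\<^bsub>group_algebra G\<^esub> b) x = c * b (inv g \<otimes> x)"
  using assms by (simp add: group_algebra_mult sum_delta_left)

lemma mult_delta:
  assumes "g \<in> carrier G" "x \<in> carrier G"
  shows "(b \<otimes>\<^bsub>group_algebra G\<^esub> delta g c) x = b (x \<otimes> inv g) * c"
proof -
  have eq: "inv y \<otimes> x = g \<longleftrightarrow> y = x \<otimes> inv g" if "y \<in> carrier G" for y
    using that assms by (metis inv_closed inv_solve_left' inv_solve_right m_closed)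
  have "(\<Sum>y\<in>carrier G. b y * delta g c (inv y \<otimes> x))
      = (\<Sum>y\<in>carrier G. delta (x \<otimes> inv g) c y * b y)"
    by (rule sum.cong) (auto simp: delta_def eq)
  also have "\<dots> = b (x \<otimes> inv g) * c"
    using assms sum_delta_left[of "x \<otimes> inv g" c b] by simp
  finally show ?thesis using assms by (simp add: group_algebra_mult)
qed

lemma delta_closed [simp]: "g \<in> carrier G \<Longrightarrow> delta g c \<in> carrier (group_algebra G)"
  by (auto simp: delta_def)

lemma group_algebra_mult_closed [simp]:
  "a \<otimes>\<^bsub>group_algebra G\<^esub> b \<in> carrier (group_algebra G)"
  by (simp add: group_algebra_mult)

lemma group_algebra_eqI:
  assumes "a \<in> carrier (group_algebra G)" "b \<in> carrier (group_algebra G)"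
    and "\<And>x. x \<in> carrier G \<Longrightarrow> a x = b x"
  shows "a = b"
proof
  fix x show "a x = b x" using assms by (cases "x \<in> carrier G") auto
qed

lemma group_algebra_assoc:
  "(a \<otimes>\<^bsub>group_algebra G\<^esub> b) \<otimes>\<^bsub>group_algebra G\<^esub> c
    = a \<otimes>\<^bsub>group_algebra G\<^esub> (b \<otimes>\<^bsub>group_algebra G\<^esub> c)"
proof (rule group_algebra_eqI)
  fix x assume x: "x \<in> carrier G"
  have "((a \<otimes>\<^bsub>group_algebra G\<^esub> b) \<otimes>\<^bsub>group_algebra G\<^esub> c) x
      = (\<Sum>y\<in>carrier G. \<Sum>z\<in>carrier G. a z * b (inv z \<otimes> y) * c (inv y \<otimes> x))"
    using x by (simp add: group_algebra_mult sum_distrib_right)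
  also have "\<dots> = (\<Sum>z\<in>carrier G. \<Sum>y\<in>carrier G. a z * b (inv z \<otimes> y) * c (inv y \<otimes> x))"
    by (rule sum.swap)
  also have "\<dots> = (\<Sum>z\<in>carrier G. \<Sum>w\<in>carrier G. a z * (b w * c (inv w \<otimes> (inv z \<otimes> x))))"
  proof (rule sum.cong[OF refl])
    fix z assume z: "z \<in> carrier G"
    have "(\<Sum>y\<in>carrier G. a z * b (inv z \<otimes> y) * c (inv y \<otimes> x))
        = (\<Sum>w\<in>carrier G. a z * b (inv z \<otimes> (z \<otimes> w)) * c (inv (z \<otimes> w) \<otimes> x))"
      by (rule sum_left_mult[OF z, symmetric])
    also have "\<dots> = (\<Sum>w\<in>carrier G. a z * (b w * c (inv w \<otimes> (inv z \<otimes> x))))"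
      by (rule sum.cong) (use x z in \<open>auto simp: inv_mult_group m_assoc\<close>)
    finally show "(\<Sum>y\<in>carrier G. a z * b (inv z \<otimes> y) * c (inv y \<otimes> x)) = \<dots>" .
  qed
  also have "\<dots> = (a \<otimes>\<^bsub>group_algebra G\<^esub> (b \<otimes>\<^bsub>group_algebra G\<^esub> c)) x"
    using x by (simp add: group_algebra_mult sum_distrib_left)
  finally show "((a \<otimes>\<^bsub>group_algebra G\<^esub> b) \<otimes>\<^bsub>group_algebra G\<^esub> c) x
    = (a \<otimes>\<^bsub>group_algebra G\<^esub> (b \<otimes>\<^bsub>group_algebra G\<^esub> c)) x" .
qed (rule group_algebra_mult_closed)+

lemma ring_group_algebra: "ring (group_algebra G :: ('a \<Rightarrow> 'k::field) ring)"
proof (rule ringI)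
  show "abelian_group (group_algebra G :: ('a \<Rightarrow> 'k) ring)"
  proof (rule abelian_groupI)
    fix x :: "'a \<Rightarrow> 'k" assume "x \<in> carrier (group_algebra G)"
    then show "\<exists>y\<in>carrier (group_algebra G). y \<oplus>\<^bsub>group_algebra G\<^esub> x = \<zero>\<^bsub>group_algebra G\<^esub>"
      by (intro bexI[of _ "\<lambda>g. - x g"]) auto
  qed (auto simp: algebra_simps)
  show "Group.monoid (group_algebra G :: ('a \<Rightarrow> 'k) ring)"
  proof (rule monoidI)
    fix x :: "'a \<Rightarrow> 'k" assume x: "x \<in> carrier (group_algebra G)"
    show "\<one>\<^bsub>group_algebra G\<^esub> \<otimes>\<^bsub>group_algebra G\<^esub> x = x"
      using x by (intro group_algebra_eqI) (auto simp: delta_mult simp del: group_algebra_simps(1))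
    show "x \<otimes>\<^bsub>group_algebra G\<^esub> \<one>\<^bsub>group_algebra G\<^esub> = x"
      using x by (intro group_algebra_eqI) (auto simp: mult_delta simp del: group_algebra_simps(1))
  qed (auto simp: group_algebra_assoc delta_def group_algebra_mult)
qed (auto simp: fun_eq_iff group_algebra_mult algebra_simps sum.distrib)

lemma group_algebra_m_inv [simp]:
  assumes "a \<in> carrier (group_algebra G)"
  shows "\<ominus>\<^bsub>group_algebra G\<^esub> a = (\<lambda>x. - a x)"
proof -
  interpret A: ring "group_algebra G" by (rule ring_group_algebra)
  show ?thesis by (rule A.minus_equality) (use assms in auto)
qed

text \<open>Commuting with \<open>delta g 1\<close> is constancy under conjugation by
  \<open>g\<close>. Conversely, replacing \<open>y\<close> by \<open>y \<otimes> inv x\<close> in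
  the inverted sum makes the two convolutions differ only in that \<open>a\<close> is evaluated at
  two elements conjugate under \<open>x\<close>.\<close>

lemma class_function_iff_central:
  fixes a :: "'a \<Rightarrow> 'k::field"
  shows "class_function G a \<longleftrightarrow> a \<in> carrier (group_algebra G) \<and>
     (\<forall>b\<in>carrier (group_algebra G). a \<otimes>\<^bsub>group_algebra G\<^esub> b = b \<otimes>\<^bsub>group_algebra G\<^esub> a)"
proof (intro iffI conjI ballI)
  assume a: "class_function G a"
  then show "a \<in> carrier (group_algebra G)" by (simp add: class_function_def)
  fix b :: "'a \<Rightarrow> 'k" assume "b \<in> carrier (group_algebra G)"
  show "a \<otimes>\<^bsub>group_algebra G\<^esub> b = b \<otimes>\<^bsub>group_algebra G\<^esub> a"
  proof (rule group_algebra_eqI)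
    fix x assume x: "x \<in> carrier G"
    have "(a \<otimes>\<^bsub>group_algebra G\<^esub> b) x = (\<Sum>y\<in>carrier G. a (inv y) * b (y \<otimes> x))"
      using x sum_inverse[of "\<lambda>y. a y * b (inv y \<otimes> x)"] by (simp add: group_algebra_mult)
    also have "\<dots> = (\<Sum>y\<in>carrier G. a (inv (y \<otimes> inv x)) * b (y \<otimes> inv x \<otimes> x))"
      using x sum_right_mult[of "inv x" "\<lambda>y. a (inv y) * b (y \<otimes> x)"] by simp
    also have "\<dots> = (\<Sum>y\<in>carrier G. b y * a (inv y \<otimes> x))"
    proof (rule sum.cong[OF refl])
      fix y assume y: "y \<in> carrier G"
      have "a (x \<otimes> (inv y \<otimes> x) \<otimes> inv x) = a (inv y \<otimes> x)"
        using a x y by (simp add: class_function_def)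
      then show "a (inv (y \<otimes> inv x)) * b (y \<otimes> inv x \<otimes> x) = b y * a (inv y \<otimes> x)"
        using x y by (simp add: inv_mult_group m_assoc)
    qed
    also have "\<dots> = (b \<otimes>\<^bsub>group_algebra G\<^esub> a) x" using x by (simp add: group_algebra_mult)
    finally show "(a \<otimes>\<^bsub>group_algebra G\<^esub> b) x = (b \<otimes>\<^bsub>group_algebra G\<^esub> a) x" .
  qed (rule group_algebra_mult_closed)+
next
  assume a: "a \<in> carrier (group_algebra G) \<and>
     (\<forall>b\<in>carrier (group_algebra G). a \<otimes>\<^bsub>group_algebra G\<^esub> b = b \<otimes>\<^bsub>group_algebra G\<^esub> a)"
  show "class_function G a"
    unfolding class_function_def
  proof (intro conjI ballI)
    fix g x assume g: "g \<in> carrier G" and x: "x \<in> carrier G"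
    have "(a \<otimes>\<^bsub>group_algebra G\<^esub> delta g 1) (g \<otimes> x) = (delta g 1 \<otimes>\<^bsub>group_algebra G\<^esub> a) (g \<otimes> x)"
      using a g delta_closed by metis
    then show "a (g \<otimes> x \<otimes> inv g) = a x"
      using g x by (simp add: delta_mult mult_delta)
  qed (use a in auto)
qed

lemma central_idempotent_iff:
  "central_idempotent (group_algebra G) e \<longleftrightarrow>
     class_function G e \<and> e \<otimes>\<^bsub>group_algebra G\<^esub> e = e"
  unfolding central_idempotent_def class_function_iff_central by blast

lemma class_function_carrier: "class_function G a \<Longrightarrow> a \<in> carrier (group_algebra G)"
  by (simp add: class_function_def)

lemma class_function_mult:
  assumes "class_function G a" "class_function G b"
  shows "class_function G (a \<otimes>\<^bsub>group_algebra G\<^esub> b)"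
  using assms unfolding class_function_iff_central
  by (metis group_algebra_assoc group_algebra_mult_closed)

lemma class_function_commute:
  assumes "class_function G a" "b \<in> carrier (group_algebra G)"
  shows "a \<otimes>\<^bsub>group_algebra G\<^esub> b = b \<otimes>\<^bsub>group_algebra G\<^esub> a"
  using assms unfolding class_function_iff_central by blast

lemma class_function_linear:
  assumes "class_function G a" "class_function G b"
  shows "class_function G (\<lambda>x. a x + b x)" "class_function G (\<lambda>x. a x - b x)"
  using assms by (auto simp: class_function_def)

lemma class_function_scale:
  assumes "class_function G a"
  shows "class_function G (\<lambda>x. c * a x)"
  using assms by (auto simp: class_function_def)

lemma group_algebra_one_mult:
  assumes "a \<in> carrier (group_algebra G)"
  shows "delta \<one> 1 \<otimes>\<^bsub>group_algebra G\<^esub> a = a" "a \<otimes>\<^bsub>group_algebra G\<^esub> delta \<one> 1 = a"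
  using ring.ring_simprules(6,13)[OF ring_group_algebra] assms ring.is_monoid[OF ring_group_algebra]
  by (metis monoid.l_one monoid.r_one group_algebra_simps(2))+

lemma class_function_one: "class_function G (delta \<one> 1)"
  unfolding class_function_iff_central using group_algebra_one_mult delta_closed one_closed by metis

lemma class_function_zero: "class_function G (\<lambda>_. 0)"
  by (simp add: class_function_def)

lemma group_algebra_zero_mult [simp]:
  "(\<lambda>_. 0) \<otimes>\<^bsub>group_algebra G\<^esub> a = (\<lambda>_. 0)" "a \<otimes>\<^bsub>group_algebra G\<^esub> (\<lambda>_. 0) = (\<lambda>_. 0)"
  by (auto simp: fun_eq_iff group_algebra_mult)

lemma group_algebra_distrib:
  "a \<otimes>\<^bsub>group_algebra G\<^esub> (\<lambda>x. b x + c x)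
    = (\<lambda>x. (a \<otimes>\<^bsub>group_algebra G\<^esub> b) x + (a \<otimes>\<^bsub>group_algebra G\<^esub> c) x)"
  "(\<lambda>x. b x + c x) \<otimes>\<^bsub>group_algebra G\<^esub> a
    = (\<lambda>x. (b \<otimes>\<^bsub>group_algebra G\<^esub> a) x + (c \<otimes>\<^bsub>group_algebra G\<^esub> a) x)"
  "a \<otimes>\<^bsub>group_algebra G\<^esub> (\<lambda>x. b x - c x)
    = (\<lambda>x. (a \<otimes>\<^bsub>group_algebra G\<^esub> b) x - (a \<otimes>\<^bsub>group_algebra G\<^esub> c) x)"
  "(\<lambda>x. b x - c x) \<otimes>\<^bsub>group_algebra G\<^esub> a
    = (\<lambda>x. (b \<otimes>\<^bsub>group_algebra G\<^esub> a) x - (c \<otimes>\<^bsub>group_algebra G\<^esub> a) x)"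
  "a \<otimes>\<^bsub>group_algebra G\<^esub> (\<lambda>x. r * b x) = (\<lambda>x. r * (a \<otimes>\<^bsub>group_algebra G\<^esub> b) x)"
  "(\<lambda>x. r * a x) \<otimes>\<^bsub>group_algebra G\<^esub> b = (\<lambda>x. r * (a \<otimes>\<^bsub>group_algebra G\<^esub> b) x)"
  by (auto simp: fun_eq_iff group_algebra_mult algebra_simps sum.distrib sum_subtractf sum_distrib_left)

text \<open>Elements of the algebra of \<open>H\<close> are functions on the whole type that vanish
  off \<open>H\<close>, so only indices \<open>y\<close> in \<open>H\<close> contribute, and for
  them \<open>x\<close> outside \<open>H\<close> gives zero. This allows products in the algebra of
  a normalizer to be computed in \<open>kG\<close>.\<close>

lemma subgroup_algebra_mult:
  assumes "subgroup H G" "a \<in> carrier (group_algebra (G\<lparr>carrier := H\<rparr>))"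
    "b \<in> carrier (group_algebra (G\<lparr>carrier := H\<rparr>))"
  shows "a \<otimes>\<^bsub>group_algebra (G\<lparr>carrier := H\<rparr>)\<^esub> b = a \<otimes>\<^bsub>group_algebra G\<^esub> b"
proof
  fix x
  interpret H: subgroup H G by fact
  have *: "(\<Sum>y\<in>carrier G. a y * b (inv y \<otimes> x)) = (\<Sum>y\<in>H. a y * b (inv y \<otimes> x))"
    by (rule sum.mono_neutral_right) (use assms H.subset in auto)
  show "(a \<otimes>\<^bsub>group_algebra (G\<lparr>carrier := H\<rparr>)\<^esub> b) x = (a \<otimes>\<^bsub>group_algebra G\<^esub> b) x"
  proof (cases "x \<in> H")
    case True
    then show ?thesis using H.subset
      by (auto simp: group_algebra_mult * m_inv_consistent[OF assms(1)] subset_iff intro!: sum.cong)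
  next
    case False
    have "b (inv y \<otimes> x) = 0" if "y \<in> H" "x \<in> carrier G" for y
    proof -
      have "inv y \<otimes> x \<notin> H"
      proof
        assume "inv y \<otimes> x \<in> H"
        then have "y \<otimes> (inv y \<otimes> x) \<in> H" using that by blast
        then show False using that H.subset False by (simp add: subset_iff)
      qed
      then show ?thesis using assms by simp
    qed
    then show ?thesis using False by (simp add: group_algebra_mult *)
  qed
qed

lemma subgroup_algebra_carrier:
  assumes "subgroup H G" "a \<in> carrier (group_algebra (G\<lparr>carrier := H\<rparr>))"
  shows "a \<in> carrier (group_algebra G)"
  using assms subgroup.subset by fastforce

lemma subgroup_centralizer:
  assumes "Q \<subseteq> carrier G"
  shows "subgroup (centralizer G Q) G"
proof (rule subgroupI)
  show "centralizer G Q \<subseteq> carrier G" by (auto simp: centralizer_def)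
  have "\<one> \<in> centralizer G Q" using assms by (auto simp: centralizer_def)
  then show "centralizer G Q \<noteq> {}" by blast
  fix a assume a: "a \<in> centralizer G Q"
  show "inv a \<in> centralizer G Q"
    unfolding centralizer_def
  proof (intro CollectI conjI ballI)
    fix q assume q: "q \<in> Q"
    then have eq: "a \<otimes> q = q \<otimes> a" using a by (simp add: centralizer_def)
    have c: "a \<in> carrier G" "q \<in> carrier G" using a q assms by (auto simp: centralizer_def)
    have "inv a \<otimes> q = inv a \<otimes> (q \<otimes> a) \<otimes> inv a" using c by (simp add: m_assoc)
    also have "\<dots> = q \<otimes> inv a" using c by (simp flip: eq)
    finally show "inv a \<otimes> q = q \<otimes> inv a" .
  qed (use a in \<open>auto simp: centralizer_def\<close>)
  fix b assume b: "b \<in> centralizer G Q"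
  show "a \<otimes> b \<in> centralizer G Q"
    unfolding centralizer_def
  proof (intro CollectI conjI ballI)
    fix q assume q: "q \<in> Q"
    have qc: "q \<in> carrier G" and ab: "a \<in> carrier G" "b \<in> carrier G"
      using a b q assms by (auto simp: centralizer_def)
    have "a \<otimes> q = q \<otimes> a" "b \<otimes> q = q \<otimes> b" using a b q by (auto simp: centralizer_def)
    then show "a \<otimes> b \<otimes> q = q \<otimes> (a \<otimes> b)" using qc ab by (metis m_assoc)
  qed (use a b in \<open>auto simp: centralizer_def\<close>)
qed

lemma conj_eq_self_iff:
  assumes "q \<in> carrier G" "x \<in> carrier G"
  shows "q \<otimes> x \<otimes> inv q = x \<longleftrightarrow> x \<otimes> q = q \<otimes> x"
  using assms by (metis inv_solve_right m_closed)

lemma centralizer_iff_conj: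
  assumes "Q \<subseteq> carrier G"
  shows "x \<in> centralizer G Q \<longleftrightarrow> x \<in> carrier G \<and> (\<forall>q\<in>Q. q \<otimes> x \<otimes> inv q = x)"
  unfolding centralizer_def using assms conj_eq_self_iff by blast

lemma brauer_hom_closed [simp]: "brauer_hom G Q a \<in> carrier (group_algebra G)"
  by (auto simp: brauer_hom_def centralizer_def)

lemma brauer_hom_linear:
  "brauer_hom G Q (\<lambda>x. a x + b x) = (\<lambda>x. brauer_hom G Q a x + brauer_hom G Q b x)"
  "brauer_hom G Q (\<lambda>x. a x - b x) = (\<lambda>x. brauer_hom G Q a x - brauer_hom G Q b x)"
  by (auto simp: brauer_hom_def)

text \<open>At \<open>x\<close> in the centralizer of \<open>Q\<close>, conjugation by
  \<open>Q\<close> permutes the summation index \<open>y\<close> and preserves the summand. In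
  characteristic \<open>p\<close> only the fixed indices survive, and these are the \<open>y\<close>
  that centralize \<open>Q\<close>.\<close>

lemma brauer_hom_mult:
  fixes a b :: "'a \<Rightarrow> 'k::field"
  assumes "subgroup Q G" "card Q = p ^ n" "Factorial_Ring.prime p" "CHAR('k) = p"
    and a: "\<And>q x. q \<in> Q \<Longrightarrow> x \<in> carrier G \<Longrightarrow> a (q \<otimes> x \<otimes> inv q) = a x"
    and b: "\<And>q x. q \<in> Q \<Longrightarrow> x \<in> carrier G \<Longrightarrow> b (q \<otimes> x \<otimes> inv q) = b x"
  shows "brauer_hom G Q (a \<otimes>\<^bsub>group_algebra G\<^esub> b)
    = brauer_hom G Q a \<otimes>\<^bsub>group_algebra G\<^esub> brauer_hom G Q b"
proof (rule group_algebra_eqI)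
  interpret Q: subgroup Q G by fact
  have C: "subgroup (centralizer G Q) G" using subgroup_centralizer[OF Q.subset] .
  interpret C: subgroup "centralizer G Q" G by fact
  fix x assume x: "x \<in> carrier G"
  have rhs: "(brauer_hom G Q a \<otimes>\<^bsub>group_algebra G\<^esub> brauer_hom G Q b) x
      = (\<Sum>y\<in>centralizer G Q. a y * brauer_hom G Q b (inv y \<otimes> x))"
    using x C.subset by (auto simp: group_algebra_mult brauer_hom_def intro!: sum.mono_neutral_cong_right)
  show "brauer_hom G Q (a \<otimes>\<^bsub>group_algebra G\<^esub> b) x
    = (brauer_hom G Q a \<otimes>\<^bsub>group_algebra G\<^esub> brauer_hom G Q b) x"
  proof (cases "x \<in> centralizer G Q")
    case True
    have xq: "q \<otimes> x \<otimes> inv q = x" if "q \<in> Q" for q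
      using True that Q.subset centralizer_iff_conj by blast
    let ?f = "\<lambda>y. a y * b (inv y \<otimes> x)"
    have QG: "group (G\<lparr>carrier := Q\<rparr>)" using subgroup_imp_group[OF assms(1)] .
    have "sum ?f (carrier G)
        = sum ?f {y \<in> carrier G. \<forall>q\<in>carrier (G\<lparr>carrier := Q\<rparr>). q \<otimes> y \<otimes> inv q = y}"
    proof (rule sum_fixed_points[OF QG _ assms(3,4), of n])
      fix q y assume q: "q \<in> carrier (G\<lparr>carrier := Q\<rparr>)" and y: "y \<in> carrier G"
      have qc: "q \<in> carrier G" using q Q.subset by auto
      show "q \<otimes> y \<otimes> inv q \<in> carrier G" using y qc by simp
      have "inv (q \<otimes> y \<otimes> inv q) \<otimes> x = inv (q \<otimes> y \<otimes> inv q) \<otimes> (q \<otimes> x \<otimes> inv q)"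
        using xq q by simp
      also have "\<dots> = q \<otimes> (inv y \<otimes> x) \<otimes> inv q"
        using qc x y by (simp add: inv_mult_group m_assoc)
      finally have "b (inv (q \<otimes> y \<otimes> inv q) \<otimes> x) = b (inv y \<otimes> x)"
        using b[of q "inv y \<otimes> x"] q x y by simp
      then show "a (q \<otimes> y \<otimes> inv q) * b (inv (q \<otimes> y \<otimes> inv q) \<otimes> x) = a y * b (inv y \<otimes> x)"
        using a q y by simp
      fix r assume "r \<in> carrier (G\<lparr>carrier := Q\<rparr>)"
      then show "q \<otimes>\<^bsub>G\<lparr>carrier := Q\<rparr>\<^esub> r \<otimes> y \<otimes> inv (q \<otimes>\<^bsub>G\<lparr>carrier := Q\<rparr>\<^esub> r)
          = q \<otimes> (r \<otimes> y \<otimes> inv r) \<otimes> inv q"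
        using conj_conj qc y Q.subset by auto
    qed (use assms in auto)
    also have "{y \<in> carrier G. \<forall>q\<in>carrier (G\<lparr>carrier := Q\<rparr>). q \<otimes> y \<otimes> inv q = y} = centralizer G Q"
      using centralizer_iff_conj[OF Q.subset] by auto
    also have "sum ?f (centralizer G Q) = (\<Sum>y\<in>centralizer G Q. a y * brauer_hom G Q b (inv y \<otimes> x))"
      by (rule sum.cong) (use True in \<open>auto simp: brauer_hom_def\<close>)
    finally show ?thesis
      using True x rhs by (simp add: brauer_hom_def[of G Q "a \<otimes>\<^bsub>group_algebra G\<^esub> b"] group_algebra_mult)
  next
    case False
    have "brauer_hom G Q b (inv y \<otimes> x) = 0" if y: "y \<in> centralizer G Q" for y
    proof -
      have "inv y \<otimes> x \<notin> centralizer G Q"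
      proof
        assume "inv y \<otimes> x \<in> centralizer G Q"
        then have "y \<otimes> (inv y \<otimes> x) \<in> centralizer G Q" using y by blast
        then show False using y x False C.subset by (simp add: subset_iff)
      qed
      then show ?thesis by (simp add: brauer_hom_def)
    qed
    then show ?thesis using False rhs by (simp add: brauer_hom_def[of G Q "a \<otimes>\<^bsub>group_algebra G\<^esub> b"])
  qed
qed (rule brauer_hom_closed group_algebra_mult_closed)+

end

section \<open>The centre of a block\<close>

definition function_subspace :: "'a set \<Rightarrow> ('a \<Rightarrow> 'k::field) set \<Rightarrow> bool" where
  "function_subspace E U \<longleftrightarrow> (\<forall>u\<in>U. \<forall>x. x \<notin> E \<longrightarrow> u x = 0) \<and> (\<lambda>_. 0) \<in> U \<and>
     (\<forall>u\<in>U. \<forall>v\<in>U. (\<lambda>x. u x + v x) \<in> U) \<and> (\<forall>u\<in>U. \<forall>c. (\<lambda>x. c * u x) \<in> U)"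

text \<open>The number of pivot positions, with respect to an enumeration of \<open>E\<close>, plays the role of the
  dimension.\<close>

lemma function_subspace_measure:
  assumes "finite E"
  obtains \<mu> :: "('a \<Rightarrow> 'k::field) set \<Rightarrow> nat"
  where "\<And>U V. function_subspace E U \<Longrightarrow> function_subspace E V \<Longrightarrow> U \<subset> V \<Longrightarrow> \<mu> U < \<mu> V"
proof -
  obtain idx :: "'a \<Rightarrow> nat" where idx: "inj_on idx E"
    using finite_imp_inj_to_nat_seg[OF assms] by blast
  \<comment> \<open>A pivot is the first position, in the order given by \<open>idx\<close>, at
    which some element of \<open>U\<close> is nonzero.\<close>
  define piv where "piv = (\<lambda>U :: ('a \<Rightarrow> 'k) set.
    {x \<in> E. \<exists>u\<in>U. u x \<noteq> 0 \<and> (\<forall>y\<in>E. idx y < idx x \<longrightarrow> u y = 0)})"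
  have "card (piv U) < card (piv V)"
    if U: "function_subspace E U" and V: "function_subspace E V" and UV: "U \<subset> V" for U V
  proof -
    have sub: "piv U \<subseteq> piv V" using UV by (auto simp: piv_def)
    have "piv U \<noteq> piv V"
    proof
      assume eq: "piv U = piv V"
      obtain N where N: "\<And>x. x \<in> E \<Longrightarrow> idx x < N"
        using assms by (metis finite_imageI finite_nat_set_iff_bounded imageI)
      \<comment> \<open>Gaussian elimination: \<open>k\<close> measures the final stretch of
        positions at which \<open>v\<close> may be nonzero. As the pivots agree, the entry of
        \<open>v\<close> at the first of these positions can be cancelled by a multiple of an
        element of \<open>U\<close> with that pivot.\<close>
      have "v \<in> U" if "v \<in> V" "\<And>y. y \<in> E \<Longrightarrow> idx y < N - k \<Longrightarrow> v y = 0" for v k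
        using that
      proof (induction k arbitrary: v)
        case 0
        then have "v y = 0" for y using N V by (cases "y \<in> E") (auto simp: function_subspace_def)
        then have "v = (\<lambda>_. 0)" by auto
        then show ?case using U by (simp add: function_subspace_def)
      next
        case (Suc k)
        show ?case
        proof (cases "\<exists>x\<in>E. idx x = N - Suc k \<and> v x \<noteq> 0")
          case False
          have "v y = 0" if y: "y \<in> E" "idx y < N - k" for y
          proof (cases "idx y < N - Suc k")
            case True
            then show ?thesis using Suc.prems y by blast
          next
            case not: False
            then have "idx y = N - Suc k" using y by linarith
            then show ?thesis using False y by blast
          qed
          then show ?thesis using Suc.IH[of v] Suc.prems(1) by blast
        next
          case True
          then obtain x where x: "x \<in> E" "idx x = N - Suc k" "v x \<noteq> 0" by blast
          then have "x \<in> piv V" using Suc.prems unfolding piv_def by auto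
          then have "x \<in> piv U" by (simp only: eq)
          then obtain u where u: "u \<in> U" "u x \<noteq> 0" "\<And>y. y \<in> E \<Longrightarrow> idx y < idx x \<Longrightarrow> u y = 0"
            unfolding piv_def by blast
          define c where "c = v x / u x"
          define w where "w = (\<lambda>y. v y + (- c) * u y)"
          have cu: "(\<lambda>y. a * u y) \<in> U" for a
            using U u by (simp add: function_subspace_def)
          have "(\<lambda>y. (- c) * u y) \<in> V" using cu UV by blast
          then have "w \<in> V" unfolding w_def
            using bspec[OF bspec[OF conjunct1[OF conjunct2[OF conjunct2[OF V[unfolded function_subspace_def]]]]
              Suc.prems(1)]] by blast
          moreover have "w y = 0" if y: "y \<in> E" "idx y < N - k" for y
          proof (cases "idx y < N - Suc k")
            case True
            then show ?thesis using Suc.prems(2) u(3) y x by (simp add: w_def)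
          next
            case False
            then have "idx y = idx x" using y x by linarith
            then have "y = x" using idx y x by (metis inj_onD)
            then show ?thesis using u by (simp add: w_def c_def)
          qed
          ultimately have "w \<in> U" using Suc.IH by blast
          then have "(\<lambda>y. w y + c * u y) \<in> U"
            using bspec[OF bspec[OF conjunct1[OF conjunct2[OF conjunct2[OF U[unfolded function_subspace_def]]]]]]
              cu by blast
          moreover have "(\<lambda>y. w y + c * u y) = v" by (auto simp: w_def)
          ultimately show ?thesis by simp
        qed
      qed
      from this[of _ N] have "V \<subseteq> U" by auto
      with UV show False by blast
    qed
    with sub have "piv U \<subset> piv V" by blast
    moreover have "finite (piv V)" using assms by (simp add: piv_def)
    ultimately show ?thesis by (rule psubset_card_mono[rotated])
  qed
  then show ?thesis using that[of "\<lambda>U. card (piv U)"] by blast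
qed

text \<open>The center of \<open>kG\<close> as a record of its own, so that powers and the facts on
  commutative rings are available for central elements.\<close>

definition class_algebra :: "('g, 'x) monoid_scheme \<Rightarrow> ('g \<Rightarrow> 'k::field) ring" where
  "class_algebra G = (group_algebra G)\<lparr>carrier := Collect (class_function G)\<rparr>"

lemma class_algebra_simps [simp]:
  "a \<in> carrier (class_algebra G) \<longleftrightarrow> class_function G a"
  "a \<otimes>\<^bsub>class_algebra G\<^esub> b = a \<otimes>\<^bsub>group_algebra G\<^esub> b"
  "\<one>\<^bsub>class_algebra G\<^esub> = delta \<one>\<^bsub>G\<^esub> 1"
  "\<zero>\<^bsub>class_algebra G\<^esub> = (\<lambda>_. 0)"
  "a \<oplus>\<^bsub>class_algebra G\<^esub> b = (\<lambda>x. a x + b x)"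
  by (simp_all add: class_algebra_def group_algebra_def)

context finite_group
begin

abbreviation conv :: "('a \<Rightarrow> 'k::field) \<Rightarrow> ('a \<Rightarrow> 'k) \<Rightarrow> 'a \<Rightarrow> 'k" (infixl \<open>\<star>\<close> 70) where
  "a \<star> b \<equiv> a \<otimes>\<^bsub>group_algebra G\<^esub> b"

lemma cring_class_algebra: "cring (class_algebra G :: ('a \<Rightarrow> 'k::field) ring)"
proof (rule cringI)
  show "abelian_group (class_algebra G :: ('a \<Rightarrow> 'k) ring)"
  proof (rule abelian_groupI)
    fix x :: "'a \<Rightarrow> 'k" assume "x \<in> carrier (class_algebra G)"
    then show "\<exists>y\<in>carrier (class_algebra G). y \<oplus>\<^bsub>class_algebra G\<^esub> x = \<zero>\<^bsub>class_algebra G\<^esub>"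
      using class_function_scale[of x "-1"]
      by (intro bexI[of _ "\<lambda>g. - x g"]) auto
  qed (auto simp: algebra_simps class_function_linear class_function_zero)
  show "comm_monoid (class_algebra G :: ('a \<Rightarrow> 'k) ring)"
    by (rule comm_monoidI)
      (auto simp: class_function_mult class_function_one group_algebra_assoc
        group_algebra_one_mult class_function_carrier intro: class_function_commute
        simp del: group_algebra_simps(1))
qed (simp add: group_algebra_distrib)

lemma conv_swap:
  assumes "class_function G b" "c \<in> carrier (group_algebra G)"
  shows "a \<star> b \<star> c = a \<star> c \<star> b"
  by (simp only: group_algebra_assoc class_function_commute[OF assms])

lemma conv_comm:
  assumes "class_function G a" "class_function G b"
  shows "a \<star> b = b \<star> a"
  using class_function_commute assms class_function_carrier by blast

text \<open>The \<open>B\<close>-component of the centre is a local ring: a power \<open>z\<^sup>m\<close> with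
  \<open>z\<^sup>m Z = z\<^bsup>2m\<^esup> Z\<close> yields an idempotent \<open>z\<^sup>m y\<close>.\<close>

lemma block_nilpotent_or_unit:
  fixes B z :: "'a \<Rightarrow> 'k::field"
  assumes B: "is_block G B" and z: "class_function G z" "z \<star> B = z"
  shows "(\<exists>m::nat. z [^]\<^bsub>class_algebra G\<^esub> m = (\<lambda>_. 0)) \<or> (\<exists>y. class_function G y \<and> z \<star> y = B)"
proof -
  interpret Z: cring "class_algebra G :: ('a \<Rightarrow> 'k) ring" by (rule cring_class_algebra)
  have cB: "class_function G B" "B \<star> B = B" "B \<noteq> (\<lambda>_. 0)"
    using B by (simp_all add: is_block_def Let_def central_idempotent_iff)
  define zp where "zp = (\<lambda>m::nat. z [^]\<^bsub>class_algebra G\<^esub> m)"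
  have zp [simp]: "class_function G (zp m)" for m
    using Z.nat_pow_closed[of z m] z by (simp add: zp_def)
  have zp_Suc: "zp (Suc m) = zp m \<star> z" for m by (simp add: zp_def)
  have zp_add: "zp (m + n) = zp m \<star> zp n" for m n
    using Z.nat_pow_mult[of z m n] z by (simp add: zp_def)
  \<comment> \<open>The principal ideals generated by the powers of \<open>z\<close>; they form a
    descending chain of subspaces.\<close>
  define U where "U = (\<lambda>m. {zp m \<star> a | a. class_function G a})"
  have sub: "function_subspace (carrier G) (U m)" for m
    unfolding function_subspace_def
  proof (intro conjI ballI allI impI)
    show "(\<lambda>_. 0) \<in> U m" unfolding U_def using class_function_zero by force
    fix u v assume u: "u \<in> U m"
    then obtain a where a: "class_function G a" "u = zp m \<star> a" unfolding U_def by auto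
    then show "u x = 0" if "x \<notin> carrier G" for x using that by (simp add: group_algebra_mult)
    show "(\<lambda>x. c * u x) \<in> U m" for c
    proof -
      have "(\<lambda>x. c * u x) = zp m \<star> (\<lambda>x. c * a x)" by (simp only: a group_algebra_distrib)
      then show ?thesis unfolding U_def using class_function_scale[OF a(1), of c] by blast
    qed
    assume v: "v \<in> U m"
    then obtain b where b: "class_function G b" "v = zp m \<star> b" unfolding U_def by auto
    show "(\<lambda>x. u x + v x) \<in> U m"
    proof -
      have "(\<lambda>x. u x + v x) = zp m \<star> (\<lambda>x. a x + b x)" by (simp only: a b group_algebra_distrib)
      then show ?thesis unfolding U_def using class_function_linear(1)[OF a(1) b(1)] by blast
    qed
  qed
  have dec: "U (Suc m) \<subseteq> U m" for m
  proof
    fix u assume "u \<in> U (Suc m)"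
    then obtain a where a: "class_function G a" "u = zp m \<star> z \<star> a" unfolding U_def zp_Suc by auto
    then have "u = zp m \<star> (z \<star> a)" by (simp add: group_algebra_assoc)
    then show "u \<in> U m" unfolding U_def using a z class_function_mult by blast
  qed
  obtain \<mu> :: "('a \<Rightarrow> 'k) set \<Rightarrow> nat" where \<mu>: "\<And>U V. function_subspace (carrier G) U \<Longrightarrow>
      function_subspace (carrier G) V \<Longrightarrow> U \<subset> V \<Longrightarrow> \<mu> U < \<mu> V"
    using function_subspace_measure[OF finite_carrier] by blast
  \<comment> \<open>The chain is stopped at a positive exponent on purpose: exponent 0 would give
    the identity of \<open>kG\<close> instead of an element of the component of \<open>B\<close>,
    and one factor \<open>z\<close> is split off at the end.\<close>
  have "\<exists>m. U (Suc (Suc m)) = U (Suc m)"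
  proof (rule ccontr)
    assume "\<nexists>m. U (Suc (Suc m)) = U (Suc m)"
    then have "\<mu> (U (Suc (Suc m))) < \<mu> (U (Suc m))" for m using dec \<mu> sub by blast
    then have "\<mu> (U (Suc m)) + m \<le> \<mu> (U (Suc 0))" for m
      by (induction m) (auto, metis add_Suc_right le_trans less_eq_Suc_le nat_add_left_cancel_le add.commute)
    from this[of "Suc (\<mu> (U (Suc 0)))"] show False by simp
  qed
  then obtain m where m: "U (Suc (Suc m)) = U (Suc m)" by blast
  let ?m = "Suc m"
  have step: "U (Suc k) = (\<lambda>u. z \<star> u) ` U k" for k
  proof -
    have "zp (Suc k) \<star> a = z \<star> (zp k \<star> a)" if "class_function G a" for a
      unfolding zp_Suc conv_comm[OF zp z(1)] by (rule group_algebra_assoc)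
    then show ?thesis unfolding U_def by (auto simp: image_iff) metis+
  qed
  have "U (?m + k) = U ?m" for k
  proof (induction k)
    case (Suc k)
    have "U (?m + Suc k) = (\<lambda>u. z \<star> u) ` U (?m + k)" by (simp only: step add_Suc_right)
    also have "\<dots> = U (Suc ?m)" by (simp only: Suc step)
    finally show ?case using m by simp
  qed simp
  from this[of ?m] have U2: "U (?m + ?m) = U ?m" .
  have "zp ?m \<in> U ?m"
    unfolding U_def using class_function_one group_algebra_one_mult(2)[of "zp ?m"]
    by (metis (mono_tags, lifting) class_function_carrier mem_Collect_eq zp)
  then obtain y where y: "class_function G y" "zp ?m = zp (?m + ?m) \<star> y"
    unfolding U2[symmetric] unfolding U_def by auto
  \<comment> \<open>From \<open>z^m = z^(2m) y\<close> it follows that \<open>e = z^m y\<close> is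
    idempotent with \<open>z^m e = z^m\<close>. Primitivity of \<open>B\<close> leaves
    \<open>e = 0\<close>, where \<open>z\<close> is nilpotent, or \<open>e = B\<close>, where
    \<open>z\<close> is invertible.\<close>
  define e where "e = zp ?m \<star> y"
  have ce: "class_function G e" unfolding e_def using y class_function_mult zp by blast
  have ze: "zp ?m \<star> e = zp ?m"
    unfolding e_def by (metis y(2) zp_add group_algebra_assoc)
  have ee: "e \<star> e = e"
  proof -
    have "e \<star> e = (zp ?m \<star> e) \<star> y"
      using conv_swap[OF y(1) class_function_carrier[OF ce], of "zp ?m"] by (simp only: e_def)
    then show ?thesis using ze by (simp add: e_def)
  qed
  have eB: "e \<star> B = e"
  proof -
    have "zp ?m \<star> B = zp ?m" unfolding zp_Suc using z(2) by (simp add: group_algebra_assoc)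
    moreover have "e \<star> B = (zp ?m \<star> B) \<star> y"
      unfolding e_def by (rule conv_swap[OF y(1) class_function_carrier[OF cB(1)]])
    ultimately show ?thesis by (simp add: e_def)
  qed
  have Be: "B \<star> e = e" using eB class_function_commute ce cB class_function_carrier by metis
  define f where "f = (\<lambda>x. B x - e x)"
  have cf: "class_function G f" unfolding f_def by (rule class_function_linear(2)[OF cB(1) ce])
  have ff: "f \<star> f = f" unfolding f_def
    by (simp add: group_algebra_distrib cB ee eB Be)
  have ef: "e \<star> f = (\<lambda>_. 0)" unfolding f_def by (simp add: group_algebra_distrib ee eB)
  have "e = (\<lambda>_. 0) \<or> f = (\<lambda>_. 0)"
  proof -
    have "B = e \<oplus>\<^bsub>group_algebra G\<^esub> f" by (simp add: f_def)
    then show ?thesis using B ce cf ee ff ef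
      unfolding is_block_def Let_def central_idempotent_iff by simp
  qed
  then show ?thesis
  proof
    assume "e = (\<lambda>_. 0)"
    then have "zp ?m = (\<lambda>_. 0)" using ze by simp
    then show ?thesis unfolding zp_def by blast
  next
    assume "f = (\<lambda>_. 0)"
    then have "B = e" by (auto simp: f_def fun_eq_iff)
    moreover have "e = z \<star> (zp m \<star> y)"
      unfolding e_def zp_Suc conv_comm[OF zp z(1)] by (rule group_algebra_assoc)
    ultimately show ?thesis using y class_function_mult zp by metis
  qed
qed

text \<open>Invertibility in the component of the center whose identity is \<open>B\<close>. The
  inverse is not asked to lie in that component, since \<open>y\<close> may be replaced by
  \<open>y \<star> B\<close>.\<close>

definition block_unit :: "('a \<Rightarrow> 'k::field) \<Rightarrow> ('a \<Rightarrow> 'k) \<Rightarrow> bool" where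
  "block_unit B z \<longleftrightarrow> (\<exists>y. class_function G y \<and> z \<star> y = B)"

text \<open>The non-units of a local ring form an ideal. Division by the sum gives
  \<open>a' + b' = B\<close>; if \<open>a'\<close> is not a unit, it is nilpotent, and repeated
  substitution writes \<open>B\<close> as a power of \<open>a'\<close> times \<open>B\<close> plus a
  multiple of \<open>b'\<close>.\<close>

lemma block_unit_add:
  fixes B a b :: "'a \<Rightarrow> 'k::field"
  assumes B: "is_block G B" and a: "class_function G a" "a \<star> B = a"
    and b: "class_function G b" "b \<star> B = b" and ab: "block_unit B (\<lambda>x. a x + b x)"
  shows "block_unit B a \<or> block_unit B b"
proof -
  interpret Z: cring "class_algebra G :: ('a \<Rightarrow> 'k) ring" by (rule cring_class_algebra)
  have cB: "class_function G B" "B \<star> B = B" "B \<noteq> (\<lambda>_. 0)"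
    using B by (simp_all add: is_block_def Let_def central_idempotent_iff)
  obtain y where y: "class_function G y" "(\<lambda>x. a x + b x) \<star> y = B"
    using ab unfolding block_unit_def by blast
  define a' where "a' = a \<star> y"
  define b' where "b' = b \<star> y"
  have c': "class_function G a'" "class_function G b'"
    unfolding a'_def b'_def using a b y class_function_mult by blast+
  have sum: "B = (\<lambda>x. a' x + b' x)" using y by (simp add: a'_def b'_def group_algebra_distrib)
  have a'B: "a' \<star> B = a'"
    unfolding a'_def conv_swap[OF y(1) class_function_carrier[OF cB(1)]] by (simp only: a)
  show ?thesis
  proof (cases "block_unit B a'")
    case True
    then obtain w where w: "class_function G w" "a' \<star> w = B" unfolding block_unit_def by blast
    then have "a \<star> (y \<star> w) = B" by (simp add: a'_def group_algebra_assoc)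
    then show ?thesis unfolding block_unit_def using w y class_function_mult by blast
  next
    case False
    then obtain m :: nat where m: "a' [^]\<^bsub>class_algebra G\<^esub> m = (\<lambda>_. 0)"
      using block_nilpotent_or_unit[OF B c'(1) a'B] unfolding block_unit_def by blast
    define ap where "ap = (\<lambda>m::nat. (a' [^]\<^bsub>class_algebra G\<^esub> m) \<star> B)"
    have ap: "class_function G (ap k)" for k
      using Z.nat_pow_closed[of a' k] c' cB class_function_mult by (simp add: ap_def)
    have ap_Suc: "ap k = (\<lambda>x. ap (Suc k) x + (b' \<star> ap k) x)" for k
    proof -
      have pk: "class_function G (a' [^]\<^bsub>class_algebra G\<^esub> k)"
        using Z.nat_pow_closed[of a' k] c' by simp
      have "ap k = ap k \<star> B" by (simp add: ap_def group_algebra_assoc cB)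
      also have "\<dots> = (\<lambda>x. (ap k \<star> a') x + (ap k \<star> b') x)"
        by (subst (1) sum) (simp add: group_algebra_distrib)
      also have "ap k \<star> a' = ap (Suc k)"
        unfolding ap_def conv_swap[OF cB(1) class_function_carrier[OF c'(1)]] by simp
      also have "ap k \<star> b' = b' \<star> ap k" by (rule conv_comm[OF ap c'(2)])
      finally show ?thesis .
    qed
    have "\<exists>t. class_function G t \<and> B = (\<lambda>x. ap k x + (b' \<star> t) x)" for k
    proof (induction k)
      case 0
      have "B = ap 0" using group_algebra_one_mult(1)[OF class_function_carrier[OF cB(1)]]
        by (simp add: ap_def)
      then show ?case by (intro exI[of _ "\<lambda>_. 0"]) (simp add: class_function_zero)
    next
      case (Suc k)
      then obtain t where t: "class_function G t" "B = (\<lambda>x. ap k x + (b' \<star> t) x)" by blast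
      have "B = (\<lambda>x. ap (Suc k) x + (b' \<star> (\<lambda>x. ap k x + t x)) x)"
        by (subst t(2), subst ap_Suc) (simp add: group_algebra_distrib add.assoc)
      then show ?case using class_function_linear(1)[OF ap t(1)] by blast
    qed
    from this[of m] obtain t where t: "class_function G t" "B = (\<lambda>x. ap m x + (b' \<star> t) x)" by blast
    have "ap m = (\<lambda>_. 0)" by (simp add: ap_def m)
    then have "B = b' \<star> t" using t(2) by simp
    then have "b \<star> (y \<star> t) = B" by (simp add: b'_def group_algebra_assoc)
    then show ?thesis unfolding block_unit_def using t y class_function_mult by blast
  qed
qed

definition class_sum :: "'a \<Rightarrow> 'a \<Rightarrow> 'k::field" where
  "class_sum x = (\<lambda>g. if \<exists>h\<in>carrier G. g = h \<otimes> x \<otimes> inv h then 1 else 0)"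

lemma conjugate_conj_iff:
  assumes "g \<in> carrier G" "x \<in> carrier G" "y \<in> carrier G"
  shows "(\<exists>h\<in>carrier G. g \<otimes> y \<otimes> inv g = h \<otimes> x \<otimes> inv h) \<longleftrightarrow> (\<exists>h\<in>carrier G. y = h \<otimes> x \<otimes> inv h)"
proof
  assume "\<exists>h\<in>carrier G. g \<otimes> y \<otimes> inv g = h \<otimes> x \<otimes> inv h"
  then obtain h where h: "h \<in> carrier G" "g \<otimes> y \<otimes> inv g = h \<otimes> x \<otimes> inv h" by blast
  have "y = inv g \<otimes> (g \<otimes> y \<otimes> inv g) \<otimes> inv (inv g)" using assms by (simp add: m_assoc)
  also have "\<dots> = (inv g \<otimes> h) \<otimes> x \<otimes> inv (inv g \<otimes> h)"
    using h assms conj_conj[of "inv g" h x] by simp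
  finally show "\<exists>h\<in>carrier G. y = h \<otimes> x \<otimes> inv h" using h assms by blast
next
  assume "\<exists>h\<in>carrier G. y = h \<otimes> x \<otimes> inv h"
  then obtain h where "h \<in> carrier G" "y = h \<otimes> x \<otimes> inv h" by blast
  then show "\<exists>h\<in>carrier G. g \<otimes> y \<otimes> inv g = h \<otimes> x \<otimes> inv h"
    using assms conj_conj[of g h x] by (intro bexI[of _ "g \<otimes> h"]) auto
qed

lemma class_function_class_sum:
  assumes "x \<in> carrier G"
  shows "class_function G (class_sum x :: 'a \<Rightarrow> 'k::field)"
  unfolding class_function_def
proof (intro conjI ballI)
  show "(class_sum x :: 'a \<Rightarrow> 'k) \<in> carrier (group_algebra G)"
    using assms by (auto simp: class_sum_def)
  fix g y assume "g \<in> carrier G" "y \<in> carrier G"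
  then show "(class_sum x (g \<otimes> y \<otimes> inv g) :: 'k) = class_sum x y"
    using conjugate_conj_iff assms by (simp add: class_sum_def)
qed

text \<open>\<open>B \<star> B = B\<close> is a unit of its component and a linear combination of
  products of \<open>B\<close> with class sums of elements in the support of \<open>B\<close>. Since
  non-units are closed under sums, one of these class sums is a unit. The induction removes one
  conjugacy class from the support at a time.\<close>

lemma block_class_sum_unit:
  fixes B :: "'a \<Rightarrow> 'k::field"
  assumes B: "is_block G B"
  obtains x where "x \<in> carrier G" "B x \<noteq> 0" "block_unit B (class_sum x)"
proof (rule ccontr)
  assume contra: "\<not> thesis"
  have cB: "class_function G B" "B \<star> B = B" "B \<noteq> (\<lambda>_. 0)"
    using B by (simp_all add: is_block_def Let_def central_idempotent_iff)
  have Bsupp: "x \<in> carrier G" if "B x \<noteq> 0" for x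
    using that class_function_carrier[OF cB(1)] by auto
  have nu: "\<not> block_unit B (class_sum x)" if "B x \<noteq> 0" for x
    using that contra Bsupp \<open>\<And>x. \<lbrakk>x \<in> carrier G; B x \<noteq> 0; block_unit B (class_sum x)\<rbrakk> \<Longrightarrow> thesis\<close>
    by blast
  \<comment> \<open>A scalar and the factor \<open>B\<close> can be moved into the inverse.\<close>
  have scale: "block_unit B z" if u: "block_unit B (\<lambda>x. c * (z \<star> B) x)" and z: "class_function G z"
    for z c
  proof -
    obtain y where y: "class_function G y" "(\<lambda>x. c * (z \<star> B) x) \<star> y = B"
      using u unfolding block_unit_def by blast
    have "z \<star> (\<lambda>x. c * (B \<star> y) x) = B"
      using y(2) by (simp add: group_algebra_distrib group_algebra_assoc)
    then show ?thesis unfolding block_unit_def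
      using class_function_scale[OF class_function_mult[OF cB(1) y(1)]] by blast
  qed
  have "\<not> block_unit B (z \<star> B)"
    if "class_function G z" "\<And>x. z x \<noteq> 0 \<Longrightarrow> B x \<noteq> 0" "card {x. z x \<noteq> 0} = n" for z n
    using that
  proof (induction n arbitrary: z rule: less_induct)
    case (less n)
    have zsupp: "{x. z x \<noteq> 0} \<subseteq> carrier G" using class_function_carrier[OF less.prems(1)] by auto
    then have fz: "finite {x. z x \<noteq> 0}" using finite_subset finite_carrier by blast
    show ?case
    proof (cases "\<exists>x. z x \<noteq> 0")
      case False
      then have "z = (\<lambda>_. 0)" by auto
      then show ?thesis using cB(3) by (auto simp: block_unit_def)
    next
      case True
      then obtain x where x: "z x \<noteq> 0" by blast
      then have xc: "x \<in> carrier G" using zsupp by blast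
      define w where "w = (\<lambda>g. z g - z x * class_sum x g)"
      have cx: "class_function G (class_sum x :: 'a \<Rightarrow> 'k)" by (rule class_function_class_sum[OF xc])
      have cw: "class_function G w" unfolding w_def
        by (rule class_function_linear(2)[OF less.prems(1) class_function_scale[OF cx]])
      have zc: "z (h \<otimes> x \<otimes> inv h) = z x" if "h \<in> carrier G" for h
        using less.prems(1) that xc by (simp add: class_function_def)
      have "w g = 0" if "z g = 0" for g
        using that zc x by (auto simp: w_def class_sum_def)
      then have sub: "{x. w x \<noteq> 0} \<subseteq> {x. z x \<noteq> 0}" by auto
      have "(class_sum x x :: 'k) = 1" using xc by (auto simp: class_sum_def intro!: bexI[of _ \<one>])
      then have "w x = 0" by (simp add: w_def)
      with x sub have "{x. w x \<noteq> 0} \<subset> {x. z x \<noteq> 0}" by blast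
      then have "card {x. w x \<noteq> 0} < n" using psubset_card_mono fz less.prems(3) by blast
      then have nw: "\<not> block_unit B (w \<star> B)"
        using less.IH[OF _ cw] less.prems(2) sub by blast
      have ns: "\<not> block_unit B (\<lambda>g. z x * (class_sum x \<star> B) g)"
        using scale[OF _ cx] nu less.prems(2) x by blast
      have eq: "z \<star> B = (\<lambda>g. (w \<star> B) g + z x * (class_sum x \<star> B) g)"
        unfolding w_def by (simp add: group_algebra_distrib)
      have c1: "class_function G (w \<star> B)" using class_function_mult cw cB by blast
      have c2: "class_function G (\<lambda>g. z x * (class_sum x \<star> B) g)"
        by (rule class_function_scale[OF class_function_mult[OF cx cB(1)]])
      have b1: "w \<star> B \<star> B = w \<star> B" by (simp add: group_algebra_assoc cB)
      have b2: "(\<lambda>g. z x * (class_sum x \<star> B) g) \<star> B = (\<lambda>g. z x * (class_sum x \<star> B) g)"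
        by (simp add: group_algebra_assoc group_algebra_distrib cB)
      show ?thesis using block_unit_add[OF B c1 b1 c2 b2] nw ns unfolding eq by blast
    qed
  qed
  then have "\<not> block_unit B (B \<star> B)" using cB(1) by blast
  moreover have "block_unit B (B \<star> B)" unfolding block_unit_def using cB by auto
  ultimately show False by blast
qed

end

section \<open>Defect groups and the Brauer homomorphism\<close>

text \<open>The fragment of the module axioms that does not involve the product of the ring; for an induced
  module it is verified without a double sum.\<close>

locale semi_module = R?: ring R + M?: abelian_group M
  for R :: "('a, 'x) ring_scheme" (structure) and M :: "('a, 'm, 'y) module_scheme" (structure) +
  assumes smult_closed:
      "\<lbrakk>a \<in> carrier R; x \<in> carrier M\<rbrakk> \<Longrightarrow> a \<odot>\<^bsub>M\<^esub> x \<in> carrier M"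
    and smult_l_distr:
      "\<lbrakk>a \<in> carrier R; b \<in> carrier R; x \<in> carrier M\<rbrakk> \<Longrightarrow>
       (a \<oplus>\<^bsub>R\<^esub> b) \<odot>\<^bsub>M\<^esub> x = a \<odot>\<^bsub>M\<^esub> x \<oplus>\<^bsub>M\<^esub> b \<odot>\<^bsub>M\<^esub> x"
    and smult_r_distr:
      "\<lbrakk>a \<in> carrier R; x \<in> carrier M; y \<in> carrier M\<rbrakk> \<Longrightarrow>
       a \<odot>\<^bsub>M\<^esub> (x \<oplus>\<^bsub>M\<^esub> y) = a \<odot>\<^bsub>M\<^esub> x \<oplus>\<^bsub>M\<^esub> a \<odot>\<^bsub>M\<^esub> y"
begin

lemma smult_zero_right [simp]: "a \<in> carrier R \<Longrightarrow> a \<odot>\<^bsub>M\<^esub> \<zero>\<^bsub>M\<^esub> = \<zero>\<^bsub>M\<^esub>"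
  using smult_r_distr[of a "\<zero>\<^bsub>M\<^esub>" "\<zero>\<^bsub>M\<^esub>"] smult_closed[of a "\<zero>\<^bsub>M\<^esub>"]
  by (metis M.add.l_cancel_one' M.zero_closed M.l_zero)

lemma smult_zero_left [simp]: "x \<in> carrier M \<Longrightarrow> \<zero>\<^bsub>R\<^esub> \<odot>\<^bsub>M\<^esub> x = \<zero>\<^bsub>M\<^esub>"
  using smult_l_distr[of "\<zero>\<^bsub>R\<^esub>" "\<zero>\<^bsub>R\<^esub>" x] smult_closed[of "\<zero>\<^bsub>R\<^esub>" x]
  by (metis M.add.l_cancel_one' R.zero_closed R.l_zero)

lemma smult_minus_left:
  assumes "a \<in> carrier R" "x \<in> carrier M"
  shows "\<ominus>\<^bsub>M\<^esub> (a \<odot>\<^bsub>M\<^esub> x) = (\<ominus>\<^bsub>R\<^esub> a) \<odot>\<^bsub>M\<^esub> x"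
proof (rule M.minus_equality)
  show "(\<ominus>\<^bsub>R\<^esub> a) \<odot>\<^bsub>M\<^esub> x \<oplus>\<^bsub>M\<^esub> a \<odot>\<^bsub>M\<^esub> x = \<zero>\<^bsub>M\<^esub>"
    using assms by (simp add: R.l_neg flip: smult_l_distr)
qed (use assms in \<open>auto intro: smult_closed\<close>)

lemma smult_minus_right:
  assumes "a \<in> carrier R" "x \<in> carrier M"
  shows "a \<odot>\<^bsub>M\<^esub> (\<ominus>\<^bsub>M\<^esub> x) = \<ominus>\<^bsub>M\<^esub> (a \<odot>\<^bsub>M\<^esub> x)"
proof (rule M.minus_equality[symmetric])
  show "a \<odot>\<^bsub>M\<^esub> (\<ominus>\<^bsub>M\<^esub> x) \<oplus>\<^bsub>M\<^esub> a \<odot>\<^bsub>M\<^esub> x = \<zero>\<^bsub>M\<^esub>"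
    using assms by (simp add: M.l_neg flip: smult_r_distr)
qed (use assms in \<open>auto intro: smult_closed\<close>)

end

sublocale left_module \<subseteq> semi_module
  by unfold_locales (fact smult_closed smult_l_distr smult_r_distr)+

definition regular_module :: "('a, 'x) ring_scheme \<Rightarrow> ('a, 'a) module" where
  "regular_module A = \<lparr>carrier = carrier A, monoid.mult = undefined, monoid.one = undefined,
     ring.zero = \<zero>\<^bsub>A\<^esub>, ring.add = (\<oplus>\<^bsub>A\<^esub>), module.smult = (\<otimes>\<^bsub>A\<^esub>)\<rparr>"

lemma left_module_regular_module:
  assumes "ring A"
  shows "left_module A (regular_module A)"
proof -
  interpret ring A by fact
  have "abelian_group (regular_module A)"
    by (rule abelian_groupI) (auto simp: regular_module_def a_ac intro: exI[of _ "\<ominus>\<^bsub>A\<^esub> _"] l_neg)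
  then show ?thesis
    unfolding left_module_def left_module_axioms_def
    using assms by (auto simp: regular_module_def m_assoc l_distr r_distr)
qed

lemma finite_range_of_int:
  assumes "CHAR('k::field) > 0"
  shows "finite (range (of_int :: int \<Rightarrow> 'k))"
proof (rule finite_subset)
  show "range (of_int :: int \<Rightarrow> 'k) \<subseteq> of_int ` {0..<int CHAR('k)}"
  proof (intro image_subsetI)
    fix i :: int
    have "(of_int i :: 'k) = of_int (int CHAR('k) * (i div int CHAR('k)) + i mod int CHAR('k))" by simp
    also have "\<dots> = of_int (i mod int CHAR('k))"
      unfolding of_int_add of_int_mult by simp
    finally show "(of_int i :: 'k) \<in> of_int ` {0..<int CHAR('k)}" using assms by force
  qed
qed simp

context finite_group
begin

lemma delta_delta_mult:
  assumes "g \<in> carrier G" "h \<in> carrier G"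
  shows "delta g c \<star> delta h d = delta (g \<otimes> h) (c * d)"
proof (rule group_algebra_eqI)
  fix x assume x: "x \<in> carrier G"
  have "inv g \<otimes> x = h \<longleftrightarrow> x = g \<otimes> h" using assms x by (metis inv_solve_left)
  then show "(delta g c \<star> delta h d) x = delta (g \<otimes> h) (c * d) x"
    using assms x by (simp add: delta_mult) (simp add: delta_def)
qed (use assms in \<open>auto simp: group_algebra_mult delta_def\<close>)

text \<open>A non-zero fixed vector of a \<open>p\<close>-group is found in the finite span of an orbit over the prime
  field: this span has order divisible by \<open>p\<close>, hence so has its set of fixed points.\<close>

lemma p_group_fixed_vector:
  fixes M :: "('a \<Rightarrow> 'k::field, 'm, 'y) module_scheme"
  assumes M: "left_module (group_algebra G) M"
    and H: "subgroup H G" "card H = p ^ n" "Factorial_Ring.prime p" "CHAR('k) = p"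
    and m: "m \<in> carrier M" "m \<noteq> \<zero>\<^bsub>M\<^esub>"
  obtains a where "a \<in> carrier (group_algebra G)" "a \<odot>\<^bsub>M\<^esub> m \<noteq> \<zero>\<^bsub>M\<^esub>"
    "\<And>h. h \<in> H \<Longrightarrow> delta h 1 \<odot>\<^bsub>M\<^esub> (a \<odot>\<^bsub>M\<^esub> m) = a \<odot>\<^bsub>M\<^esub> m"
proof -
  interpret M: left_module "group_algebra G" M by fact
  interpret H: subgroup H G by fact
  \<comment> \<open>The group ring of \<open>H\<close> over the prime field; the set
    \<open>S\<close> of its multiples of \<open>m\<close> is finite and stable under
    \<open>H\<close>.\<close>
  define F where "F = {a :: 'a \<Rightarrow> 'k. \<forall>x. (x \<in> H \<longrightarrow> a x \<in> range of_int) \<and> (x \<notin> H \<longrightarrow> a x = 0)}"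
  have p0: "p > 1" using H(3) prime_gt_1_nat by blast
  have "finite F"
    unfolding F_def using finite_subgroup[OF H(1)] finite_range_of_int[where ?'k = 'k] H(4) p0
    by (intro finite_set_of_finite_funs) auto
  have FA: "a \<in> carrier (group_algebra G)" if "a \<in> F" for a
    using that H.subset by (auto simp: F_def)
  define S where "S = (\<lambda>a. a \<odot>\<^bsub>M\<^esub> m) ` F"
  have fS: "finite S" using \<open>finite F\<close> by (simp add: S_def)
  have SM: "S \<subseteq> carrier M" using FA m M.smult_closed by (auto simp: S_def)
  have FI: "a \<in> F" if "\<And>x. x \<in> H \<Longrightarrow> a x \<in> range of_int" "\<And>x. x \<notin> H \<Longrightarrow> a x = 0" for a
    unfolding F_def using that by blast
  have F0: "a x = 0" if "a \<in> F" "x \<notin> H" for a x using that unfolding F_def by blast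
  have FD: "a x \<in> range of_int" if "a \<in> F" for a x
  proof (cases "x \<in> H")
    case True
    then show ?thesis using that unfolding F_def by blast
  next
    case False
    then have "a x = of_int 0" using F0[OF that] by simp
    then show ?thesis by (rule range_eqI)
  qed
  have Fadd: "(\<lambda>x. a x + b x) \<in> F" if ab: "a \<in> F" "b \<in> F" for a b
  proof (rule FI)
    fix x
    obtain i j where "a x = of_int i" "b x = of_int j"
      using FD[OF ab(1), of x] FD[OF ab(2), of x] by blast
    then have "a x + b x = of_int (i + j)" by simp
    then show "a x + b x \<in> range of_int" by (rule range_eqI)
  qed (simp add: F0 ab)
  have Fneg: "(\<lambda>x. - a x) \<in> F" if a: "a \<in> F" for a
  proof (rule FI)
    fix x
    obtain i where "a x = of_int i" using FD[OF a, of x] by blast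
    then have "- a x = of_int (- i)" by simp
    then show "- a x \<in> range of_int" by (rule range_eqI)
  qed (simp add: F0 a)
  have Fdelta: "delta \<one> (of_int i) \<in> F" for i
  proof (rule FI)
    fix x :: 'a
    have "delta \<one> (of_int i) x = (of_int (if x = \<one> then i else 0) :: 'k)" by (simp add: delta_def)
    then show "delta \<one> (of_int i) x \<in> range (of_int :: int \<Rightarrow> 'k)" by (rule range_eqI)
  qed (auto simp: delta_def)
  have Sadd: "s \<oplus>\<^bsub>M\<^esub> t \<in> S" if st: "s \<in> S" "t \<in> S" for s t
  proof -
    obtain a b where ab: "a \<in> F" "b \<in> F" "s = a \<odot>\<^bsub>M\<^esub> m" "t = b \<odot>\<^bsub>M\<^esub> m"
      using st unfolding S_def by blast
    then have "s \<oplus>\<^bsub>M\<^esub> t = (\<lambda>x. a x + b x) \<odot>\<^bsub>M\<^esub> m"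
      using M.smult_l_distr[OF FA FA m(1)] by simp
    then show ?thesis using Fadd ab by (auto simp: S_def)
  qed
  have Sneg: "\<ominus>\<^bsub>M\<^esub> s \<in> S" if s: "s \<in> S" for s
  proof -
    obtain a where a: "a \<in> F" "s = a \<odot>\<^bsub>M\<^esub> m" using s unfolding S_def by blast
    then have "\<ominus>\<^bsub>M\<^esub> s = (\<lambda>x. - a x) \<odot>\<^bsub>M\<^esub> m"
      using M.smult_minus_left[OF FA m(1)] group_algebra_m_inv[OF FA] by simp
    then show ?thesis using Fneg a by (auto simp: S_def)
  qed
  have mS: "delta \<one> (of_int i) \<odot>\<^bsub>M\<^esub> m \<in> S" for i unfolding S_def using Fdelta by blast
  have m1: "delta \<one> 1 \<odot>\<^bsub>M\<^esub> m = m" using M.smult_one[OF m(1)] by simp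
  have m0: "delta \<one> 0 \<odot>\<^bsub>M\<^esub> m = \<zero>\<^bsub>M\<^esub>"
    using M.smult_zero_left[OF m(1)] by (simp add: delta_def)
  have mem: "m \<in> S" "\<zero>\<^bsub>M\<^esub> \<in> S" using mS[of 1] mS[of 0] m1 m0 by auto
  have subS: "subgroup S (add_monoid M)"
    by (rule M.add.subgroupI) (use SM mem Sadd Sneg in \<open>auto simp: a_inv_def\<close>)
  let ?SG = "(add_monoid M)\<lparr>carrier := S\<rparr>"
  interpret SG: group ?SG by (rule M.add.subgroup_imp_group[OF subS])
  \<comment> \<open>Additive multiples of \<open>m\<close> are multiples by scalars from
    \<open>k\<close>, so \<open>m\<close> has additive order \<open>p\<close>, and \<open>p\<close>
    divides the order of \<open>S\<close>.\<close>
  have pow: "m [^]\<^bsub>?SG\<^esub> (k::nat) = delta \<one> (of_nat k) \<odot>\<^bsub>M\<^esub> m" for k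
  proof (induction k)
    case 0
    then show ?case by (simp add: m0)
  next
    case (Suc k)
    have "delta \<one> (of_nat (Suc k)) = (\<lambda>x. delta \<one> (of_nat k) x + (delta \<one> 1 x :: 'k))"
      by (auto simp: delta_def)
    then have "delta \<one> (of_nat (Suc k)) \<odot>\<^bsub>M\<^esub> m
        = delta \<one> (of_nat k) \<odot>\<^bsub>M\<^esub> m \<oplus>\<^bsub>M\<^esub> delta \<one> 1 \<odot>\<^bsub>M\<^esub> m"
      using M.smult_l_distr[OF delta_closed[OF one_closed] delta_closed[OF one_closed] m(1), of "of_nat k" 1]
      by simp
    then show ?case using Suc m1 by simp
  qed
  have "m [^]\<^bsub>?SG\<^esub> p = \<one>\<^bsub>?SG\<^esub>"
    using pow[of p] m0 H(4) by (metis (no_types) monoid.simps(2) of_nat_CHAR partial_object.update_convs(1) monoid.update_convs(2) pow nat_pow_0 of_nat_0)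
  then have "SG.ord m dvd p" using SG.pow_eq_id[of m p] mem by simp
  moreover have "SG.ord m \<noteq> 1"
    using SG.ord_eq_1[of m] mem m(2) by simp
  ultimately have "SG.ord m = p" using H(3) prime_nat_iff by blast
  then have pS: "p dvd card S"
    using SG.ord_dvd_group_order[of m] mem by (simp add: Coset.order_def)
  have dF: "delta h 1 \<star> a \<in> F" if h: "h \<in> H" and a: "a \<in> F" for h a
  proof -
    have hc: "h \<in> carrier G" using h H.subset by auto
    have "(delta h 1 \<star> a) x \<in> range of_int" if "x \<in> H" for x
    proof -
      have "x \<in> carrier G" "inv h \<otimes> x \<in> H" using that h H.subset by auto
      then show ?thesis using delta_mult[OF hc, of x 1 a] a by (simp add: F_def)
    qed
    moreover have "(delta h 1 \<star> a) x = 0" if x: "x \<notin> H" for x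
    proof (cases "x \<in> carrier G")
      case True
      have "inv h \<otimes> x \<notin> H"
      proof
        assume "inv h \<otimes> x \<in> H"
        then have "h \<otimes> (inv h \<otimes> x) \<in> H" using h by blast
        then show False using True hc x by simp
      qed
      then show ?thesis using delta_mult[OF hc True, of 1 a] a by (simp add: F_def)
    qed (simp add: group_algebra_mult)
    ultimately show ?thesis by (simp add: F_def)
  qed
  have HG: "group (G\<lparr>carrier := H\<rparr>)" using subgroup_imp_group[OF H(1)] .
  have "card S mod p = card {s \<in> S. \<forall>h\<in>carrier (G\<lparr>carrier := H\<rparr>). delta h 1 \<odot>\<^bsub>M\<^esub> s = s} mod p"
  proof (rule card_fixed_points_mod[OF HG _ H(3) fS, of n])
    show "card (carrier (G\<lparr>carrier := H\<rparr>)) = p ^ n" using H(2) by simp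
    show "delta \<one>\<^bsub>G\<lparr>carrier := H\<rparr>\<^esub> 1 \<odot>\<^bsub>M\<^esub> s = s" if "s \<in> S" for s
      using M.smult_one[of s] that SM by auto
    fix h s assume h: "h \<in> carrier (G\<lparr>carrier := H\<rparr>)" and s: "s \<in> S"
    obtain a where a: "a \<in> F" "s = a \<odot>\<^bsub>M\<^esub> m" using s by (auto simp: S_def)
    have hc: "h \<in> carrier G" using h H.subset by auto
    have "delta h 1 \<odot>\<^bsub>M\<^esub> s = (delta h 1 \<star> a) \<odot>\<^bsub>M\<^esub> m"
      using a M.smult_assoc[OF delta_closed[OF hc] FA[OF a(1)] m(1)] by simp
    then show "delta h 1 \<odot>\<^bsub>M\<^esub> s \<in> S" using dF a h by (auto simp: S_def)
    fix k assume k: "k \<in> carrier (G\<lparr>carrier := H\<rparr>)"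
    have kc: "k \<in> carrier G" using k H.subset by auto
    have "delta (h \<otimes> k) 1 = delta h 1 \<star> (delta k 1 :: 'a \<Rightarrow> 'k)"
      using delta_delta_mult[OF hc kc, of "1 :: 'k" 1] by simp
    then show "delta (h \<otimes>\<^bsub>G\<lparr>carrier := H\<rparr>\<^esub> k) 1 \<odot>\<^bsub>M\<^esub> s = delta h 1 \<odot>\<^bsub>M\<^esub> (delta k 1 \<odot>\<^bsub>M\<^esub> s)"
      using M.smult_assoc[OF delta_closed[OF hc] delta_closed[OF kc], of s 1 1] s SM by auto
  qed
  then have "p dvd card {s \<in> S. \<forall>h\<in>H. delta h 1 \<odot>\<^bsub>M\<^esub> s = s}" (is "p dvd card ?Fix")
    using pS by (simp add: dvd_eq_mod_eq_0)
  moreover have "\<zero>\<^bsub>M\<^esub> \<in> ?Fix"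
    using mem H.subset delta_closed by (auto simp del: group_algebra_simps(1) intro!: M.smult_zero_right)
  moreover have "finite ?Fix" using fS by simp
  ultimately have "\<not> ?Fix \<subseteq> {\<zero>\<^bsub>M\<^esub>}"
  proof (intro notI)
    assume "p dvd card ?Fix" "\<zero>\<^bsub>M\<^esub> \<in> ?Fix" "?Fix \<subseteq> {\<zero>\<^bsub>M\<^esub>}"
    then have "?Fix = {\<zero>\<^bsub>M\<^esub>}" by blast
    then have "card ?Fix = 1" by simp
    with \<open>p dvd card ?Fix\<close> p0 show False by simp
  qed
  then obtain s where "s \<in> S" "\<forall>h\<in>H. delta h 1 \<odot>\<^bsub>M\<^esub> s = s" "s \<noteq> \<zero>\<^bsub>M\<^esub>" by blast
  then show ?thesis using that FA by (auto simp: S_def simp del: group_algebra_simps)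
qed

text \<open>Otherwise the left ideal generated by \<open>e\<close> contains a nonzero vector
  \<open>v\<close> fixed by \<open>H\<close>, and \<open>e \<star> v = v\<close>. In the sum for
  \<open>v g\<close> the group \<open>H\<close> acts on the index by conjugation; normality and the
  invariance of \<open>v\<close> make the summands invariant, so only indices centralizing
  \<open>H\<close> remain, and there \<open>e\<close> vanishes.\<close>

lemma normal_p_subgroup_idempotent_eq_0:
  fixes e :: "'a \<Rightarrow> 'k::field"
  assumes e: "class_function G e" "e \<star> e = e"
    and H: "subgroup H G" "card H = p ^ n" "Factorial_Ring.prime p" "CHAR('k) = p"
    and normal: "\<And>g h. g \<in> carrier G \<Longrightarrow> h \<in> H \<Longrightarrow> g \<otimes> h \<otimes> inv g \<in> H"
    and br: "brauer_hom G H e = (\<lambda>_. 0)"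
  shows "e = (\<lambda>_. 0)"
proof (rule ccontr)
  assume ne: "e \<noteq> (\<lambda>_. 0)"
  interpret H: subgroup H G by fact
  let ?A = "group_algebra G :: ('a \<Rightarrow> 'k) ring"
  have M: "left_module ?A (regular_module ?A)"
    by (rule left_module_regular_module[OF ring_group_algebra])
  have reg [simp]: "carrier (regular_module ?A) = carrier ?A" "\<zero>\<^bsub>regular_module ?A\<^esub> = (\<lambda>_. 0)"
    "a \<odot>\<^bsub>regular_module ?A\<^esub> b = a \<star> b" for a b
    by (simp_all add: regular_module_def)
  have "e \<in> carrier (regular_module ?A)" "e \<noteq> \<zero>\<^bsub>regular_module ?A\<^esub>"
    using class_function_carrier[OF e(1)] ne by (simp_all del: group_algebra_simps(1))
  from p_group_fixed_vector[OF M H this]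
  obtain a where a: "a \<in> carrier ?A" "a \<star> e \<noteq> (\<lambda>_. 0)"
    "\<And>h. h \<in> H \<Longrightarrow> delta h 1 \<star> (a \<star> e) = a \<star> e"
    unfolding reg by blast
  define v where "v = a \<star> e"
  have v: "v (inv h \<otimes> g) = v g" if "h \<in> H" "g \<in> carrier G" for h g
    using fun_cong[OF a(3)[OF that(1)], of g] delta_mult[of h g 1 v] that H.subset
    by (auto simp: v_def)
  have ev: "e \<star> v = v"
    unfolding v_def using class_function_commute[OF e(1) a(1)] group_algebra_assoc e(2) by metis
  have "v g = 0" if g: "g \<in> carrier G" for g
  proof -
    let ?f = "\<lambda>y. e y * v (inv y \<otimes> g)"
    have HG: "group (G\<lparr>carrier := H\<rparr>)" using subgroup_imp_group[OF H(1)] .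
    have "v g = sum ?f (carrier G)" using g fun_cong[OF ev, of g] by (simp add: group_algebra_mult)
    also have "\<dots> = sum ?f {y \<in> carrier G. \<forall>h\<in>carrier (G\<lparr>carrier := H\<rparr>). h \<otimes> y \<otimes> inv h = y}"
    proof (rule sum_fixed_points[OF HG _ H(3,4), of n])
      fix h y assume h: "h \<in> carrier (G\<lparr>carrier := H\<rparr>)" and y: "y \<in> carrier G"
      have hc: "h \<in> carrier G" using h H.subset by auto
      show "h \<otimes> y \<otimes> inv h \<in> carrier G" using y hc by simp
      have e1: "e (h \<otimes> y \<otimes> inv h) = e y" using e(1) hc y by (simp add: class_function_def)
      \<comment> \<open>Normality lets \<open>h\<close> pass to the other side of \<open>y\<close>,
        where it is absorbed by the left invariance of \<open>v\<close>.\<close>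
      define h' where "h' = inv y \<otimes> h \<otimes> y"
      have h': "h' \<in> H" "h' \<in> carrier G"
        using normal[of "inv y" h] y h hc by (simp_all add: h'_def)
      have "inv (h \<otimes> y \<otimes> inv h) \<otimes> g = h \<otimes> (inv y \<otimes> (inv h \<otimes> g))"
        using hc y g by (simp add: inv_mult_group m_assoc)
      also have "v \<dots> = v (inv y \<otimes> (inv h \<otimes> g))"
        using v[of "inv h" "inv y \<otimes> (inv h \<otimes> g)"] h hc y g by simp
      also have "inv y \<otimes> (inv h \<otimes> g) = inv h' \<otimes> (inv y \<otimes> g)"
        using hc y g by (simp add: h'_def inv_mult_group m_assoc)
      also have "v \<dots> = v (inv y \<otimes> g)" using v[OF h'(1)] y g by simp
      finally show "e (h \<otimes> y \<otimes> inv h) * v (inv (h \<otimes> y \<otimes> inv h) \<otimes> g) = e y * v (inv y \<otimes> g)"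
        using e1 by simp
      fix k assume "k \<in> carrier (G\<lparr>carrier := H\<rparr>)"
      then show "h \<otimes>\<^bsub>G\<lparr>carrier := H\<rparr>\<^esub> k \<otimes> y \<otimes> inv (h \<otimes>\<^bsub>G\<lparr>carrier := H\<rparr>\<^esub> k)
          = h \<otimes> (k \<otimes> y \<otimes> inv k) \<otimes> inv h"
        using conj_conj hc y H.subset by auto
    qed (use H in auto)
    also have "{y \<in> carrier G. \<forall>h\<in>carrier (G\<lparr>carrier := H\<rparr>). h \<otimes> y \<otimes> inv h = y} = centralizer G H"
      using centralizer_iff_conj[OF H.subset] by auto
    also have "sum ?f (centralizer G H) = 0"
    proof (rule sum.neutral, rule ballI)
      fix y assume "y \<in> centralizer G H"
      then have "e y = 0" using fun_cong[OF br, of y] by (simp add: brauer_hom_def)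
      then show "e y * v (inv y \<otimes> g) = 0" by simp
    qed
    finally show ?thesis .
  qed
  moreover have "v g = 0" if "g \<notin> carrier G" for g using that by (simp add: v_def group_algebra_mult)
  ultimately have "v = (\<lambda>_. 0)" by blast
  with a(2) show False by (simp add: v_def)
qed

lemma class_function_brauer_hom:
  fixes a :: "'a \<Rightarrow> 'k::field"
  assumes "class_function G a" "subgroup H G"
    and normal: "\<And>g h. g \<in> carrier G \<Longrightarrow> h \<in> H \<Longrightarrow> g \<otimes> h \<otimes> inv g \<in> H"
  shows "class_function G (brauer_hom G H a)"
proof -
  interpret H: subgroup H G by fact
  have C: "g \<otimes> x \<otimes> inv g \<in> centralizer G H"
    if g: "g \<in> carrier G" and x: "x \<in> centralizer G H" for g x
    unfolding centralizer_iff_conj[OF H.subset]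
  proof (intro conjI ballI)
    have xc: "x \<in> carrier G" using x by (simp add: centralizer_def)
    then show "g \<otimes> x \<otimes> inv g \<in> carrier G" using g by simp
    fix h assume h: "h \<in> H"
    have hc: "h \<in> carrier G" using h H.subset by auto
    have "inv g \<otimes> h \<otimes> g \<in> H" using normal[of "inv g" h] g h by simp
    then have "(inv g \<otimes> h \<otimes> g) \<otimes> x \<otimes> inv (inv g \<otimes> h \<otimes> g) = x"
      using x unfolding centralizer_iff_conj[OF H.subset] by blast
    then have "g \<otimes> ((inv g \<otimes> h \<otimes> g) \<otimes> x \<otimes> inv (inv g \<otimes> h \<otimes> g)) \<otimes> inv g = g \<otimes> x \<otimes> inv g" by simp
    then show "h \<otimes> (g \<otimes> x \<otimes> inv g) \<otimes> inv h = g \<otimes> x \<otimes> inv g"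
      using g xc hc by (simp add: inv_mult_group m_assoc)
  qed
  have "g \<otimes> x \<otimes> inv g \<in> centralizer G H \<longleftrightarrow> x \<in> centralizer G H"
    if g: "g \<in> carrier G" and x: "x \<in> carrier G" for g x
    using C[of g x] C[of "inv g" "g \<otimes> x \<otimes> inv g"] g x conj_inv_conj[OF g x] by auto
  then show ?thesis
    using assms(1) brauer_hom_closed by (simp add: class_function_def brauer_hom_def)
qed

lemma class_function_conj:
  assumes "class_function G a" "subgroup H G" "h \<in> H" "x \<in> carrier G"
  shows "a (h \<otimes> x \<otimes> inv h) = a x"
  using assms subgroup.subset by (fastforce simp: class_function_def)

text \<open>With \<open>e'\<close> the truncation of \<open>e\<close>, the product
  \<open>e \<star> e'\<close> differs from \<open>e\<close> and from \<open>e'\<close> by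
  idempotents whose truncations vanish; by the preceding vanishing result both differences are
  zero.\<close>

lemma normal_p_subgroup_idempotent_support:
  fixes e :: "'a \<Rightarrow> 'k::field"
  assumes e: "class_function G e" "e \<star> e = e"
    and H: "subgroup H G" "card H = p ^ n" "Factorial_Ring.prime p" "CHAR('k) = p"
    and normal: "\<And>g h. g \<in> carrier G \<Longrightarrow> h \<in> H \<Longrightarrow> g \<otimes> h \<otimes> inv g \<in> H"
  shows "brauer_hom G H e = e"
proof -
  define e' where "e' = brauer_hom G H e"
  have br_mult: "brauer_hom G H (a \<star> b) = brauer_hom G H a \<star> brauer_hom G H b"
    if "class_function G a" "class_function G b" for a b :: "'a \<Rightarrow> 'k"
    using brauer_hom_mult[OF H] class_function_conj[OF that(1) H(1)] class_function_conj[OF that(2) H(1)]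
    by blast
  have ce': "class_function G e'" unfolding e'_def by (rule class_function_brauer_hom[OF e(1) H(1) normal])
  have ee': "e' \<star> e' = e'" using br_mult[OF e(1) e(1)] e(2) by (simp add: e'_def)
  have bre': "brauer_hom G H e' = e'" by (auto simp: e'_def brauer_hom_def)
  have comm: "e' \<star> e = e \<star> e'" by (rule conv_comm[OF ce' e(1)])
  have c: "class_function G (e \<star> e')" using class_function_mult e ce' by blast
  have i: "e \<star> (e \<star> e') = e \<star> e'" "e' \<star> (e \<star> e') = e \<star> e'" "e \<star> e' \<star> e = e \<star> e'" "e \<star> e' \<star> e' = e \<star> e'"
       "e \<star> e' \<star> (e \<star> e') = e \<star> e'"
  proof -
    show 1: "e \<star> (e \<star> e') = e \<star> e'" by (metis group_algebra_assoc e(2))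
    show 2: "e' \<star> (e \<star> e') = e \<star> e'" by (metis group_algebra_assoc ee' comm)
    show "e \<star> e' \<star> e = e \<star> e'" by (metis group_algebra_assoc comm e(2))
    show "e \<star> e' \<star> e' = e \<star> e'" by (metis group_algebra_assoc ee')
    show "e \<star> e' \<star> (e \<star> e') = e \<star> e'" by (metis group_algebra_assoc 1 2)
  qed
  have br: "brauer_hom G H (e \<star> e') = e'" using br_mult[OF e(1) ce'] bre' ee' by (simp add: e'_def)
  have "(\<lambda>x. e x - (e \<star> e') x) = (\<lambda>_. 0)"
    by (rule normal_p_subgroup_idempotent_eq_0[OF _ _ H normal])
      (auto simp: group_algebra_distrib e i br brauer_hom_linear class_function_linear c e'_def[symmetric])
  moreover have "(\<lambda>x. e' x - (e \<star> e') x) = (\<lambda>_. 0)"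
    by (rule normal_p_subgroup_idempotent_eq_0[OF _ _ H normal])
      (auto simp: group_algebra_distrib ee' i br brauer_hom_linear class_function_linear c ce' bre' comm)
  ultimately have "e' x = e x" for x by (metis eq_iff_diff_eq_0)
  then show ?thesis by (auto simp: e'_def)
qed

lemma normalizer_iff:
  assumes "H \<subseteq> carrier G"
  shows "g \<in> normalizer G H \<longleftrightarrow> g \<in> carrier G \<and> (\<lambda>h. g \<otimes> h \<otimes> inv g) ` H = H"
proof -
  have "g <# H #> inv g = (\<lambda>h. g \<otimes> h \<otimes> inv g) ` H"
    by (auto simp: l_coset_def r_coset_def)
  then show ?thesis using assms by (auto simp: normalizer_def stabilizer_def)
qed

lemma normalizer_iff_closed:
  assumes "H \<subseteq> carrier G"
  shows "g \<in> normalizer G H \<longleftrightarrow> g \<in> carrier G \<and> (\<forall>h\<in>H. g \<otimes> h \<otimes> inv g \<in> H)"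
proof -
  have "finite H" using assms finite_carrier finite_subset by blast
  then have "(\<lambda>h. g \<otimes> h \<otimes> inv g) ` H = H" if "g \<in> carrier G" "\<forall>h\<in>H. g \<otimes> h \<otimes> inv g \<in> H"
    using that card_conj[OF assms that(1)] by (intro card_subset_eq) auto
  then show ?thesis unfolding normalizer_iff[OF assms] by blast
qed

lemma subgroup_self_normalizer:
  assumes "subgroup H G"
  shows "H \<subseteq> normalizer G H"
proof
  interpret H: subgroup H G by fact
  fix h assume "h \<in> H"
  then show "h \<in> normalizer G H" using H.subset by (auto simp: normalizer_iff_closed)
qed

lemma centralizer_subset_normalizer:
  assumes "H \<subseteq> carrier G"
  shows "centralizer G H \<subseteq> normalizer G H"
proof
  fix x assume x: "x \<in> centralizer G H"
  have "x \<otimes> h \<otimes> inv x = h" if "h \<in> H" for h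
  proof -
    have "x \<in> carrier G" "h \<in> carrier G" "x \<otimes> h = h \<otimes> x"
      using x that assms by (simp_all add: centralizer_def subset_iff)
    then show ?thesis by (simp add: m_assoc)
  qed
  then show "x \<in> normalizer G H" using x by (simp add: normalizer_iff_closed[OF assms] centralizer_def)
qed

text \<open>This links defect groups defined by truncation with those of conjugacy classes. The
  truncation of \<open>class_sum x \<star> y = B\<close> at \<open>D\<close> is nonzero, so the
  class meets the centralizer of \<open>D\<close>. Truncation at a Sylow subgroup of the centralizer
  of \<open>x\<close> containing \<open>D\<close> still keeps the coefficient at \<open>x\<close>,
  so by maximality \<open>D\<close> is that Sylow subgroup.\<close>

lemma block_defect_class:
  fixes B :: "'a \<Rightarrow> 'k::field"
  assumes B: "is_block G B" and D: "is_defect_group G B D"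
    and p: "Factorial_Ring.prime p" "CHAR('k) = p"
  obtains x y where "x \<in> centralizer G D" "class_function G y" "class_sum x \<star> y = B"
    "card D dvd card (centralizer G {x})" "\<not> p dvd card (centralizer G {x}) div card D"
proof -
  have cB: "class_function G B" "B \<star> B = B" "B \<noteq> (\<lambda>_. 0)"
    using B by (simp_all add: is_block_def Let_def central_idempotent_iff)
  obtain n where sD: "subgroup D G" "card D = p ^ n"
    using D p by (auto simp: is_defect_group_def p_subgroup_def)
  interpret D: subgroup D G by fact
  obtain x0 y where x0: "x0 \<in> carrier G" "B x0 \<noteq> 0" "class_function G y" "class_sum x0 \<star> y = B"
    using block_class_sum_unit[OF B] unfolding block_unit_def by metis
  have c0: "class_function G (class_sum x0 :: 'a \<Rightarrow> 'k)" by (rule class_function_class_sum[OF x0(1)])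
  have "brauer_hom G D B = brauer_hom G D (class_sum x0) \<star> brauer_hom G D y"
    unfolding x0(4)[symmetric]
    by (rule brauer_hom_mult[OF sD p]) (rule class_function_conj[OF _ sD(1)], (rule c0 x0 | assumption)+)+
  then have "brauer_hom G D (class_sum x0 :: 'a \<Rightarrow> 'k) \<noteq> (\<lambda>_. 0)"
    using D by (auto simp: is_defect_group_def)
  then obtain x where x: "brauer_hom G D (class_sum x0 :: 'a \<Rightarrow> 'k) x \<noteq> 0" by auto
  then have xC: "x \<in> centralizer G D" by (auto simp: brauer_hom_def split: if_splits)
  have xc: "x \<in> carrier G" using xC by (simp add: centralizer_def)
  obtain h where h: "h \<in> carrier G" "x = h \<otimes> x0 \<otimes> inv h"
    using x by (auto simp: brauer_hom_def class_sum_def split: if_splits)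
  have Bx: "B x \<noteq> 0" using cB(1) h x0 by (simp add: class_function_def)
  have "(class_sum x :: 'a \<Rightarrow> 'k) = class_sum x0"
  proof -
    have "(\<exists>k\<in>carrier G. g = k \<otimes> x \<otimes> inv k) \<longleftrightarrow> (\<exists>k\<in>carrier G. g = k \<otimes> x0 \<otimes> inv k)" for g
    proof
      assume "\<exists>k\<in>carrier G. g = k \<otimes> x \<otimes> inv k"
      then obtain k where "k \<in> carrier G" "g = k \<otimes> x \<otimes> inv k" by blast
      then show "\<exists>k\<in>carrier G. g = k \<otimes> x0 \<otimes> inv k"
        using h x0 conj_conj[of k h x0] by (intro bexI[of _ "k \<otimes> h"]) auto
    next
      assume "\<exists>k\<in>carrier G. g = k \<otimes> x0 \<otimes> inv k"
      then obtain k where k: "k \<in> carrier G" "g = k \<otimes> x0 \<otimes> inv k" by blast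
      have "x0 = inv h \<otimes> x \<otimes> inv (inv h)" using h x0 by (simp add: m_assoc)
      then show "\<exists>k\<in>carrier G. g = k \<otimes> x \<otimes> inv k"
        using k h xc conj_conj[of k "inv h" x] by (intro bexI[of _ "k \<otimes> inv h"]) auto
    qed
    then show ?thesis by (simp add: class_sum_def)
  qed
  then have xy: "class_sum x \<star> y = B" using x0 by simp
  let ?C = "centralizer G {x}"
  have sC: "subgroup ?C G" using xc by (intro subgroup_centralizer) auto
  have DC: "D \<subseteq> ?C"
  proof
    fix d assume "d \<in> D"
    then show "d \<in> ?C" using xC D.subset by (simp add: centralizer_def subset_iff)
  qed
  obtain P where P: "subgroup P G" "P \<subseteq> ?C" "\<exists>n. card P = p ^ n" "card P dvd card ?C"
      "\<not> p dvd card ?C div card P"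
    using subgroup_sylow_exists[OF finite_carrier sC p(1)] by blast
  obtain c where c: "c \<in> ?C" "\<And>d. d \<in> D \<Longrightarrow> inv c \<otimes> d \<otimes> c \<in> P"
    using sylow_conj[OF finite_carrier sC P(1,2) sD(1) DC sD(2) p(1) P(5)] by blast
  have cc: "c \<in> carrier G" using c by (simp add: centralizer_def)
  \<comment> \<open>A conjugate of \<open>D\<close> under the centralizer of \<open>x\<close> lies
    in the Sylow subgroup \<open>P\<close>; conjugating \<open>P\<close> back gives one that
    contains \<open>D\<close>.\<close>
  define P' where "P' = (\<lambda>h. c \<otimes> h \<otimes> inv c) ` P"
  have P'C: "P' \<subseteq> ?C"
    using P(2) c(1) sC unfolding P'_def
    by (auto intro!: subgroup.m_closed[OF sC] subgroup.m_inv_closed[OF sC])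
  have sP': "subgroup P' G" unfolding P'_def by (rule subgroup_conj_closed[OF P(1) cc])
  have cP': "card P' = card P" unfolding P'_def
    by (rule card_conj[OF subgroup.subset[OF P(1)] cc])
  have DP': "D \<subseteq> P'"
  proof
    fix d assume d: "d \<in> D"
    have "d = c \<otimes> (inv c \<otimes> d \<otimes> c) \<otimes> inv c" using d D.subset cc by (auto simp: m_assoc)
    then show "d \<in> P'" unfolding P'_def using c(2)[OF d] by blast
  qed
  have "x \<in> centralizer G P'"
    unfolding centralizer_def
  proof (intro CollectI conjI ballI xc)
    fix q assume "q \<in> P'"
    then have "q \<in> ?C" using P'C by blast
    then show "x \<otimes> q = q \<otimes> x" by (simp add: centralizer_def)
  qed
  then have "brauer_hom G P' B x \<noteq> 0" using Bx by (simp add: brauer_hom_def)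
  then have "brauer_hom G P' B \<noteq> (\<lambda>_. 0)" by auto
  moreover have "p_subgroup CHAR('k) P' G" using sP' cP' P(3) p(2) by (simp add: p_subgroup_def)
  ultimately have "\<not> D \<subset> P'" using D by (auto simp: is_defect_group_def)
  then have "D = P'" using DP' by blast
  then show ?thesis using that[OF xC x0(3) xy] P(4,5) cP' by simp
qed

lemma normalizer_conj:
  assumes "subgroup H G" "g \<in> normalizer G H" "h \<in> H"
  shows "g \<otimes> h \<otimes> inv g \<in> H"
  using assms by (simp add: normalizer_iff_closed[OF subgroup.subset])

lemma subgroup_normalizer: "H \<subseteq> carrier G \<Longrightarrow> subgroup (normalizer G H) G"
  by (rule normalizer_imp_subgroup)

text \<open>For \<open>D \<subseteq> Q \<subseteq> N\<close> the centralizer of \<open>Q\<close>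
  lies in that of \<open>D\<close>, which lies in \<open>N\<close>. So truncating at
  \<open>D\<close> and then, inside \<open>N\<close>, at \<open>Q\<close> is the same as truncating
  \<open>B\<close> at \<open>Q\<close>; this is how \<open>D\<close> remains a defect group.\<close>

lemma defect_brauer_hom:
  fixes B :: "'a \<Rightarrow> 'k::field"
  assumes B: "is_block G B" and D: "is_defect_group G B D"
    and p: "Factorial_Ring.prime p" "CHAR('k) = p"
    and N: "N = normalizer G D"
  defines "H \<equiv> G\<lparr>carrier := N\<rparr>" and "c \<equiv> brauer_hom G D B"
  shows "class_function H c" "c \<otimes>\<^bsub>group_algebra H\<^esub> c = c" "c \<noteq> (\<lambda>_. 0)"
    and "\<And>Q. D \<subseteq> Q \<Longrightarrow> Q \<subseteq> N \<Longrightarrow> brauer_hom H Q c = brauer_hom G Q B"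
    and "is_defect_group H c D"
proof -
  have cB: "class_function G B" "B \<star> B = B" "B \<noteq> (\<lambda>_. 0)"
    using B by (simp_all add: is_block_def Let_def central_idempotent_iff)
  obtain n where sD: "subgroup D G" "card D = p ^ n"
    using D p by (auto simp: is_defect_group_def p_subgroup_def)
  interpret D: subgroup D G by fact
  have sN: "subgroup N G" unfolding N by (rule subgroup_normalizer[OF D.subset])
  interpret N: subgroup N G by fact
  interpret H: finite_group H unfolding H_def by (rule subgroup_finite_group[OF sN])
  have CN: "centralizer G D \<subseteq> N" unfolding N by (rule centralizer_subset_normalizer[OF D.subset])
  have DN: "D \<subseteq> N" unfolding N by (rule subgroup_self_normalizer[OF sD(1)])
  have invH: "inv\<^bsub>H\<^esub> x = inv x" if "x \<in> N" for x
    using that m_inv_consistent[OF sN] by (simp add: H_def)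
  have cH: "c \<in> carrier (group_algebra H)"
    using CN by (auto simp: H_def c_def brauer_hom_def)
  have Cconj: "g \<otimes> x \<otimes> inv g \<in> centralizer G D" if g: "g \<in> N" and x: "x \<in> centralizer G D" for g x
    unfolding centralizer_iff_conj[OF D.subset]
  proof (intro conjI ballI)
    have gc: "g \<in> carrier G" and xc: "x \<in> carrier G" using x g N.subset by (auto simp: centralizer_def)
    then show "g \<otimes> x \<otimes> inv g \<in> carrier G" by simp
    fix h assume h: "h \<in> D"
    have hc: "h \<in> carrier G" using h D.subset by auto
    have "inv g \<otimes> h \<otimes> inv (inv g) \<in> D"
      by (rule normalizer_conj[OF sD(1) _ h]) (use g N.m_inv_closed in \<open>simp add: N\<close>)
    then have "(inv g \<otimes> h \<otimes> g) \<otimes> x \<otimes> inv (inv g \<otimes> h \<otimes> g) = x"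
      using x gc unfolding centralizer_iff_conj[OF D.subset] by simp
    then have "g \<otimes> ((inv g \<otimes> h \<otimes> g) \<otimes> x \<otimes> inv (inv g \<otimes> h \<otimes> g)) \<otimes> inv g = g \<otimes> x \<otimes> inv g" by simp
    then show "h \<otimes> (g \<otimes> x \<otimes> inv g) \<otimes> inv h = g \<otimes> x \<otimes> inv g"
      using gc xc hc by (simp add: inv_mult_group m_assoc)
  qed
  have Ceq: "g \<otimes> x \<otimes> inv g \<in> centralizer G D \<longleftrightarrow> x \<in> centralizer G D"
    if g: "g \<in> N" and x: "x \<in> carrier G" for g x
    using Cconj[of g x] Cconj[of "inv g" "g \<otimes> x \<otimes> inv g"] g x conj_inv_conj[of g x] N.subset by auto
  show cc: "class_function H c"
    unfolding class_function_def
  proof (intro conjI ballI cH)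
    fix g x assume "g \<in> carrier H" "x \<in> carrier H"
    then have gx: "g \<in> N" "x \<in> N" "g \<in> carrier G" "x \<in> carrier G" using N.subset by (auto simp: H_def)
    have "B (g \<otimes> x \<otimes> inv g) = B x" using cB(1) gx by (simp add: class_function_def)
    then have "c (g \<otimes> x \<otimes> inv g) = c x" using Ceq gx by (simp add: c_def brauer_hom_def)
    then show "c (g \<otimes>\<^bsub>H\<^esub> x \<otimes>\<^bsub>H\<^esub> inv\<^bsub>H\<^esub> g) = c x" using gx invH by (simp add: H_def)
  qed
  have "c \<star> c = c"
    unfolding c_def
    using brauer_hom_mult[OF sD p, of B B] class_function_conj[OF cB(1) sD(1)] cB(2) by metis
  then show "c \<otimes>\<^bsub>group_algebra H\<^esub> c = c"
    using subgroup_algebra_mult[OF sN, of c c] cH by (simp only: H_def)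
  show cne: "c \<noteq> (\<lambda>_. 0)" unfolding c_def using D by (simp add: is_defect_group_def)
  show brQ: "brauer_hom H Q c = brauer_hom G Q B" if Q: "D \<subseteq> Q" "Q \<subseteq> N" for Q
  proof -
    have "centralizer H Q = centralizer G Q"
    proof -
      have "x \<in> N" if "x \<in> centralizer G Q" for x
        using that Q CN unfolding centralizer_def by blast
      then show ?thesis using N.subset by (auto simp: centralizer_def H_def)
    qed
    moreover have "centralizer G Q \<subseteq> centralizer G D" using Q unfolding centralizer_def by blast
    ultimately show ?thesis unfolding brauer_hom_def c_def by (auto simp: fun_eq_iff)
  qed
  show "is_defect_group H c D"
    unfolding is_defect_group_def
  proof (intro conjI allI impI)
    have "subgroup D H" unfolding H_def by (rule subgroup_incl[OF sD(1) sN DN])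
    then show "p_subgroup CHAR('k) D H" using sD p by (auto simp: p_subgroup_def)
    show "brauer_hom H D c \<noteq> (\<lambda>_. 0)" using brQ[OF order_refl DN] cne by (simp add: c_def)
    fix Q assume Q: "p_subgroup CHAR('k) Q H \<and> D \<subset> Q"
    then have sQ: "subgroup Q H" by (simp add: p_subgroup_def)
    have "Q \<subseteq> N" using subgroup.subset[OF sQ] by (simp add: H_def)
    moreover have "subgroup Q G" using sQ incl_subgroup[OF sN] by (simp add: H_def)
    ultimately have "brauer_hom H Q c = brauer_hom G Q B" "p_subgroup CHAR('k) Q G"
      using brQ Q by (auto simp: p_subgroup_def)
    then show "brauer_hom H Q c = (\<lambda>_. 0)" using D Q by (auto simp: is_defect_group_def)
  qed
qed

text \<open>A larger \<open>Q\<close> has zero truncation by the maximality of \<open>D\<close>. As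
  \<open>Q\<close> is normal in the normalizer of \<open>D\<close>, the truncation of
  \<open>B\<close> at \<open>D\<close>, a central idempotent of the algebra of that normalizer,
  would then have to be zero.\<close>

lemma defect_group_radical:
  fixes B :: "'a \<Rightarrow> 'k::field"
  assumes B: "is_block G B" and D: "is_defect_group G B D"
    and p: "Factorial_Ring.prime p" "CHAR('k) = p"
    and Q: "subgroup Q G" "card Q = p ^ n" "D \<subseteq> Q" "Q \<subseteq> normalizer G D"
    and normal: "\<And>g h. g \<in> normalizer G D \<Longrightarrow> h \<in> Q \<Longrightarrow> g \<otimes> h \<otimes> inv g \<in> Q"
  shows "Q = D"
proof (rule ccontr)
  assume "Q \<noteq> D"
  then have "D \<subset> Q" using Q by blast
  moreover have "p_subgroup CHAR('k) Q G" using Q p by (auto simp: p_subgroup_def)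
  ultimately have 0: "brauer_hom G Q B = (\<lambda>_. 0)" using D by (auto simp: is_defect_group_def)
  define N where "N = normalizer G D"
  define H where "H = G\<lparr>carrier := N\<rparr>"
  define c where "c = brauer_hom G D B"
  note c = defect_brauer_hom[OF B D p N_def, folded H_def c_def]
  have "D \<subseteq> carrier G" using Q subgroup.subset by blast
  then have sN: "subgroup N G" unfolding N_def by (rule subgroup_normalizer)
  interpret H: finite_group H unfolding H_def by (rule subgroup_finite_group[OF sN])
  have QN: "Q \<subseteq> N" using Q by (simp add: N_def)
  have sQ: "subgroup Q H" unfolding H_def by (rule subgroup_incl[OF Q(1) sN QN])
  have "c = (\<lambda>_. 0)"
  proof (rule H.normal_p_subgroup_idempotent_eq_0[OF c(1,2) sQ Q(2) p])
    show "brauer_hom H Q c = (\<lambda>_. 0)" using c(4)[OF Q(3) QN] 0 by simp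
    show "g \<otimes>\<^bsub>H\<^esub> h \<otimes>\<^bsub>H\<^esub> inv\<^bsub>H\<^esub> g \<in> Q" if "g \<in> carrier H" "h \<in> Q" for g h
      using that normal[of g h] m_inv_consistent[OF sN, of g] by (simp add: H_def N_def)
  qed
  with c(3) show False by simp
qed

end

section \<open>Fusion in the normalizer and Brauer's first main theorem\<close>

context finite_group
begin

text \<open>Burnside's argument: \<open>D\<close> and its conjugate by \<open>inv g\<close> both lie
  in the centralizer of \<open>z\<close>, where \<open>D\<close> is a Sylow subgroup. An element
  \<open>y\<close> of this centralizer carries one to the other, so \<open>g \<otimes> y\<close>
  normalizes \<open>D\<close> and acts on \<open>z\<close> as \<open>g\<close> does.\<close>

lemma defect_group_controls_fusion:
  assumes D: "subgroup D G" "card D = p ^ n" and p: "Factorial_Ring.prime p"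
    and z: "z \<in> centralizer G D" "\<not> p dvd card (centralizer G {z}) div card D"
    and g: "g \<in> carrier G" "g \<otimes> z \<otimes> inv g \<in> centralizer G D"
  obtains k where "k \<in> normalizer G D" "k \<otimes> z \<otimes> inv k = g \<otimes> z \<otimes> inv g"
proof -
  interpret D: subgroup D G by fact
  have zc: "z \<in> carrier G" using z by (simp add: centralizer_def)
  let ?C = "centralizer G {z}"
  have sC: "subgroup ?C G" using zc by (intro subgroup_centralizer) auto
  have memC: "x \<in> ?C" if "x \<in> carrier G" "x \<otimes> z \<otimes> inv x = z" for x
    using conj_eq_self_iff[of x z] that zc by (simp add: centralizer_def)
  have Cz: "x \<otimes> z \<otimes> inv x = z" if "x \<in> ?C" for x
    using that zc conj_eq_self_iff[of x z] by (simp add: centralizer_def)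
  have DC: "D \<subseteq> ?C"
  proof
    fix d assume d: "d \<in> D"
    then have "d \<otimes> z \<otimes> inv d = z" using z centralizer_iff_conj[OF D.subset] by blast
    then show "d \<in> ?C" using memC d D.subset by blast
  qed
  define R where "R = (\<lambda>d. inv g \<otimes> d \<otimes> inv (inv g)) ` D"
  have sR: "subgroup R G" unfolding R_def by (rule subgroup_conj_closed[OF D(1)]) (simp add: g)
  have cR: "card R = card D" unfolding R_def by (rule card_conj[OF D.subset]) (simp add: g)
  have RC: "R \<subseteq> ?C"
  proof
    fix r assume "r \<in> R"
    then obtain d where d: "d \<in> D" "r = inv g \<otimes> d \<otimes> g" unfolding R_def using g by auto
    have dc: "d \<in> carrier G" using d D.subset by auto
    have "d \<otimes> (g \<otimes> z \<otimes> inv g) \<otimes> inv d = g \<otimes> z \<otimes> inv g"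
      using d g centralizer_iff_conj[OF D.subset] by blast
    then have "inv g \<otimes> (d \<otimes> (g \<otimes> z \<otimes> inv g) \<otimes> inv d) \<otimes> g = z"
      using conj_inv_conj[OF g(1) zc] by simp
    then have "r \<otimes> z \<otimes> inv r = z" using d dc g zc by (simp add: inv_mult_group m_assoc)
    then show "r \<in> ?C" using memC d dc g by simp
  qed
  obtain y where y: "y \<in> ?C" "(\<lambda>h. y \<otimes> h \<otimes> inv y) ` D = R"
    using sylow_conj_eq[OF finite_carrier sC D(1) DC sR RC cR D(2) p z(2)] by blast
  have yc: "y \<in> carrier G" using y by (simp add: centralizer_def)
  have "g \<otimes> y \<in> normalizer G D"
    unfolding normalizer_iff_closed[OF D.subset]
  proof (intro conjI ballI)
    fix d assume d: "d \<in> D"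
    then obtain d' where d': "d' \<in> D" "y \<otimes> d \<otimes> inv y = inv g \<otimes> d' \<otimes> inv (inv g)"
      using y(2) unfolding R_def by (metis (no_types, lifting) imageE imageI)
    have "(g \<otimes> y) \<otimes> d \<otimes> inv (g \<otimes> y) = g \<otimes> (y \<otimes> d \<otimes> inv y) \<otimes> inv g"
      using conj_conj[of g y d] g yc d D.subset by auto
    also have "\<dots> = d'" unfolding d'(2) using g d' D.subset by (auto simp: m_assoc)
    finally show "g \<otimes> y \<otimes> d \<otimes> inv (g \<otimes> y) \<in> D" using d' by simp
  qed (use g yc in simp)
  moreover have "(g \<otimes> y) \<otimes> z \<otimes> inv (g \<otimes> y) = g \<otimes> z \<otimes> inv g"
    using conj_conj[of g y z] g yc zc Cz[OF y(1)] by simp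
  ultimately show ?thesis using that by blast
qed

text \<open>Brauer's first main theorem: a class function on \<open>N\<^sub>G(D)\<close> that is a summand of the image of
  \<open>B\<close> lifts to a class function on \<open>G\<close>, because its support consists of elements \<open>z\<close> for which
  \<open>D\<close> is a Sylow subgroup of the centralizer.\<close>

lemma defect_brauer_hom_primitive:
  fixes B :: "'a \<Rightarrow> 'k::field"
  assumes B: "is_block G B" and D: "is_defect_group G B D"
    and p: "Factorial_Ring.prime p" "CHAR('k) = p"
    and N: "N = normalizer G D"
  shows "is_block (G\<lparr>carrier := N\<rparr>) (brauer_hom G D B)"
proof -
  define H where "H = G\<lparr>carrier := N\<rparr>"
  define c where "c = brauer_hom G D B"
  note c = defect_brauer_hom[OF B D p N, folded H_def c_def]
  have cB: "class_function G B" "B \<star> B = B" "B \<noteq> (\<lambda>_. 0)"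
    using B by (simp_all add: is_block_def Let_def central_idempotent_iff)
  obtain n where sD: "subgroup D G" "card D = p ^ n"
    using D p by (auto simp: is_defect_group_def p_subgroup_def)
  interpret D: subgroup D G by fact
  have sN: "subgroup N G" unfolding N by (rule subgroup_normalizer[OF D.subset])
  interpret N: subgroup N G by fact
  interpret H: finite_group H unfolding H_def by (rule subgroup_finite_group[OF sN])
  have DN: "D \<subseteq> N" unfolding N by (rule subgroup_self_normalizer[OF sD(1)])
  have CN: "centralizer G D \<subseteq> N" unfolding N by (rule centralizer_subset_normalizer[OF D.subset])
  have HC: "carrier H = N" by (simp add: H_def)
  have Hm: "x \<otimes>\<^bsub>H\<^esub> y = x \<otimes> y" for x y by (simp add: H_def)
  have Hi: "inv\<^bsub>H\<^esub> x = inv x" if "x \<in> N" for x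
    using that m_inv_consistent[OF sN] by (simp add: H_def)
  have sDH: "subgroup D H" unfolding H_def by (rule subgroup_incl[OF sD(1) sN DN])
  have normalD: "g \<otimes>\<^bsub>H\<^esub> h \<otimes>\<^bsub>H\<^esub> inv\<^bsub>H\<^esub> g \<in> D" if "g \<in> carrier H" "h \<in> D" for g h
    using that normalizer_conj[OF sD(1), of g h] by (simp add: HC Hm Hi N)
  have Hconv: "a \<otimes>\<^bsub>group_algebra H\<^esub> b = a \<star> b"
    if "a \<in> carrier (group_algebra H)" "b \<in> carrier (group_algebra H)" for a b :: "'a \<Rightarrow> 'k"
    using subgroup_algebra_mult[OF sN] that by (simp only: H_def)
  have brD: "brauer_hom G D (a \<star> b) = brauer_hom G D a \<star> brauer_hom G D b"
    if "class_function G a" "class_function G b" for a b :: "'a \<Rightarrow> 'k"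
    using brauer_hom_mult[OF sD p] class_function_conj[OF that(1) sD(1)]
      class_function_conj[OF that(2) sD(1)] by blast
  have key: "e = (\<lambda>_. 0) \<or> f = (\<lambda>_. 0)"
    if e: "class_function H e" "e \<otimes>\<^bsub>group_algebra H\<^esub> e = e"
      and f: "class_function H f"
      and ef: "e \<otimes>\<^bsub>group_algebra H\<^esub> f = (\<lambda>_. 0)" and sum: "c = (\<lambda>x. e x + f x)"
      and ff: "f \<otimes>\<^bsub>group_algebra H\<^esub> f = f" for e f
  proof -
    note eA = H.class_function_carrier[OF e(1)] and fA = H.class_function_carrier[OF f]
      and cA = H.class_function_carrier[OF c(1)]
    have ec: "e \<otimes>\<^bsub>group_algebra H\<^esub> c = e"
      unfolding sum by (simp add: H.group_algebra_distrib e ef)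
    have fe: "f \<otimes>\<^bsub>group_algebra H\<^esub> e = (\<lambda>_. 0)" using H.conv_comm[OF f e(1)] ef by simp
    have fc: "f \<otimes>\<^bsub>group_algebra H\<^esub> c = f"
      unfolding sum by (simp add: H.group_algebra_distrib fe ff)
    have bre: "brauer_hom H D e = e"
      by (rule H.normal_p_subgroup_idempotent_support[OF e sDH sD(2) p normalD])
    have suppH: "z \<in> centralizer H D" if "e z \<noteq> 0" for z
      using fun_cong[OF bre, of z] that by (auto simp: brauer_hom_def split: if_splits)
    have supp: "z \<in> centralizer G D" if "e z \<noteq> 0" for z
      using suppH[OF that] N.subset by (auto simp: centralizer_def H_def)
    \<comment> \<open>A Sylow subgroup \<open>P\<close> of the centralizer of \<open>z\<close> in
      \<open>N\<close> contains the normal subgroup \<open>D\<close>, and the truncation of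
      \<open>e\<close> at \<open>P\<close> does not vanish; hence neither does that of
      \<open>B\<close>, and \<open>P = D\<close>. To pass from \<open>N\<close> to the whole group,
      the indices of \<open>D\<close> in the two centralizers of \<open>z\<close> are compared; they
      are congruent modulo \<open>p\<close>.\<close>
    have syl: "\<not> p dvd card (centralizer G {z}) div card D" if ez: "e z \<noteq> 0" for z
    proof -
      have zD: "z \<in> centralizer G D" by (rule supp[OF ez])
      have zN: "z \<in> N" using zD CN by blast
      have zc: "z \<in> carrier G" using zN N.subset by blast
      let ?C = "centralizer H {z}"
      have sC: "subgroup ?C H" using zN by (intro H.subgroup_centralizer) (auto simp: HC)
      have DC: "D \<subseteq> ?C"
      proof
        fix d assume d: "d \<in> D"
        then have "z \<otimes> d = d \<otimes> z" using zD by (simp add: centralizer_def)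
        then show "d \<in> ?C" using d DN by (auto simp: centralizer_def HC Hm)
      qed
      obtain P where P: "subgroup P H" "P \<subseteq> ?C" "\<exists>n. card P = p ^ n" "card P dvd card ?C"
          "\<not> p dvd card ?C div card P"
        using H.subgroup_sylow_exists[OF H.finite_carrier sC p(1)] by blast
      obtain y where y: "y \<in> ?C" "\<And>d. d \<in> D \<Longrightarrow> inv\<^bsub>H\<^esub> y \<otimes>\<^bsub>H\<^esub> d \<otimes>\<^bsub>H\<^esub> y \<in> P"
        using H.sylow_conj[OF H.finite_carrier sC P(1,2) sDH DC sD(2) p(1) P(5)] by blast
      have yc: "y \<in> carrier H" using y by (simp add: centralizer_def)
      have DP: "D \<subseteq> P"
      proof
        fix d assume d: "d \<in> D"
        have dc: "d \<in> carrier H" using d DN HC by auto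
        have "inv\<^bsub>H\<^esub> y \<otimes>\<^bsub>H\<^esub> (y \<otimes>\<^bsub>H\<^esub> d \<otimes>\<^bsub>H\<^esub> inv\<^bsub>H\<^esub> y) \<otimes>\<^bsub>H\<^esub> y \<in> P" using y(2) normalD[OF yc d] by blast
        then show "d \<in> P" using H.conj_inv_conj[OF yc dc] by simp
      qed
      have PN: "P \<subseteq> N" using subgroup.subset[OF P(1)] HC by simp
      have PG: "subgroup P G" using P(1) incl_subgroup[OF sN] by (simp add: H_def)
      have "z \<in> centralizer H P"
        using P(2) zN unfolding centralizer_def by (auto simp: HC)
      then have "brauer_hom H P e z \<noteq> 0" using ez by (simp add: brauer_hom_def)
      moreover have "brauer_hom H P e = brauer_hom H P e \<otimes>\<^bsub>group_algebra H\<^esub> brauer_hom H P c"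
      proof -
        obtain m where "card P = p ^ m" using P(3) by blast
        then have "brauer_hom H P (e \<otimes>\<^bsub>group_algebra H\<^esub> c)
            = brauer_hom H P e \<otimes>\<^bsub>group_algebra H\<^esub> brauer_hom H P c"
          using H.brauer_hom_mult[OF P(1) _ p] H.class_function_conj[OF e(1) P(1)]
            H.class_function_conj[OF c(1) P(1)] by blast
        then show ?thesis by (simp only: ec)
      qed
      ultimately have "brauer_hom H P c \<noteq> (\<lambda>_. 0)" by auto
      then have "brauer_hom G P B \<noteq> (\<lambda>_. 0)" using c(4)[OF DP PN] by simp
      moreover have "p_subgroup CHAR('k) P G" using PG P(3) p by (simp add: p_subgroup_def)
      ultimately have "P = D" using D DP unfolding is_defect_group_def by blast
      then have nd: "\<not> p dvd card ?C div card D" using P(5) by simp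
      let ?CG = "centralizer G {z}"
      have sCG: "subgroup ?CG G" using zc by (intro subgroup_centralizer) auto
      have DCG: "D \<subseteq> ?CG"
      proof
        fix d assume d: "d \<in> D"
        then have "z \<otimes> d = d \<otimes> z" using zD by (simp add: centralizer_def)
        then show "d \<in> ?CG" using d D.subset by (auto simp: centralizer_def)
      qed
      have CHG: "subgroup ?C G" using sC incl_subgroup[OF sN] by (simp add: H_def)
      have "{y \<in> ?CG. \<forall>r\<in>D. inv y \<otimes> r \<otimes> y \<in> D} = ?C"
      proof -
        have "(\<forall>r\<in>D. inv y \<otimes> r \<otimes> y \<in> D) \<longleftrightarrow> y \<in> N" if "y \<in> carrier G" for y
        proof -
          have "(\<forall>r\<in>D. inv y \<otimes> r \<otimes> y \<in> D) \<longleftrightarrow> inv y \<in> N"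
            using that by (simp add: N normalizer_iff_closed[OF D.subset])
          also have "\<dots> \<longleftrightarrow> y \<in> N" using that N.m_inv_closed[of "inv y"] N.m_inv_closed[of y] by auto
          finally show ?thesis .
        qed
        then show ?thesis using N.subset by (auto simp: centralizer_def HC Hm)
      qed
      then have "(card ?CG div card D) mod p = card ((\<lambda>y. y <# D) ` ?C) mod p"
        using card_fixed_lcosets_mod[OF finite_carrier sCG sD(1) DCG sD(1) DCG sD(2) p(1)] by simp
      also have "card ((\<lambda>y. y <# D) ` ?C) = card ?C div card D"
        using card_lcosets[OF finite_carrier CHG sD(1) DC] card_subgroup_pos[OF sD(1)]
        by (metis nonzero_mult_div_cancel_right not_gr_zero)
      finally show ?thesis using nd by (simp add: dvd_eq_mod_eq_0)
    qed
    have fusion: "e z' = e z" if ez: "e z \<noteq> 0" and h: "h \<in> carrier G" "z' = h \<otimes> z \<otimes> inv h"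
        and z': "z' \<in> centralizer G D" for z z' h
    proof -
      obtain k where k: "k \<in> N" "k \<otimes> z \<otimes> inv k = z'"
        using defect_group_controls_fusion[OF sD p(1) supp[OF ez] syl[OF ez] h(1)] h(2) z' N by metis
      have "z \<in> N" using supp[OF ez] CN by blast
      then have "e (k \<otimes>\<^bsub>H\<^esub> z \<otimes>\<^bsub>H\<^esub> inv\<^bsub>H\<^esub> k) = e z" using e(1) k(1) HC by (simp add: class_function_def)
      then show ?thesis using k by (simp add: Hm Hi)
    qed
    \<comment> \<open>\<open>w\<close> spreads \<open>e\<close> over the conjugacy classes of the
      whole group. It is a class function by construction; fusion control is what makes the element
      chosen by \<open>SOME\<close> irrelevant and the truncation of \<open>w\<close> equal to
      \<open>e\<close>.\<close>
    define T where "T = (\<lambda>g. {z. e z \<noteq> 0 \<and> (\<exists>h\<in>carrier G. z = h \<otimes> g \<otimes> inv h)})"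
    define w where "w = (\<lambda>g. if g \<in> carrier G \<and> T g \<noteq> {} then e (SOME z. z \<in> T g) else 0)"
    have Tconj: "T (k \<otimes> g \<otimes> inv k) = T g" if "k \<in> carrier G" "g \<in> carrier G" for k g
    proof -
      have "(\<exists>h\<in>carrier G. z = h \<otimes> (k \<otimes> g \<otimes> inv k) \<otimes> inv h) \<longleftrightarrow> (\<exists>h\<in>carrier G. z = h \<otimes> g \<otimes> inv h)" for z
      proof
        assume "\<exists>h\<in>carrier G. z = h \<otimes> (k \<otimes> g \<otimes> inv k) \<otimes> inv h"
        then obtain h where "h \<in> carrier G" "z = h \<otimes> (k \<otimes> g \<otimes> inv k) \<otimes> inv h" by blast
        then show "\<exists>h\<in>carrier G. z = h \<otimes> g \<otimes> inv h"
          using that conj_conj[of h k g] by (intro bexI[of _ "h \<otimes> k"]) auto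
      next
        assume "\<exists>h\<in>carrier G. z = h \<otimes> g \<otimes> inv h"
        then obtain h where "h \<in> carrier G" "z = h \<otimes> g \<otimes> inv h" by blast
        then show "\<exists>h\<in>carrier G. z = h \<otimes> (k \<otimes> g \<otimes> inv k) \<otimes> inv h"
          using that by (intro bexI[of _ "h \<otimes> inv k"]) (auto simp: inv_mult_group m_assoc)
      qed
      then show ?thesis by (simp add: T_def)
    qed
    have cw: "class_function G w"
      unfolding class_function_def
    proof (intro conjI ballI)
      show "w \<in> carrier (group_algebra G)" by (simp add: w_def)
      fix g x assume "g \<in> carrier G" "x \<in> carrier G"
      then show "w (g \<otimes> x \<otimes> inv g) = w x" using Tconj by (simp add: w_def)
    qed
    have brw: "brauer_hom G D w = e"
    proof
      fix g show "brauer_hom G D w g = e g"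
      proof (cases "g \<in> centralizer G D")
        case False
        then show ?thesis using supp[of g] by (auto simp: brauer_hom_def)
      next
        case True
        then have gc: "g \<in> carrier G" by (simp add: centralizer_def)
        have T: "e z = e g" if z: "z \<in> T g" for z
        proof -
          obtain h where h: "e z \<noteq> 0" "h \<in> carrier G" "z = h \<otimes> g \<otimes> inv h"
            using z unfolding T_def by blast
          have "g = inv h \<otimes> z \<otimes> inv (inv h)" using h gc by (simp add: m_assoc)
          then show ?thesis using fusion[OF h(1) _ _ True] h(2) inv_closed by metis
        qed
        have "e g = 0" if "T g = {}"
        proof (rule ccontr)
          assume "e g \<noteq> 0"
          then have "g \<in> T g" using gc by (auto simp: T_def intro!: bexI[of _ \<one>])
          with that show False by simp
        qed
        moreover have "e (SOME z. z \<in> T g) = e g" if "T g \<noteq> {}"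
          by (rule T[OF someI_ex]) (use that in blast)
        ultimately show ?thesis using True gc by (auto simp: brauer_hom_def w_def)
      qed
    qed
    \<comment> \<open>\<open>w \<star> B\<close> lies in the local ring belonging to
      \<open>B\<close> and truncates to the idempotent \<open>e\<close>. Nilpotency gives
      \<open>e = 0\<close>; invertibility makes \<open>c\<close> a multiple of \<open>e\<close>,
      which forces \<open>f = 0\<close>.\<close>
    have cwB: "class_function G (w \<star> B)" by (rule class_function_mult[OF cw cB(1)])
    have brwB: "brauer_hom G D (w \<star> B) = e"
      using brD[OF cw cB(1)] brw ec Hconv[OF eA cA] by (simp add: c_def[symmetric])
    have "(w \<star> B) \<star> B = w \<star> B" by (simp add: group_algebra_assoc cB)
    from block_nilpotent_or_unit[OF B cwB this]
    show ?thesis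
    proof
      assume "\<exists>m::nat. (w \<star> B) [^]\<^bsub>class_algebra G\<^esub> m = (\<lambda>_. 0)"
      then obtain m :: nat where m: "(w \<star> B) [^]\<^bsub>class_algebra G\<^esub> m = (\<lambda>_. 0)" by blast
      interpret Z: cring "class_algebra G :: ('a \<Rightarrow> 'k) ring" by (rule cring_class_algebra)
      have pw: "class_function G ((w \<star> B) [^]\<^bsub>class_algebra G\<^esub> k)" for k :: nat
        using Z.nat_pow_closed[of "w \<star> B" k] cwB by simp
      have eAG: "e \<in> carrier (group_algebra G)"
        using subgroup_algebra_carrier[OF sN] eA by (simp only: H_def)
      have "brauer_hom G D ((w \<star> B) [^]\<^bsub>class_algebra G\<^esub> k) \<star> e = e" for k :: nat
      proof (induction k)
        case 0
        have "\<one> \<in> centralizer G D" using D.subset by (auto simp: centralizer_def)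
        then have "brauer_hom G D (delta \<one> (1 :: 'k)) = delta \<one> 1" by (auto simp: brauer_hom_def delta_def)
        then show ?case using group_algebra_one_mult(1)[OF eAG] by simp
      next
        case (Suc k)
        have "brauer_hom G D ((w \<star> B) [^]\<^bsub>class_algebra G\<^esub> Suc k)
            = brauer_hom G D ((w \<star> B) [^]\<^bsub>class_algebra G\<^esub> k) \<star> e"
          using brD[OF pw cwB] brwB by simp
        then show ?case using Suc e(2) Hconv[OF eA eA] by (simp add: group_algebra_assoc)
      qed
      from this[of m] have "e = (\<lambda>_. 0)" by (simp add: m brauer_hom_def)
      then show ?thesis ..
    next
      assume "\<exists>y. class_function G y \<and> w \<star> B \<star> y = B"
      then obtain y where y: "class_function G y" "w \<star> B \<star> y = B" by blast
      have "c = e \<star> brauer_hom G D y"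
        using brD[OF cwB y(1)] y(2) brwB by (simp add: c_def)
      then have "f \<star> c = (f \<star> e) \<star> brauer_hom G D y" by (simp add: group_algebra_assoc)
      then have "f = (\<lambda>_. 0)" using fc fe Hconv[OF fA cA] Hconv[OF fA eA] by simp
      then show ?thesis ..
    qed
  qed
  show ?thesis
    unfolding H_def[symmetric] c_def[symmetric] is_block_def Let_def H.central_idempotent_iff
    using key c(1-3) by (simp only: group_algebra_simps) blast
qed

text \<open>Uniqueness comes from the normality of \<open>D\<close> in \<open>N\<close>: a central
  idempotent of the algebra of \<open>N\<close> is its own truncation, so the required truncation
  determines the block.\<close>

lemma brauer_correspondent_normalizer:
  fixes B :: "'a \<Rightarrow> 'k::field"
  assumes B: "is_block G B" and D: "is_defect_group G B D"
    and p: "Factorial_Ring.prime p" "CHAR('k) = p"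
    and N: "N = normalizer G D"
  shows "brauer_correspondent G N D B = brauer_hom G D B"
proof -
  define H where "H = G\<lparr>carrier := N\<rparr>"
  define c where "c = brauer_hom G D B"
  note c = defect_brauer_hom[OF B D p N, folded H_def c_def]
  obtain n where sD: "subgroup D G" "card D = p ^ n"
    using D p by (auto simp: is_defect_group_def p_subgroup_def)
  interpret D: subgroup D G by fact
  have sN: "subgroup N G" unfolding N by (rule subgroup_normalizer[OF D.subset])
  interpret N: subgroup N G by fact
  interpret H: finite_group H unfolding H_def by (rule subgroup_finite_group[OF sN])
  have DN: "D \<subseteq> N" unfolding N by (rule subgroup_self_normalizer[OF sD(1)])
  have sDH: "subgroup D H" unfolding H_def by (rule subgroup_incl[OF sD(1) sN DN])
  have normalD: "g \<otimes>\<^bsub>H\<^esub> h \<otimes>\<^bsub>H\<^esub> inv\<^bsub>H\<^esub> g \<in> D" if "g \<in> carrier H" "h \<in> D" for g h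
    using that normalizer_conj[OF sD(1), of g h] m_inv_consistent[OF sN, of g] by (simp add: H_def N)
  show ?thesis
    unfolding brauer_correspondent_def
  proof (rule the_equality, intro conjI)
    show "is_block (G\<lparr>carrier := N\<rparr>) (brauer_hom G D B)"
      by (rule defect_brauer_hom_primitive[OF B D p N])
    show "is_defect_group (G\<lparr>carrier := N\<rparr>) (brauer_hom G D B) D"
      using c(5) by (simp add: H_def c_def)
    show "brauer_hom (G\<lparr>carrier := N\<rparr>) D (brauer_hom G D B) = brauer_hom G D B"
      using c(4)[OF order_refl DN] by (simp add: H_def c_def)
    fix b assume b: "is_block (G\<lparr>carrier := N\<rparr>) b \<and> is_defect_group (G\<lparr>carrier := N\<rparr>) b D \<and>
      brauer_hom (G\<lparr>carrier := N\<rparr>) D b = brauer_hom G D B"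
    then have "class_function H b" "b \<otimes>\<^bsub>group_algebra H\<^esub> b = b"
      unfolding H_def[symmetric] is_block_def Let_def H.central_idempotent_iff by auto
    then have "brauer_hom H D b = b"
      by (rule H.normal_p_subgroup_idempotent_support[OF _ _ sDH sD(2) p normalD])
    then show "b = brauer_hom G D B" using b by (simp add: H_def)
  qed
qed

end

section \<open>Simple modules and direct summands\<close>

definition module_hom ::
    "('a, 'x) ring_scheme \<Rightarrow> ('a, 'm, 'y) module_scheme \<Rightarrow> ('a, 'n, 'z) module_scheme \<Rightarrow>
     ('m \<Rightarrow> 'n) \<Rightarrow> bool" where
  "module_hom R M N f \<longleftrightarrow> f \<in> carrier M \<rightarrow> carrier N \<and>
     (\<forall>x\<in>carrier M. \<forall>y\<in>carrier M. f (x \<oplus>\<^bsub>M\<^esub> y) = f x \<oplus>\<^bsub>N\<^esub> f y) \<and>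
     (\<forall>a\<in>carrier R. \<forall>x\<in>carrier M. f (a \<odot>\<^bsub>M\<^esub> x) = a \<odot>\<^bsub>N\<^esub> f x)"

lemma module_homD:
  assumes "module_hom R M N f"
  shows "x \<in> carrier M \<Longrightarrow> f x \<in> carrier N"
    "x \<in> carrier M \<Longrightarrow> y \<in> carrier M \<Longrightarrow> f (x \<oplus>\<^bsub>M\<^esub> y) = f x \<oplus>\<^bsub>N\<^esub> f y"
    "a \<in> carrier R \<Longrightarrow> x \<in> carrier M \<Longrightarrow> f (a \<odot>\<^bsub>M\<^esub> x) = a \<odot>\<^bsub>N\<^esub> f x"
  using assms unfolding module_hom_def by blast+

lemma additive_zero:
  assumes "abelian_group M" "abelian_group N"
    and "f \<in> carrier M \<rightarrow> carrier N"
    and "\<And>x y. x \<in> carrier M \<Longrightarrow> y \<in> carrier M \<Longrightarrow> f (x \<oplus>\<^bsub>M\<^esub> y) = f x \<oplus>\<^bsub>N\<^esub> f y"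
  shows "f \<zero>\<^bsub>M\<^esub> = \<zero>\<^bsub>N\<^esub>"
proof -
  interpret M: abelian_group M by fact
  interpret N: abelian_group N by fact
  have c: "f \<zero>\<^bsub>M\<^esub> \<in> carrier N" using assms(3) by blast
  have "f \<zero>\<^bsub>M\<^esub> \<oplus>\<^bsub>N\<^esub> f \<zero>\<^bsub>M\<^esub> = f \<zero>\<^bsub>M\<^esub>" using assms(4)[of "\<zero>\<^bsub>M\<^esub>" "\<zero>\<^bsub>M\<^esub>"] by simp
  then show ?thesis using c N.add.l_cancel_one' by (metis N.add.l_cancel_one N.zero_closed)
qed

lemma additive_minus:
  assumes "abelian_group M" "abelian_group N"
    and "f \<in> carrier M \<rightarrow> carrier N"
    and "\<And>x y. x \<in> carrier M \<Longrightarrow> y \<in> carrier M \<Longrightarrow> f (x \<oplus>\<^bsub>M\<^esub> y) = f x \<oplus>\<^bsub>N\<^esub> f y"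
    and x: "x \<in> carrier M"
  shows "f (\<ominus>\<^bsub>M\<^esub> x) = \<ominus>\<^bsub>N\<^esub> f x"
proof -
  interpret M: abelian_group M by fact
  interpret N: abelian_group N by fact
  have c: "f x \<in> carrier N" "f (\<ominus>\<^bsub>M\<^esub> x) \<in> carrier N" using assms(3) x by auto
  have "f (\<ominus>\<^bsub>M\<^esub> x) \<oplus>\<^bsub>N\<^esub> f x = \<zero>\<^bsub>N\<^esub>"
    using assms(4)[of "\<ominus>\<^bsub>M\<^esub> x" x] x M.l_neg[OF x] additive_zero[OF assms(1-4)] by simp
  then show ?thesis using c N.minus_equality by metis
qed

text \<open>Only additivity is assumed because \<open>f\<close> is also taken to be the evaluation
  of induced functions at a point.\<close>

lemma additive_finsum:
  assumes "abelian_group M" "abelian_group N"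
    and "f \<in> carrier M \<rightarrow> carrier N"
    and "\<And>x y. x \<in> carrier M \<Longrightarrow> y \<in> carrier M \<Longrightarrow> f (x \<oplus>\<^bsub>M\<^esub> y) = f x \<oplus>\<^bsub>N\<^esub> f y"
    and "finite I" "h \<in> I \<rightarrow> carrier M"
  shows "f (finsum M h I) = finsum N (\<lambda>i. f (h i)) I"
proof -
  interpret M: abelian_group M by fact
  interpret N: abelian_group N by fact
  show ?thesis
    using assms(5,6)
  proof (induction I rule: finite_induct)
    case empty
    then show ?case using additive_zero[OF assms(1-4)] by simp
  next
    case (insert i I)
    have h: "h i \<in> carrier M" "h \<in> I \<rightarrow> carrier M" using insert.prems by auto
    have fh: "(\<lambda>i. f (h i)) \<in> I \<rightarrow> carrier N" "f (h i) \<in> carrier N" using h assms(3) by auto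
    have "f (finsum M h (insert i I)) = f (h i \<oplus>\<^bsub>M\<^esub> finsum M h I)"
      using insert.hyps h by simp
    also have "\<dots> = f (h i) \<oplus>\<^bsub>N\<^esub> f (finsum M h I)"
      by (rule assms(4)[OF h(1) M.finsum_closed[OF h(2)]])
    also have "\<dots> = finsum N (\<lambda>i. f (h i)) (insert i I)"
      using insert.hyps fh insert.IH[OF h(2)] by simp
    finally show ?case .
  qed
qed

text \<open>\<open>N\<close> is the direct sum of the image of \<open>f\<close> and the kernel of
  \<open>g\<close>. The composite need only be bijective rather than the identity, which is the form
  that Schur's lemma delivers.\<close>

lemma iso_direct_summandI:
  assumes "abelian_group M" "abelian_group N"
    and f: "module_hom R M N f" and g: "module_hom R N M g"
    and smult: "\<And>a. a \<in> carrier R \<Longrightarrow> a \<odot>\<^bsub>M\<^esub> \<zero>\<^bsub>M\<^esub> = \<zero>\<^bsub>M\<^esub>"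
    and closed: "\<And>a x. a \<in> carrier R \<Longrightarrow> x \<in> carrier M \<Longrightarrow> a \<odot>\<^bsub>M\<^esub> x \<in> carrier M"
      "\<And>a x. a \<in> carrier R \<Longrightarrow> x \<in> carrier N \<Longrightarrow> a \<odot>\<^bsub>N\<^esub> x \<in> carrier N"
    and bij: "bij_betw (\<lambda>x. g (f x)) (carrier M) (carrier M)"
  shows "iso_direct_summand R M N"
proof -
  interpret M: abelian_group M by fact
  interpret N: abelian_group N by fact
  note fD = module_homD[OF f] and gD = module_homD[OF g]
  have fF: "f \<in> carrier M \<rightarrow> carrier N" and gF: "g \<in> carrier N \<rightarrow> carrier M"
    using fD gD by auto
  have f0: "f \<zero>\<^bsub>M\<^esub> = \<zero>\<^bsub>N\<^esub>"
    by (rule additive_zero[OF assms(1,2) fF fD(2)])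
  have g0: "g \<zero>\<^bsub>N\<^esub> = \<zero>\<^bsub>M\<^esub>"
    by (rule additive_zero[OF assms(2,1) gF gD(2)])
  have fm: "f (\<ominus>\<^bsub>M\<^esub> x) = \<ominus>\<^bsub>N\<^esub> f x" if "x \<in> carrier M" for x
    by (rule additive_minus[OF assms(1,2) fF fD(2) that])
  have gm: "g (\<ominus>\<^bsub>N\<^esub> x) = \<ominus>\<^bsub>M\<^esub> g x" if "x \<in> carrier N" for x
    by (rule additive_minus[OF assms(2,1) gF gD(2) that])
  define U where "U = f ` carrier M"
  define V where "V = {x \<in> carrier N. g x = \<zero>\<^bsub>M\<^esub>}"
  have U: "submodule U R N"
  proof (intro submodule.intro submodule_axioms.intro)
    show "subgroup U (add_monoid N)"
    proof (rule N.add.subgroupI)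
      show "U \<subseteq> carrier N" "U \<noteq> {}" using fD(1) by (auto simp: U_def)
      fix x assume "x \<in> U"
      then obtain m where m: "m \<in> carrier M" "x = f m" by (auto simp: U_def)
      then show "\<ominus>\<^bsub>N\<^esub> x \<in> U"
        using fm[OF m(1)] by (auto simp: U_def intro!: image_eqI[of _ _ "\<ominus>\<^bsub>M\<^esub> m"])
      fix y assume "y \<in> U"
      then obtain m' where m': "m' \<in> carrier M" "y = f m'" by (auto simp: U_def)
      then show "x \<oplus>\<^bsub>N\<^esub> y \<in> U"
        using m fD(2)[OF m(1) m'(1)] by (auto simp: U_def intro!: image_eqI[of _ _ "m \<oplus>\<^bsub>M\<^esub> m'"])
    qed
    fix a x assume a: "a \<in> carrier R" and "x \<in> U"
    then obtain m where m: "m \<in> carrier M" "x = f m" by (auto simp: U_def)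
    then show "a \<odot>\<^bsub>N\<^esub> x \<in> U"
      using fD(3)[OF a m(1)] closed(1)[OF a m(1)] by (auto simp: U_def intro!: image_eqI[of _ _ "a \<odot>\<^bsub>M\<^esub> m"])
  qed
  have V: "submodule V R N"
  proof (intro submodule.intro submodule_axioms.intro)
    show "subgroup V (add_monoid N)"
    proof (rule N.add.subgroupI)
      show "V \<subseteq> carrier N" "V \<noteq> {}" using g0 by (auto simp: V_def)
      fix x assume x: "x \<in> V"
      then show "\<ominus>\<^bsub>N\<^esub> x \<in> V"
        using gm[of x] by (auto simp: V_def)
      fix y assume y: "y \<in> V"
      then show "x \<oplus>\<^bsub>N\<^esub> y \<in> V" using x gD(2)[of x y] by (auto simp: V_def)
    qed
    fix a x assume a: "a \<in> carrier R" and "x \<in> V"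
    then show "a \<odot>\<^bsub>N\<^esub> x \<in> V" using gD(3)[of a x] closed(2) smult by (auto simp: V_def)
  qed
  have gf: "m = m'" if "m \<in> carrier M" "m' \<in> carrier M" "g (f m) = g (f m')" for m m'
    using bij that unfolding bij_betw_def inj_on_def by blast
  have UV: "U \<inter> V = {\<zero>\<^bsub>N\<^esub>}"
  proof
    show "U \<inter> V \<subseteq> {\<zero>\<^bsub>N\<^esub>}"
    proof
      fix x assume "x \<in> U \<inter> V"
      then obtain m where m: "m \<in> carrier M" "x = f m" "g (f m) = \<zero>\<^bsub>M\<^esub>" by (auto simp: U_def V_def)
      then have "m = \<zero>\<^bsub>M\<^esub>" using gf[of m "\<zero>\<^bsub>M\<^esub>"] f0 g0 by simp
      then show "x \<in> {\<zero>\<^bsub>N\<^esub>}" using m f0 by simp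
    qed
    show "{\<zero>\<^bsub>N\<^esub>} \<subseteq> U \<inter> V"
      using f0 g0 by (auto simp: U_def V_def intro!: image_eqI[of _ _ "\<zero>\<^bsub>M\<^esub>"])
  qed
  have sum: "U <+>\<^bsub>N\<^esub> V = carrier N"
  proof
    have "U \<subseteq> carrier N" "V \<subseteq> carrier N" using fD(1) by (auto simp: U_def V_def)
    then show "U <+>\<^bsub>N\<^esub> V \<subseteq> carrier N" by (auto simp: set_add_def' subset_iff)
    show "carrier N \<subseteq> U <+>\<^bsub>N\<^esub> V"
    proof
      fix x assume x: "x \<in> carrier N"
      have "g x \<in> (\<lambda>x. g (f x)) ` carrier M" using bij gD(1)[OF x] by (simp add: bij_betw_def)
      then obtain m where m: "m \<in> carrier M" "g x = g (f m)" by blast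
      define v where "v = x \<oplus>\<^bsub>N\<^esub> \<ominus>\<^bsub>N\<^esub> f m"
      have fm': "f m \<in> carrier N" using fD(1) m by blast
      have "g v = g x \<oplus>\<^bsub>M\<^esub> \<ominus>\<^bsub>M\<^esub> g (f m)"
        unfolding v_def using gD(2)[of x "\<ominus>\<^bsub>N\<^esub> f m"] x fm' gm[OF fm'] by simp
      also have "\<dots> = \<zero>\<^bsub>M\<^esub>" using m gD(1)[OF fm'] by (simp add: M.r_neg)
      finally have "v \<in> V" using x fm' by (simp add: V_def v_def)
      moreover have "x = f m \<oplus>\<^bsub>N\<^esub> v"
        unfolding v_def using x fm' by (simp add: N.a_ac N.r_neg2 N.r_neg N.r_neg1)
      moreover have "f m \<in> U" using m by (simp add: U_def)
      ultimately show "x \<in> U <+>\<^bsub>N\<^esub> V" unfolding set_add_def' by blast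
    qed
  qed
  have "module_iso R M (N\<lparr>carrier := U\<rparr>)"
    unfolding module_iso_def
  proof (intro bexI[of _ f] ballI)
    have "inj_on f (carrier M)" using gf by (auto intro!: inj_onI)
    then show "f \<in> iso (add_monoid M) (add_monoid (N\<lparr>carrier := U\<rparr>))"
      using fD(2) by (auto simp: iso_def hom_def U_def bij_betw_def)
    show "f (a \<odot>\<^bsub>M\<^esub> x) = a \<odot>\<^bsub>N\<lparr>carrier := U\<rparr>\<^esub> f x"
      if "a \<in> carrier R" "x \<in> carrier M" for a x using fD(3) that by simp
  qed
  then show ?thesis
    unfolding iso_direct_summand_def direct_decomposition_def using U V UV sum by blast
qed

text \<open>\<open>f\<close> is the embedding, and \<open>g\<close> is the projection along the
  complement followed by the inverse of \<open>f\<close>.\<close>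

lemma iso_direct_summandE:
  assumes N: "abelian_group N" and M: "abelian_group M"
    and smult: "\<And>a x y. \<lbrakk>a \<in> carrier R; x \<in> carrier N; y \<in> carrier N\<rbrakk> \<Longrightarrow>
      a \<odot>\<^bsub>N\<^esub> (x \<oplus>\<^bsub>N\<^esub> y) = a \<odot>\<^bsub>N\<^esub> x \<oplus>\<^bsub>N\<^esub> a \<odot>\<^bsub>N\<^esub> y"
      "\<And>a x. a \<in> carrier R \<Longrightarrow> x \<in> carrier M \<Longrightarrow> a \<odot>\<^bsub>M\<^esub> x \<in> carrier M"
    and "iso_direct_summand R M N"
  obtains f g where "module_hom R M N f" "module_hom R N M g"
    "\<And>x. x \<in> carrier M \<Longrightarrow> g (f x) = x"
proof -
  interpret N: abelian_group N by fact
  interpret M: abelian_group M by fact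
  obtain U V f where UV: "submodule U R N" "submodule V R N" "U \<inter> V = {\<zero>\<^bsub>N\<^esub>}" "U <+>\<^bsub>N\<^esub> V = carrier N"
    and f: "f \<in> iso (add_monoid M) (add_monoid (N\<lparr>carrier := U\<rparr>))"
      "\<And>a x. a \<in> carrier R \<Longrightarrow> x \<in> carrier M \<Longrightarrow> f (a \<odot>\<^bsub>M\<^esub> x) = a \<odot>\<^bsub>N\<lparr>carrier := U\<rparr>\<^esub> f x"
    using assms(5) unfolding iso_direct_summand_def direct_decomposition_def module_iso_def by blast
  interpret U: submodule U R N by fact
  interpret V: submodule V R N by fact
  have fU: "f x \<in> U" if "x \<in> carrier M" for x using f(1) that by (auto simp: iso_def hom_def)
  have fadd: "f (x \<oplus>\<^bsub>M\<^esub> y) = f x \<oplus>\<^bsub>N\<^esub> f y" if "x \<in> carrier M" "y \<in> carrier M" for x y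
    using f(1) that by (auto simp: iso_def hom_def)
  have fbij: "bij_betw f (carrier M) U" using f(1) by (auto simp: iso_def)
  have Usub: "U \<subseteq> carrier N" and Vsub: "V \<subseteq> carrier N" using U.subset V.subset by auto
  have Uadd: "u \<oplus>\<^bsub>N\<^esub> u' \<in> U" if "u \<in> U" "u' \<in> U" for u u' using U.m_closed that by simp
  have Vadd: "u \<oplus>\<^bsub>N\<^esub> u' \<in> V" if "u \<in> V" "u' \<in> V" for u u' using V.m_closed that by simp
  have Uneg: "\<ominus>\<^bsub>N\<^esub> u \<in> U" if "u \<in> U" for u using U.m_inv_closed[of u] that by (simp add: a_inv_def)
  have Vneg: "\<ominus>\<^bsub>N\<^esub> u \<in> V" if "u \<in> V" for u using V.m_inv_closed[of u] that by (simp add: a_inv_def)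
  have uniq: "u = u'" if "u \<in> U" "u' \<in> U" "v \<in> V" "v' \<in> V" "u \<oplus>\<^bsub>N\<^esub> v = u' \<oplus>\<^bsub>N\<^esub> v'" for u u' v v'
  proof -
    have c: "u \<in> carrier N" "u' \<in> carrier N" "v \<in> carrier N" "v' \<in> carrier N" using that Usub Vsub by auto
    have "\<ominus>\<^bsub>N\<^esub> u' \<oplus>\<^bsub>N\<^esub> u = \<ominus>\<^bsub>N\<^esub> u' \<oplus>\<^bsub>N\<^esub> (u \<oplus>\<^bsub>N\<^esub> v) \<oplus>\<^bsub>N\<^esub> \<ominus>\<^bsub>N\<^esub> v" using c by (simp add: N.a_assoc N.r_neg)
    also have "\<dots> = v' \<oplus>\<^bsub>N\<^esub> \<ominus>\<^bsub>N\<^esub> v" unfolding that(5) using c by (simp add: N.r_neg1)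
    finally have "\<ominus>\<^bsub>N\<^esub> u' \<oplus>\<^bsub>N\<^esub> u \<in> U \<inter> V" using Uadd[OF Uneg[OF that(2)] that(1)] Vadd[OF that(4) Vneg[OF that(3)]] by simp
    then have "\<ominus>\<^bsub>N\<^esub> u' \<oplus>\<^bsub>N\<^esub> u = \<zero>\<^bsub>N\<^esub>" using UV(3) by blast
    then have "u' \<oplus>\<^bsub>N\<^esub> (\<ominus>\<^bsub>N\<^esub> u' \<oplus>\<^bsub>N\<^esub> u) = u'" using c by simp
    then show ?thesis using c by (simp add: N.r_neg2)
  qed
  have ex: "\<exists>u\<in>U. \<exists>v\<in>V. x = u \<oplus>\<^bsub>N\<^esub> v" if "x \<in> carrier N" for x
    using that UV(4) unfolding set_add_def' by blast
  define pr where "pr = (\<lambda>x. THE u. u \<in> U \<and> (\<exists>v\<in>V. x = u \<oplus>\<^bsub>N\<^esub> v))"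
  have pr: "pr (u \<oplus>\<^bsub>N\<^esub> v) = u" if "u \<in> U" "v \<in> V" for u v
    unfolding pr_def by (rule the_equality) (use that uniq in blast)+
  define finv where "finv = the_inv_into (carrier M) f"
  have finv: "finv (f x) = x" if "x \<in> carrier M" for x
    using the_inv_into_f_f fbij that unfolding finv_def bij_betw_def by metis
  have fU': "\<exists>x\<in>carrier M. u = f x" if "u \<in> U" for u
    using fbij that unfolding bij_betw_def by blast
  define g where "g = (\<lambda>x. finv (pr x))"
  have dec: "\<exists>m\<in>carrier M. \<exists>v\<in>V. x = f m \<oplus>\<^bsub>N\<^esub> v" if "x \<in> carrier N" for x
    using ex[OF that] fU' by blast
  have g: "g (f m \<oplus>\<^bsub>N\<^esub> v) = m" if "m \<in> carrier M" "v \<in> V" for m v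
    using pr[OF fU[OF that(1)] that(2)] finv that by (simp add: g_def)
  have zV: "\<zero>\<^bsub>N\<^esub> \<in> V" using V.one_closed by simp
  have "module_hom R M N f"
    unfolding module_hom_def using fU Usub fadd f(2) by auto
  moreover have "module_hom R N M g"
    unfolding module_hom_def
  proof (intro conjI ballI)
    show "g \<in> carrier N \<rightarrow> carrier M"
    proof
      fix x assume "x \<in> carrier N"
      then obtain m v where "m \<in> carrier M" "v \<in> V" "x = f m \<oplus>\<^bsub>N\<^esub> v" using dec by blast
      then show "g x \<in> carrier M" using g by simp
    qed
    fix x assume "x \<in> carrier N"
    then obtain m v where x: "m \<in> carrier M" "v \<in> V" "x = f m \<oplus>\<^bsub>N\<^esub> v" using dec by blast
    have c: "f m \<in> carrier N" "v \<in> carrier N" using x fU Usub Vsub by auto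
    show "g (x \<oplus>\<^bsub>N\<^esub> y) = g x \<oplus>\<^bsub>M\<^esub> g y" if yN: "y \<in> carrier N" for y
    proof -
      obtain m' v' where y: "m' \<in> carrier M" "v' \<in> V" "y = f m' \<oplus>\<^bsub>N\<^esub> v'" using dec[OF yN] by blast
      have c': "f m' \<in> carrier N" "v' \<in> carrier N" using y fU Usub Vsub by auto
      have "x \<oplus>\<^bsub>N\<^esub> y = f (m \<oplus>\<^bsub>M\<^esub> m') \<oplus>\<^bsub>N\<^esub> (v \<oplus>\<^bsub>N\<^esub> v')"
        using x y fadd c c' by (simp add: N.a_ac)
      then show ?thesis using g x y Vadd by simp
    qed
    show "g (a \<odot>\<^bsub>N\<^esub> x) = a \<odot>\<^bsub>M\<^esub> g x" if a: "a \<in> carrier R" for a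
    proof -
      have "a \<odot>\<^bsub>N\<^esub> x = f (a \<odot>\<^bsub>M\<^esub> m) \<oplus>\<^bsub>N\<^esub> (a \<odot>\<^bsub>N\<^esub> v)"
        using x c a smult(1) f(2)[OF a x(1)] by simp
      then show ?thesis using g[OF smult(2)[OF a x(1)] V.smult_closed[OF a x(2)]] g[OF x(1,2)] x by simp
    qed
  qed
  moreover have "g (f x) = x" if "x \<in> carrier M" for x
    using g[OF that zV] fU[OF that] Usub by (simp add: subset_iff)
  ultimately show ?thesis using that by blast
qed

context semi_module
begin

lemma finsum_smult:
  assumes "a \<in> carrier R" "finite I" "h \<in> I \<rightarrow> carrier M"
  shows "a \<odot>\<^bsub>M\<^esub> finsum M h I = finsum M (\<lambda>i. a \<odot>\<^bsub>M\<^esub> h i) I"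
  by (rule additive_finsum[OF M.abelian_group_axioms M.abelian_group_axioms])
    (use assms smult_closed smult_r_distr in auto)

end

context finite_group
begin

lemma sum_smult:
  fixes M :: "('a \<Rightarrow> 'k::field, 'm, 'y) module_scheme"
  assumes "semi_module (group_algebra G) M" "finite I"
    and "\<And>i. i \<in> I \<Longrightarrow> a i \<in> carrier (group_algebra G)" "m \<in> carrier M"
  shows "(\<lambda>x. \<Sum>i\<in>I. a i x) \<odot>\<^bsub>M\<^esub> m = finsum M (\<lambda>i. a i \<odot>\<^bsub>M\<^esub> m) I"
proof -
  interpret M: semi_module "group_algebra G" M by fact
  show ?thesis
    using assms(2,3)
  proof (induction I rule: finite_induct)
    case empty
    then show ?case using M.smult_zero_left[OF assms(4)] by simp
  next
    case (insert i I)
    have a: "a i \<in> carrier (group_algebra G)" "(\<lambda>x. \<Sum>i\<in>I. a i x) \<in> carrier (group_algebra G)"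
      using insert.prems by auto
    have c: "(\<lambda>i. a i \<odot>\<^bsub>M\<^esub> m) \<in> I \<rightarrow> carrier M" "a i \<odot>\<^bsub>M\<^esub> m \<in> carrier M"
      using insert.prems M.smult_closed assms(4) by (auto simp del: group_algebra_simps(1))
    have "(\<lambda>x. \<Sum>i\<in>insert i I. a i x) = a i \<oplus>\<^bsub>group_algebra G\<^esub> (\<lambda>x. \<Sum>i\<in>I. a i x)"
      using insert.hyps by simp
    then have "(\<lambda>x. \<Sum>i\<in>insert i I. a i x) \<odot>\<^bsub>M\<^esub> m = a i \<odot>\<^bsub>M\<^esub> m \<oplus>\<^bsub>M\<^esub> (\<lambda>x. \<Sum>i\<in>I. a i x) \<odot>\<^bsub>M\<^esub> m"
      using M.smult_l_distr[OF a assms(4)] by simp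
    also have "\<dots> = finsum M (\<lambda>i. a i \<odot>\<^bsub>M\<^esub> m) (insert i I)"
      using insert.hyps insert.IH insert.prems c by simp
    finally show ?case .
  qed
qed

lemma sum_delta:
  assumes "a \<in> carrier (group_algebra G)"
  shows "(\<lambda>x. \<Sum>g\<in>carrier G. delta g (a g) x) = a"
proof
  fix x
  show "(\<Sum>g\<in>carrier G. delta g (a g) x) = a x"
    using assms by (cases "x \<in> carrier G") (auto simp: delta_def sum.delta)
qed

lemma smult_expand:
  fixes M :: "('a \<Rightarrow> 'k::field, 'm, 'y) module_scheme"
  assumes "semi_module (group_algebra G) M" "a \<in> carrier (group_algebra G)" "m \<in> carrier M"
  shows "a \<odot>\<^bsub>M\<^esub> m = finsum M (\<lambda>g. delta g (a g) \<odot>\<^bsub>M\<^esub> m) (carrier G)"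
  using sum_smult[OF assms(1) finite_carrier delta_closed assms(3), of "\<lambda>g. g" "\<lambda>g. a g"]
    sum_delta[OF assms(2)] by simp

text \<open>The elements \<open>delta g c\<close> span \<open>kG\<close> additively, so
  compatibility needs to be checked on them only. The scalar stays inside \<open>delta\<close>
  because modules over \<open>kG\<close> carry no separate scalar multiplication.\<close>

lemma module_hom_from_delta:
  fixes M :: "('a \<Rightarrow> 'k::field, 'm, 'y) module_scheme" and N :: "('a \<Rightarrow> 'k, 'n, 'z) module_scheme"
  assumes M: "semi_module (group_algebra G) M" and N: "semi_module (group_algebra G) N"
    and f: "f \<in> carrier M \<rightarrow> carrier N"
      "\<And>x y. x \<in> carrier M \<Longrightarrow> y \<in> carrier M \<Longrightarrow> f (x \<oplus>\<^bsub>M\<^esub> y) = f x \<oplus>\<^bsub>N\<^esub> f y"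
      "\<And>g c x. g \<in> carrier G \<Longrightarrow> x \<in> carrier M \<Longrightarrow> f (delta g c \<odot>\<^bsub>M\<^esub> x) = delta g c \<odot>\<^bsub>N\<^esub> f x"
  shows "module_hom (group_algebra G) M N f"
  unfolding module_hom_def
proof (intro conjI ballI f)
  interpret M: semi_module "group_algebra G" M by fact
  interpret N: semi_module "group_algebra G" N by fact
  fix a :: "'a \<Rightarrow> 'k" and x assume a: "a \<in> carrier (group_algebra G)" and x: "x \<in> carrier M"
  have c: "(\<lambda>g. delta g (a g :: 'k) \<odot>\<^bsub>M\<^esub> x) \<in> carrier G \<rightarrow> carrier M"
    using M.smult_closed[OF delta_closed x] by blast
  have c': "(\<lambda>g. delta g (a g) \<odot>\<^bsub>N\<^esub> f x) \<in> carrier G \<rightarrow> carrier N"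
    using N.smult_closed[OF delta_closed] f(1) x by blast
  have "f (a \<odot>\<^bsub>M\<^esub> x) = finsum N (\<lambda>g. f (delta g (a g) \<odot>\<^bsub>M\<^esub> x)) (carrier G)"
    unfolding smult_expand[OF M a x]
    by (rule additive_finsum[OF M.abelian_group_axioms N.abelian_group_axioms f(1,2) finite_carrier c])
  also have "\<dots> = finsum N (\<lambda>g. delta g (a g) \<odot>\<^bsub>N\<^esub> f x) (carrier G)"
    by (rule N.finsum_cong'[OF refl c']) (use f(3) x in blast)
  also have "\<dots> = a \<odot>\<^bsub>N\<^esub> f x" using smult_expand[OF N a funcset_mem[OF f(1) x]] by (rule sym)
  finally show "f (a \<odot>\<^bsub>M\<^esub> x) = a \<odot>\<^bsub>N\<^esub> f x" .
qed

lemma smult_closed_from_delta: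
  fixes M :: "('a \<Rightarrow> 'k::field, 'm, 'y) module_scheme"
  assumes M: "semi_module (group_algebra G) M"
    and U: "U \<subseteq> carrier M" "\<zero>\<^bsub>M\<^esub> \<in> U" "\<And>x y. x \<in> U \<Longrightarrow> y \<in> U \<Longrightarrow> x \<oplus>\<^bsub>M\<^esub> y \<in> U"
      "\<And>g c x. g \<in> carrier G \<Longrightarrow> x \<in> U \<Longrightarrow> delta g c \<odot>\<^bsub>M\<^esub> x \<in> U"
    and a: "a \<in> carrier (group_algebra G)" and u: "u \<in> U"
  shows "a \<odot>\<^bsub>M\<^esub> u \<in> U"
proof -
  interpret M: semi_module "group_algebra G" M by fact
  have fs: "finsum M h I \<in> U" if "finite I" "h \<in> I \<rightarrow> U" for h :: "'a \<Rightarrow> 'm" and I :: "'a set"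
    using that
  proof (induction I rule: finite_induct)
    case (insert i I)
    then have "h \<in> I \<rightarrow> carrier M" "h i \<in> carrier M" using U(1) by auto
    then show ?case using insert U(3) by auto
  qed (simp add: U(2))
  show ?thesis
    unfolding smult_expand[OF M a subsetD[OF U(1) u]]
    by (rule fs) (use U(4) u in auto)
qed

lemma submodule_from_delta:
  fixes M :: "('a \<Rightarrow> 'k::field, 'm, 'y) module_scheme"
  assumes M: "left_module (group_algebra G) M"
    and U: "U \<subseteq> carrier M" "\<zero>\<^bsub>M\<^esub> \<in> U" "\<And>x y. x \<in> U \<Longrightarrow> y \<in> U \<Longrightarrow> x \<oplus>\<^bsub>M\<^esub> y \<in> U"
      "\<And>g c x. g \<in> carrier G \<Longrightarrow> x \<in> U \<Longrightarrow> delta g c \<odot>\<^bsub>M\<^esub> x \<in> U"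
  shows "submodule U (group_algebra G) M"
proof (intro submodule.intro submodule_axioms.intro)
  interpret M: left_module "group_algebra G" M by fact
  show "subgroup U (add_monoid M)"
  proof (rule M.add.subgroupI)
    fix x assume x: "x \<in> U"
    have xc: "x \<in> carrier M" using x U(1) by blast
    have 1: "delta \<one> 1 \<in> carrier (group_algebra G :: ('a \<Rightarrow> 'k) ring)" by (rule delta_closed[OF one_closed])
    have "\<ominus>\<^bsub>M\<^esub> x = \<ominus>\<^bsub>M\<^esub> (delta \<one> 1 \<odot>\<^bsub>M\<^esub> x)" using M.smult_one[OF xc] by simp
    also have "\<dots> = (\<lambda>y. - delta \<one> 1 y) \<odot>\<^bsub>M\<^esub> x"
      using M.smult_minus_left[OF 1 xc] group_algebra_m_inv[OF 1] by simp
    also have "(\<lambda>y. - delta \<one> 1 y) = (delta \<one> (- 1) :: 'a \<Rightarrow> 'k)" by (auto simp: delta_def)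
    finally show "\<ominus>\<^bsub>M\<^esub> x \<in> U" using U(4)[OF one_closed x] by simp
  qed (use U in auto)
  show "a \<odot>\<^bsub>M\<^esub> u \<in> U" if "a \<in> carrier (group_algebra G)" "u \<in> U" for a :: "'a \<Rightarrow> 'k" and u
    by (rule smult_closed_from_delta[OF M.semi_module_axioms U that])
qed

text \<open>Normality of \<open>D\<close> makes the vectors fixed by \<open>D\<close> a submodule,
  and it is nonzero because a \<open>p\<close>-group in characteristic \<open>p\<close> has a
  nonzero fixed vector.\<close>

lemma simple_module_normal_p_subgroup_trivial:
  fixes M :: "('a \<Rightarrow> 'k::field, 'm, 'y) module_scheme"
  assumes M: "simple_module (group_algebra G) M"
    and D: "subgroup D G" "card D = p ^ n" "Factorial_Ring.prime p" "CHAR('k) = p"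
    and normal: "\<And>g h. g \<in> carrier G \<Longrightarrow> h \<in> D \<Longrightarrow> g \<otimes> h \<otimes> inv g \<in> D"
    and d: "d \<in> D" and m: "m \<in> carrier M"
  shows "delta d 1 \<odot>\<^bsub>M\<^esub> m = m"
proof -
  have lM: "left_module (group_algebra G) M" using M by (simp add: simple_module_def)
  interpret M: left_module "group_algebra G" M by fact
  interpret D: subgroup D G by fact
  define U where "U = {m \<in> carrier M. \<forall>d\<in>D. delta d 1 \<odot>\<^bsub>M\<^esub> m = m}"
  have dA: "delta d c \<in> carrier (group_algebra G :: ('a \<Rightarrow> 'k) ring)" if "d \<in> D" for d c
    using that D.subset delta_closed by blast
  have "submodule U (group_algebra G) M"
  proof (rule submodule_from_delta[OF lM])
    show "U \<subseteq> carrier M" by (auto simp: U_def)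
    show "\<zero>\<^bsub>M\<^esub> \<in> U" using M.smult_zero_right dA by (simp add: U_def del: group_algebra_simps(1))
    show "x \<oplus>\<^bsub>M\<^esub> y \<in> U" if "x \<in> U" "y \<in> U" for x y
      using that M.smult_r_distr[OF dA] by (simp add: U_def)
    fix g c x assume g: "g \<in> carrier G" and x: "x \<in> U"
    have xc: "x \<in> carrier M" using x by (simp add: U_def)
    have "delta d 1 \<odot>\<^bsub>M\<^esub> (delta g c \<odot>\<^bsub>M\<^esub> x) = delta g c \<odot>\<^bsub>M\<^esub> x" if d: "d \<in> D" for d
    proof -
      have dc: "d \<in> carrier G" using d D.subset by blast
      define d' where "d' = inv g \<otimes> d \<otimes> g"
      have d': "d' \<in> D" using normal[of "inv g" d] g d by (simp add: d'_def)
      have dc': "d' \<in> carrier G" using d' D.subset by blast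
      have "delta d 1 \<star> delta g c = delta g c \<star> delta d' 1"
        using delta_delta_mult[OF dc g, of 1 c] delta_delta_mult[OF g dc', of c 1] g dc
        by (simp add: d'_def m_assoc)
      then have "delta d 1 \<odot>\<^bsub>M\<^esub> (delta g c \<odot>\<^bsub>M\<^esub> x) = delta g c \<odot>\<^bsub>M\<^esub> (delta d' 1 \<odot>\<^bsub>M\<^esub> x)"
        using M.smult_assoc[OF dA[OF d] delta_closed[OF g] xc] M.smult_assoc[OF delta_closed[OF g] dA[OF d'] xc]
        by metis
      then show ?thesis using x d' by (simp add: U_def)
    qed
    then show "delta g c \<odot>\<^bsub>M\<^esub> x \<in> U" using M.smult_closed[OF delta_closed[OF g] xc] by (simp add: U_def)
  qed
  then have "U = {\<zero>\<^bsub>M\<^esub>} \<or> U = carrier M" using M unfolding simple_module_def by blast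
  moreover have "U \<noteq> {\<zero>\<^bsub>M\<^esub>}"
  proof -
    have "\<exists>m\<in>carrier M. m \<noteq> \<zero>\<^bsub>M\<^esub>" using M unfolding simple_module_def using M.zero_closed by blast
    then obtain m where m: "m \<in> carrier M" "m \<noteq> \<zero>\<^bsub>M\<^esub>" by blast
    from p_group_fixed_vector[OF lM D m] obtain a where "a \<in> carrier (group_algebra G)"
      "a \<odot>\<^bsub>M\<^esub> m \<noteq> \<zero>\<^bsub>M\<^esub>" "\<And>h. h \<in> D \<Longrightarrow> delta h 1 \<odot>\<^bsub>M\<^esub> (a \<odot>\<^bsub>M\<^esub> m) = a \<odot>\<^bsub>M\<^esub> m" by blast
    then have "a \<odot>\<^bsub>M\<^esub> m \<in> U" using M.smult_closed[OF _ m(1)] by (simp add: U_def del: group_algebra_simps(1))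
    then show ?thesis using \<open>a \<odot>\<^bsub>M\<^esub> m \<noteq> \<zero>\<^bsub>M\<^esub>\<close> by blast
  qed
  ultimately have "U = carrier M" by blast
  then show ?thesis using d m by (auto simp: U_def)
qed

end

context finite_group
begin

abbreviation scale :: "('a \<Rightarrow> 'k::field, 'm, 'y) module_scheme \<Rightarrow> 'k \<Rightarrow> 'm \<Rightarrow> 'm" where
  "scale M c m \<equiv> delta \<one> c \<odot>\<^bsub>M\<^esub> m"

lemma delta_one_zero: "delta \<one> 0 = (\<lambda>_. 0)"
  by (auto simp: delta_def)

lemma scale_simps:
  fixes M :: "('a \<Rightarrow> 'k::field, 'm, 'y) module_scheme"
  assumes "left_module (group_algebra G) M"
  shows "m \<in> carrier M \<Longrightarrow> scale M c m \<in> carrier M"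
    and "m \<in> carrier M \<Longrightarrow> scale M (c + d) m = scale M c m \<oplus>\<^bsub>M\<^esub> scale M d m"
    and "m \<in> carrier M \<Longrightarrow> m' \<in> carrier M \<Longrightarrow> scale M c (m \<oplus>\<^bsub>M\<^esub> m') = scale M c m \<oplus>\<^bsub>M\<^esub> scale M c m'"
    and "m \<in> carrier M \<Longrightarrow> scale M c (scale M d m) = scale M (c * d) m"
    and "m \<in> carrier M \<Longrightarrow> scale M 1 m = m"
    and "m \<in> carrier M \<Longrightarrow> scale M 0 m = \<zero>\<^bsub>M\<^esub>"
    and "scale M c \<zero>\<^bsub>M\<^esub> = \<zero>\<^bsub>M\<^esub>"
    and "g \<in> carrier G \<Longrightarrow> m \<in> carrier M \<Longrightarrow> scale M c (delta g d \<odot>\<^bsub>M\<^esub> m) = delta g (c * d) \<odot>\<^bsub>M\<^esub> m"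
    and "g \<in> carrier G \<Longrightarrow> m \<in> carrier M \<Longrightarrow> delta g d \<odot>\<^bsub>M\<^esub> scale M c m = delta g (c * d) \<odot>\<^bsub>M\<^esub> m"
proof -
  interpret M: left_module "group_algebra G" M by fact
  note dA = delta_closed[OF one_closed]
  show "m \<in> carrier M \<Longrightarrow> scale M c m \<in> carrier M" by (rule M.smult_closed[OF dA])
  have "delta \<one> (c + d) = (\<lambda>x. delta \<one> c x + delta \<one> d x)" by (auto simp: delta_def)
  then show "m \<in> carrier M \<Longrightarrow> scale M (c + d) m = scale M c m \<oplus>\<^bsub>M\<^esub> scale M d m"
    using M.smult_l_distr[OF dA dA, of m c d] by simp
  show "m \<in> carrier M \<Longrightarrow> m' \<in> carrier M \<Longrightarrow> scale M c (m \<oplus>\<^bsub>M\<^esub> m') = scale M c m \<oplus>\<^bsub>M\<^esub> scale M c m'"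
    by (rule M.smult_r_distr[OF dA])
  show "m \<in> carrier M \<Longrightarrow> scale M c (scale M d m) = scale M (c * d) m"
    using M.smult_assoc[OF dA dA, of m c d] delta_delta_mult[OF one_closed one_closed, of c d] by simp
  show "m \<in> carrier M \<Longrightarrow> scale M 1 m = m" using M.smult_one by simp
  show "m \<in> carrier M \<Longrightarrow> scale M 0 m = \<zero>\<^bsub>M\<^esub>" using M.smult_zero_left by (simp add: delta_one_zero)
  show "scale M c \<zero>\<^bsub>M\<^esub> = \<zero>\<^bsub>M\<^esub>" by (rule M.smult_zero_right[OF dA])
  show "g \<in> carrier G \<Longrightarrow> m \<in> carrier M \<Longrightarrow> scale M c (delta g d \<odot>\<^bsub>M\<^esub> m) = delta g (c * d) \<odot>\<^bsub>M\<^esub> m"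
    using M.smult_assoc[OF dA delta_closed, of g m c d] delta_delta_mult[OF one_closed, of g c d] by simp
  show "g \<in> carrier G \<Longrightarrow> m \<in> carrier M \<Longrightarrow> delta g d \<odot>\<^bsub>M\<^esub> scale M c m = delta g (c * d) \<odot>\<^bsub>M\<^esub> m"
    using M.smult_assoc[OF delta_closed dA, of g m d c] delta_delta_mult[OF _ one_closed, of g d c]
    by (simp add: mult.commute)
qed

text \<open>A finite spanning family that is minimal yields a basis together with its dual basis.\<close>

lemma dual_basis_exists:
  fixes M :: "('a \<Rightarrow> 'k::field, 'm, 'y) module_scheme" and v :: "'i \<Rightarrow> 'm"
  assumes M: "left_module (group_algebra G) M"
    and v: "finite I" "v \<in> I \<rightarrow> carrier M"
      "\<And>m. m \<in> carrier M \<Longrightarrow> \<exists>c. m = finsum M (\<lambda>i. scale M (c i) (v i)) I"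
  obtains J \<phi> where "finite J" "v \<in> J \<rightarrow> carrier M"
    "\<And>j x y. j \<in> J \<Longrightarrow> x \<in> carrier M \<Longrightarrow> y \<in> carrier M \<Longrightarrow> \<phi> j (x \<oplus>\<^bsub>M\<^esub> y) = (\<phi> j x + \<phi> j y :: 'k)"
    "\<And>j x c. j \<in> J \<Longrightarrow> x \<in> carrier M \<Longrightarrow> \<phi> j (scale M c x) = c * \<phi> j x"
    "\<And>m. m \<in> carrier M \<Longrightarrow> m = finsum M (\<lambda>j. scale M (\<phi> j m) (v j)) J"
proof -
  interpret M: left_module "group_algebra G" M by fact
  note sc = scale_simps[OF M]
  define spans where "spans = (\<lambda>J. J \<subseteq> I \<and>
    (\<forall>m\<in>carrier M. \<exists>c. m = finsum M (\<lambda>i. scale M (c i) (v i)) J))"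
  have "spans I" using v by (auto simp: spans_def)
  then obtain J where J: "spans J" "\<And>K. spans K \<Longrightarrow> card J \<le> card K"
    using ex_has_least_nat[of spans I card] by blast
  have fJ: "finite J" using J(1) v(1) finite_subset by (auto simp: spans_def)
  have vJ: "v i \<in> carrier M" if "i \<in> J" for i using J(1) v(2) that by (auto simp: spans_def)
  have fc: "(\<lambda>i. scale M (c i) (v i)) \<in> K \<rightarrow> carrier M" if "K \<subseteq> J" for c :: "'i \<Rightarrow> 'k" and K
    using sc(1) vJ that by blast
  have add: "finsum M (\<lambda>i. scale M (c i + d i) (v i)) J
      = finsum M (\<lambda>i. scale M (c i) (v i)) J \<oplus>\<^bsub>M\<^esub> finsum M (\<lambda>i. scale M (d i) (v i)) J" for c d
  proof -
    have "finsum M (\<lambda>i. scale M (c i + d i) (v i)) J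
        = finsum M (\<lambda>i. scale M (c i) (v i) \<oplus>\<^bsub>M\<^esub> scale M (d i) (v i)) J"
      by (rule M.finsum_cong'[OF refl]) (use sc(1,2) vJ in auto)
    also have "\<dots> = finsum M (\<lambda>i. scale M (c i) (v i)) J \<oplus>\<^bsub>M\<^esub> finsum M (\<lambda>i. scale M (d i) (v i)) J"
      by (rule M.finsum_addf) (use fc in auto)
    finally show ?thesis .
  qed
  have mult: "scale M r (finsum M (\<lambda>i. scale M (c i) (v i)) J)
      = finsum M (\<lambda>i. scale M (r * c i) (v i)) J" for c r
  proof -
    have "scale M r (finsum M (\<lambda>i. scale M (c i) (v i)) J)
        = finsum M (\<lambda>i. scale M r (scale M (c i) (v i))) J"
      by (rule M.finsum_smult[OF delta_closed[OF one_closed] fJ fc[OF order_refl]])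
    also have "\<dots> = finsum M (\<lambda>i. scale M (r * c i) (v i)) J"
      by (rule M.finsum_cong'[OF refl fc[OF order_refl]]) (use sc(4) vJ in auto)
    finally show ?thesis .
  qed
  have indep: "c j = 0" if c0: "finsum M (\<lambda>i. scale M (c i) (v i)) J = \<zero>\<^bsub>M\<^esub>" and j: "j \<in> J" for c j
  proof (rule ccontr)
    assume cj: "c j \<noteq> 0"
    have "spans (J - {j})"
      unfolding spans_def
    proof (intro conjI ballI)
      show "J - {j} \<subseteq> I" using J(1) by (auto simp: spans_def)
      fix m assume m: "m \<in> carrier M"
      then obtain d where d: "m = finsum M (\<lambda>i. scale M (d i) (v i)) J"
        using J(1) by (auto simp: spans_def)
      \<comment> \<open>A relation with \<open>c j\<close> nonzero is used to dispense with
        \<open>v j\<close>: the factor \<open>- d j / c j\<close> is chosen such that the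
        coefficient at \<open>j\<close> vanishes, contrary to the minimality of
        \<open>J\<close>.\<close>
      define e where "e = (\<lambda>i. d i + (- d j / c j) * c i)"
      have "m = m \<oplus>\<^bsub>M\<^esub> scale M (- d j / c j) (finsum M (\<lambda>i. scale M (c i) (v i)) J)"
        unfolding c0 using m sc(7) by simp
      also have "\<dots> = finsum M (\<lambda>i. scale M (e i) (v i)) J"
        unfolding mult e_def add using d by simp
      also have "\<dots> = finsum M (\<lambda>i. scale M (e i) (v i)) (insert j (J - {j}))"
        using j by (simp add: insert_absorb)
      also have "\<dots> = scale M (e j) (v j) \<oplus>\<^bsub>M\<^esub> finsum M (\<lambda>i. scale M (e i) (v i)) (J - {j})"
        by (rule M.finsum_insert) (use fJ fc sc(1) vJ j in auto)
      also have "e j = 0" using cj by (simp add: e_def)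
      also have "scale M 0 (v j) \<oplus>\<^bsub>M\<^esub> finsum M (\<lambda>i. scale M (e i) (v i)) (J - {j})
          = finsum M (\<lambda>i. scale M (e i) (v i)) (J - {j})"
        using sc(6)[OF vJ[OF j]] M.finsum_closed[OF fc[of "J - {j}"]] by auto
      finally show "\<exists>c. m = finsum M (\<lambda>i. scale M (c i) (v i)) (J - {j})" by blast
    qed
    then have "card J \<le> card (J - {j})" by (rule J(2))
    then show False using fJ j by (metis card_Diff1_less linorder_not_less)
  qed
  have unique: "c j = d j"
    if "finsum M (\<lambda>i. scale M (c i) (v i)) J = finsum M (\<lambda>i. scale M (d i) (v i)) J" "j \<in> J" for c d j
  proof -
    let ?s = "\<lambda>c. finsum M (\<lambda>i. scale M (c i) (v i)) J"
    have s: "?s c \<in> carrier M" for c by (rule M.finsum_closed[OF fc[OF order_refl]])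
    have "?s (\<lambda>i. c i + (- 1) * d i) = ?s c \<oplus>\<^bsub>M\<^esub> scale M (- 1) (?s d)" unfolding add mult ..
    also have "\<dots> = scale M 1 (?s c) \<oplus>\<^bsub>M\<^esub> scale M (- 1) (?s c)" using that(1) sc(5)[OF s] by simp
    also have "\<dots> = scale M (1 + - 1) (?s c)" using sc(2)[OF s] by metis
    also have "\<dots> = \<zero>\<^bsub>M\<^esub>" using sc(6)[OF s] by simp
    finally have "c j + (- 1) * d j = 0" by (rule indep[OF _ that(2)])
    then show ?thesis by simp
  qed
  define coord where "coord = (\<lambda>m. SOME c. m = finsum M (\<lambda>i. scale M (c i) (v i)) J)"
  have coord: "m = finsum M (\<lambda>i. scale M (coord m i) (v i)) J" if "m \<in> carrier M" for m
  proof -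
    have "\<exists>c. m = finsum M (\<lambda>i. scale M (c i) (v i)) J" using J(1) that unfolding spans_def by blast
    then show ?thesis unfolding coord_def by (rule someI_ex)
  qed
  show ?thesis
  proof (rule that[of J "\<lambda>j m. coord m j"])
    show "finite J" "v \<in> J \<rightarrow> carrier M" using fJ vJ by auto
    fix j x assume j: "j \<in> J" and x: "x \<in> carrier M"
    show "coord (x \<oplus>\<^bsub>M\<^esub> y) j = coord x j + coord y j" if y: "y \<in> carrier M" for y
      by (rule unique[OF _ j]) (use coord[of "x \<oplus>\<^bsub>M\<^esub> y"] coord[OF x] coord[OF y] x y add in simp)
    show "coord (scale M c x) j = c * coord x j" for c
    proof (rule unique[OF _ j])
      have "finsum M (\<lambda>i. scale M (coord (scale M c x) i) (v i)) J = scale M c x"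
        by (rule coord[OF sc(1)[OF x], symmetric])
      also have "\<dots> = scale M c (finsum M (\<lambda>i. scale M (coord x i) (v i)) J)"
        by (rule arg_cong[where f = "\<lambda>m. scale M c m", OF coord[OF x]])
      also have "\<dots> = finsum M (\<lambda>i. scale M (c * coord x i) (v i)) J" by (rule mult)
      finally show "finsum M (\<lambda>i. scale M (coord (scale M c x) i) (v i)) J = \<dots>" .
    qed
  qed (use coord in blast)
qed

lemma simple_module_generated:
  fixes M :: "('a \<Rightarrow> 'k::field, 'm, 'y) module_scheme"
  assumes M: "simple_module (group_algebra G) M" and m: "m \<in> carrier M" "m \<noteq> \<zero>\<^bsub>M\<^esub>"
    and U: "submodule U (group_algebra G) M" "m \<in> U"
  shows "U = carrier M"
  using M U m unfolding simple_module_def by blast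

lemma simple_module_cyclic:
  fixes M :: "('a \<Rightarrow> 'k::field, 'm, 'y) module_scheme"
  assumes M: "simple_module (group_algebra G) M" and m: "m \<in> carrier M" "m \<noteq> \<zero>\<^bsub>M\<^esub>"
    and x: "x \<in> carrier M"
  obtains a where "a \<in> carrier (group_algebra G)" "x = a \<odot>\<^bsub>M\<^esub> m"
proof -
  have lM: "left_module (group_algebra G) M" using M by (simp add: simple_module_def)
  interpret M: left_module "group_algebra G" M by fact
  let ?A = "group_algebra G :: ('a \<Rightarrow> 'k) ring"
  define U where "U = (\<lambda>a. a \<odot>\<^bsub>M\<^esub> m) ` carrier ?A"
  have "submodule U (group_algebra G) M"
  proof (rule submodule_from_delta[OF lM])
    show "U \<subseteq> carrier M" using M.smult_closed m by (auto simp: U_def simp del: group_algebra_simps(1))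
    show "\<zero>\<^bsub>M\<^esub> \<in> U"
      unfolding U_def using M.smult_zero_left[OF m(1)] by (intro image_eqI[of _ _ "\<zero>\<^bsub>?A\<^esub>"]) auto
    fix x assume "x \<in> U"
    then obtain a where a: "a \<in> carrier ?A" "x = a \<odot>\<^bsub>M\<^esub> m" unfolding U_def by blast
    show "x \<oplus>\<^bsub>M\<^esub> y \<in> U" if y: "y \<in> U" for y
    proof -
      obtain b where b: "b \<in> carrier ?A" "y = b \<odot>\<^bsub>M\<^esub> m" using y unfolding U_def by blast
      have "x \<oplus>\<^bsub>M\<^esub> y = (a \<oplus>\<^bsub>?A\<^esub> b) \<odot>\<^bsub>M\<^esub> m"
        unfolding a(2) b(2) by (rule M.smult_l_distr[OF a(1) b(1) m(1), symmetric])
      then show ?thesis unfolding U_def using M.R.a_closed[OF a(1) b(1)] by blast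
    qed
    show "delta g c \<odot>\<^bsub>M\<^esub> x \<in> U" if g: "g \<in> carrier G" for g c
    proof -
      have "delta g c \<odot>\<^bsub>M\<^esub> x = (delta g c \<star> a) \<odot>\<^bsub>M\<^esub> m"
        unfolding a(2) by (rule M.smult_assoc[OF delta_closed[OF g] a(1) m(1), symmetric])
      then show ?thesis unfolding U_def using group_algebra_mult_closed by blast
    qed
  qed
  moreover have "m \<in> U" unfolding U_def using M.smult_one[OF m(1)] M.R.one_closed by force
  ultimately have "U = carrier M" by (rule simple_module_generated[OF M m])
  then show ?thesis using x that unfolding U_def by blast
qed

lemma simple_module_fg:
  fixes M :: "('a \<Rightarrow> 'k::field, 'm, 'y) module_scheme"
  assumes M: "simple_module (group_algebra G) M"
  shows "fg_module (group_algebra G) M" "indecomposable_module (group_algebra G) M"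
proof -
  have lM: "left_module (group_algebra G) M" using M by (simp add: simple_module_def)
  interpret M: left_module "group_algebra G" M by fact
  obtain m where m: "m \<in> carrier M" "m \<noteq> \<zero>\<^bsub>M\<^esub>"
    using M M.zero_closed unfolding simple_module_def by blast
  have "\<forall>U. submodule U (group_algebra G) M \<and> {m} \<subseteq> U \<longrightarrow> U = carrier M"
    using simple_module_generated[OF M m] by blast
  then show "fg_module (group_algebra G) M"
    unfolding fg_module_def using lM m(1) by (intro conjI exI[of _ "{m}"]) auto
  show "indecomposable_module (group_algebra G) M"
    unfolding indecomposable_module_def
  proof (intro conjI allI impI)
    show "left_module (group_algebra G) M" "carrier M \<noteq> {\<zero>\<^bsub>M\<^esub>}" using M by (auto simp: simple_module_def)
    fix U V assume UV: "direct_decomposition (group_algebra G) M U V"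
    then have "U = {\<zero>\<^bsub>M\<^esub>} \<or> U = carrier M" using M unfolding simple_module_def direct_decomposition_def by blast
    moreover have "V \<subseteq> carrier M"
    proof -
      have "submodule V (group_algebra G) M" using UV unfolding direct_decomposition_def by blast
      then show ?thesis using subgroup.subset[OF submodule.axioms(1)] by fastforce
    qed
    moreover have "U \<inter> V = {\<zero>\<^bsub>M\<^esub>}" using UV unfolding direct_decomposition_def by blast
    ultimately show "U = {\<zero>\<^bsub>M\<^esub>} \<or> V = {\<zero>\<^bsub>M\<^esub>}" by blast
  qed
qed

text \<open>The translates of one nonzero vector span a simple module over \<open>k\<close>, so the
  group itself can index the finite spanning family.\<close>

lemma simple_module_dual_basis:
  fixes M :: "('a \<Rightarrow> 'k::field, 'm, 'y) module_scheme"
  assumes M: "simple_module (group_algebra G) M"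
  obtains J :: "'a set" and v \<phi> where "finite J" "v \<in> J \<rightarrow> carrier M"
    "\<And>j x y. j \<in> J \<Longrightarrow> x \<in> carrier M \<Longrightarrow> y \<in> carrier M \<Longrightarrow> \<phi> j (x \<oplus>\<^bsub>M\<^esub> y) = (\<phi> j x + \<phi> j y :: 'k)"
    "\<And>j x c. j \<in> J \<Longrightarrow> x \<in> carrier M \<Longrightarrow> \<phi> j (scale M c x) = c * \<phi> j x"
    "\<And>m. m \<in> carrier M \<Longrightarrow> m = finsum M (\<lambda>j. scale M (\<phi> j m) (v j)) J"
proof -
  have lM: "left_module (group_algebra G) M" using M by (simp add: simple_module_def)
  interpret M: left_module "group_algebra G" M by fact
  obtain m where m: "m \<in> carrier M" "m \<noteq> \<zero>\<^bsub>M\<^esub>"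
    using M M.zero_closed unfolding simple_module_def by blast
  define v where "v = (\<lambda>g. delta g 1 \<odot>\<^bsub>M\<^esub> m)"
  have v: "v \<in> carrier G \<rightarrow> carrier M" unfolding v_def using M.smult_closed[OF delta_closed m(1)] by blast
  have sp: "\<exists>c. x = finsum M (\<lambda>i. scale M (c i) (v i)) (carrier G)" if x: "x \<in> carrier M" for x
  proof -
    obtain a where a: "a \<in> carrier (group_algebra G)" "x = a \<odot>\<^bsub>M\<^esub> m"
      by (rule simple_module_cyclic[OF M m x])
    have "x = finsum M (\<lambda>g. delta g (a g) \<odot>\<^bsub>M\<^esub> m) (carrier G)"
      unfolding a(2) by (rule smult_expand[OF M.semi_module_axioms a(1) m(1)])
    also have "\<dots> = finsum M (\<lambda>g. scale M (a g) (v g)) (carrier G)"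
      by (rule M.finsum_cong') (use scale_simps(1,8)[OF lM] M.smult_closed[OF delta_closed] m v in \<open>auto simp: v_def\<close>)
    finally show ?thesis by blast
  qed
  show ?thesis by (rule dual_basis_exists[OF lM finite_carrier v sp], assumption) (rule that)
qed

text \<open>The counterpart of \<open>additive_finsum\<close> for functionals: their target is a
  field as a type, not an abelian group as a record.\<close>

lemma functional_zero_finsum:
  fixes M :: "('a \<Rightarrow> 'k::field, 'm, 'y) module_scheme" and \<phi> :: "'m \<Rightarrow> 'k"
  assumes "abelian_group M"
    and add: "\<And>x y. x \<in> carrier M \<Longrightarrow> y \<in> carrier M \<Longrightarrow> \<phi> (x \<oplus>\<^bsub>M\<^esub> y) = \<phi> x + \<phi> y"
  shows "\<phi> \<zero>\<^bsub>M\<^esub> = 0"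
    and "finite I \<Longrightarrow> h \<in> I \<rightarrow> carrier M \<Longrightarrow> \<phi> (finsum M h I) = (\<Sum>i\<in>I. \<phi> (h i))"
proof -
  interpret M: abelian_group M by fact
  show z: "\<phi> \<zero>\<^bsub>M\<^esub> = 0"
  proof -
    have "\<phi> \<zero>\<^bsub>M\<^esub> + 0 = \<phi> \<zero>\<^bsub>M\<^esub> + \<phi> \<zero>\<^bsub>M\<^esub>"
      using add[OF M.zero_closed M.zero_closed] by (simp only: M.l_zero[OF M.zero_closed] add_0_right)
    then show ?thesis by (metis add_left_cancel)
  qed
  show "finite I \<Longrightarrow> h \<in> I \<rightarrow> carrier M \<Longrightarrow> \<phi> (finsum M h I) = (\<Sum>i\<in>I. \<phi> (h i))"
  proof (induction I rule: finite_induct)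
    case (insert i I)
    then have h: "h \<in> I \<rightarrow> carrier M" "h i \<in> carrier M" by auto
    then show ?case using insert add[OF h(2) M.finsum_closed[OF h(1)]] by simp
  qed (simp add: z)
qed

lemma induced_module_simps:
  "carrier (induced_module G H L) = {f \<in> carrier G \<rightarrow>\<^sub>E carrier L. \<forall>x\<in>carrier G. \<forall>h\<in>H.
        f (x \<otimes> h) = delta (inv h) 1 \<odot>\<^bsub>L\<^esub> f x}"
  "\<zero>\<^bsub>induced_module G H L\<^esub> = (\<lambda>x\<in>carrier G. \<zero>\<^bsub>L\<^esub>)"
  "f \<oplus>\<^bsub>induced_module G H L\<^esub> f' = (\<lambda>x\<in>carrier G. f x \<oplus>\<^bsub>L\<^esub> f' x)"
  "a \<odot>\<^bsub>induced_module G H L\<^esub> f = (\<lambda>x\<in>carrier G.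
        (\<Oplus>\<^bsub>L\<^esub>y\<in>carrier G. delta \<one> (a y) \<odot>\<^bsub>L\<^esub> f (inv y \<otimes> x)))"
  by (simp_all add: induced_module_def)

lemma induced_module_mem:
  assumes "f \<in> carrier (induced_module G H L)" "x \<in> carrier G"
  shows "f x \<in> carrier L" and "h \<in> H \<Longrightarrow> f (x \<otimes> h) = delta (inv h) 1 \<odot>\<^bsub>L\<^esub> f x"
  using assms by (auto simp: induced_module_simps)

lemma induced_module_eqI:
  assumes "f \<in> carrier (induced_module G H L)" "f' \<in> carrier (induced_module G H L)"
    and "\<And>x. x \<in> carrier G \<Longrightarrow> f x = f' x"
  shows "f = f'"
  using assms by (intro PiE_ext[of f "carrier G" "\<lambda>_. carrier L" f']) (auto simp: induced_module_simps)

text \<open>For \<open>delta g c\<close> all summands of the action vanish except the one for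
  \<open>y = g\<close>. The resulting translation formula replaces the defining sum in later
  computations.\<close>

lemma semi_module_induced_module:
  fixes L :: "('a \<Rightarrow> 'k::field, 'm, 'y) module_scheme"
  assumes H: "subgroup H G" and L: "left_module (group_algebra (G\<lparr>carrier := H\<rparr>)) L"
  shows "semi_module (group_algebra G) (induced_module G H L)"
    and "\<And>g c f x. g \<in> carrier G \<Longrightarrow> f \<in> carrier (induced_module G H L) \<Longrightarrow> x \<in> carrier G \<Longrightarrow>
      (delta g c \<odot>\<^bsub>induced_module G H L\<^esub> f) x = delta \<one> c \<odot>\<^bsub>L\<^esub> f (inv g \<otimes> x)"
proof -
  interpret Hs: subgroup H G by fact
  interpret Hg: finite_group "G\<lparr>carrier := H\<rparr>" by (rule subgroup_finite_group[OF H])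
  interpret L: left_module "group_algebra (G\<lparr>carrier := H\<rparr>)" L by fact
  let ?I = "induced_module G H L"
  have dH: "delta h c \<in> carrier (group_algebra (G\<lparr>carrier := H\<rparr>))" if "h \<in> H" for h and c :: 'k
    using Hg.delta_closed[of h c] that by simp
  note d1 = dH[OF Hs.one_closed]
  note mem = induced_module_mem
  have comm: "delta h 1 \<odot>\<^bsub>L\<^esub> (delta \<one> c \<odot>\<^bsub>L\<^esub> v) = delta \<one> c \<odot>\<^bsub>L\<^esub> (delta h 1 \<odot>\<^bsub>L\<^esub> v)"
    if "h \<in> H" "v \<in> carrier L" for h c v
    using Hg.scale_simps(8,9)[OF L, of h v] that by simp
  have fsc: "(\<lambda>y. delta \<one> (a y) \<odot>\<^bsub>L\<^esub> f (inv y \<otimes> x)) \<in> carrier G \<rightarrow> carrier L"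
    if f: "f \<in> carrier ?I" and x: "x \<in> carrier G" for a f x
  proof
    fix y assume "y \<in> carrier G"
    then show "delta \<one> (a y) \<odot>\<^bsub>L\<^esub> f (inv y \<otimes> x) \<in> carrier L"
      by (intro L.smult_closed[OF d1] mem(1)[OF f]) (use x in simp)
  qed
  have sc1: "delta \<one> c \<odot>\<^bsub>L\<^esub> v \<in> carrier L" if "v \<in> carrier L" for c v
    by (rule L.smult_closed[OF d1 that])
  have smult_mem: "a \<odot>\<^bsub>?I\<^esub> f \<in> carrier ?I" if f: "f \<in> carrier ?I" for a f
    unfolding induced_module_simps(1)
  proof (intro CollectI conjI ballI)
    show "a \<odot>\<^bsub>?I\<^esub> f \<in> carrier G \<rightarrow>\<^sub>E carrier L"
      unfolding induced_module_simps using L.finsum_closed[OF fsc[OF f]] by auto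
    fix x h assume x: "x \<in> carrier G" and h: "h \<in> H"
    have hc: "h \<in> carrier G" using h Hs.subset by blast
    have ih: "inv h \<in> H" using h by blast
    have "(a \<odot>\<^bsub>?I\<^esub> f) (x \<otimes> h) = finsum L (\<lambda>y. delta (inv h) 1 \<odot>\<^bsub>L\<^esub> (delta \<one> (a y) \<odot>\<^bsub>L\<^esub> f (inv y \<otimes> x))) (carrier G)"
      unfolding induced_module_simps(4) using x hc
    proof (simp, intro L.finsum_cong'[OF refl])
      show "(\<lambda>y. delta (inv h) 1 \<odot>\<^bsub>L\<^esub> (delta \<one> (a y) \<odot>\<^bsub>L\<^esub> f (inv y \<otimes> x))) \<in> carrier G \<rightarrow> carrier L"
        using fsc[OF f x, of a] L.smult_closed[OF dH[OF ih]] by blast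
      fix y assume y: "y \<in> carrier G"
      have "f (inv y \<otimes> (x \<otimes> h)) = delta (inv h) 1 \<odot>\<^bsub>L\<^esub> f (inv y \<otimes> x)"
        using mem(2)[OF f, of "inv y \<otimes> x" h] x y hc h by (simp add: m_assoc)
      then show "delta \<one> (a y) \<odot>\<^bsub>L\<^esub> f (inv y \<otimes> (x \<otimes> h))
          = delta (inv h) 1 \<odot>\<^bsub>L\<^esub> (delta \<one> (a y) \<odot>\<^bsub>L\<^esub> f (inv y \<otimes> x))"
        using comm[OF ih mem(1)[OF f]] x y by simp
    qed
    also have "\<dots> = delta (inv h) 1 \<odot>\<^bsub>L\<^esub> (a \<odot>\<^bsub>?I\<^esub> f) x"
      unfolding induced_module_simps(4)
      using L.finsum_smult[OF dH[OF ih] finite_carrier fsc[OF f x]] x by simp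
    finally show "(a \<odot>\<^bsub>?I\<^esub> f) (x \<otimes> h) = delta (inv h) 1 \<odot>\<^bsub>L\<^esub> (a \<odot>\<^bsub>?I\<^esub> f) x" .
  qed
  have add_mem: "f \<oplus>\<^bsub>?I\<^esub> f' \<in> carrier ?I" if f: "f \<in> carrier ?I" "f' \<in> carrier ?I" for f f'
    unfolding induced_module_simps(1)
  proof (intro CollectI conjI ballI)
    show "f \<oplus>\<^bsub>?I\<^esub> f' \<in> carrier G \<rightarrow>\<^sub>E carrier L"
      unfolding induced_module_simps using mem(1)[OF f(1)] mem(1)[OF f(2)] by auto
    fix x h assume x: "x \<in> carrier G" and h: "h \<in> H"
    have hc: "h \<in> carrier G" using h Hs.subset by blast
    have ih: "inv h \<in> H" using h by blast
    show "(f \<oplus>\<^bsub>?I\<^esub> f') (x \<otimes> h) = delta (inv h) 1 \<odot>\<^bsub>L\<^esub> (f \<oplus>\<^bsub>?I\<^esub> f') x"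
      using x hc h mem(2)[OF f(1) x h] mem(2)[OF f(2) x h] mem(1)[OF f(1) x] mem(1)[OF f(2) x]
        L.smult_r_distr[OF dH[OF ih]]
      by (simp add: induced_module_simps)
  qed
  have zero_mem: "\<zero>\<^bsub>?I\<^esub> \<in> carrier ?I"
    using Hs.subset L.smult_zero_right[OF dH[OF Hs.m_inv_closed]]
    by (auto simp: induced_module_simps subset_iff)
  have minus_mem: "(\<lambda>x\<in>carrier G. \<ominus>\<^bsub>L\<^esub> f x) \<in> carrier ?I" if f: "f \<in> carrier ?I" for f
    unfolding induced_module_simps(1)
  proof (intro CollectI conjI ballI)
    show "(\<lambda>x\<in>carrier G. \<ominus>\<^bsub>L\<^esub> f x) \<in> carrier G \<rightarrow>\<^sub>E carrier L" using mem(1)[OF f] by auto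
    fix x h assume x: "x \<in> carrier G" and h: "h \<in> H"
    have hc: "h \<in> carrier G" using h Hs.subset by blast
    have ih: "inv h \<in> H" using h by blast
    show "(\<lambda>x\<in>carrier G. \<ominus>\<^bsub>L\<^esub> f x) (x \<otimes> h) = delta (inv h) 1 \<odot>\<^bsub>L\<^esub> (\<lambda>x\<in>carrier G. \<ominus>\<^bsub>L\<^esub> f x) x"
      using x hc h mem(2)[OF f x h] mem(1)[OF f x] L.smult_minus_right[OF dH[OF ih]] by simp
  qed
  show "semi_module (group_algebra G) ?I"
    unfolding semi_module_def
  proof (intro conjI semi_module_axioms.intro)
    show "ring (group_algebra G :: ('a \<Rightarrow> 'k) ring)" by (rule ring_group_algebra)
    show "abelian_group ?I"
    proof (rule abelian_groupI)
      show "x \<oplus>\<^bsub>?I\<^esub> y \<in> carrier ?I" if "x \<in> carrier ?I" "y \<in> carrier ?I" for x y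
        by (rule add_mem[OF that])
      show "\<zero>\<^bsub>?I\<^esub> \<in> carrier ?I" by (rule zero_mem)
      show "x \<oplus>\<^bsub>?I\<^esub> y \<oplus>\<^bsub>?I\<^esub> z = x \<oplus>\<^bsub>?I\<^esub> (y \<oplus>\<^bsub>?I\<^esub> z)"
        if "x \<in> carrier ?I" "y \<in> carrier ?I" "z \<in> carrier ?I" for x y z
        using mem(1)[OF that(1)] mem(1)[OF that(2)] mem(1)[OF that(3)]
        by (auto simp: induced_module_simps(3) L.a_assoc)
      show "x \<oplus>\<^bsub>?I\<^esub> y = y \<oplus>\<^bsub>?I\<^esub> x" if "x \<in> carrier ?I" "y \<in> carrier ?I" for x y
        using mem(1)[OF that(1)] mem(1)[OF that(2)]
        by (auto simp: induced_module_simps(3) L.a_comm)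
      fix x assume x: "x \<in> carrier ?I"
      show "\<zero>\<^bsub>?I\<^esub> \<oplus>\<^bsub>?I\<^esub> x = x"
        by (rule induced_module_eqI[OF add_mem[OF zero_mem x] x])
          (use mem(1)[OF x] in \<open>simp add: induced_module_simps(2,3)\<close>)
      show "\<exists>y\<in>carrier ?I. y \<oplus>\<^bsub>?I\<^esub> x = \<zero>\<^bsub>?I\<^esub>"
        by (rule bexI[OF _ minus_mem[OF x]])
          (use mem(1)[OF x] in \<open>auto simp: induced_module_simps(2,3) L.l_neg\<close>)
    qed
    fix a b :: "'a \<Rightarrow> 'k" and f assume f: "f \<in> carrier ?I"
    show "a \<odot>\<^bsub>?I\<^esub> f \<in> carrier ?I" by (rule smult_mem[OF f])
    show "(a \<oplus>\<^bsub>group_algebra G\<^esub> b) \<odot>\<^bsub>?I\<^esub> f = a \<odot>\<^bsub>?I\<^esub> f \<oplus>\<^bsub>?I\<^esub> b \<odot>\<^bsub>?I\<^esub> f"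
    proof (rule induced_module_eqI[OF smult_mem[OF f] add_mem[OF smult_mem[OF f] smult_mem[OF f]]])
      fix x assume x: "x \<in> carrier G"
      have "finsum L (\<lambda>y. delta \<one> (a y + b y) \<odot>\<^bsub>L\<^esub> f (inv y \<otimes> x)) (carrier G)
        = finsum L (\<lambda>y. delta \<one> (a y) \<odot>\<^bsub>L\<^esub> f (inv y \<otimes> x) \<oplus>\<^bsub>L\<^esub> delta \<one> (b y) \<odot>\<^bsub>L\<^esub> f (inv y \<otimes> x)) (carrier G)"
        by (rule L.finsum_cong'[OF refl])
          (use sc1 Hg.scale_simps(2)[OF L] mem(1)[OF f] x in auto)
      also have "\<dots> = finsum L (\<lambda>y. delta \<one> (a y) \<odot>\<^bsub>L\<^esub> f (inv y \<otimes> x)) (carrier G)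
          \<oplus>\<^bsub>L\<^esub> finsum L (\<lambda>y. delta \<one> (b y) \<odot>\<^bsub>L\<^esub> f (inv y \<otimes> x)) (carrier G)"
        by (rule L.finsum_addf[OF fsc[OF f x] fsc[OF f x]])
      finally show "((a \<oplus>\<^bsub>group_algebra G\<^esub> b) \<odot>\<^bsub>?I\<^esub> f) x = (a \<odot>\<^bsub>?I\<^esub> f \<oplus>\<^bsub>?I\<^esub> b \<odot>\<^bsub>?I\<^esub> f) x"
        using x by (simp add: induced_module_simps(3,4))
    qed
    fix f' assume f': "f' \<in> carrier ?I"
    show "a \<odot>\<^bsub>?I\<^esub> (f \<oplus>\<^bsub>?I\<^esub> f') = a \<odot>\<^bsub>?I\<^esub> f \<oplus>\<^bsub>?I\<^esub> a \<odot>\<^bsub>?I\<^esub> f'"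
    proof (rule induced_module_eqI[OF smult_mem[OF add_mem[OF f f']] add_mem[OF smult_mem[OF f] smult_mem[OF f']]])
      fix x assume x: "x \<in> carrier G"
      have "finsum L (\<lambda>y. delta \<one> (a y) \<odot>\<^bsub>L\<^esub> (f \<oplus>\<^bsub>?I\<^esub> f') (inv y \<otimes> x)) (carrier G)
        = finsum L (\<lambda>y. delta \<one> (a y) \<odot>\<^bsub>L\<^esub> f (inv y \<otimes> x) \<oplus>\<^bsub>L\<^esub> delta \<one> (a y) \<odot>\<^bsub>L\<^esub> f' (inv y \<otimes> x)) (carrier G)"
        by (rule L.finsum_cong'[OF refl])
          (use sc1 L.smult_r_distr[OF d1] mem(1)[OF f] mem(1)[OF f'] x in
            \<open>auto simp: induced_module_simps(3)\<close>)
      also have "\<dots> = finsum L (\<lambda>y. delta \<one> (a y) \<odot>\<^bsub>L\<^esub> f (inv y \<otimes> x)) (carrier G)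
          \<oplus>\<^bsub>L\<^esub> finsum L (\<lambda>y. delta \<one> (a y) \<odot>\<^bsub>L\<^esub> f' (inv y \<otimes> x)) (carrier G)"
        by (rule L.finsum_addf[OF fsc[OF f x] fsc[OF f' x]])
      finally show "(a \<odot>\<^bsub>?I\<^esub> (f \<oplus>\<^bsub>?I\<^esub> f')) x = (a \<odot>\<^bsub>?I\<^esub> f \<oplus>\<^bsub>?I\<^esub> a \<odot>\<^bsub>?I\<^esub> f') x"
        using x by (simp add: induced_module_simps(4)) (simp add: induced_module_simps(3))
    qed
  qed
  fix g c f x assume g: "g \<in> carrier G" and f: "f \<in> carrier ?I" and x: "x \<in> carrier G"
  have "finsum L (\<lambda>y. delta \<one> (delta g c y) \<odot>\<^bsub>L\<^esub> f (inv y \<otimes> x)) (carrier G)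
      = finsum L (\<lambda>y. if g = y then delta \<one> c \<odot>\<^bsub>L\<^esub> f (inv y \<otimes> x) else \<zero>\<^bsub>L\<^esub>) (carrier G)"
    by (rule L.finsum_cong'[OF refl])
      (use fsc[OF f x, of "\<lambda>_. c"] Hg.scale_simps(6)[OF L] mem(1)[OF f] x in \<open>auto simp: delta_def[of g]\<close>)
  also have "\<dots> = delta \<one> c \<odot>\<^bsub>L\<^esub> f (inv g \<otimes> x)"
    by (rule L.finsum_singleton[OF g finite_carrier]) (rule fsc[OF f x])
  finally show "(delta g c \<odot>\<^bsub>?I\<^esub> f) x = delta \<one> c \<odot>\<^bsub>L\<^esub> f (inv g \<otimes> x)"
    using x by (simp add: induced_module_simps(4))
qed

end

section \<open>Sources of simple modules\<close>

definition coset_rep :: "('g, 'x) monoid_scheme \<Rightarrow> 'g set \<Rightarrow> 'g set \<Rightarrow> 'g" where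
  "coset_rep G D C = (SOME g. g \<in> carrier G \<and> g <#\<^bsub>G\<^esub> D = C)"

definition left_cosets :: "('g, 'x) monoid_scheme \<Rightarrow> 'g set \<Rightarrow> 'g set set" where
  "left_cosets G D = (\<lambda>g. g <#\<^bsub>G\<^esub> D) ` carrier G"

text \<open>A copy of the trivial module inside the type \<open>kmod\<close>, over which the
  definition of a common source ranges; only coordinate 0 carries a value.\<close>

definition trivial_kmod :: "'g set \<Rightarrow> ('g, 'k::field) kmod" where
  "trivial_kmod D = \<lparr>
     carrier = {v. \<forall>i>0. v i = 0}, monoid.mult = undefined, monoid.one = undefined,
     ring.zero = (\<lambda>_. 0), ring.add = (\<lambda>v w i. v i + w i),
     module.smult = (\<lambda>a v i. (\<Sum>g\<in>D. a g) * v i)\<rparr>"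

lemma trivial_kmod_simps [simp]:
  "v \<in> carrier (trivial_kmod D) \<longleftrightarrow> (\<forall>i>0. v i = 0)"
  "\<zero>\<^bsub>trivial_kmod D\<^esub> = (\<lambda>_. 0)"
  "v \<oplus>\<^bsub>trivial_kmod D\<^esub> w = (\<lambda>i. v i + w i)"
  "a \<odot>\<^bsub>trivial_kmod D\<^esub> v = (\<lambda>i. (\<Sum>g\<in>D. a g) * v i)"
  by (simp_all add: trivial_kmod_def)

context finite_group
begin

lemma finite_left_cosets [simp]: "finite (left_cosets G D)"
  by (simp add: left_cosets_def)

lemma coset_rep:
  assumes "C \<in> left_cosets G D"
  shows "coset_rep G D C \<in> carrier G" "coset_rep G D C <# D = C"
proof -
  have "\<exists>g. g \<in> carrier G \<and> g <# D = C" using assms by (auto simp: left_cosets_def)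
  from someI_ex[OF this] show "coset_rep G D C \<in> carrier G" "coset_rep G D C <# D = C"
    by (auto simp: coset_rep_def)
qed

lemma coset_rep_invariant:
  assumes D: "subgroup D G" and g: "g \<in> carrier G"
    and F: "\<And>x d. x \<in> carrier G \<Longrightarrow> d \<in> D \<Longrightarrow> F (x \<otimes> d) = F x"
  shows "F (coset_rep G D (g <# D)) = F g"
proof -
  let ?r = "coset_rep G D (g <# D)"
  have r: "?r \<in> carrier G" "?r <# D = g <# D" using coset_rep[of "g <# D" D] g by (auto simp: left_cosets_def)
  then have "inv g \<otimes> ?r \<in> D" using lcoset_eq_iff[OF D g r(1)] by simp
  then have "F (g \<otimes> (inv g \<otimes> ?r)) = F g" by (rule F[OF g])
  then show ?thesis using g r by simp
qed

lemma l_coset_left_cosets: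
  assumes D: "subgroup D G" and g: "g \<in> carrier G"
  shows "(\<lambda>C. g <# C) ` left_cosets G D = left_cosets G D" "inj_on (\<lambda>C. g <# C) (left_cosets G D)"
proof -
  have inv: "inv h <# (h <# C) = C" if "C \<in> left_cosets G D" "h \<in> carrier G" for C h
    using that D by (auto simp: left_cosets_def l_coset_mult)
  show inj: "inj_on (\<lambda>C. g <# C) (left_cosets G D)"
    by (rule inj_on_inverseI[of _ "\<lambda>C. inv g <# C"]) (rule inv[OF _ g])
  have "(\<lambda>C. g <# C) ` left_cosets G D \<subseteq> left_cosets G D"
    using D g by (auto simp: left_cosets_def l_coset_mult)
  then show "(\<lambda>C. g <# C) ` left_cosets G D = left_cosets G D"
    using inj by (intro endo_inj_surj) auto
qed

text \<open>Left multiplication by \<open>g\<close> permutes the cosets, and a function constant on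
  cosets does not see the change of representatives. This is what makes maps defined by sums over
  representatives commute with the group.\<close>

lemma finsum_coset_shift:
  assumes D: "subgroup D G" and g: "g \<in> carrier G" and M: "abelian_group M"
    and F: "F \<in> carrier G \<rightarrow> carrier M"
      "\<And>x d. x \<in> carrier G \<Longrightarrow> d \<in> D \<Longrightarrow> F (x \<otimes> d) = F x"
  shows "finsum M (\<lambda>C. F (g \<otimes> coset_rep G D C)) (left_cosets G D)
    = finsum M (\<lambda>C. F (coset_rep G D C)) (left_cosets G D)"
proof -
  interpret M: abelian_group M by fact
  have Fc: "F (coset_rep G D C) \<in> carrier M" if "C \<in> left_cosets G D" for C
    using coset_rep[OF that] F(1) by blast
  have "finsum M (\<lambda>C. F (coset_rep G D C)) (left_cosets G D)
      = finsum M (\<lambda>C. F (coset_rep G D C)) ((\<lambda>C. g <# C) ` left_cosets G D)"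
    by (simp only: l_coset_left_cosets(1)[OF D g])
  also have "\<dots> = finsum M (\<lambda>C. F (coset_rep G D (g <# C))) (left_cosets G D)"
    by (rule M.finsum_reindex[OF _ l_coset_left_cosets(2)[OF D g]])
      (use Fc l_coset_left_cosets(1)[OF D g] in blast)
  also have "\<dots> = finsum M (\<lambda>C. F (g \<otimes> coset_rep G D C)) (left_cosets G D)"
  proof (rule M.finsum_cong'[OF refl])
    show "(\<lambda>C. F (g \<otimes> coset_rep G D C)) \<in> left_cosets G D \<rightarrow> carrier M"
      using coset_rep g F(1) by blast
    fix C assume C: "C \<in> left_cosets G D"
    have "g <# C = (g \<otimes> coset_rep G D C) <# D"
      using l_coset_mult[OF D g coset_rep(1)[OF C]] coset_rep(2)[OF C] by simp
    then show "F (coset_rep G D (g <# C)) = F (g \<otimes> coset_rep G D C)"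
      using coset_rep_invariant[OF D _ F(2), of "g \<otimes> coset_rep G D C"] g coset_rep(1)[OF C] by simp
  qed
  finally show ?thesis ..
qed

text \<open>The left side is the relative trace of \<open>x\<close> from \<open>D\<close>. The
  conjugate of \<open>x\<close> by \<open>g\<close> depends only on the coset of \<open>g\<close>
  modulo the centralizer of \<open>x\<close>, and every such coset splits into the same number of
  cosets of \<open>D\<close>, which is the factor on the right.\<close>

lemma sum_coset_conjugates:
  assumes D: "subgroup D G" and x: "x \<in> centralizer G D"
  shows "(\<Sum>C\<in>left_cosets G D. delta (coset_rep G D C \<otimes> x \<otimes> inv (coset_rep G D C)) 1 z)
    = of_nat (card (centralizer G {x}) div card D) * (class_sum x z :: 'k::field)"
proof -
  interpret D: subgroup D G by fact
  have xc: "x \<in> carrier G" using x by (simp add: centralizer_def)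
  let ?F = "\<lambda>g. g \<otimes> x \<otimes> inv g" and ?r = "coset_rep G D"
  let ?X = "centralizer G {x}"
  have X: "subgroup ?X G" using xc by (intro subgroup_centralizer) auto
  have Xiff: "y \<in> ?X \<longleftrightarrow> y \<in> carrier G \<and> ?F y = x" for y
    using conj_eq_self_iff[of y x] xc by (auto simp: centralizer_def)
  have dx: "?F d = x" if "d \<in> D" for d
    using x that centralizer_iff_conj[OF D.subset] by blast
  have DX: "D \<subseteq> ?X" using dx D.subset Xiff by blast
  have Fr: "?F (?r (g <# D)) = ?F g" if "g \<in> carrier G" for g
  proof (rule coset_rep_invariant[OF D that])
    fix y d assume "y \<in> carrier G" "d \<in> D"
    then show "?F (y \<otimes> d) = ?F y" using conj_conj[of y d x] dx D.subset xc by auto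
  qed
  have "(\<Sum>C\<in>left_cosets G D. delta (?F (?r C)) 1 z)
      = (\<Sum>C\<in>left_cosets G D. if ?F (?r C) = z then 1 else (0 :: 'k))"
    by (rule sum.cong) (auto simp: delta_def)
  also have "\<dots> = of_nat (card {C \<in> left_cosets G D. ?F (?r C) = z})"
    by (simp add: sum.If_cases Int_def)
  also have "\<dots> = of_nat (card ?X div card D) * class_sum x z"
  proof (cases "\<exists>h\<in>carrier G. z = ?F h")
    case False
    then have 1: "{C \<in> left_cosets G D. ?F (?r C) = z} = {}" using coset_rep(1) by blast
    have "(class_sum x z :: 'k) = 0" using False by (simp add: class_sum_def)
    then show ?thesis unfolding 1 by simp
  next
    case True
    then obtain h where h: "h \<in> carrier G" "z = ?F h" by blast
    have "{C \<in> left_cosets G D. ?F (?r C) = z} = (\<lambda>K. h <# K) ` (\<lambda>y. y <# D) ` ?X"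
    proof (intro equalityI subsetI)
      fix C assume C: "C \<in> {C \<in> left_cosets G D. ?F (?r C) = z}"
      then obtain g where g: "g \<in> carrier G" "C = g <# D" by (auto simp: left_cosets_def)
      have gz: "?F g = z" using C Fr[OF g(1)] g(2) by simp
      have "?F (inv h \<otimes> g) = inv h \<otimes> ?F g \<otimes> inv (inv h)"
        using conj_conj[of "inv h" g x] h g xc by simp
      also have "\<dots> = x" using gz h conj_inv_conj[OF h(1) xc] by simp
      finally have "inv h \<otimes> g \<in> ?X" using Xiff h g by simp
      moreover have "C = h <# ((inv h \<otimes> g) <# D)" using h g l_coset_mult[OF D, of h "inv h \<otimes> g"] by simp
      ultimately show "C \<in> (\<lambda>K. h <# K) ` (\<lambda>y. y <# D) ` ?X" by blast
    next
      fix C assume "C \<in> (\<lambda>K. h <# K) ` (\<lambda>y. y <# D) ` ?X"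
      then obtain y where y: "y \<in> ?X" "C = h <# (y <# D)" by blast
      have yc: "y \<in> carrier G" "?F y = x" using y Xiff by auto
      have C: "C = (h \<otimes> y) <# D" using y l_coset_mult[OF D h(1) yc(1)] by simp
      have "?F (h \<otimes> y) = ?F h" using conj_conj[OF h(1) yc(1) xc] yc(2) by simp
      then have "?F (?r C) = z" using Fr[of "h \<otimes> y"] h yc C by simp
      moreover have "C \<in> left_cosets G D" using C h yc by (auto simp: left_cosets_def)
      ultimately show "C \<in> {C \<in> left_cosets G D. ?F (?r C) = z}" by blast
    qed
    moreover have "card ((\<lambda>K. h <# K) ` (\<lambda>y. y <# D) ` ?X) = card ((\<lambda>y. y <# D) ` ?X)"
    proof (rule card_image, rule inj_on_subset[OF l_coset_left_cosets(2)[OF D h(1)]])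
      show "(\<lambda>y. y <# D) ` ?X \<subseteq> left_cosets G D" using Xiff unfolding left_cosets_def by blast
    qed
    moreover have "card ((\<lambda>y. y <# D) ` ?X) = card ?X div card D"
      using card_lcosets[OF finite_carrier X D DX] card_subgroup_pos[OF D]
      by (metis nonzero_mult_div_cancel_right not_gr_zero)
    moreover have "(class_sum x z :: 'k) = 1" using h by (auto simp: class_sum_def)
    ultimately show ?thesis by simp
  qed
  finally show ?thesis .
qed

text \<open>Higman's criterion: the block idempotent is a relative trace from the defect group.\<close>

lemma block_module_trace:
  fixes b :: "'a \<Rightarrow> 'k::field" and M :: "('a \<Rightarrow> 'k, 'm, 'y) module_scheme"
  assumes b: "is_block G b" and D: "is_defect_group G b D"
    and p: "Factorial_Ring.prime p" "CHAR('k) = p"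
    and M: "left_module (group_algebra G) M" "in_block b M"
  obtains a where "a \<in> carrier (group_algebra G)"
    "\<And>m. m \<in> carrier M \<Longrightarrow> m = finsum M (\<lambda>C. delta (coset_rep G D C) 1 \<odot>\<^bsub>M\<^esub>
       (a \<odot>\<^bsub>M\<^esub> (delta (inv (coset_rep G D C)) 1 \<odot>\<^bsub>M\<^esub> m))) (left_cosets G D)"
proof -
  interpret M: left_module "group_algebra G" M by fact
  have sD: "subgroup D G" using D by (simp add: is_defect_group_def p_subgroup_def)
  obtain x y where x: "x \<in> centralizer G D" and y: "class_function G y" and xy: "class_sum x \<star> y = b"
    and k: "\<not> p dvd card (centralizer G {x}) div card D"
    by (rule block_defect_class[OF b D p])
  have xc: "x \<in> carrier G" using x by (simp add: centralizer_def)
  \<comment> \<open>\<open>D\<close> is a Sylow subgroup of the centralizer of \<open>x\<close>, so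
    the multiplicity is invertible in \<open>k\<close>, and the class sum is the relative trace of
    \<open>r\<close> times \<open>x\<close>.\<close>
  define r :: 'k where "r = 1 / of_nat (card (centralizer G {x}) div card D)"
  have r: "r * of_nat (card (centralizer G {x}) div card D) = 1"
    using k p by (simp add: r_def of_nat_eq_0_iff_char_dvd)
  let ?r = "coset_rep G D"
  note yA = class_function_carrier[OF y]
  \<comment> \<open>As \<open>y\<close> is central, multiplication by \<open>y\<close> passes into
    the trace, and \<open>b\<close> becomes the relative trace of \<open>a\<close>.\<close>
  define a where "a = delta x r \<star> y"
  have aA: "a \<in> carrier (group_algebra G)" unfolding a_def by (rule group_algebra_mult_closed)
  have cl: "class_sum x = (\<lambda>z. \<Sum>C\<in>left_cosets G D. delta (?r C \<otimes> x \<otimes> inv (?r C)) r z)"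
  proof
    fix z
    have "(\<Sum>C\<in>left_cosets G D. delta (?r C \<otimes> x \<otimes> inv (?r C)) r z)
        = r * (\<Sum>C\<in>left_cosets G D. delta (?r C \<otimes> x \<otimes> inv (?r C)) 1 z)"
      unfolding sum_distrib_left by (rule sum.cong) (auto simp: delta_def)
    also have "\<dots> = class_sum x z"
      unfolding sum_coset_conjugates[OF sD x] using r by (simp flip: mult.assoc)
    finally show "class_sum x z = (\<Sum>C\<in>left_cosets G D. delta (?r C \<otimes> x \<otimes> inv (?r C)) r z)" ..
  qed
  have "m = finsum M (\<lambda>C. delta (?r C) 1 \<odot>\<^bsub>M\<^esub> (a \<odot>\<^bsub>M\<^esub> (delta (inv (?r C)) 1 \<odot>\<^bsub>M\<^esub> m))) (left_cosets G D)"
    if m: "m \<in> carrier M" for m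
  proof -
    have ym: "y \<odot>\<^bsub>M\<^esub> m \<in> carrier M" by (rule M.smult_closed[OF yA m])
    have clA: "class_sum x \<in> carrier (group_algebra G :: ('a \<Rightarrow> 'k) ring)"
      by (rule class_function_carrier[OF class_function_class_sum[OF xc]])
    have tc: "?r C \<otimes> x \<otimes> inv (?r C) \<in> carrier G" if "C \<in> left_cosets G D" for C
      using coset_rep(1)[OF that] xc by simp
    have "m = b \<odot>\<^bsub>M\<^esub> m" using M(2) m by (simp add: in_block_def)
    also have "\<dots> = class_sum x \<odot>\<^bsub>M\<^esub> (y \<odot>\<^bsub>M\<^esub> m)"
      unfolding xy[symmetric] by (rule M.smult_assoc[OF clA yA m])
    also have "\<dots> = finsum M (\<lambda>C. delta (?r C \<otimes> x \<otimes> inv (?r C)) r \<odot>\<^bsub>M\<^esub> (y \<odot>\<^bsub>M\<^esub> m)) (left_cosets G D)"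
      by (subst cl, rule sum_smult[OF M.semi_module_axioms finite_left_cosets delta_closed[OF tc] ym])
    also have "\<dots> = finsum M (\<lambda>C. delta (?r C) 1 \<odot>\<^bsub>M\<^esub> (a \<odot>\<^bsub>M\<^esub> (delta (inv (?r C)) 1 \<odot>\<^bsub>M\<^esub> m))) (left_cosets G D)"
    proof (rule M.finsum_cong'[OF refl])
      have rc: "?r C \<in> carrier G" "inv (?r C) \<in> carrier G" if "C \<in> left_cosets G D" for C
        using coset_rep(1)[OF that] by auto
      show "(\<lambda>C. delta (?r C) 1 \<odot>\<^bsub>M\<^esub> (a \<odot>\<^bsub>M\<^esub> (delta (inv (?r C)) 1 \<odot>\<^bsub>M\<^esub> m))) \<in> left_cosets G D \<rightarrow> carrier M"
        by (intro Pi_I M.smult_closed[OF delta_closed] M.smult_closed[OF aA] rc m)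
      fix C assume C: "C \<in> left_cosets G D"
      define t where "t = ?r C"
      have t: "t \<in> carrier G" "inv t \<in> carrier G" using rc[OF C] by (auto simp: t_def)
      have "delta (t \<otimes> x \<otimes> inv t) r = delta t 1 \<star> delta x r \<star> delta (inv t) 1"
        using delta_delta_mult[OF t(1) xc, of 1 r] delta_delta_mult[of "t \<otimes> x" "inv t" r 1] t xc by simp
      then have "delta (t \<otimes> x \<otimes> inv t) r \<star> y = delta t 1 \<star> (a \<star> delta (inv t) 1)"
        unfolding a_def
        using class_function_commute[OF y delta_closed[OF t(2)], of 1] by (simp add: group_algebra_assoc)
      then have "(delta (t \<otimes> x \<otimes> inv t) r \<star> y) \<odot>\<^bsub>M\<^esub> m = (delta t 1 \<star> (a \<star> delta (inv t) 1)) \<odot>\<^bsub>M\<^esub> m"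
        by simp
      also have "\<dots> = delta t 1 \<odot>\<^bsub>M\<^esub> ((a \<star> delta (inv t) 1) \<odot>\<^bsub>M\<^esub> m)"
        by (rule M.smult_assoc[OF delta_closed[OF t(1)] group_algebra_mult_closed m])
      also have "(a \<star> delta (inv t) 1) \<odot>\<^bsub>M\<^esub> m = a \<odot>\<^bsub>M\<^esub> (delta (inv t) 1 \<odot>\<^bsub>M\<^esub> m)"
        by (rule M.smult_assoc[OF aA delta_closed[OF t(2)] m])
      finally show "delta (?r C \<otimes> x \<otimes> inv (?r C)) r \<odot>\<^bsub>M\<^esub> (y \<odot>\<^bsub>M\<^esub> m)
          = delta (?r C) 1 \<odot>\<^bsub>M\<^esub> (a \<odot>\<^bsub>M\<^esub> (delta (inv (?r C)) 1 \<odot>\<^bsub>M\<^esub> m))"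
        using M.smult_assoc[OF delta_closed[OF tc[OF C]] yA m, of r] by (simp add: t_def)
    qed
    finally show ?thesis .
  qed
  then show ?thesis using that aA by blast
qed

lemma left_module_trivial_kmod: "left_module (group_algebra G) (trivial_kmod (carrier G) :: ('a, 'k::field) kmod)"
  unfolding left_module_def
proof (intro conjI left_module_axioms.intro)
  let ?T = "trivial_kmod (carrier G) :: ('a, 'k) kmod"
  show "ring (group_algebra G :: ('a \<Rightarrow> 'k) ring)" by (rule ring_group_algebra)
  show "abelian_group ?T"
  proof (rule abelian_groupI)
    fix v assume "v \<in> carrier ?T"
    then show "\<exists>w\<in>carrier ?T. w \<oplus>\<^bsub>?T\<^esub> v = \<zero>\<^bsub>?T\<^esub>"
      by (intro bexI[of _ "\<lambda>i. - v i"]) auto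
  qed (auto simp: algebra_simps)
  fix a b :: "'a \<Rightarrow> 'k" and v
  show "(a \<otimes>\<^bsub>group_algebra G\<^esub> b) \<odot>\<^bsub>?T\<^esub> v = a \<odot>\<^bsub>?T\<^esub> (b \<odot>\<^bsub>?T\<^esub> v)"
  proof -
    have "(\<Sum>x\<in>carrier G. (a \<star> b) x) = (\<Sum>x\<in>carrier G. \<Sum>y\<in>carrier G. a y * b (inv y \<otimes> x))"
      by (simp add: group_algebra_mult)
    also have "\<dots> = (\<Sum>y\<in>carrier G. \<Sum>x\<in>carrier G. a y * b (inv y \<otimes> x))" by (rule sum.swap)
    also have "\<dots> = (\<Sum>y\<in>carrier G. a y * (\<Sum>x\<in>carrier G. b x))"
      by (rule sum.cong) (simp_all add: sum_left_mult[of "inv _" b] flip: sum_distrib_left)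
    finally show ?thesis by (simp add: sum_distrib_right mult.assoc)
  qed
  show "\<one>\<^bsub>group_algebra G\<^esub> \<odot>\<^bsub>?T\<^esub> v = v" by (simp add: delta_def)
qed (auto simp: algebra_simps sum.distrib)

lemma trivial_kmod_fg: "fg_module (group_algebra G) (trivial_kmod (carrier G) :: ('a, 'k::field) kmod)"
    (is "fg_module _ ?T")
  and trivial_kmod_indecomposable: "indecomposable_module (group_algebra G) (trivial_kmod (carrier G) :: ('a, 'k::field) kmod)"
proof -
  have gen: "U = carrier ?T" if U: "submodule U (group_algebra G) ?T" and v: "v \<in> U" "v \<noteq> (\<lambda>_. 0)" for U v
  proof -
    interpret U: submodule U "group_algebra G" ?T by fact
    have Us: "U \<subseteq> carrier ?T" using U.subset by auto
    have v0: "v 0 \<noteq> 0"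
    proof
      assume "v 0 = 0"
      moreover have "v i = 0" if "i > 0" for i using v(1) Us that by auto
      ultimately have "v i = 0" for i by (cases "i = 0") auto
      with v(2) show False by auto
    qed
    have "w \<in> U" if w: "w \<in> carrier ?T" for w
    proof -
      have "delta \<one> (w 0 / v 0) \<odot>\<^bsub>?T\<^esub> v \<in> U" by (rule U.smult_closed[OF delta_closed[OF one_closed] v(1)])
      moreover have "delta \<one> (w 0 / v 0) \<odot>\<^bsub>?T\<^esub> v = w"
      proof
        fix i
        have "w 0 / v 0 * v i = w i" using w v0 v(1) Us by (cases "i = 0") auto
        then show "(delta \<one> (w 0 / v 0) \<odot>\<^bsub>?T\<^esub> v) i = w i" by (simp add: delta_def)
      qed
      ultimately show ?thesis by simp
    qed
    with Us show ?thesis by blast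
  qed
  define e where "e = (\<lambda>i::nat. if i = 0 then 1 else (0 :: 'k))"
  have e: "e \<in> carrier ?T" "e \<noteq> (\<lambda>_. 0)" by (auto simp: e_def fun_eq_iff)
  show "fg_module (group_algebra G) ?T"
    unfolding fg_module_def
    using left_module_trivial_kmod gen[OF _ _ e(2)] e(1) by (intro conjI exI[of _ "{e}"]) auto
  show "indecomposable_module (group_algebra G) ?T"
    unfolding indecomposable_module_def
  proof (intro conjI allI impI left_module_trivial_kmod)
    show "carrier ?T \<noteq> {\<zero>\<^bsub>?T\<^esub>}" using e by (auto simp del: trivial_kmod_simps(1))
    fix U V assume UV: "direct_decomposition (group_algebra G) ?T U V"
    then have sU: "submodule U (group_algebra G) ?T" and sV: "submodule V (group_algebra G) ?T"
      and i: "U \<inter> V = {\<zero>\<^bsub>?T\<^esub>}"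
      unfolding direct_decomposition_def by blast+
    show "U = {\<zero>\<^bsub>?T\<^esub>} \<or> V = {\<zero>\<^bsub>?T\<^esub>}"
    proof (rule ccontr)
      assume "\<not> ?thesis"
      moreover have "\<zero>\<^bsub>?T\<^esub> \<in> U" "\<zero>\<^bsub>?T\<^esub> \<in> V" using i by blast+
      ultimately obtain u v where "u \<in> U" "u \<noteq> \<zero>\<^bsub>?T\<^esub>" "v \<in> V" "v \<noteq> \<zero>\<^bsub>?T\<^esub>" by blast
      then have "U = carrier ?T" "V = carrier ?T" using gen[OF sU] gen[OF sV] by simp_all
      then show False using i e by auto
    qed
  qed
qed

text \<open>Schur's lemma: kernel and image are submodules, and one nonzero value excludes the
  degenerate case for both.\<close>

lemma simple_module_endomorphism_bij:
  fixes M :: "('a \<Rightarrow> 'k::field, 'm, 'y) module_scheme"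
  assumes M: "simple_module (group_algebra G) M" and f: "module_hom (group_algebra G) M M f"
    and m: "m \<in> carrier M" "f m \<noteq> \<zero>\<^bsub>M\<^esub>"
  shows "bij_betw f (carrier M) (carrier M)"
proof -
  have lM: "left_module (group_algebra G) M" using M by (simp add: simple_module_def)
  interpret M: left_module "group_algebra G" M by fact
  note fD = module_homD[OF f]
  have fF: "f \<in> carrier M \<rightarrow> carrier M" using fD(1) by blast
  have f0: "f \<zero>\<^bsub>M\<^esub> = \<zero>\<^bsub>M\<^esub>"
    by (rule additive_zero[OF M.abelian_group_axioms M.abelian_group_axioms fF fD(2)])
  have fm: "f (\<ominus>\<^bsub>M\<^esub> x) = \<ominus>\<^bsub>M\<^esub> f x" if "x \<in> carrier M" for x
    by (rule additive_minus[OF M.abelian_group_axioms M.abelian_group_axioms fF fD(2) that])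
  define K where "K = {x \<in> carrier M. f x = \<zero>\<^bsub>M\<^esub>}"
  have "submodule K (group_algebra G) M"
  proof (rule submodule_from_delta[OF lM])
    show "delta g c \<odot>\<^bsub>M\<^esub> x \<in> K" if "g \<in> carrier G" "x \<in> K" for g c x
      using fD(3)[OF delta_closed[OF that(1)], of x c] M.smult_closed[OF delta_closed[OF that(1)], of x c] that(2)
        M.smult_zero_right[OF delta_closed[OF that(1)], of c] by (auto simp: K_def)
  qed (use f0 fD(2) in \<open>auto simp: K_def\<close>)
  then have "K = {\<zero>\<^bsub>M\<^esub>}" using M m unfolding simple_module_def K_def by blast
  then have inj: "inj_on f (carrier M)"
  proof (intro inj_onI)
    fix x y assume K: "K = {\<zero>\<^bsub>M\<^esub>}" and x: "x \<in> carrier M" and y: "y \<in> carrier M" and eq: "f x = f y"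
    have "f (x \<oplus>\<^bsub>M\<^esub> \<ominus>\<^bsub>M\<^esub> y) = \<zero>\<^bsub>M\<^esub>"
      using fD(2)[OF x M.a_inv_closed[OF y]] fm[OF y] eq fD(1)[OF y] by (simp add: M.r_neg)
    then have "x \<oplus>\<^bsub>M\<^esub> \<ominus>\<^bsub>M\<^esub> y \<in> K" using x y by (simp add: K_def)
    then have "x \<oplus>\<^bsub>M\<^esub> \<ominus>\<^bsub>M\<^esub> y = \<zero>\<^bsub>M\<^esub>" using K by simp
    then show "x = y" using x y M.minus_equality[of x "\<ominus>\<^bsub>M\<^esub> y"] by simp
  qed
  have "submodule (f ` carrier M) (group_algebra G) M"
  proof (rule submodule_from_delta[OF lM])
    show "f ` carrier M \<subseteq> carrier M" using fF by blast
    show "\<zero>\<^bsub>M\<^esub> \<in> f ` carrier M" using f0 by force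
    show "x \<oplus>\<^bsub>M\<^esub> y \<in> f ` carrier M" if xy: "x \<in> f ` carrier M" "y \<in> f ` carrier M" for x y
    proof -
      obtain x' y' where "x' \<in> carrier M" "y' \<in> carrier M" "x = f x'" "y = f y'" using xy by blast
      then show ?thesis using fD(2) by (intro image_eqI[of _ _ "x' \<oplus>\<^bsub>M\<^esub> y'"]) auto
    qed
    show "delta g c \<odot>\<^bsub>M\<^esub> x \<in> f ` carrier M" if g: "g \<in> carrier G" and x: "x \<in> f ` carrier M" for g c x
    proof -
      obtain x' where x': "x' \<in> carrier M" "x = f x'" using x by blast
      show ?thesis
        by (rule image_eqI[of _ _ "delta g c \<odot>\<^bsub>M\<^esub> x'"])
          (use fD(3)[OF delta_closed[OF g] x'(1)] M.smult_closed[OF delta_closed[OF g] x'(1)] x'(2) in auto)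
    qed
  qed
  then have "f ` carrier M = carrier M" using M m unfolding simple_module_def by blast
  with inj show ?thesis by (simp add: bij_betw_def)
qed

text \<open>The trace formula for the identity of \<open>M\<close>, combined with a dual basis,
  writes the identity as the sum over \<open>j\<close> of the composites of
  \<open>\<alpha> j\<close> and \<open>\<beta> j\<close>, which factor through the module induced
  from the trivial module. One of them is nonzero, hence bijective, so a single copy of the induced
  module suffices.\<close>

lemma simple_module_trivial_source:
  fixes b :: "'a \<Rightarrow> 'k::field" and M :: "('a \<Rightarrow> 'k, 'm, 'y) module_scheme"
  assumes b: "is_block G b" and D: "is_defect_group G b D"
    and p: "Factorial_Ring.prime p" "CHAR('k) = p"
    and M: "simple_module (group_algebra G) M" "in_block b M"
    and triv: "\<And>d m. d \<in> D \<Longrightarrow> m \<in> carrier M \<Longrightarrow> delta d 1 \<odot>\<^bsub>M\<^esub> m = m"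
  shows "iso_direct_summand (group_algebra G) M (induced_module G D (trivial_kmod D))"
proof -
  have lM: "left_module (group_algebra G) M" using M by (simp add: simple_module_def)
  interpret M: left_module "group_algebra G" M by fact
  have sD: "subgroup D G" using D by (simp add: is_defect_group_def p_subgroup_def)
  interpret D: subgroup D G by fact
  interpret Dg: finite_group "G\<lparr>carrier := D\<rparr>" by (rule subgroup_finite_group[OF sD])
  let ?T = "trivial_kmod D :: ('a, 'k) kmod"
  let ?I = "induced_module G D ?T"
  have lT: "left_module (group_algebra (G\<lparr>carrier := D\<rparr>)) ?T" using Dg.left_module_trivial_kmod by simp
  note Ism = semi_module_induced_module[OF sD lT]
  interpret I: semi_module "group_algebra G" ?I by (rule Ism(1))
  note sc = scale_simps[OF lM]
  have fD: "finite D" by (rule finite_subgroup[OF sD])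
  have dT: "delta d c \<odot>\<^bsub>?T\<^esub> v = (\<lambda>i. c * v i)" if "d \<in> D" for d c v
    using that fD by (simp add: delta_def)
  obtain J :: "'a set" and v \<phi> where J: "finite J" and v: "v \<in> J \<rightarrow> carrier M"
    and \<phi>add: "\<And>j x y. j \<in> J \<Longrightarrow> x \<in> carrier M \<Longrightarrow> y \<in> carrier M \<Longrightarrow> \<phi> j (x \<oplus>\<^bsub>M\<^esub> y) = (\<phi> j x + \<phi> j y :: 'k)"
    and \<phi>sc: "\<And>j x c. j \<in> J \<Longrightarrow> x \<in> carrier M \<Longrightarrow> \<phi> j (scale M c x) = c * \<phi> j x"
    and basis: "\<And>m. m \<in> carrier M \<Longrightarrow> m = finsum M (\<lambda>j. scale M (\<phi> j m) (v j)) J"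
    by (rule simple_module_dual_basis[OF M(1)]) blast
  obtain a where aA: "a \<in> carrier (group_algebra G)"
    and trace: "\<And>m. m \<in> carrier M \<Longrightarrow> m = finsum M (\<lambda>C. delta (coset_rep G D C) 1 \<odot>\<^bsub>M\<^esub>
       (a \<odot>\<^bsub>M\<^esub> (delta (inv (coset_rep G D C)) 1 \<odot>\<^bsub>M\<^esub> m))) (left_cosets G D)"
    by (rule block_module_trace[OF b D p lM M(2)]) blast
  let ?r = "coset_rep G D"
  have gm: "delta g c \<odot>\<^bsub>M\<^esub> m \<in> carrier M" if "g \<in> carrier G" "m \<in> carrier M" for g c m
    by (rule M.smult_closed[OF delta_closed[OF that(1)] that(2)])
  have dd: "delta g c \<odot>\<^bsub>M\<^esub> (delta h d \<odot>\<^bsub>M\<^esub> m) = delta (g \<otimes> h) (c * d) \<odot>\<^bsub>M\<^esub> m"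
    if "g \<in> carrier G" "h \<in> carrier G" "m \<in> carrier M" for g h c d m
    using M.smult_assoc[OF delta_closed[OF that(1)] delta_closed[OF that(2)] that(3), of c d]
      delta_delta_mult[OF that(1,2), of c d] by simp
  \<comment> \<open>\<open>\<alpha> j\<close> corresponds to the coordinate functional
    \<open>\<phi> j\<close> under Frobenius reciprocity, with values in coordinate 0; triviality of
    \<open>D\<close> on \<open>M\<close> gives the coset condition. \<open>\<beta> j\<close> sends
    \<open>f\<close> to the sum of the translates of \<open>a \<odot> v j\<close> by coset
    representatives, weighted by \<open>f\<close>.\<close>
  define \<alpha> where "\<alpha> = (\<lambda>j m. \<lambda>x\<in>carrier G. \<lambda>i::nat. if i = 0 then \<phi> j (delta (inv x) 1 \<odot>\<^bsub>M\<^esub> m) else (0 :: 'k))"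
  define \<beta> where "\<beta> = (\<lambda>j f. finsum M (\<lambda>C. delta (?r C) (f (?r C) (0 :: nat)) \<odot>\<^bsub>M\<^esub> (a \<odot>\<^bsub>M\<^esub> v j)) (left_cosets G D))"
  have \<alpha>: "module_hom (group_algebra G) M ?I (\<alpha> j)" if j: "j \<in> J" for j
  proof (rule module_hom_from_delta[OF M.semi_module_axioms Ism(1)])
    have mem: "\<alpha> j m \<in> carrier ?I" if m: "m \<in> carrier M" for m
      unfolding induced_module_simps(1)
    proof (intro CollectI conjI ballI)
      show "\<alpha> j m \<in> carrier G \<rightarrow>\<^sub>E carrier ?T" by (auto simp: \<alpha>_def)
      fix x h assume x: "x \<in> carrier G" and h: "h \<in> D"
      have hc: "h \<in> carrier G" using h D.subset by blast
      have "delta (inv (x \<otimes> h)) 1 \<odot>\<^bsub>M\<^esub> m = delta (inv h) 1 \<odot>\<^bsub>M\<^esub> (delta (inv x) 1 \<odot>\<^bsub>M\<^esub> m)"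
        using dd[of "inv h" "inv x" m 1 1] x hc m by (simp add: inv_mult_group)
      also have "\<dots> = delta (inv x) 1 \<odot>\<^bsub>M\<^esub> m" using triv[of "inv h"] h gm x m by simp
      finally show "\<alpha> j m (x \<otimes> h) = delta (inv h) 1 \<odot>\<^bsub>?T\<^esub> \<alpha> j m x"
        using x hc dT[of "inv h" 1] h by (simp add: \<alpha>_def cong: if_cong)
    qed
    then show "\<alpha> j \<in> carrier M \<rightarrow> carrier ?I" by blast
    fix x assume x: "x \<in> carrier M"
    show "\<alpha> j (x \<oplus>\<^bsub>M\<^esub> y) = \<alpha> j x \<oplus>\<^bsub>?I\<^esub> \<alpha> j y" if y: "y \<in> carrier M" for y
    proof (rule induced_module_eqI[OF mem[OF M.a_closed[OF x y]] I.a_closed[OF mem[OF x] mem[OF y]]])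
      fix g assume g: "g \<in> carrier G"
      have "delta (inv g) 1 \<odot>\<^bsub>M\<^esub> (x \<oplus>\<^bsub>M\<^esub> y) = delta (inv g) 1 \<odot>\<^bsub>M\<^esub> x \<oplus>\<^bsub>M\<^esub> delta (inv g) 1 \<odot>\<^bsub>M\<^esub> y"
        by (rule M.smult_r_distr[OF delta_closed x y]) (use g in simp)
      then show "\<alpha> j (x \<oplus>\<^bsub>M\<^esub> y) g = (\<alpha> j x \<oplus>\<^bsub>?I\<^esub> \<alpha> j y) g"
        using g \<phi>add[OF j gm gm] x y by (auto simp: \<alpha>_def induced_module_simps(3))
    qed
    fix g c assume g: "g \<in> carrier G"
    show "\<alpha> j (delta g c \<odot>\<^bsub>M\<^esub> x) = delta g c \<odot>\<^bsub>?I\<^esub> \<alpha> j x"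
    proof (rule induced_module_eqI[OF mem[OF gm[OF g x]] I.smult_closed[OF delta_closed[OF g] mem[OF x]]])
      fix z assume z: "z \<in> carrier G"
      have "delta (inv z) 1 \<odot>\<^bsub>M\<^esub> (delta g c \<odot>\<^bsub>M\<^esub> x) = delta (inv z \<otimes> g) c \<odot>\<^bsub>M\<^esub> x"
        using dd[of "inv z" g x 1 c] z g x by simp
      also have "\<dots> = scale M c (delta (inv (inv g \<otimes> z)) 1 \<odot>\<^bsub>M\<^esub> x)"
        using sc(8)[of "inv z \<otimes> g" x c 1] z g x by (simp add: inv_mult_group)
      finally have "\<phi> j (delta (inv z) 1 \<odot>\<^bsub>M\<^esub> (delta g c \<odot>\<^bsub>M\<^esub> x)) = c * \<phi> j (delta (inv (inv g \<otimes> z)) 1 \<odot>\<^bsub>M\<^esub> x)"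
        using \<phi>sc[OF j gm] z g x by simp
      then show "\<alpha> j (delta g c \<odot>\<^bsub>M\<^esub> x) z = (delta g c \<odot>\<^bsub>?I\<^esub> \<alpha> j x) z"
        unfolding Ism(2)[OF g mem[OF x] z] dT[OF D.one_closed] using z g by (auto simp: \<alpha>_def)
    qed
  qed
  have vj: "v j \<in> carrier M" "a \<odot>\<^bsub>M\<^esub> v j \<in> carrier M" if "j \<in> J" for j
    using v that M.smult_closed[OF aA] by auto
  have \<beta>c: "(\<lambda>C. delta (?r C) (f (?r C) 0) \<odot>\<^bsub>M\<^esub> (a \<odot>\<^bsub>M\<^esub> v j)) \<in> left_cosets G D \<rightarrow> carrier M"
    if "j \<in> J" for j f
    using gm[OF coset_rep(1) vj(2)[OF that]] by blast
  have \<beta>: "module_hom (group_algebra G) ?I M (\<beta> j)" if j: "j \<in> J" for j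
  proof (rule module_hom_from_delta[OF Ism(1) M.semi_module_axioms])
    show "\<beta> j \<in> carrier ?I \<rightarrow> carrier M"
      unfolding \<beta>_def using M.finsum_closed[OF \<beta>c[OF j]] by blast
    let ?u = "a \<odot>\<^bsub>M\<^esub> v j"
    note u = vj(2)[OF j]
    fix f assume f: "f \<in> carrier ?I"
    show "\<beta> j (f \<oplus>\<^bsub>?I\<^esub> f') = \<beta> j f \<oplus>\<^bsub>M\<^esub> \<beta> j f'" if f': "f' \<in> carrier ?I" for f'
    proof -
      have "\<beta> j (f \<oplus>\<^bsub>?I\<^esub> f') = finsum M (\<lambda>C. delta (?r C) (f (?r C) 0) \<odot>\<^bsub>M\<^esub> ?u \<oplus>\<^bsub>M\<^esub> delta (?r C) (f' (?r C) 0) \<odot>\<^bsub>M\<^esub> ?u) (left_cosets G D)"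
        unfolding \<beta>_def
      proof (rule M.finsum_cong'[OF refl])
        show "(\<lambda>C. delta (?r C) (f (?r C) 0) \<odot>\<^bsub>M\<^esub> ?u \<oplus>\<^bsub>M\<^esub> delta (?r C) (f' (?r C) 0) \<odot>\<^bsub>M\<^esub> ?u) \<in> left_cosets G D \<rightarrow> carrier M"
          using \<beta>c[OF j] by blast
        fix C assume C: "C \<in> left_cosets G D"
        have "delta (?r C) ((f \<oplus>\<^bsub>?I\<^esub> f') (?r C) 0)
            = (\<lambda>x. delta (?r C) (f (?r C) 0) x + delta (?r C) (f' (?r C) 0) x)"
          using coset_rep(1)[OF C] by (auto simp: induced_module_simps(3) delta_def)
        then show "delta (?r C) ((f \<oplus>\<^bsub>?I\<^esub> f') (?r C) 0) \<odot>\<^bsub>M\<^esub> ?u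
            = delta (?r C) (f (?r C) 0) \<odot>\<^bsub>M\<^esub> ?u \<oplus>\<^bsub>M\<^esub> delta (?r C) (f' (?r C) 0) \<odot>\<^bsub>M\<^esub> ?u"
          using M.smult_l_distr[OF delta_closed[OF coset_rep(1)[OF C]] delta_closed[OF coset_rep(1)[OF C]] u]
          by simp
      qed
      then show ?thesis unfolding \<beta>_def using M.finsum_addf[OF \<beta>c[OF j] \<beta>c[OF j]] by simp
    qed
    fix g c assume g: "g \<in> carrier G"
    let ?F = "\<lambda>z. delta z (c * f (inv g \<otimes> z) 0) \<odot>\<^bsub>M\<^esub> ?u"
    have "\<beta> j (delta g c \<odot>\<^bsub>?I\<^esub> f) = finsum M (\<lambda>C. ?F (?r C)) (left_cosets G D)"
      unfolding \<beta>_def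
    proof (rule M.finsum_cong'[OF refl])
      show "(\<lambda>C. ?F (?r C)) \<in> left_cosets G D \<rightarrow> carrier M" using gm[OF coset_rep(1) u] by blast
      show "delta (?r C) ((delta g c \<odot>\<^bsub>?I\<^esub> f) (?r C) 0) \<odot>\<^bsub>M\<^esub> ?u = ?F (?r C)" if C: "C \<in> left_cosets G D" for C
        unfolding Ism(2)[OF g f coset_rep(1)[OF C]] dT[OF D.one_closed] ..
    qed
    also have "\<dots> = finsum M (\<lambda>C. ?F (g \<otimes> ?r C)) (left_cosets G D)"
    proof (rule finsum_coset_shift[OF sD g M.abelian_group_axioms, symmetric])
      show "?F \<in> carrier G \<rightarrow> carrier M" using gm[OF _ u] by blast
      fix z d assume z: "z \<in> carrier G" and d: "d \<in> D"
      have dc: "d \<in> carrier G" using d D.subset by blast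
      have "f (inv g \<otimes> (z \<otimes> d)) = delta (inv d) 1 \<odot>\<^bsub>?T\<^esub> f (inv g \<otimes> z)"
        using induced_module_mem(2)[OF f, of "inv g \<otimes> z" d] g z dc d by (simp add: m_assoc)
      also have "\<dots> = f (inv g \<otimes> z)" using dT[of "inv d" 1] d by simp
      finally have 1: "f (inv g \<otimes> (z \<otimes> d)) = f (inv g \<otimes> z)" .
      have "delta (z \<otimes> d) s \<odot>\<^bsub>M\<^esub> ?u = delta z s \<odot>\<^bsub>M\<^esub> ?u" for s
        using dd[OF z dc u, of s 1] triv[OF d u] by simp
      then show "?F (z \<otimes> d) = ?F z" unfolding 1 .
    qed
    also have "\<dots> = finsum M (\<lambda>C. delta g c \<odot>\<^bsub>M\<^esub> (delta (?r C) (f (?r C) 0) \<odot>\<^bsub>M\<^esub> ?u)) (left_cosets G D)"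
    proof (rule M.finsum_cong'[OF refl])
      show "(\<lambda>C. delta g c \<odot>\<^bsub>M\<^esub> (delta (?r C) (f (?r C) 0) \<odot>\<^bsub>M\<^esub> ?u)) \<in> left_cosets G D \<rightarrow> carrier M"
        using gm[OF g gm[OF coset_rep(1) u]] by blast
      show "?F (g \<otimes> ?r C) = delta g c \<odot>\<^bsub>M\<^esub> (delta (?r C) (f (?r C) 0) \<odot>\<^bsub>M\<^esub> ?u)" if C: "C \<in> left_cosets G D" for C
        using dd[OF g coset_rep(1)[OF C] u] g coset_rep(1)[OF C] by simp
    qed
    also have "\<dots> = delta g c \<odot>\<^bsub>M\<^esub> \<beta> j f"
      unfolding \<beta>_def by (rule M.finsum_smult[OF delta_closed[OF g] finite_left_cosets \<beta>c[OF j], symmetric])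
    finally show "\<beta> j (delta g c \<odot>\<^bsub>?I\<^esub> f) = delta g c \<odot>\<^bsub>M\<^esub> \<beta> j f" .
  qed
  obtain m0 where m0: "m0 \<in> carrier M" "m0 \<noteq> \<zero>\<^bsub>M\<^esub>"
    using M(1) M.zero_closed unfolding simple_module_def by blast
  have "\<exists>j\<in>J. \<beta> j (\<alpha> j m0) \<noteq> \<zero>\<^bsub>M\<^esub>"
  proof (rule ccontr)
    assume "\<not> (\<exists>j\<in>J. \<beta> j (\<alpha> j m0) \<noteq> \<zero>\<^bsub>M\<^esub>)"
    then have 0: "\<beta> j (\<alpha> j m0) = \<zero>\<^bsub>M\<^esub>" if "j \<in> J" for j using that by blast
    let ?X = "\<lambda>C j. delta (?r C) (\<phi> j (delta (inv (?r C)) 1 \<odot>\<^bsub>M\<^esub> m0)) \<odot>\<^bsub>M\<^esub> (a \<odot>\<^bsub>M\<^esub> v j)"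
    have Xc: "?X C j \<in> carrier M" if "C \<in> left_cosets G D" "j \<in> J" for C j
      using gm[OF coset_rep(1)[OF that(1)] vj(2)[OF that(2)]] .
    have \<beta>\<alpha>: "\<beta> j (\<alpha> j m0) = finsum M (\<lambda>C. ?X C j) (left_cosets G D)" if j: "j \<in> J" for j
      unfolding \<beta>_def by (rule M.finsum_cong'[OF refl]) (use Xc j coset_rep(1) in \<open>auto simp: \<alpha>_def\<close>)
    have inner: "delta (?r C) 1 \<odot>\<^bsub>M\<^esub> (a \<odot>\<^bsub>M\<^esub> (delta (inv (?r C)) 1 \<odot>\<^bsub>M\<^esub> m0)) = finsum M (\<lambda>j. ?X C j) J"
      if C: "C \<in> left_cosets G D" for C
    proof -
      note r = coset_rep(1)[OF C]
      define m1 where "m1 = delta (inv (?r C)) 1 \<odot>\<^bsub>M\<^esub> m0"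
      have m1: "m1 \<in> carrier M" unfolding m1_def by (rule gm) (use r m0 in auto)
      have c1: "(\<lambda>j. scale M (\<phi> j m1) (v j)) \<in> J \<rightarrow> carrier M" using sc(1) vj(1) by blast
      have c2: "(\<lambda>j. a \<odot>\<^bsub>M\<^esub> scale M (\<phi> j m1) (v j)) \<in> J \<rightarrow> carrier M" using c1 M.smult_closed[OF aA] by blast
      have "a \<odot>\<^bsub>M\<^esub> m1 = a \<odot>\<^bsub>M\<^esub> finsum M (\<lambda>j. scale M (\<phi> j m1) (v j)) J"
        using basis[OF m1] by (rule arg_cong)
      also have "\<dots> = finsum M (\<lambda>j. a \<odot>\<^bsub>M\<^esub> scale M (\<phi> j m1) (v j)) J" by (rule M.finsum_smult[OF aA J c1])
      finally have "delta (?r C) 1 \<odot>\<^bsub>M\<^esub> (a \<odot>\<^bsub>M\<^esub> m1)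
          = finsum M (\<lambda>j. delta (?r C) 1 \<odot>\<^bsub>M\<^esub> (a \<odot>\<^bsub>M\<^esub> scale M (\<phi> j m1) (v j))) J"
        using M.finsum_smult[OF delta_closed[OF r] J c2] by simp
      also have "\<dots> = finsum M (\<lambda>j. ?X C j) J"
      proof (rule M.finsum_cong'[OF refl])
        show "?X C \<in> J \<rightarrow> carrier M" using Xc[OF C] by blast
        fix j assume j: "j \<in> J"
        have "a \<star> delta \<one> (\<phi> j m1) = delta \<one> (\<phi> j m1) \<star> a"
        proof (rule group_algebra_eqI)
          fix x assume "x \<in> carrier G"
          then show "(a \<star> delta \<one> (\<phi> j m1)) x = (delta \<one> (\<phi> j m1) \<star> a) x"
            by (simp add: delta_mult mult_delta mult.commute)
        qed (rule group_algebra_mult_closed)+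
        then have "a \<odot>\<^bsub>M\<^esub> scale M (\<phi> j m1) (v j) = scale M (\<phi> j m1) (a \<odot>\<^bsub>M\<^esub> v j)"
          using M.smult_assoc[OF aA delta_closed[OF one_closed] vj(1)[OF j], of "\<phi> j m1"]
            M.smult_assoc[OF delta_closed[OF one_closed] aA vj(1)[OF j], of "\<phi> j m1"] by simp
        then show "delta (?r C) 1 \<odot>\<^bsub>M\<^esub> (a \<odot>\<^bsub>M\<^esub> scale M (\<phi> j m1) (v j)) = ?X C j"
          using sc(9)[OF r vj(2)[OF j], of 1 "\<phi> j m1"] by (simp add: m1_def)
      qed
      finally show ?thesis by (simp add: m1_def)
    qed
    \<comment> \<open>A functional carries the double sum over cosets and basis indices into
      \<open>k\<close>, where the order of summation can be exchanged.\<close>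
    have "\<phi> i m0 = 0" if i: "i \<in> J" for i
    proof -
      note \<phi>f = functional_zero_finsum[OF M.abelian_group_axioms \<phi>add[OF i]]
      have "\<phi> i m0 = \<phi> i (finsum M (\<lambda>C. finsum M (\<lambda>j. ?X C j) J) (left_cosets G D))"
      proof (rule arg_cong[of _ _ "\<phi> i"])
        have "m0 = finsum M (\<lambda>C. delta (?r C) 1 \<odot>\<^bsub>M\<^esub> (a \<odot>\<^bsub>M\<^esub> (delta (inv (?r C)) 1 \<odot>\<^bsub>M\<^esub> m0))) (left_cosets G D)"
          by (rule trace[OF m0(1)])
        also have "\<dots> = finsum M (\<lambda>C. finsum M (\<lambda>j. ?X C j) J) (left_cosets G D)"
          by (rule M.finsum_cong'[OF refl]) (use inner M.finsum_closed Xc in auto)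
        finally show "m0 = \<dots>" .
      qed
      also have "\<dots> = (\<Sum>C\<in>left_cosets G D. \<phi> i (finsum M (\<lambda>j. ?X C j) J))"
        by (rule \<phi>f(2)) (use M.finsum_closed Xc in auto)
      also have "\<dots> = (\<Sum>C\<in>left_cosets G D. \<Sum>j\<in>J. \<phi> i (?X C j))"
        by (rule sum.cong[OF refl], rule \<phi>f(2)) (use J Xc in auto)
      also have "\<dots> = (\<Sum>j\<in>J. \<Sum>C\<in>left_cosets G D. \<phi> i (?X C j))" by (rule sum.swap)
      also have "\<dots> = (\<Sum>j\<in>J. \<phi> i (finsum M (\<lambda>C. ?X C j) (left_cosets G D)))"
        by (rule sum.cong[OF refl], rule \<phi>f(2)[symmetric]) (use Xc in auto)
      also have "\<dots> = (\<Sum>j\<in>J. \<phi> i \<zero>\<^bsub>M\<^esub>)"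
        by (rule sum.cong[OF refl]) (use \<beta>\<alpha> 0 in auto)
      also have "\<dots> = 0" using \<phi>f(1) by simp
      finally show ?thesis .
    qed
    then have "finsum M (\<lambda>j. scale M (\<phi> j m0) (v j)) J = finsum M (\<lambda>j. \<zero>\<^bsub>M\<^esub>) J"
      by (intro M.finsum_cong'[OF refl]) (use sc(6) vj(1) in auto)
    then have "m0 = \<zero>\<^bsub>M\<^esub>" using basis[OF m0(1)] M.finsum_zero by metis
    with m0(2) show False by simp
  qed
  then obtain j where j: "j \<in> J" "\<beta> j (\<alpha> j m0) \<noteq> \<zero>\<^bsub>M\<^esub>" by blast
  have "module_hom (group_algebra G) M M (\<lambda>m. \<beta> j (\<alpha> j m))"
    using module_homD[OF \<alpha>[OF j(1)]] module_homD[OF \<beta>[OF j(1)]] by (auto simp: module_hom_def)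
  then have "bij_betw (\<lambda>m. \<beta> j (\<alpha> j m)) (carrier M) (carrier M)"
    by (rule simple_module_endomorphism_bij[where f = "\<lambda>m. \<beta> j (\<alpha> j m)", OF M(1) _ m0(1) j(2)])
  then show ?thesis
    by (intro iso_direct_summandI[OF M.abelian_group_axioms I.abelian_group_axioms \<alpha>[OF j(1)] \<beta>[OF j(1)]])
      (rule M.smult_zero_right M.smult_closed I.smult_closed; assumption)+
qed

end

section \<open>Coset components, minimality of the vertex and uniqueness of the source\<close>

definition coset_part :: "('g, 'x) monoid_scheme \<Rightarrow> ('k, 'm, 'y) module_scheme \<Rightarrow> ('g \<Rightarrow> 'm) \<Rightarrow> 'g set \<Rightarrow> 'g \<Rightarrow> 'm" where
  "coset_part G L f C = (\<lambda>x\<in>carrier G. if x \<in> C then f x else \<zero>\<^bsub>L\<^esub>)"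

text \<open>Simple modules will be found as left ideals of \<open>kG\<close>, whose elements are
  functions on the group; this moves them along an injection into the type of sequences required by
  \<open>kmod\<close>.\<close>

definition transport_module :: "('m \<Rightarrow> 'n) \<Rightarrow> ('a, 'm, 'y) module_scheme \<Rightarrow> ('a, 'n) module" where
  "transport_module f M = \<lparr>carrier = f ` carrier M, monoid.mult = undefined, monoid.one = undefined,
     ring.zero = f \<zero>\<^bsub>M\<^esub>,
     ring.add = (\<lambda>x y. f (the_inv_into (carrier M) f x \<oplus>\<^bsub>M\<^esub> the_inv_into (carrier M) f y)),
     module.smult = (\<lambda>a x. f (a \<odot>\<^bsub>M\<^esub> the_inv_into (carrier M) f x))\<rparr>"

lemma transport_module_simps:
  assumes "inj_on f (carrier M)"
  shows "carrier (transport_module f M) = f ` carrier M" "\<zero>\<^bsub>transport_module f M\<^esub> = f \<zero>\<^bsub>M\<^esub>"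
    "x \<in> carrier M \<Longrightarrow> y \<in> carrier M \<Longrightarrow> f x \<oplus>\<^bsub>transport_module f M\<^esub> f y = f (x \<oplus>\<^bsub>M\<^esub> y)"
    "x \<in> carrier M \<Longrightarrow> a \<odot>\<^bsub>transport_module f M\<^esub> f x = f (a \<odot>\<^bsub>M\<^esub> x)"
  using assms by (simp_all add: transport_module_def the_inv_into_f_f)

lemma left_module_transport_module:
  assumes M: "left_module R M" and f: "inj_on f (carrier M)"
  shows "left_module R (transport_module f M)"
proof -
  interpret M: left_module R M by fact
  note t = transport_module_simps[OF f]
  show ?thesis
    unfolding left_module_def
  proof (intro conjI left_module_axioms.intro)
    show "ring R" by (rule M.R.ring_axioms)
    show "abelian_group (transport_module f M)"
    proof (rule abelian_groupI)
      fix x assume "x \<in> carrier (transport_module f M)"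
      then obtain x' where x': "x' \<in> carrier M" "x = f x'" by (auto simp: t)
      then show "\<exists>y\<in>carrier (transport_module f M). y \<oplus>\<^bsub>transport_module f M\<^esub> x = \<zero>\<^bsub>transport_module f M\<^esub>"
        by (intro bexI[of _ "f (\<ominus>\<^bsub>M\<^esub> x')"]) (auto simp: t M.l_neg)
    qed (auto simp: t M.a_ac)
  qed (auto simp: t M.smult_closed M.smult_l_distr M.smult_r_distr M.smult_assoc M.smult_one)
qed

lemma simple_module_transport_module:
  assumes M: "simple_module R M" and f: "inj_on f (carrier M)"
  shows "simple_module R (transport_module f M)"
proof -
  have lM: "left_module R M" using M by (simp add: simple_module_def)
  interpret M: left_module R M by fact
  note t = transport_module_simps[OF f]
  let ?N = "transport_module f M"
  have lN: "left_module R ?N" by (rule left_module_transport_module[OF lM f])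
  interpret N: left_module R ?N by fact
  show ?thesis
    unfolding simple_module_def
  proof (intro conjI allI impI lN)
    obtain m where m: "m \<in> carrier M" "m \<noteq> \<zero>\<^bsub>M\<^esub>"
      using M M.zero_closed unfolding simple_module_def by blast
    then have "f m \<noteq> f \<zero>\<^bsub>M\<^esub>" using f by (auto dest: inj_onD)
    then show "carrier ?N \<noteq> {\<zero>\<^bsub>?N\<^esub>}" using m by (auto simp: t)
    fix U assume U: "submodule U R ?N"
    interpret U: submodule U R ?N by fact
    have Us: "U \<subseteq> f ` carrier M" using U.subset by (simp add: t)
    define V where "V = {x \<in> carrier M. f x \<in> U}"
    have UV: "U = f ` V" using Us by (auto simp: V_def)
    have "submodule V R M"
    proof (intro submodule.intro submodule_axioms.intro)
      show "subgroup V (add_monoid M)"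
      proof (rule M.add.subgroupI)
        show "V \<subseteq> carrier M" by (auto simp: V_def)
        show "V \<noteq> {}" using U.one_closed by (auto simp: V_def t)
        fix x assume x: "x \<in> V"
        have xc: "x \<in> carrier M" "f x \<in> U" using x by (auto simp: V_def)
        have "\<ominus>\<^bsub>?N\<^esub> f x = f (\<ominus>\<^bsub>M\<^esub> x)"
          by (rule N.minus_equality) (use xc in \<open>auto simp: t M.l_neg\<close>)
        moreover have "\<ominus>\<^bsub>?N\<^esub> f x \<in> U" using U.m_inv_closed[of "f x"] xc by (simp add: a_inv_def)
        ultimately show "\<ominus>\<^bsub>M\<^esub> x \<in> V" using xc by (simp add: V_def)
        fix y assume "y \<in> V"
        then have yc: "y \<in> carrier M" "f y \<in> U" by (auto simp: V_def)
        have "f x \<oplus>\<^bsub>?N\<^esub> f y \<in> U" using U.m_closed xc yc by simp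
        then show "x \<oplus>\<^bsub>M\<^esub> y \<in> V" using xc yc by (simp add: V_def t)
      qed
      fix a x assume a: "a \<in> carrier R" and "x \<in> V"
      then have xc: "x \<in> carrier M" "f x \<in> U" by (auto simp: V_def)
      have "a \<odot>\<^bsub>?N\<^esub> f x \<in> U" by (rule U.smult_closed[OF a xc(2)])
      then show "a \<odot>\<^bsub>M\<^esub> x \<in> V" using xc a M.smult_closed by (simp add: V_def t)
    qed
    then have "V = {\<zero>\<^bsub>M\<^esub>} \<or> V = carrier M" using M unfolding simple_module_def by blast
    then show "U = {\<zero>\<^bsub>?N\<^esub>} \<or> U = carrier ?N" unfolding UV by (auto simp: t)
  qed
qed

context finite_group
begin

text \<open>The induced module is the direct sum of copies of \<open>L\<close> indexed by the left
  cosets, and the group permutes these copies; \<open>coset_part G L f C\<close> is the component of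
  \<open>f\<close> at \<open>C\<close>.\<close>

lemma coset_part:
  fixes L :: "('a \<Rightarrow> 'k::field, 'm, 'y) module_scheme"
  assumes H: "subgroup H G" and L: "left_module (group_algebra (G\<lparr>carrier := H\<rparr>)) L"
    and f: "f \<in> carrier (induced_module G H L)"
  shows "C \<in> left_cosets G H \<Longrightarrow> coset_part G L f C \<in> carrier (induced_module G H L)"
    and "f = finsum (induced_module G H L) (coset_part G L f) (left_cosets G H)"
    and "g \<in> carrier G \<Longrightarrow> C \<in> left_cosets G H \<Longrightarrow> delta g 1 \<odot>\<^bsub>induced_module G H L\<^esub> coset_part G L f C
      = coset_part G L (delta g 1 \<odot>\<^bsub>induced_module G H L\<^esub> f) (g <# C)"
proof -
  interpret Hs: subgroup H G by fact
  interpret L: left_module "group_algebra (G\<lparr>carrier := H\<rparr>)" L by fact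
  let ?I = "induced_module G H L"
  note Ism = semi_module_induced_module[OF H L]
  interpret I: semi_module "group_algebra G" ?I by (rule Ism(1))
  note mem = induced_module_mem
  interpret Hg: finite_group "G\<lparr>carrier := H\<rparr>" by (rule subgroup_finite_group[OF H])
  have dH: "delta h c \<in> carrier (group_algebra (G\<lparr>carrier := H\<rparr>))" if "h \<in> H" for h and c :: 'k
    using Hg.delta_closed[of h c] that by simp
  have one1: "delta \<one> 1 \<odot>\<^bsub>L\<^esub> v = v" if "v \<in> carrier L" for v using L.smult_one[OF that] by simp
  have mem_coset: "x \<in> y <# H \<longleftrightarrow> inv y \<otimes> x \<in> H" if "x \<in> carrier G" "y \<in> carrier G" for x y
  proof -
    have "x \<in> y <# H \<longleftrightarrow> x <# H = y <# H"
    proof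
      assume "x \<in> y <# H"
      then show "x <# H = y <# H" using l_repr_independence that H by metis
    next
      assume "x <# H = y <# H"
      moreover have "x \<in> x <# H" using that Hs.one_closed unfolding l_coset_def by force
      ultimately show "x \<in> y <# H" by simp
    qed
    then show ?thesis using lcoset_eq_iff[OF H that(2,1)] by auto
  qed
  have cp: "coset_part G L f C \<in> carrier ?I"
    if C: "C \<in> left_cosets G H" and f: "f \<in> carrier ?I" for f C
    unfolding induced_module_simps(1)
  proof (intro CollectI conjI ballI)
    show "coset_part G L f C \<in> carrier G \<rightarrow>\<^sub>E carrier L" using mem(1)[OF f] by (auto simp: coset_part_def)
    fix x h assume x: "x \<in> carrier G" and h: "h \<in> H"
    have hc: "h \<in> carrier G" using h Hs.subset by blast
    obtain y where y: "y \<in> carrier G" "C = y <# H" using C by (auto simp: left_cosets_def)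
    have "x \<otimes> h \<in> C \<longleftrightarrow> x \<in> C"
    proof -
      have "inv y \<otimes> x \<otimes> h \<in> H \<longleftrightarrow> inv y \<otimes> x \<in> H"
      proof
        assume "inv y \<otimes> x \<otimes> h \<in> H"
        then have "inv y \<otimes> x \<otimes> h \<otimes> inv h \<in> H" using h by blast
        then show "inv y \<otimes> x \<in> H" using x y hc by (simp add: m_assoc)
      qed (use h in blast)
      then show ?thesis using mem_coset x y hc by (simp add: m_assoc)
    qed
    then show "coset_part G L f C (x \<otimes> h) = delta (inv h) 1 \<odot>\<^bsub>L\<^esub> coset_part G L f C x"
      using x hc h mem(2)[OF f x h] L.smult_zero_right[OF dH[OF Hs.m_inv_closed[OF h]]]
      by (simp add: coset_part_def)
  qed
  show "coset_part G L f C \<in> carrier ?I" if "C \<in> left_cosets G H"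
    by (rule cp[OF that f])
  show "f = finsum ?I (coset_part G L f) (left_cosets G H)"
  proof (rule induced_module_eqI[OF f])
    have pc: "coset_part G L f \<in> left_cosets G H \<rightarrow> carrier ?I" using cp[OF _ f] by blast
    show "finsum ?I (coset_part G L f) (left_cosets G H) \<in> carrier ?I" by (rule I.finsum_closed[OF pc])
    fix x assume x: "x \<in> carrier G"
    have xC: "x <# H \<in> left_cosets G H" using x by (auto simp: left_cosets_def)
    have "finsum ?I (coset_part G L f) (left_cosets G H) x
        = finsum L (\<lambda>C. coset_part G L f C x) (left_cosets G H)"
      by (rule additive_finsum[of ?I L "\<lambda>F. F x", OF I.abelian_group_axioms L.abelian_group_axioms])
        (use mem(1) x pc in \<open>auto simp: induced_module_simps(3)\<close>)
    also have "\<dots> = finsum L (\<lambda>C. if x <# H = C then f x else \<zero>\<^bsub>L\<^esub>) (left_cosets G H)"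
    proof (rule L.finsum_cong'[OF refl])
      fix C assume C: "C \<in> left_cosets G H"
      obtain y where y: "y \<in> carrier G" "C = y <# H" using C by (auto simp: left_cosets_def)
      have "x \<in> C \<longleftrightarrow> x <# H = C" using mem_coset[OF x y(1)] lcoset_eq_iff[OF H y(1) x] y(2) by auto
      then show "coset_part G L f C x = (if x <# H = C then f x else \<zero>\<^bsub>L\<^esub>)"
        using x by (simp add: coset_part_def)
    qed (use mem(1)[OF f x] in auto)
    also have "\<dots> = f x"
      by (rule L.finsum_singleton[OF xC finite_left_cosets]) (use mem(1)[OF f x] in auto)
    finally show "f x = finsum ?I (coset_part G L f) (left_cosets G H) x" ..
  qed
  show "delta g 1 \<odot>\<^bsub>?I\<^esub> coset_part G L f C = coset_part G L (delta g 1 \<odot>\<^bsub>?I\<^esub> f) (g <# C)"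
    if g: "g \<in> carrier G" and C: "C \<in> left_cosets G H"
  proof (rule induced_module_eqI)
    show "delta g 1 \<odot>\<^bsub>?I\<^esub> coset_part G L f C \<in> carrier ?I"
      by (rule I.smult_closed[OF delta_closed[OF g] cp[OF C f]])
    have gC: "g <# C \<in> left_cosets G H" using l_coset_left_cosets(1)[OF H g] C by blast
    show "coset_part G L (delta g 1 \<odot>\<^bsub>?I\<^esub> f) (g <# C) \<in> carrier ?I"
      by (rule cp[OF gC I.smult_closed[OF delta_closed[OF g] f]])
    fix x assume x: "x \<in> carrier G"
    have Cs: "C \<subseteq> carrier G" using C l_coset_subset_G[OF Hs.subset] by (auto simp: left_cosets_def)
    have "inv g \<otimes> x \<in> C \<longleftrightarrow> x \<in> g <# C"
    proof
      assume "inv g \<otimes> x \<in> C"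
      then show "x \<in> g <# C" unfolding l_coset_def using g x by (intro UN_I[of "inv g \<otimes> x"]) auto
    next
      assume "x \<in> g <# C"
      then obtain c where "c \<in> C" "x = g \<otimes> c" unfolding l_coset_def by blast
      then show "inv g \<otimes> x \<in> C" using g Cs by (auto simp: subset_iff)
    qed
    then show "(delta g 1 \<odot>\<^bsub>?I\<^esub> coset_part G L f C) x = coset_part G L (delta g 1 \<odot>\<^bsub>?I\<^esub> f) (g <# C) x"
      using Ism(2)[OF g cp[OF C f] x, of 1] Ism(2)[OF g f x, of 1] g x
        one1 mem(1)[OF f, of "inv g \<otimes> x"] by (auto simp: coset_part_def)
  qed
qed

text \<open>Suppose that \<open>g (f x) = x\<close> through a module induced from \<open>R\<close>.
  \<open>D\<close> fixes \<open>f m\<close> and so permutes its coset components, while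
  \<open>g\<close> does not distinguish components in one orbit because \<open>D\<close> acts
  trivially on \<open>M\<close>. Thus \<open>\<phi> j m\<close> is the sum of a
  \<open>D\<close>-invariant function over the cosets of \<open>R\<close>, none of which is fixed by
  \<open>D\<close>, and so it is zero.\<close>

lemma not_relatively_projective:
  fixes M :: "('a, 'k::field) kmod"
  assumes M: "simple_module (group_algebra G) M"
    and D: "subgroup D G" "card D = p ^ n" and p: "Factorial_Ring.prime p" "CHAR('k) = p"
    and triv: "\<And>d m. d \<in> D \<Longrightarrow> m \<in> carrier M \<Longrightarrow> delta d 1 \<odot>\<^bsub>M\<^esub> m = m"
    and R: "subgroup R G" "R \<subset> D"
  shows "\<not> relatively_projective G R M"
proof
  assume "relatively_projective G R M"
  then obtain L :: "('a, 'k) kmod" where L: "left_module (group_algebra (G\<lparr>carrier := R\<rparr>)) L"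
    and sm: "iso_direct_summand (group_algebra G) M (induced_module G R L)"
    unfolding relatively_projective_def fg_module_def by blast
  have lM: "left_module (group_algebra G) M" using M by (simp add: simple_module_def)
  interpret M: left_module "group_algebra G" M by fact
  interpret D: subgroup D G by fact
  let ?I = "induced_module G R L"
  note Ism = semi_module_induced_module[OF R(1) L]
  interpret I: semi_module "group_algebra G" ?I by (rule Ism(1))
  obtain f g where f: "module_hom (group_algebra G) M ?I f" and g: "module_hom (group_algebra G) ?I M g"
    and gf: "\<And>x. x \<in> carrier M \<Longrightarrow> g (f x) = x"
    by (rule iso_direct_summandE[OF I.abelian_group_axioms M.abelian_group_axioms I.smult_r_distr M.smult_closed sm])
      (assumption | blast)+
  note fD = module_homD[OF f] and gD = module_homD[OF g]
  obtain J :: "'a set" and v \<phi> where J: "finite J" and v: "v \<in> J \<rightarrow> carrier M"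
    and \<phi>add: "\<And>j x y. j \<in> J \<Longrightarrow> x \<in> carrier M \<Longrightarrow> y \<in> carrier M \<Longrightarrow> \<phi> j (x \<oplus>\<^bsub>M\<^esub> y) = (\<phi> j x + \<phi> j y :: 'k)"
    and \<phi>sc: "\<And>j x c. j \<in> J \<Longrightarrow> x \<in> carrier M \<Longrightarrow> \<phi> j (scale M c x) = c * \<phi> j x"
    and basis: "\<And>m. m \<in> carrier M \<Longrightarrow> m = finsum M (\<lambda>j. scale M (\<phi> j m) (v j)) J"
    by (rule simple_module_dual_basis[OF M(1)]) blast
  obtain m where m: "m \<in> carrier M" "m \<noteq> \<zero>\<^bsub>M\<^esub>"
    using M M.zero_closed unfolding simple_module_def by blast
  define F where "F = f m"
  have F: "F \<in> carrier ?I" unfolding F_def by (rule fD(1)[OF m(1)])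
  let ?P = "coset_part G L F"
  note cp = coset_part[OF R(1) L F]
  have DF: "delta d 1 \<odot>\<^bsub>?I\<^esub> F = F" if "d \<in> D" for d
    using fD(3)[OF delta_closed m(1), of d 1] triv[OF that m(1)] that D.subset by (auto simp: F_def)
  have act: "g (?P (d <# C)) = g (?P C)" if d: "d \<in> D" and C: "C \<in> left_cosets G R" for d C
  proof -
    have dc: "d \<in> carrier G" using d D.subset by blast
    have "?P (d <# C) = delta d 1 \<odot>\<^bsub>?I\<^esub> ?P C" using cp(3)[OF dc C] DF[OF d] by simp
    then show ?thesis
      using gD(3)[OF delta_closed[OF dc] cp(1)[OF C], of 1] triv[OF d gD(1)[OF cp(1)[OF C]]] by simp
  qed
  have "\<phi> j m = 0" if j: "j \<in> J" for j
  proof -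
    note \<phi>f = functional_zero_finsum[where \<phi> = "\<phi> j", OF M.abelian_group_axioms \<phi>add[OF j]]
    have Pc: "?P \<in> left_cosets G R \<rightarrow> carrier ?I" using cp(1) by blast
    have gF: "g \<in> carrier ?I \<rightarrow> carrier M" using gD(1) by blast
    have "m = g (finsum ?I ?P (left_cosets G R))" using gf[OF m(1)] cp(2) by (simp add: F_def)
    also have "\<dots> = finsum M (\<lambda>C. g (?P C)) (left_cosets G R)"
      by (rule additive_finsum[OF I.abelian_group_axioms M.abelian_group_axioms gF gD(2) finite_left_cosets Pc])
    finally have "\<phi> j m = \<phi> j (finsum M (\<lambda>C. g (?P C)) (left_cosets G R))" by simp
    also have "\<dots> = (\<Sum>C\<in>left_cosets G R. \<phi> j (g (?P C)))"
      by (rule \<phi>f(2)) (use gD(1) cp(1) in auto)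
    also have "\<dots> = (\<Sum>C | C \<in> left_cosets G R \<and> (\<forall>d\<in>carrier (G\<lparr>carrier := D\<rparr>). d <# C = C). \<phi> j (g (?P C)))"
    proof (rule sum_fixed_points[OF subgroup_imp_group[OF D(1)] _ p finite_left_cosets, of n])
      show "card (carrier (G\<lparr>carrier := D\<rparr>)) = p ^ n" using D(2) by simp
      show "\<one>\<^bsub>G\<lparr>carrier := D\<rparr>\<^esub> <# C = C" if "C \<in> left_cosets G R" for C
        using that l_coset_mult[OF R(1), of \<one>] by (auto simp: left_cosets_def)
      fix d C assume d: "d \<in> carrier (G\<lparr>carrier := D\<rparr>)" and C: "C \<in> left_cosets G R"
      have dc: "d \<in> carrier G" using d D.subset by auto
      show "d <# C \<in> left_cosets G R" using l_coset_left_cosets(1)[OF R(1) dc] C by blast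
      show "\<phi> j (g (?P (d <# C))) = \<phi> j (g (?P C))" using act d C by simp
      show "(d \<otimes>\<^bsub>G\<lparr>carrier := D\<rparr>\<^esub> e) <# C = d <# (e <# C)" if "e \<in> carrier (G\<lparr>carrier := D\<rparr>)" for e
      proof -
        have "e \<in> carrier G" using that D.subset by auto
        then show ?thesis using C dc by (auto simp: left_cosets_def l_coset_mult[OF R(1)] m_assoc)
      qed
    qed
    \<comment> \<open>A fixed coset of \<open>y\<close> would give a conjugate of \<open>D\<close>
      inside the smaller group \<open>R\<close>.\<close>
    also have "{C. C \<in> left_cosets G R \<and> (\<forall>d\<in>carrier (G\<lparr>carrier := D\<rparr>). d <# C = C)} = {}"
    proof (rule ccontr)
      assume "\<not> ?thesis"
      then obtain y where y: "y \<in> carrier G" "\<And>d. d \<in> D \<Longrightarrow> d <# (y <# R) = y <# R"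
        by (auto simp: left_cosets_def)
      have "inv y \<otimes> d \<otimes> inv (inv y) \<in> R" if d: "d \<in> D" for d
      proof -
        have dc: "d \<in> carrier G" using d D.subset by blast
        have "y <# R = (d \<otimes> y) <# R" using y(2)[OF d] l_coset_mult[OF R(1) dc y(1)] by simp
        then show ?thesis using lcoset_eq_iff[OF R(1) y(1), of "d \<otimes> y"] dc y(1) by (simp add: m_assoc)
      qed
      then have "(\<lambda>d. inv y \<otimes> d \<otimes> inv (inv y)) ` D \<subseteq> R" by blast
      then have "card ((\<lambda>d. inv y \<otimes> d \<otimes> inv (inv y)) ` D) \<le> card R"
        by (rule card_mono[OF finite_subgroup[OF R(1)]])
      moreover have "card ((\<lambda>d. inv y \<otimes> d \<otimes> inv (inv y)) ` D) = card D"
        by (rule card_conj[OF D.subset]) (use y in simp)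
      ultimately have "card D \<le> card R" by simp
      moreover have "card R < card D" by (rule psubset_card_mono[OF finite_subgroup[OF D(1)] R(2)])
      ultimately show False by simp
    qed
    finally show ?thesis by simp
  qed
  then have "finsum M (\<lambda>j. scale M (\<phi> j m) (v j)) J = finsum M (\<lambda>j. \<zero>\<^bsub>M\<^esub>) J"
    by (intro M.finsum_cong'[OF refl]) (use scale_simps(6)[OF lM] v in auto)
  then have "m = \<zero>\<^bsub>M\<^esub>" using basis[OF m(1)] M.finsum_zero by metis
  with m(2) show False by simp
qed

text \<open>The fixed vector \<open>w\<close> and the invariant functional \<open>\<phi>\<close>
  with \<open>\<phi> w \<noteq> 0\<close> split \<open>W\<close> into the line of \<open>w\<close>
  and the kernel of \<open>\<phi>\<close>. Indecomposability kills the kernel, and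
  \<open>\<phi>\<close> itself becomes the isomorphism.\<close>

lemma indecomposable_trivial_module_iso:
  fixes W :: "('a \<Rightarrow> 'k::field, 'm, 'y) module_scheme" and \<phi> :: "'m \<Rightarrow> 'k"
  assumes W: "indecomposable_module (group_algebra G) W"
    and w: "w \<in> carrier W" "\<And>g. g \<in> carrier G \<Longrightarrow> delta g 1 \<odot>\<^bsub>W\<^esub> w = w" "\<phi> w \<noteq> 0"
    and add: "\<And>x y. x \<in> carrier W \<Longrightarrow> y \<in> carrier W \<Longrightarrow> \<phi> (x \<oplus>\<^bsub>W\<^esub> y) = \<phi> x + \<phi> y"
    and sc: "\<And>c x. x \<in> carrier W \<Longrightarrow> \<phi> (scale W c x) = c * \<phi> x"
    and inv: "\<And>g x. g \<in> carrier G \<Longrightarrow> x \<in> carrier W \<Longrightarrow> \<phi> (delta g 1 \<odot>\<^bsub>W\<^esub> x) = \<phi> x"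
  shows "module_iso (group_algebra G) W (trivial_module G)"
proof -
  have lW: "left_module (group_algebra G) W" using W by (simp add: indecomposable_module_def)
  interpret W: left_module "group_algebra G" W by fact
  note ss = scale_simps[OF lW]
  note \<phi>0 = functional_zero_finsum(1)[OF W.abelian_group_axioms add]
  note \<phi>sum = functional_zero_finsum(2)[OF W.abelian_group_axioms add]
  have gm: "delta g c \<odot>\<^bsub>W\<^esub> x \<in> carrier W" if "g \<in> carrier G" "x \<in> carrier W" for g c x
    by (rule W.smult_closed[OF delta_closed[OF that(1)] that(2)])
  have split: "delta g c \<odot>\<^bsub>W\<^esub> x = scale W c (delta g 1 \<odot>\<^bsub>W\<^esub> x)" if "g \<in> carrier G" "x \<in> carrier W" for g c x
    using ss(8)[OF that, of c 1] by simp
  have \<phi>g: "\<phi> (delta g c \<odot>\<^bsub>W\<^esub> x) = c * \<phi> x" if "g \<in> carrier G" "x \<in> carrier W" for g c x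
    using split[OF that, of c] sc[OF gm[OF that], of c 1] inv[OF that] by simp
  define U where "U = range (\<lambda>c. scale W c w)"
  define V where "V = {x \<in> carrier W. \<phi> x = 0}"
  have U: "submodule U (group_algebra G) W"
  proof (rule submodule_from_delta[OF lW])
    show "U \<subseteq> carrier W" using ss(1)[OF w(1)] by (auto simp: U_def)
    show "\<zero>\<^bsub>W\<^esub> \<in> U" unfolding U_def by (rule range_eqI[of _ _ 0]) (simp add: ss(6)[OF w(1)])
    fix x assume "x \<in> U"
    then obtain c where c: "x = scale W c w" by (auto simp: U_def)
    show "x \<oplus>\<^bsub>W\<^esub> y \<in> U" if y: "y \<in> U" for y
    proof -
      obtain d where d: "y = scale W d w" using y by (auto simp: U_def)
      have "x \<oplus>\<^bsub>W\<^esub> y = scale W (c + d) w" using c d ss(2)[OF w(1)] by simp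
      then show ?thesis unfolding U_def by (rule range_eqI)
    qed
    show "delta g d \<odot>\<^bsub>W\<^esub> x \<in> U" if g: "g \<in> carrier G" for g d
    proof -
      have "delta g d \<odot>\<^bsub>W\<^esub> x = scale W (c * d) w"
        unfolding c ss(9)[OF g w(1)] split[OF g w(1), of "c * d"] w(2)[OF g] ..
      then show ?thesis unfolding U_def by (rule range_eqI)
    qed
  qed
  have V: "submodule V (group_algebra G) W"
    by (rule submodule_from_delta[OF lW]) (auto simp: V_def \<phi>0 add gm \<phi>g)
  have minus: "\<phi> (\<ominus>\<^bsub>W\<^esub> x) = - \<phi> x" if "x \<in> carrier W" for x
    using add[of "\<ominus>\<^bsub>W\<^esub> x" x] that W.l_neg[OF that] \<phi>0 by (simp add: add_eq_0_iff2)
  have UV: "U \<inter> V = {\<zero>\<^bsub>W\<^esub>}"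
  proof
    show "U \<inter> V \<subseteq> {\<zero>\<^bsub>W\<^esub>}"
    proof
      fix x assume x: "x \<in> U \<inter> V"
      then obtain c where c: "x = scale W c w" by (auto simp: U_def)
      then have "c * \<phi> w = 0" using x sc[OF w(1)] by (simp add: V_def)
      then show "x \<in> {\<zero>\<^bsub>W\<^esub>}" using c w(3) ss(6)[OF w(1)] by simp
    qed
    show "{\<zero>\<^bsub>W\<^esub>} \<subseteq> U \<inter> V"
      using subgroup.one_closed[OF submodule.axioms(1)[OF U]] subgroup.one_closed[OF submodule.axioms(1)[OF V]] by simp
  qed
  have "U <+>\<^bsub>W\<^esub> V = carrier W"
  proof
    have "U \<subseteq> carrier W" "V \<subseteq> carrier W" using ss(1)[OF w(1)] by (auto simp: U_def V_def)
    then show "U <+>\<^bsub>W\<^esub> V \<subseteq> carrier W" by (auto simp: set_add_def' subset_iff)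
    show "carrier W \<subseteq> U <+>\<^bsub>W\<^esub> V"
    proof
      fix x assume x: "x \<in> carrier W"
      define u where "u = scale W (\<phi> x / \<phi> w) w"
      define y where "y = x \<oplus>\<^bsub>W\<^esub> \<ominus>\<^bsub>W\<^esub> u"
      have u: "u \<in> carrier W" "\<phi> u = \<phi> x" using ss(1)[OF w(1)] sc[OF w(1)] w(3) by (auto simp: u_def)
      have "y \<in> V" using x u minus[OF u(1)] add[OF x, of "\<ominus>\<^bsub>W\<^esub> u"] by (simp add: V_def y_def)
      moreover have "u \<in> U" by (auto simp: U_def u_def)
      moreover have "x = u \<oplus>\<^bsub>W\<^esub> y" unfolding y_def using x u(1) by (simp add: W.a_lcomm[of u x] W.r_neg)
      ultimately show "x \<in> U <+>\<^bsub>W\<^esub> V" unfolding set_add_def' by blast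
    qed
  qed
  then have "direct_decomposition (group_algebra G) W U V"
    unfolding direct_decomposition_def using U V UV by blast
  then have "U = {\<zero>\<^bsub>W\<^esub>} \<or> V = {\<zero>\<^bsub>W\<^esub>}" using W unfolding indecomposable_module_def by blast
  moreover have "U \<noteq> {\<zero>\<^bsub>W\<^esub>}"
  proof
    assume "U = {\<zero>\<^bsub>W\<^esub>}"
    moreover have "w \<in> U" unfolding U_def by (rule range_eqI[of _ _ 1]) (simp add: ss(5)[OF w(1)])
    ultimately show False using w(3) \<phi>0 by simp
  qed
  ultimately have V0: "V = {\<zero>\<^bsub>W\<^esub>}" by blast
  have inj: "inj_on \<phi> (carrier W)"
  proof (rule inj_onI)
    fix x y assume x: "x \<in> carrier W" and y: "y \<in> carrier W" and eq: "\<phi> x = \<phi> y"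
    have "x \<oplus>\<^bsub>W\<^esub> \<ominus>\<^bsub>W\<^esub> y \<in> V" using add[OF x, of "\<ominus>\<^bsub>W\<^esub> y"] minus[OF y] eq x y by (simp add: V_def)
    then have "x \<oplus>\<^bsub>W\<^esub> \<ominus>\<^bsub>W\<^esub> y = \<zero>\<^bsub>W\<^esub>" using V0 by simp
    then show "x = y" using x y W.minus_equality[of x "\<ominus>\<^bsub>W\<^esub> y"] by simp
  qed
  have "\<phi> ` carrier W = UNIV"
  proof (intro equalityI subsetI UNIV_I)
    fix c :: 'k
    have "c = \<phi> (scale W (c / \<phi> w) w)" using sc[OF w(1)] w(3) by simp
    then show "c \<in> \<phi> ` carrier W" using ss(1)[OF w(1)] by blast
  qed
  with inj have "\<phi> \<in> iso (add_monoid W) (add_monoid (trivial_module G))"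
    using add by (auto simp: iso_def hom_def bij_betw_def trivial_module_def)
  moreover have "\<phi> (a \<odot>\<^bsub>W\<^esub> x) = a \<odot>\<^bsub>trivial_module G\<^esub> \<phi> x"
    if a: "a \<in> carrier (group_algebra G)" and x: "x \<in> carrier W" for a x
  proof -
    have "\<phi> (a \<odot>\<^bsub>W\<^esub> x) = (\<Sum>g\<in>carrier G. \<phi> (delta g (a g) \<odot>\<^bsub>W\<^esub> x))"
      unfolding smult_expand[OF W.semi_module_axioms a x] by (rule \<phi>sum) (use gm x in auto)
    also have "\<dots> = (\<Sum>g\<in>carrier G. a g) * \<phi> x"
      unfolding sum_distrib_right by (rule sum.cong) (use \<phi>g x in auto)
    finally show ?thesis by (simp add: trivial_module_def)
  qed
  ultimately show ?thesis unfolding module_iso_def by blast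
qed

text \<open>The preceding criterion is applied to a coset component, of the image of a nonzero
  vector, that the projection \<open>g\<close> does not annihilate. Its value at \<open>x\<close> is
  fixed by \<open>D\<close> because \<open>D\<close> is normal; a coordinate of \<open>g\<close> on
  functions supported on the coset of \<open>x\<close> is the invariant functional.\<close>

lemma source_trivial:
  fixes M :: "('a \<Rightarrow> 'k::field, 'm, 'y) module_scheme" and W :: "('a \<Rightarrow> 'k, 'n, 'z) module_scheme"
  assumes M: "simple_module (group_algebra G) M" and D: "subgroup D G"
    and normal: "\<And>g h. g \<in> carrier G \<Longrightarrow> h \<in> D \<Longrightarrow> g \<otimes> h \<otimes> inv g \<in> D"
    and triv: "\<And>d m. d \<in> D \<Longrightarrow> m \<in> carrier M \<Longrightarrow> delta d 1 \<odot>\<^bsub>M\<^esub> m = m"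
    and W: "indecomposable_module (group_algebra (G\<lparr>carrier := D\<rparr>)) W"
    and sm: "iso_direct_summand (group_algebra G) M (induced_module G D W)"
  shows "module_iso (group_algebra (G\<lparr>carrier := D\<rparr>)) W (trivial_module (G\<lparr>carrier := D\<rparr>))"
proof -
  have lM: "left_module (group_algebra G) M" using M by (simp add: simple_module_def)
  interpret M: left_module "group_algebra G" M by fact
  have lW: "left_module (group_algebra (G\<lparr>carrier := D\<rparr>)) W" using W by (simp add: indecomposable_module_def)
  interpret W: left_module "group_algebra (G\<lparr>carrier := D\<rparr>)" W by fact
  interpret D: subgroup D G by fact
  interpret Dg: finite_group "G\<lparr>carrier := D\<rparr>" by (rule subgroup_finite_group[OF D])
  let ?I = "induced_module G D W"
  note Ism = semi_module_induced_module[OF D lW]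
  note mem = induced_module_mem
  interpret I: semi_module "group_algebra G" ?I by (rule Ism(1))
  have dH: "delta h c \<in> carrier (group_algebra (G\<lparr>carrier := D\<rparr>))" if "h \<in> D" for h and c :: 'k
    using Dg.delta_closed[of h c] that by simp
  have one1: "delta \<one> 1 \<odot>\<^bsub>W\<^esub> v = v" if "v \<in> carrier W" for v using W.smult_one[OF that] by simp
  have wc: "delta h c \<odot>\<^bsub>W\<^esub> v \<in> carrier W" if "h \<in> D" "v \<in> carrier W" for h c v
    by (rule W.smult_closed[OF dH[OF that(1)] that(2)])
  have wdd: "delta g c \<odot>\<^bsub>W\<^esub> (delta h d \<odot>\<^bsub>W\<^esub> m) = delta (g \<otimes> h) (c * d) \<odot>\<^bsub>W\<^esub> m"
    if "g \<in> D" "h \<in> D" "m \<in> carrier W" for g h c d m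
    using W.smult_assoc[OF dH[OF that(1)] dH[OF that(2)] that(3), of c d]
      Dg.delta_delta_mult[of g h c d] that(1,2) by simp
  obtain f g where f: "module_hom (group_algebra G) M ?I f" and g: "module_hom (group_algebra G) ?I M g"
    and gf: "\<And>x. x \<in> carrier M \<Longrightarrow> g (f x) = x"
    by (rule iso_direct_summandE[OF I.abelian_group_axioms M.abelian_group_axioms I.smult_r_distr M.smult_closed sm])
      (assumption | blast)+
  note fD = module_homD[OF f] and gD = module_homD[OF g]
  obtain J :: "'a set" and v \<phi> where J: "finite J" and v: "v \<in> J \<rightarrow> carrier M"
    and \<phi>add: "\<And>j x y. j \<in> J \<Longrightarrow> x \<in> carrier M \<Longrightarrow> y \<in> carrier M \<Longrightarrow> \<phi> j (x \<oplus>\<^bsub>M\<^esub> y) = (\<phi> j x + \<phi> j y :: 'k)"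
    and \<phi>sc: "\<And>j x c. j \<in> J \<Longrightarrow> x \<in> carrier M \<Longrightarrow> \<phi> j (scale M c x) = c * \<phi> j x"
    and basis: "\<And>m. m \<in> carrier M \<Longrightarrow> m = finsum M (\<lambda>j. scale M (\<phi> j m) (v j)) J"
    by (rule simple_module_dual_basis[OF M(1)]) blast
  have zeroI: "m = \<zero>\<^bsub>M\<^esub>" if m: "m \<in> carrier M" and 0: "\<And>j. j \<in> J \<Longrightarrow> \<phi> j m = 0" for m
  proof -
    have "finsum M (\<lambda>j. scale M (\<phi> j m) (v j)) J = finsum M (\<lambda>j. \<zero>\<^bsub>M\<^esub>) J"
      by (intro M.finsum_cong'[OF refl]) (use scale_simps(6)[OF lM] v 0 in auto)
    then show ?thesis using basis[OF m] M.finsum_zero by metis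
  qed
  obtain m where m: "m \<in> carrier M" "m \<noteq> \<zero>\<^bsub>M\<^esub>"
    using M M.zero_closed unfolding simple_module_def by blast
  define F where "F = f m"
  have F: "F \<in> carrier ?I" unfolding F_def by (rule fD(1)[OF m(1)])
  note cp = coset_part[OF D lW F]
  have DF: "delta d 1 \<odot>\<^bsub>?I\<^esub> F = F" if "d \<in> D" for d
    using fD(3)[OF delta_closed m(1), of d 1] triv[OF that m(1)] that D.subset by (auto simp: F_def)
  have "\<exists>C\<in>left_cosets G D. g (coset_part G W F C) \<noteq> \<zero>\<^bsub>M\<^esub>"
  proof (rule ccontr)
    assume 0: "\<not> ?thesis"
    have gF: "g \<in> carrier ?I \<rightarrow> carrier M" using gD(1) by blast
    have "m = g (finsum ?I (coset_part G W F) (left_cosets G D))" using gf[OF m(1)] cp(2) by (simp add: F_def)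
    also have "\<dots> = finsum M (\<lambda>C. g (coset_part G W F C)) (left_cosets G D)"
      by (rule additive_finsum[where f = g, OF I.abelian_group_axioms M.abelian_group_axioms gF gD(2) finite_left_cosets])
        (use cp(1) in auto)
    also have "\<dots> = finsum M (\<lambda>C. \<zero>\<^bsub>M\<^esub>) (left_cosets G D)"
      by (rule M.finsum_cong'[OF refl]) (use 0 in auto)
    also have "\<dots> = \<zero>\<^bsub>M\<^esub>" by (rule M.finsum_zero)
    finally show False using m(2) by simp
  qed
  then obtain x where x: "x \<in> carrier G" "g (coset_part G W F (x <# D)) \<noteq> \<zero>\<^bsub>M\<^esub>"
    by (auto simp: left_cosets_def)
  have xC: "x <# D \<in> left_cosets G D" using x by (auto simp: left_cosets_def)
  \<comment> \<open>\<open>E w\<close> is the tensor of \<open>x\<close> with \<open>w\<close>,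
    written as a function supported on the coset of \<open>x\<close>.\<close>
  define E where "E = (\<lambda>w. \<lambda>y\<in>carrier G. if inv x \<otimes> y \<in> D then delta (inv (inv x \<otimes> y)) 1 \<odot>\<^bsub>W\<^esub> w else \<zero>\<^bsub>W\<^esub>)"
  have E: "E w \<in> carrier ?I" if w: "w \<in> carrier W" for w
    unfolding induced_module_simps(1)
  proof (intro CollectI conjI ballI)
    show "E w \<in> carrier G \<rightarrow>\<^sub>E carrier W" using wc[OF D.m_inv_closed w] by (auto simp: E_def)
    fix y h assume y: "y \<in> carrier G" and h: "h \<in> D"
    have hc: "h \<in> carrier G" using h D.subset by blast
    define d where "d = inv x \<otimes> y"
    have dc: "d \<in> carrier G" using x y by (simp add: d_def)
    have eq: "inv x \<otimes> (y \<otimes> h) = d \<otimes> h" using x y hc by (simp add: d_def m_assoc)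
    have iff: "d \<otimes> h \<in> D \<longleftrightarrow> d \<in> D"
    proof
      assume "d \<otimes> h \<in> D"
      then have "d \<otimes> h \<otimes> inv h \<in> D" using h by blast
      then show "d \<in> D" using dc hc by (simp add: m_assoc)
    qed (use h in blast)
    show "E w (y \<otimes> h) = delta (inv h) 1 \<odot>\<^bsub>W\<^esub> E w y"
    proof (cases "d \<in> D")
      case True
      have "delta (inv (d \<otimes> h)) 1 \<odot>\<^bsub>W\<^esub> w = delta (inv h) 1 \<odot>\<^bsub>W\<^esub> (delta (inv d) 1 \<odot>\<^bsub>W\<^esub> w)"
        using wdd[of "inv h" "inv d" w 1 1] True h w dc hc by (simp add: inv_mult_group)
      then show ?thesis using True iff y hc eq by (simp add: E_def flip: d_def)
    next
      case False
      then show ?thesis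
        using iff y hc eq W.smult_zero_right[OF dH[OF D.m_inv_closed[OF h]]] by (simp add: E_def flip: d_def)
    qed
  qed
  define w where "w = F x"
  have w: "w \<in> carrier W" unfolding w_def by (rule mem(1)[OF F x(1)])
  have Ew: "coset_part G W F (x <# D) = E w"
  proof (rule induced_module_eqI[OF cp(1)[OF xC] E[OF w]])
    fix y assume y: "y \<in> carrier G"
    have "y \<in> x <# D \<longleftrightarrow> inv x \<otimes> y \<in> D"
    proof
      assume "y \<in> x <# D"
      then obtain d where "d \<in> D" "y = x \<otimes> d" unfolding l_coset_def by blast
      then show "inv x \<otimes> y \<in> D" using x D.subset by (auto simp: subset_iff)
    next
      assume "inv x \<otimes> y \<in> D"
      then show "y \<in> x <# D" unfolding l_coset_def using x y by (intro UN_I[of "inv x \<otimes> y"]) auto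
    qed
    moreover have "F y = delta (inv (inv x \<otimes> y)) 1 \<odot>\<^bsub>W\<^esub> w" if "inv x \<otimes> y \<in> D"
      using mem(2)[OF F x(1) that] x y by (simp add: w_def)
    ultimately show "coset_part G W F (x <# D) y = E w y" using y by (simp add: coset_part_def E_def)
  qed
  have wfix: "delta h 1 \<odot>\<^bsub>W\<^esub> w = w" if h: "h \<in> D" for h
  proof -
    have hc: "h \<in> carrier G" using h D.subset by blast
    have ih: "inv h \<in> D" using h by blast
    define d where "d = x \<otimes> h \<otimes> inv x"
    have d: "d \<in> D" unfolding d_def by (rule normal[OF x(1) h])
    have dc: "d \<in> carrier G" using d D.subset by blast
    have "F (x \<otimes> inv h) = delta h 1 \<odot>\<^bsub>W\<^esub> F x" using mem(2)[OF F x(1) ih] hc by simp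
    moreover have "F (x \<otimes> inv h) = F x"
    proof -
      have "F x = (delta d 1 \<odot>\<^bsub>?I\<^esub> F) x" using DF[OF d] by simp
      also have "\<dots> = delta \<one> 1 \<odot>\<^bsub>W\<^esub> F (inv d \<otimes> x)" by (rule Ism(2)[OF dc F x(1)])
      also have "\<dots> = F (inv d \<otimes> x)" by (rule one1[OF mem(1)[OF F]]) (use dc x in simp)
      also have "inv d \<otimes> x = x \<otimes> inv h" using x hc by (simp add: d_def inv_mult_group m_assoc)
      finally show ?thesis ..
    qed
    ultimately show ?thesis by (simp add: w_def)
  qed
  obtain j where j: "j \<in> J" "\<phi> j (g (E w)) \<noteq> 0"
    using zeroI[OF gD(1)[OF E[OF w]]] x(2) Ew by auto
  define \<psi> where "\<psi> = (\<lambda>u. \<phi> j (g (E u)))"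
  have Iadd: "E (u \<oplus>\<^bsub>W\<^esub> u') = E u \<oplus>\<^bsub>?I\<^esub> E u'" if u: "u \<in> carrier W" "u' \<in> carrier W" for u u'
  proof (rule induced_module_eqI[OF E[OF W.a_closed[OF u]] I.a_closed[OF E[OF u(1)] E[OF u(2)]]])
    fix y assume y: "y \<in> carrier G"
    show "E (u \<oplus>\<^bsub>W\<^esub> u') y = (E u \<oplus>\<^bsub>?I\<^esub> E u') y"
      using y W.smult_r_distr[OF dH[OF D.m_inv_closed] u] by (simp add: E_def induced_module_simps(3))
  qed
  have Isc: "E (scale W c u) = scale ?I c (E u)" if u: "u \<in> carrier W" for u c
  proof (rule induced_module_eqI[OF E[OF wc[OF D.one_closed u]] I.smult_closed[OF delta_closed[OF one_closed] E[OF u]]])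
    fix y assume y: "y \<in> carrier G"
    have "scale ?I c (E u) y = scale W c (E u y)" using Ism(2)[OF one_closed E[OF u] y, of c] y by simp
    moreover have "delta (inv d) 1 \<odot>\<^bsub>W\<^esub> scale W c u = scale W c (delta (inv d) 1 \<odot>\<^bsub>W\<^esub> u)" if "d \<in> D" for d
      using wdd[OF D.m_inv_closed[OF that] D.one_closed u, of 1 c] wdd[OF D.one_closed D.m_inv_closed[OF that] u, of c 1]
        that D.subset by auto
    ultimately show "E (scale W c u) y = scale ?I c (E u) y"
      using y W.smult_zero_right[OF dH[OF D.one_closed], of c] by (simp add: E_def)
  qed
  have Iinv: "E (delta h 1 \<odot>\<^bsub>W\<^esub> u) = delta (x \<otimes> h \<otimes> inv x) 1 \<odot>\<^bsub>?I\<^esub> E u" if h: "h \<in> D" and u: "u \<in> carrier W" for h u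
  proof -
    have hc: "h \<in> carrier G" using h D.subset by blast
    define d where "d = x \<otimes> h \<otimes> inv x"
    have dc: "d \<in> carrier G" using x hc by (simp add: d_def)
    show ?thesis
      unfolding d_def[symmetric]
    proof (rule induced_module_eqI[OF E[OF wc[OF h u]] I.smult_closed[OF delta_closed[OF dc] E[OF u]]])
      fix y assume y: "y \<in> carrier G"
      define z where "z = inv x \<otimes> y"
      have zc: "z \<in> carrier G" using x y by (simp add: z_def)
      have dy: "inv d \<otimes> y \<in> carrier G" using dc y by simp
      have "(delta d 1 \<odot>\<^bsub>?I\<^esub> E u) y = E u (inv d \<otimes> y)"
        using Ism(2)[OF dc E[OF u] y, of 1] one1[OF mem(1)[OF E[OF u] dy]] by simp
      moreover have "inv x \<otimes> (inv d \<otimes> y) = inv h \<otimes> z"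
        using x hc y by (simp add: d_def z_def inv_mult_group m_assoc)
      moreover have "inv h \<otimes> z \<in> D \<longleftrightarrow> z \<in> D"
      proof
        assume "inv h \<otimes> z \<in> D"
        then have "h \<otimes> (inv h \<otimes> z) \<in> D" using h by blast
        then show "z \<in> D" using hc zc by simp
      qed (use h in blast)
      moreover have "delta (inv (inv h \<otimes> z)) 1 \<odot>\<^bsub>W\<^esub> u = delta (inv z) 1 \<odot>\<^bsub>W\<^esub> (delta h 1 \<odot>\<^bsub>W\<^esub> u)" if "z \<in> D"
        using wdd[of "inv z" h u 1 1] that h u hc zc by (simp add: inv_mult_group)
      ultimately show "E (delta h 1 \<odot>\<^bsub>W\<^esub> u) y = (delta d 1 \<odot>\<^bsub>?I\<^esub> E u) y"
        using y dy by (simp add: E_def flip: z_def)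
    qed
  qed
  show ?thesis
  proof (rule Dg.indecomposable_trivial_module_iso[OF W w, of \<psi>])
    show "delta h 1 \<odot>\<^bsub>W\<^esub> w = w" if "h \<in> carrier (G\<lparr>carrier := D\<rparr>)" for h using wfix that by simp
    show "\<psi> w \<noteq> 0" using j by (simp add: \<psi>_def)
    fix u assume u: "u \<in> carrier W"
    note gE = gD(1)[OF E[OF u]]
    show "\<psi> (u \<oplus>\<^bsub>W\<^esub> u') = \<psi> u + \<psi> u'" if u': "u' \<in> carrier W" for u'
      unfolding \<psi>_def Iadd[OF u u'] gD(2)[OF E[OF u] E[OF u']] by (rule \<phi>add[OF j(1) gE gD(1)[OF E[OF u']]])
    show "\<psi> (delta \<one>\<^bsub>G\<lparr>carrier := D\<rparr>\<^esub> c \<odot>\<^bsub>W\<^esub> u) = c * \<psi> u" for c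
      unfolding \<psi>_def using Isc[OF u, of c] gD(3)[OF delta_closed[OF one_closed] E[OF u], of c] \<phi>sc[OF j(1) gE] by simp
    show "\<psi> (delta h 1 \<odot>\<^bsub>W\<^esub> u) = \<psi> u" if h: "h \<in> carrier (G\<lparr>carrier := D\<rparr>)" for h
    proof -
      have hD: "h \<in> D" using h by simp
      have dc: "x \<otimes> h \<otimes> inv x \<in> carrier G" using x hD D.subset by auto
      show ?thesis
        unfolding \<psi>_def Iinv[OF hD u] gD(3)[OF delta_closed[OF dc] E[OF u]] triv[OF normal[OF x(1) hD] gE] ..
    qed
  qed
qed

text \<open>A minimal nonzero left ideal inside the ideal generated by \<open>b\<close> is simple,
  and \<open>b\<close> acts on it as the identity. Minimality is taken with respect to the measure
  on subspaces, which drops at every proper inclusion.\<close>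

lemma block_simple_module_exists:
  fixes b :: "'a \<Rightarrow> 'k::field"
  assumes b: "is_block G b"
  obtains M :: "('a, 'k) kmod" where "simple_module (group_algebra G) M" "in_block b M"
proof -
  let ?A = "group_algebra G :: ('a \<Rightarrow> 'k) ring"
  have cb: "class_function G b" "b \<star> b = b" "b \<noteq> (\<lambda>_. 0)"
    using b by (simp_all add: is_block_def Let_def central_idempotent_iff)
  obtain \<mu> :: "('a \<Rightarrow> 'k) set \<Rightarrow> nat" where \<mu>: "\<And>U V. function_subspace (carrier G) U \<Longrightarrow>
      function_subspace (carrier G) V \<Longrightarrow> U \<subset> V \<Longrightarrow> \<mu> U < \<mu> V"
    using function_subspace_measure[OF finite_carrier] by blast
  \<comment> \<open>Only stability under group elements is demanded; together with the subspace
    property it makes \<open>U\<close> a left ideal.\<close>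
  define P where "P = (\<lambda>U. function_subspace (carrier G) U \<and> (\<forall>g\<in>carrier G. \<forall>u\<in>U. delta g 1 \<star> u \<in> U) \<and>
    (\<forall>u\<in>U. b \<star> u = u) \<and> U \<noteq> {\<lambda>_. 0})"
  have bA: "b \<in> carrier ?A" by (rule class_function_carrier[OF cb(1)])
  have "P {b \<star> a | a. a \<in> carrier ?A}" (is "P ?U")
    unfolding P_def function_subspace_def
  proof (intro conjI ballI allI impI)
    fix u v assume u: "u \<in> ?U"
    then obtain a where a: "a \<in> carrier ?A" "u = b \<star> a" by blast
    show "u x = 0" if "x \<notin> carrier G" for x using that a by (simp add: group_algebra_mult)
    have "(\<lambda>x. c * u x) = b \<star> (\<lambda>x. c * a x)" for c unfolding a(2) by (simp only: group_algebra_distrib)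
    moreover have "(\<lambda>x. c * a x) \<in> carrier ?A" for c using a by simp
    ultimately show "(\<lambda>x. c * u x) \<in> ?U" for c by blast
    show "b \<star> u = u" unfolding a(2) by (metis group_algebra_assoc cb(2))
    show "delta g 1 \<star> u \<in> ?U" if g: "g \<in> carrier G" for g
    proof -
      have "delta g 1 \<star> u = b \<star> (delta g 1 \<star> a)"
        unfolding a(2) using class_function_commute[OF cb(1) delta_closed[OF g], of 1]
        by (metis group_algebra_assoc)
      then show ?thesis using group_algebra_mult_closed by blast
    qed
    assume "v \<in> ?U"
    then obtain a' where a': "a' \<in> carrier ?A" "v = b \<star> a'" by blast
    have "(\<lambda>x. u x + v x) = b \<star> (\<lambda>x. a x + a' x)" unfolding a(2) a'(2) by (simp only: group_algebra_distrib)
    moreover have "(\<lambda>x. a x + a' x) \<in> carrier ?A" using a a' by simp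
    ultimately show "(\<lambda>x. u x + v x) \<in> ?U" by blast
  next
    have "(\<lambda>_. 0) = b \<star> (\<lambda>_. 0)" "(\<lambda>_. 0) \<in> carrier ?A" by simp_all
    then show "(\<lambda>_. 0) \<in> ?U" by blast
    have "b = b \<star> b \<and> b \<in> carrier ?A" using cb(2) bA by simp
    then have "b \<in> ?U" by blast
    then show "?U \<noteq> {\<lambda>_. 0}" using cb(3) by blast
  qed
  then obtain U where U: "P U" "\<And>V. P V \<Longrightarrow> \<mu> U \<le> \<mu> V"
    using ex_has_least_nat[of P _ \<mu>] by blast
  have fs: "function_subspace (carrier G) U" and Ug: "\<And>g u. g \<in> carrier G \<Longrightarrow> u \<in> U \<Longrightarrow> delta g 1 \<star> u \<in> U"
    and Ub: "\<And>u. u \<in> U \<Longrightarrow> b \<star> u = u" and U0: "U \<noteq> {\<lambda>_. 0}"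
    using U(1) unfolding P_def by blast+
  have UA: "u \<in> carrier ?A" if "u \<in> U" for u using fs that unfolding function_subspace_def by simp
  have Uz: "(\<lambda>_. 0) \<in> U" and Uadd: "\<And>u v. u \<in> U \<Longrightarrow> v \<in> U \<Longrightarrow> (\<lambda>x. u x + v x) \<in> U"
    and Usc: "\<And>u c. u \<in> U \<Longrightarrow> (\<lambda>x. c * u x) \<in> U"
    using fs unfolding function_subspace_def by blast+
  have Usum: "(\<lambda>x. \<Sum>i\<in>I. h i x) \<in> U" if "finite I" "\<And>i. i \<in> I \<Longrightarrow> h i \<in> U" for h :: "'a \<Rightarrow> 'a \<Rightarrow> 'k" and I
    using that by (induction I rule: finite_induct) (auto simp: Uz intro: Uadd)
  have Umult: "a \<star> u \<in> U" if u: "u \<in> U" for a u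
  proof -
    have "a \<star> u = (\<lambda>x. \<Sum>g\<in>carrier G. a g * (delta g 1 \<star> u) x)"
      by (auto simp: fun_eq_iff group_algebra_mult[of G a u] delta_mult) (simp add: group_algebra_mult)
    also have "\<dots> \<in> U" by (rule Usum[OF finite_carrier Usc[OF Ug[OF _ u]]])
    finally show ?thesis .
  qed
  define M where "M = (regular_module ?A)\<lparr>carrier := U\<rparr>"
  have Ms: "carrier M = U" "\<zero>\<^bsub>M\<^esub> = (\<lambda>_. 0)" "u \<oplus>\<^bsub>M\<^esub> v = (\<lambda>x. u x + v x)" "a \<odot>\<^bsub>M\<^esub> u = a \<star> u" for a u v
    by (simp_all add: M_def regular_module_def)
  have lM: "left_module ?A M"
    unfolding left_module_def
  proof (intro conjI left_module_axioms.intro)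
    show "ring ?A" by (rule ring_group_algebra)
    show "abelian_group M"
    proof (rule abelian_groupI)
      fix x assume "x \<in> carrier M"
      then show "\<exists>y\<in>carrier M. y \<oplus>\<^bsub>M\<^esub> x = \<zero>\<^bsub>M\<^esub>"
        using Usc[of x "- 1"] by (intro bexI[of _ "\<lambda>g. - x g"]) (auto simp: Ms)
    qed (auto simp: Ms Uadd Uz algebra_simps)
    show "\<one>\<^bsub>?A\<^esub> \<odot>\<^bsub>M\<^esub> x = x" if "x \<in> carrier M" for x
      using group_algebra_one_mult(1)[OF UA] that by (simp add: Ms)
  qed (auto simp: Ms Umult group_algebra_distrib group_algebra_assoc)
  have sM: "simple_module ?A M"
    unfolding simple_module_def
  proof (intro conjI allI impI lM)
    show "carrier M \<noteq> {\<zero>\<^bsub>M\<^esub>}" using U0 by (simp add: Ms)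
    fix V assume V: "submodule V ?A M"
    interpret V: submodule V ?A M by fact
    have VU: "V \<subseteq> U" using V.subset by (simp add: Ms)
    have Vm: "a \<star> v \<in> V" if "a \<in> carrier ?A" "v \<in> V" for a v using V.smult_closed[OF that] by (simp add: Ms)
    show "V = {\<zero>\<^bsub>M\<^esub>} \<or> V = carrier M"
    proof (rule ccontr)
      assume "\<not> ?thesis"
      then have ne: "V \<noteq> {\<lambda>_. 0}" "V \<subset> U" using VU by (auto simp: Ms)
      have Vfs: "function_subspace (carrier G) V"
        unfolding function_subspace_def
      proof (intro conjI ballI allI impI)
        show "(\<lambda>_. 0) \<in> V" using V.one_closed by (simp add: Ms)
        fix u assume u: "u \<in> V"
        show "u x = 0" if "x \<notin> carrier G" for x using UA[of u] u VU that by auto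
        show "(\<lambda>x. u x + v x) \<in> V" if "v \<in> V" for v using V.m_closed[OF u that] by (simp add: Ms)
        fix c
        have "(\<lambda>x. c * u x) = delta \<one> c \<star> u"
        proof (rule group_algebra_eqI)
          show "(\<lambda>x. c * u x) \<in> carrier ?A" using UA[of u] u VU by auto
          show "(c * u x) = (delta \<one> c \<star> u) x" if "x \<in> carrier G" for x
            using that by (simp add: delta_mult)
        qed (rule group_algebra_mult_closed)
        then show "(\<lambda>x. c * u x) \<in> V" using Vm[OF delta_closed[OF one_closed] u] by simp
      qed
      have "P V" unfolding P_def using Vfs Vm[OF delta_closed] Ub VU ne(1) by blast
      then have "\<mu> U \<le> \<mu> V" by (rule U(2))
      moreover have "\<mu> V < \<mu> U" by (rule \<mu>[OF Vfs fs ne(2)])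
      ultimately show False by simp
    qed
  qed
  obtain idx :: "'a \<Rightarrow> nat" where idx: "inj_on idx (carrier G)"
    using finite_imp_inj_to_nat_seg[OF finite_carrier] by blast
  define f where "f = (\<lambda>a :: 'a \<Rightarrow> 'k. \<lambda>i. if i \<in> idx ` carrier G then a (the_inv_into (carrier G) idx i) else 0)"
  have f: "f a (idx x) = a x" if "x \<in> carrier G" for a x
    using that idx by (simp add: f_def the_inv_into_f_f)
  have inj: "inj_on f (carrier M)"
  proof (rule inj_onI)
    fix u v assume uv: "u \<in> carrier M" "v \<in> carrier M" "f u = f v"
    show "u = v"
      by (rule group_algebra_eqI[OF UA UA]) (use uv f in \<open>metis Ms(1)\<close>)+
  qed
  have "in_block b (transport_module f M)"
    using transport_module_simps[OF inj] Ub by (auto simp: in_block_def Ms)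
  then show ?thesis using that simple_module_transport_module[OF sM inj] by blast
qed

text \<open>The first part ensures that the choice by \<open>SOME\<close> succeeds, the second that
  every possible choice is trivial. The second needs a simple module in the block, because being a
  common source is a universal condition on such modules.\<close>

lemma common_source_trivial:
  fixes b :: "'a \<Rightarrow> 'k::field"
  assumes b: "is_block G b" and D: "is_defect_group G b D"
    and p: "Factorial_Ring.prime p" "CHAR('k) = p"
    and normal: "\<And>g h. g \<in> carrier G \<Longrightarrow> h \<in> D \<Longrightarrow> g \<otimes> h \<otimes> inv g \<in> D"
  shows "is_common_source G b D (trivial_kmod D)"
    and "is_common_source G b D W \<Longrightarrow>
      module_iso (group_algebra (G\<lparr>carrier := D\<rparr>)) W (trivial_module (G\<lparr>carrier := D\<rparr>))"
proof -
  obtain n where sD: "subgroup D G" "card D = p ^ n"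
    using D p by (auto simp: is_defect_group_def p_subgroup_def)
  interpret Dg: finite_group "G\<lparr>carrier := D\<rparr>" by (rule subgroup_finite_group[OF sD(1)])
  note triv = simple_module_normal_p_subgroup_trivial[OF _ sD p normal]
  show "is_common_source G b D (trivial_kmod D)"
    unfolding is_common_source_def
  proof (intro allI impI)
    fix M :: "('a, 'k) kmod" assume M: "simple_module (group_algebra G) M \<and> in_block b M"
    have fgT: "fg_module (group_algebra (G\<lparr>carrier := D\<rparr>)) (trivial_kmod D :: ('a, 'k) kmod)"
      and indT: "indecomposable_module (group_algebra (G\<lparr>carrier := D\<rparr>)) (trivial_kmod D :: ('a, 'k) kmod)"
      using Dg.trivial_kmod_fg Dg.trivial_kmod_indecomposable by simp_all
    have sm: "iso_direct_summand (group_algebra G) M (induced_module G D (trivial_kmod D))"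
      by (rule simple_module_trivial_source[OF b D p conjunct1[OF M] conjunct2[OF M] triv[OF conjunct1[OF M]]])
    then have "relatively_projective G D M" unfolding relatively_projective_def using fgT by blast
    moreover have "\<not> relatively_projective G R M" if "subgroup R G" "R \<subset> D" for R
      by (rule not_relatively_projective[OF conjunct1[OF M] sD p triv[OF conjunct1[OF M]] that])
    ultimately show "is_source G M D (trivial_kmod D)"
      unfolding is_source_def is_vertex_def using simple_module_fg M sD fgT indT sm by blast
  qed
  assume W: "is_common_source G b D W"
  obtain M :: "('a, 'k) kmod" where M: "simple_module (group_algebra G) M" "in_block b M"
    by (rule block_simple_module_exists[OF b])
  then have "is_source G M D W" using W unfolding is_common_source_def by blast
  then show "module_iso (group_algebra (G\<lparr>carrier := D\<rparr>)) W (trivial_module (G\<lparr>carrier := D\<rparr>))"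
    using source_trivial[OF M(1) sD(1) normal triv[OF M(1)]] unfolding is_source_def by blast
qed

text \<open>The hypothesis on normalizers identifies the group over which \<open>W_module\<close> is
  formed with the normalizer of \<open>D\<close>, in which \<open>D\<close> is normal and the
  correspondent of \<open>B\<close> is its truncation.\<close>

lemma W_module_trivial:
  fixes B :: "'a \<Rightarrow> 'k::field"
  assumes B: "is_block G B" and D: "is_defect_group G B D"
    and p: "Factorial_Ring.prime p" "CHAR('k) = p"
    and N: "normalizer G (order_p_subgroup G p D) = normalizer G D"
  shows "module_iso (group_algebra (G\<lparr>carrier := D\<rparr>)) (W_module G B D) (trivial_module (G\<lparr>carrier := D\<rparr>))"
proof -
  define H where "H = G\<lparr>carrier := normalizer G D\<rparr>"
  define c where "c = brauer_hom G D B"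
  have sD: "subgroup D G" using D by (simp add: is_defect_group_def p_subgroup_def)
  have sN: "subgroup (normalizer G D) G" by (rule subgroup_normalizer[OF subgroup.subset[OF sD]])
  interpret H: finite_group H unfolding H_def by (rule subgroup_finite_group[OF sN])
  have bc: "brauer_correspondent G (normalizer G D) D B = c"
    unfolding c_def by (rule brauer_correspondent_normalizer[OF B D p refl])
  have W: "W_module G B D = (SOME W. is_common_source H c D W)"
    unfolding W_module_def Let_def p(2) N bc H_def ..
  have block: "is_block H c" unfolding H_def c_def by (rule defect_brauer_hom_primitive[OF B D p refl])
  have defect: "is_defect_group H c D" unfolding H_def c_def by (rule defect_brauer_hom(5)[OF B D p refl])
  have normal: "g \<otimes>\<^bsub>H\<^esub> h \<otimes>\<^bsub>H\<^esub> inv\<^bsub>H\<^esub> g \<in> D" if "g \<in> carrier H" "h \<in> D" for g h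
    using that normalizer_conj[OF sD, of g h] m_inv_consistent[OF sN, of g] by (simp add: H_def)
  have "is_common_source H c D (W_module G B D)"
    unfolding W using H.common_source_trivial(1)[OF block defect p normal] by (rule someI)
  then show ?thesis
    using H.common_source_trivial(2)[OF block defect p normal] by (simp add: H_def)
qed

end

section \<open>Cyclic radical subgroups of alternating groups\<close>

text \<open>The hypothesis says that \<open>t\<close> conjugates \<open>s\<close> to
  \<open>s ^^ r\<close>. It expresses throughout, without inverses of permutations, that
  \<open>t\<close> normalizes the cyclic group generated by \<open>s\<close>.\<close>

lemma funpow_conj:
  assumes "\<And>x. t (s x) = (s ^^ r) (t x)"
  shows "t ((s ^^ i) x) = (s ^^ (r * i)) (t x)"
proof (induction i arbitrary: x)
  case (Suc i)
  have "t ((s ^^ Suc i) x) = (s ^^ r) (t ((s ^^ i) x))" using assms by simp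
  also have "\<dots> = (s ^^ (r + r * i)) (t x)" by (simp add: Suc funpow_add)
  finally show ?case by simp
qed simp

lemma funpow_conj_power:
  assumes "\<And>x. t (s x) = (s ^^ r) (t x)"
  shows "(t ^^ m) (s x) = (s ^^ (r ^ m)) ((t ^^ m) x)"
proof (induction m)
  case (Suc m)
  then show ?case using funpow_conj[of t s r "r ^ m", OF assms] by simp
qed simp

lemma funpow_eq_iff:
  assumes "permutation s"
  shows "(s ^^ i) x = (s ^^ j) x \<longleftrightarrow> i mod least_power s x = j mod least_power s x"
proof -
  have inj: "inj s" using assms permutation_bijective bij_is_inj by blast
  have "(s ^^ i) x = (s ^^ j) x \<longleftrightarrow> i mod least_power s x = j mod least_power s x" if "i \<le> j" for i j
  proof -
    have "(s ^^ i) x = (s ^^ j) x \<longleftrightarrow> (s ^^ (j - i)) x = x"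
    proof
      assume "(s ^^ (j - i)) x = x"
      then have "(s ^^ i) ((s ^^ (j - i)) x) = (s ^^ i) x" by simp
      then show "(s ^^ i) x = (s ^^ j) x" using that by (simp add: funpow_add[symmetric, THEN fun_cong, simplified comp_def])
    qed (rule funpow_diff[OF inj that])
    also have "\<dots> \<longleftrightarrow> least_power s x dvd j - i" by (rule least_power_dvd[OF assms, symmetric])
    also have "\<dots> \<longleftrightarrow> i mod least_power s x = j mod least_power s x"
      using mod_eq_dvd_iff_nat[OF that, of "least_power s x"] by auto
    finally show ?thesis .
  qed
  from this[of i j] this[of j i] show ?thesis by (cases "i \<le> j") auto
qed

lemma evenperm_funpow_odd:
  assumes "permutation s" "odd m"
  shows "evenperm (s ^^ m) \<longleftrightarrow> evenperm s"
proof -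
  have "evenperm (s ^^ m) \<longleftrightarrow> even m \<or> evenperm s" for m
  proof (induction m)
    case (Suc m)
    have "evenperm (s \<circ> s ^^ m) \<longleftrightarrow> evenperm s = evenperm (s ^^ m)"
      by (rule evenperm_comp[OF assms(1) permutation_funpow[OF assms(1)]])
    then show ?case unfolding funpow.simps even_Suc Suc by blast
  qed simp
  with assms(2) show ?thesis by simp
qed

lemma evenperm_cycle_of_list:
  assumes "cycle cs" "cs \<noteq> []"
  shows "evenperm (cycle_of_list cs) \<longleftrightarrow> odd (length cs)"
  using assms
proof (induction cs rule: cycle_of_list.induct)
  case (1 i j cs)
  then have "i \<noteq> j" by auto
  then show ?case
    using 1 evenperm_comp[OF permutation_swap_id permutation_of_cycle, of i j "j # cs"]
    by (simp add: evenperm_swap comp_def)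
qed (auto simp: id_def[symmetric])

lemma one_plus_power_expand: "\<exists>c. (1 + x) ^ m = 1 + m * x + x ^ 2 * (c :: nat)"
proof (induction m)
  case 0
  show ?case by (intro exI[of _ 0]) simp
next
  case (Suc m)
  then obtain c where "(1 + x) ^ m = 1 + m * x + x ^ 2 * c" by blast
  then have "(1 + x) ^ Suc m = 1 + Suc m * x + x ^ 2 * (m + c + x * c)"
    by (simp add: algebra_simps power2_eq_square)
  then show ?case by blast
qed

text \<open>Raising to the \<open>p\<close>-th power improves a congruence to 1 modulo
  \<open>p ^ Suc a\<close> by one power of \<open>p\<close>. Consequently a multiplier that is 1
  modulo \<open>p\<close> acts on a cyclic \<open>p\<close>-group with order a power of
  \<open>p\<close>.\<close>

lemma power_prime_power_mod:
  fixes p r :: nat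
  assumes "r mod p = 1"
  shows "\<exists>c. r ^ (p ^ a) = 1 + p ^ Suc a * c"
proof (induction a)
  case 0
  have "r = 1 + p * (r div p)" using assms by (metis mult_div_mod_eq add.commute)
  then show ?case by (intro exI[of _ "r div p"]) simp
next
  case (Suc a)
  then obtain c where c: "r ^ (p ^ a) = 1 + p ^ Suc a * c" by blast
  define x where "x = p ^ Suc a * c"
  obtain d where d: "(1 + x) ^ p = 1 + p * x + x ^ 2 * d" using one_plus_power_expand by blast
  have "r ^ (p ^ Suc a) = (r ^ (p ^ a)) ^ p" by (simp add: mult.commute flip: power_mult)
  also have "\<dots> = (1 + x) ^ p" by (simp only: c x_def)
  also have "\<dots> = 1 + p ^ Suc (Suc a) * (c + p ^ a * c * c * d)"
    unfolding d by (simp add: x_def algebra_simps power2_eq_square)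
  finally show ?case by blast
qed

text \<open>The last condition says that \<open>Y\<close> is invariant under conjugation by the elements of \<open>A\<^sub>n\<close> that
  normalize \<open>\<langle>s\<rangle>\<close>, where \<open>g = t f t\<^sup>-\<^sup>1\<close>. Closure under inverses follows by finiteness.\<close>

definition admissible_perms :: "nat \<Rightarrow> nat \<Rightarrow> (nat \<Rightarrow> nat) \<Rightarrow> (nat \<Rightarrow> nat) set \<Rightarrow> bool" where
  "admissible_perms p n s Y \<longleftrightarrow>
     (\<forall>f\<in>Y. f permutes {1..n} \<and> evenperm f \<and> (\<exists>k. f ^^ (p ^ k) = id) \<and>
        (\<exists>r. \<forall>x. f (s x) = (s ^^ r) (f x))) \<and>
     s \<in> Y \<and> (\<forall>f\<in>Y. \<forall>g\<in>Y. f \<circ> g \<in> Y) \<and>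
     (\<forall>t f g. t permutes {1..n} \<and> evenperm t \<and> (\<exists>r. \<forall>x. t (s x) = (s ^^ r) (t x)) \<and> f \<in> Y \<and>
        g permutes {1..n} \<and> evenperm g \<and> (\<forall>x. g (t x) = t (f x)) \<longrightarrow> g \<in> Y)"

lemma admissible_permsI:
  assumes "\<And>f. f \<in> Y \<Longrightarrow> f permutes {1..n}" "\<And>f. f \<in> Y \<Longrightarrow> evenperm f"
    and "\<And>f. f \<in> Y \<Longrightarrow> \<exists>k. f ^^ (p ^ k) = id"
    and "\<And>f. f \<in> Y \<Longrightarrow> \<exists>r. \<forall>x. f (s x) = (s ^^ r) (f x)"
    and "s \<in> Y" "\<And>f g. f \<in> Y \<Longrightarrow> g \<in> Y \<Longrightarrow> f \<circ> g \<in> Y"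
    and conj: "\<And>t r f g. \<lbrakk>t permutes {1..n}; \<And>x. t (s x) = (s ^^ r) (t x); f \<in> Y;
        g permutes {1..n}; evenperm g; \<And>x. g (t x) = t (f x)\<rbrakk> \<Longrightarrow> g \<in> Y"
  shows "admissible_perms p n s Y"
  unfolding admissible_perms_def
proof (intro conjI ballI allI impI assms(1-6))
  fix t f g
  assume h: "t permutes {1..n} \<and> evenperm t \<and> (\<exists>r. \<forall>x. t (s x) = (s ^^ r) (t x)) \<and> f \<in> Y \<and>
    g permutes {1..n} \<and> evenperm g \<and> (\<forall>x. g (t x) = t (f x))"
  then obtain r where r: "\<forall>x. t (s x) = (s ^^ r) (t x)" by blast
  show "g \<in> Y" by (rule conj[of t r f g]) (use h r in blast)+
qed

text \<open>The \<open>p\<close>-subgroup of the alternating group that normalizes \<open>\<langle>s\<rangle>\<close>, acts trivially on \<open>\<langle>s\<rangle>\<close>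
  modulo \<open>p\<close>-th powers, and stabilizes every orbit of \<open>s\<close>.\<close>

definition orbit_normalizer :: "nat \<Rightarrow> nat \<Rightarrow> (nat \<Rightarrow> nat) \<Rightarrow> (nat \<Rightarrow> nat) set" where
  "orbit_normalizer p n s = {f. f permutes {1..n} \<and> evenperm f \<and>
     (\<exists>r. r mod p = 1 \<and> (\<forall>x. f (s x) = (s ^^ r) (f x))) \<and> (\<forall>x. \<exists>i. f x = (s ^^ i) x)}"

lemma permutes_imp_permutation: "f permutes {1..n :: nat} \<Longrightarrow> permutation f"
  using permutation_permutes by blast

lemma funpow_fixed_pow: "(f ^^ m) = id \<Longrightarrow> (f ^^ (m * k)) x = x"
  by (simp add: funpow_mult[symmetric] id_funpow)

text \<open>The point to check is that elements have \<open>p\<close>-power order. The power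
  \<open>f ^^ (p ^ a)\<close> commutes with \<open>s\<close>, since its multiplier acts as 1 on
  powers of \<open>s\<close>; as it preserves orbits, it agrees on each orbit with a power of
  \<open>s\<close>, and so its own power with exponent \<open>p ^ a\<close> is the identity.\<close>

lemma admissible_orbit_normalizer:
  assumes p: "Factorial_Ring.prime p" and s: "s permutes {1..n}" "evenperm s" "s ^^ (p ^ a) = id"
  shows "admissible_perms p n s (orbit_normalizer p n s)"
proof -
  have p1: "1 mod p = (1 :: nat)" using p prime_gt_1_nat[of p] by simp
  have ppow: "\<exists>k. f ^^ (p ^ k) = id" if f: "f \<in> orbit_normalizer p n s" for f
  proof -
    obtain r where r: "r mod p = 1" "\<And>x. f (s x) = (s ^^ r) (f x)"
      using f by (auto simp: orbit_normalizer_def)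
    have orb: "\<exists>i. f x = (s ^^ i) x" for x using f by (auto simp: orbit_normalizer_def)
    define h where "h = f ^^ (p ^ a)"
    have hs: "h (s x) = s (h x)" for x
    proof -
      obtain c where c: "r ^ (p ^ a) = 1 + p ^ Suc a * c" using power_prime_power_mod[OF r(1)] by blast
      have "(s ^^ (r ^ (p ^ a))) y = s y" for y
        unfolding c using funpow_fixed_pow[OF s(3), of "p * c" y] by (simp add: ac_simps)
      then show ?thesis
        unfolding h_def using funpow_conj_power[of f s r "p ^ a" x, OF r(2)] by simp
    qed
    have horb: "\<exists>i. h x = (s ^^ i) x" for x
    proof -
      have "\<exists>i. (f ^^ m) x = (s ^^ i) x" for m
      proof (induction m)
        case 0
        show ?case by (intro exI[of _ 0]) simp
      next
        case (Suc m)
        then obtain i where "(f ^^ m) x = (s ^^ i) x" by blast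
        then have "(f ^^ Suc m) x = (s ^^ (r * i)) (f x)" using funpow_conj[of f s r i x, OF r(2)] by simp
        moreover obtain j where "f x = (s ^^ j) x" using orb by blast
        ultimately have "(f ^^ Suc m) x = (s ^^ (r * i + j)) x" by (simp add: funpow_add)
        then show ?case by blast
      qed
      then show ?thesis by (simp add: h_def)
    qed
    have "(h ^^ (p ^ a)) x = x" for x
    proof -
      obtain i where i: "h x = (s ^^ i) x" using horb by blast
      have "(h ^^ m) x = (s ^^ (i * m)) x" for m
      proof (induction m)
        case (Suc m)
        have "(h ^^ Suc m) x = h ((s ^^ (i * m)) x)" using Suc by simp
        also have "\<dots> = (s ^^ (i * m)) (h x)" using funpow_conj[of h s 1 "i * m" x] hs by simp
        also have "\<dots> = (s ^^ (i * m + i)) x" by (simp add: i funpow_add)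
        finally show ?case by (simp add: add.commute)
      qed simp
      then have "(h ^^ (p ^ a)) x = (s ^^ (p ^ a * i)) x" by (simp add: mult.commute)
      then show ?thesis using funpow_fixed_pow[OF s(3)] by simp
    qed
    then have "f ^^ (p ^ a * p ^ a) = id" unfolding h_def by (auto simp: funpow_mult)
    then show ?thesis by (intro exI[of _ "a + a"]) (simp add: power_add)
  qed
  have comp: "f \<circ> g \<in> orbit_normalizer p n s"
    if f: "f \<in> orbit_normalizer p n s" and g: "g \<in> orbit_normalizer p n s" for f g
  proof -
    obtain r where r: "r mod p = 1" "\<And>x. f (s x) = (s ^^ r) (f x)"
      using f by (auto simp: orbit_normalizer_def)
    obtain r' where r': "r' mod p = 1" "\<And>x. g (s x) = (s ^^ r') (g x)"
      using g by (auto simp: orbit_normalizer_def)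
    have fg: "f permutes {1..n}" "g permutes {1..n}" "evenperm f" "evenperm g"
      using f g by (auto simp: orbit_normalizer_def)
    have "(f \<circ> g) (s x) = (s ^^ (r * r')) ((f \<circ> g) x)" for x
      using r'(2) funpow_conj[of f s r r', OF r(2)] by simp
    moreover have "(r * r') mod p = 1" using r(1) r'(1) p1 by (metis mod_mult_eq mult_1)
    moreover have "\<exists>i. (f \<circ> g) x = (s ^^ i) x" for x
    proof -
      obtain i j where "g x = (s ^^ i) x" "f x = (s ^^ j) x" using f g unfolding orbit_normalizer_def by blast
      then have "(f \<circ> g) x = (s ^^ (r * i + j)) x" using funpow_conj[of f s r i x, OF r(2)] by (simp add: funpow_add)
      then show ?thesis by blast
    qed
    moreover have "evenperm (f \<circ> g)"
      using fg evenperm_comp[of f g] permutes_imp_permutation by blast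
    ultimately show ?thesis
      using permutes_compose[OF fg(2,1)] unfolding orbit_normalizer_def by blast
  qed
  have conj: "g \<in> orbit_normalizer p n s"
    if t: "t permutes {1..n}" "\<And>x. t (s x) = (s ^^ r0) (t x)" and f: "f \<in> orbit_normalizer p n s"
      and g: "g permutes {1..n}" "evenperm g" "\<And>x. g (t x) = t (f x)" for t f g r0
  proof -
    obtain r where r: "r mod p = 1" "\<And>x. f (s x) = (s ^^ r) (f x)"
      using f by (auto simp: orbit_normalizer_def)
    obtain m where m: "t ^^ m = id" "m > 0"
      using permutation_is_nilpotent[OF permutes_imp_permutation[OF t(1)]] by blast
    \<comment> \<open>As \<open>t ^^ m = id\<close>, the multiplier \<open>r0\<close> is invertible
      modulo the order of \<open>s\<close> with inverse \<open>k\<close>. So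
      \<open>s = s ^^ (r0 * k)\<close>, and the conjugation by \<open>t\<close> can be read in the
      reverse direction.\<close>
    define k where "k = r0 ^ (m - 1)"
    have "r0 ^ m = r0 * k" using m(2) by (cases m) (simp_all add: k_def)
    then have k: "(s ^^ (r0 * k)) x = s x" for x
      using funpow_conj_power[of t s r0 m x, OF t(2)] m(1) by simp
    then have k': "s ^^ (r0 * k) = s" by blast
    have "g (s x) = (s ^^ r) (g x)" for x
    proof -
      obtain y where y: "x = t y" using t(1) permutes_surj by blast
      have "g (s x) = g ((s ^^ (r0 * k)) (t y))" using k y by simp
      also have "\<dots> = t (f ((s ^^ k) y))"
        unfolding funpow_conj[of t s r0 k y, OF t(2), symmetric] by (rule g(3))
      also have "\<dots> = t ((s ^^ (r * k)) (f y))" using funpow_conj[of f s r k y, OF r(2)] by simp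
      also have "\<dots> = (s ^^ (r0 * (r * k))) (t (f y))" using funpow_conj[of t s r0, OF t(2)] by simp
      also have "s ^^ (r0 * (r * k)) = (s ^^ (r0 * k)) ^^ r" by (simp add: funpow_mult ac_simps)
      also have "\<dots> = s ^^ r" by (simp only: k')
      finally show ?thesis using g(3) y by simp
    qed
    moreover have "\<exists>i. g x = (s ^^ i) x" for x
    proof -
      obtain y where y: "x = t y" using t(1) permutes_surj by blast
      obtain i where "f y = (s ^^ i) y" using f unfolding orbit_normalizer_def by blast
      then have "g x = (s ^^ (r0 * i)) x" using y g(3) funpow_conj[of t s r0, OF t(2)] by simp
      then show ?thesis by blast
    qed
    ultimately show ?thesis using g(1,2) r(1) unfolding orbit_normalizer_def by blast
  qed
  have "s \<in> orbit_normalizer p n s"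
    unfolding orbit_normalizer_def
  proof (intro CollectI conjI s allI)
    show "\<exists>r. r mod p = 1 \<and> (\<forall>x. s (s x) = (s ^^ r) (s x))" using p1 by (intro exI[of _ 1]) simp
    show "\<exists>i. s x = (s ^^ i) x" for x by (intro exI[of _ 1]) simp
  qed
  then show ?thesis
  proof (rule admissible_permsI[rotated 4])
    show "f permutes {1..n}" "evenperm f" "\<exists>r. \<forall>x. f (s x) = (s ^^ r) (f x)"
      if "f \<in> orbit_normalizer p n s" for f
      using that unfolding orbit_normalizer_def by blast+
  qed (fact ppow comp conj)+
qed

section \<open>Permutations supported on a single orbit\<close>

definition cycle_part :: "('a \<Rightarrow> 'a) \<Rightarrow> 'a \<Rightarrow> 'a \<Rightarrow> 'a" where
  "cycle_part s x = cycle_of_list (support s x)"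

definition orbit_of :: "('a \<Rightarrow> 'a) \<Rightarrow> 'a \<Rightarrow> 'a set" where
  "orbit_of s x = range (\<lambda>i. (s ^^ i) x)"

lemma orbit_of_step:
  assumes "permutation s"
  shows "s y \<in> orbit_of s x \<longleftrightarrow> y \<in> orbit_of s x"
proof
  assume "y \<in> orbit_of s x"
  then obtain i where "y = (s ^^ i) x" by (auto simp: orbit_of_def)
  then have "s y = (s ^^ Suc i) x" by simp
  then show "s y \<in> orbit_of s x" unfolding orbit_of_def by blast
next
  assume "s y \<in> orbit_of s x"
  then obtain i where i: "s y = (s ^^ i) x" by (auto simp: orbit_of_def)
  obtain m where m: "s ^^ m = id" "m > 0" using permutation_is_nilpotent[OF assms] by blast
  then obtain m' where m': "m = Suc m'" by (cases m) auto
  have "y = (s ^^ m') (s y)" using m m' by (simp add: funpow_swap1[symmetric] fun_eq_iff)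
  also have "\<dots> = (s ^^ (m' + i)) x" by (simp add: i funpow_add)
  finally show "y \<in> orbit_of s x" unfolding orbit_of_def by blast
qed

lemma orbit_of_subset:
  assumes "s permutes A" "x \<in> A"
  shows "orbit_of s x \<subseteq> A"
  using assms by (auto simp: orbit_of_def permutes_in_image permutes_funpow)

lemma orbit_of_sym:
  assumes "permutation s" "y \<in> orbit_of s x"
  shows "x \<in> orbit_of s y"
proof -
  obtain i where i: "y = (s ^^ i) x" using assms(2) by (auto simp: orbit_of_def)
  obtain m where m: "s ^^ m = id" "m > i" using permutation_is_nilpotent'[OF assms(1)] by blast
  have "(s ^^ (m - i)) y = (s ^^ (m - i + i)) x" by (simp only: i funpow_add comp_def)
  then have "(s ^^ (m - i)) y = x" using m by simp
  then show ?thesis unfolding orbit_of_def by (metis rangeI)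
qed

lemma cycle_part:
  assumes s: "permutation s"
  shows "y \<in> orbit_of s x \<Longrightarrow> cycle_part s x y = s y"
    and "y \<notin> orbit_of s x \<Longrightarrow> cycle_part s x y = y"
    and "permutation (cycle_part s x)"
    and "cycle_part s x (s y) = s (cycle_part s x y)"
    and "evenperm (cycle_part s x) \<longleftrightarrow> odd (least_power s x)"
proof -
  have set: "set (support s x) = orbit_of s x" unfolding orbit_of_def by (rule support_set[OF s])
  show 1: "y \<in> orbit_of s x \<Longrightarrow> cycle_part s x y = s y"
    and 2: "y \<notin> orbit_of s x \<Longrightarrow> cycle_part s x y = y" for y
    unfolding cycle_part_def using cycle_restrict[OF s, of y x] id_outside_supp[of y "support s x"] set by auto
  show "permutation (cycle_part s x)" unfolding cycle_part_def by (rule permutation_of_cycle)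
  show "cycle_part s x (s y) = s (cycle_part s x y)"
    using 1 2 orbit_of_step[OF s] by (cases "y \<in> orbit_of s x") simp_all
  have "support s x \<noteq> []" using least_power_of_permutation(2)[OF s, of x] by simp
  then show "evenperm (cycle_part s x) \<longleftrightarrow> odd (least_power s x)"
    unfolding cycle_part_def using evenperm_cycle_of_list[OF cycle_of_permutation[OF s]] by simp
qed

lemma cycle_part_permutes:
  assumes "s permutes {1..n :: nat}" "x \<in> {1..n}"
  shows "cycle_part s x permutes {1..n}"
proof -
  have "set (support s x) = orbit_of s x"
    unfolding orbit_of_def by (rule support_set[OF permutes_imp_permutation[OF assms(1)]])
  then show ?thesis
    unfolding cycle_part_def using cycle_permutes permutes_subset orbit_of_subset[OF assms] by metis
qed

lemma cycle_part_funpow: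
  assumes "permutation s" "s ^^ m = id"
  shows "cycle_part s x ^^ m = id"
proof
  fix y
  show "(cycle_part s x ^^ m) y = id y"
  proof (cases "y \<in> orbit_of s x")
    case True
    have "(cycle_part s x ^^ k) y = (s ^^ k) y \<and> (s ^^ k) y \<in> orbit_of s x" for k
      using True by (induction k) (simp_all add: cycle_part(1)[OF assms(1)] orbit_of_step[OF assms(1)])
    then show ?thesis using assms(2) by simp
  next
    case False
    have "(cycle_part s x ^^ k) y = y" for k
      by (induction k) (simp_all add: cycle_part(2)[OF assms(1) False])
    then show ?thesis by simp
  qed
qed

text \<open>Multiplication by \<open>r\<close> on the orbit of \<open>x\<close>, after identifying
  \<open>(s ^^ i) x\<close> with the residue of \<open>i\<close> modulo the orbit length. For
  \<open>r\<close> prime to this length it conjugates the cycle through \<open>x\<close> to its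
  \<open>r\<close>-th power.\<close>

definition mult_perm :: "('a \<Rightarrow> 'a) \<Rightarrow> 'a \<Rightarrow> nat \<Rightarrow> 'a \<Rightarrow> 'a" where
  "mult_perm s x r y = (if y \<in> orbit_of s x then (s ^^ (r * (SOME i. y = (s ^^ i) x))) x else y)"

lemma mult_perm:
  assumes s: "permutation s" and r: "coprime r (least_power s x)"
  shows "mult_perm s x r ((s ^^ i) x) = (s ^^ (r * i)) x"
    and "y \<notin> orbit_of s x \<Longrightarrow> mult_perm s x r y = y"
    and "s permutes A \<Longrightarrow> finite A \<Longrightarrow> x \<in> A \<Longrightarrow> mult_perm s x r permutes A"
proof -
  show 1: "mult_perm s x r ((s ^^ i) x) = (s ^^ (r * i)) x" for i
  proof -
    define j where "j = (SOME j. (s ^^ i) x = (s ^^ j) x)"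
    have "(s ^^ i) x = (s ^^ j) x" unfolding j_def by (rule someI) (rule refl)
    then have "i mod least_power s x = j mod least_power s x" using funpow_eq_iff[OF s] by simp
    then have "(r * i) mod least_power s x = (r * j) mod least_power s x" by (metis mod_mult_right_eq)
    then have "(s ^^ (r * i)) x = (s ^^ (r * j)) x" using funpow_eq_iff[OF s] by simp
    moreover have "(s ^^ i) x \<in> orbit_of s x" by (simp add: orbit_of_def)
    ultimately show ?thesis by (simp add: mult_perm_def j_def)
  qed
  show 2: "y \<notin> orbit_of s x \<Longrightarrow> mult_perm s x r y = y" for y by (simp add: mult_perm_def)
  assume A: "s permutes A" "finite A" "x \<in> A"
  have orbA: "orbit_of s x \<subseteq> A" by (rule orbit_of_subset[OF A(1,3)])
  have orb: "mult_perm s x r y \<in> orbit_of s x \<longleftrightarrow> y \<in> orbit_of s x" for y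
    using 1 2 by (cases "y \<in> orbit_of s x") (auto simp: orbit_of_def)
  have "inj_on (mult_perm s x r) A"
  proof (rule inj_onI)
    fix y z assume eq: "mult_perm s x r y = mult_perm s x r z"
    show "y = z"
    proof (cases "y \<in> orbit_of s x")
      case True
      then have "z \<in> orbit_of s x" using orb[of y] orb[of z] eq by simp
      then obtain i j where ij: "y = (s ^^ i) x" "z = (s ^^ j) x" using True by (auto simp: orbit_of_def)
      then have "(r * i) mod least_power s x = (r * j) mod least_power s x"
        using eq 1 funpow_eq_iff[OF s] by simp
      then have "i mod least_power s x = j mod least_power s x"
      proof (induction i j rule: linorder_wlog)
        case (le i j)
        then have "least_power s x dvd r * j - r * i"
          using mod_eq_dvd_iff_nat[of "r * i" "r * j" "least_power s x"] by auto
        then have "least_power s x dvd r * (j - i)" by (simp add: diff_mult_distrib2)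
        then have "least_power s x dvd j - i"
          using r by (metis coprime_commute coprime_dvd_mult_right_iff)
        then show ?case using mod_eq_dvd_iff_nat[OF le(1), of "least_power s x"] by auto
      qed simp
      then show ?thesis using ij funpow_eq_iff[OF s] by simp
    next
      case False
      then have "z \<notin> orbit_of s x" using orb[of y] orb[of z] eq by simp
      then show ?thesis using 2 False eq by simp
    qed
  qed
  moreover have "mult_perm s x r ` A \<subseteq> A"
  proof
    fix z assume "z \<in> mult_perm s x r ` A"
    then obtain y where "y \<in> A" "z = mult_perm s x r y" by blast
    then show "z \<in> A" using orb orbA 2 by (cases "y \<in> orbit_of s x") auto
  qed
  ultimately have "bij_betw (mult_perm s x r) A A"
    using A(2) by (simp add: bij_betw_def endo_inj_surj)
  then show "mult_perm s x r permutes A"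
    by (rule bij_imp_permutes) (use 2 orbA in blast)
qed

lemma prime_power_period:
  assumes p: "Factorial_Ring.prime p" and s: "s ^^ (p ^ a) = id" "s x \<noteq> x"
  obtains b where "least_power s x = p ^ Suc b"
proof -
  have "least_power s x dvd p ^ a" by (rule least_power_minimal) (simp add: s)
  then obtain b where b: "least_power s x = p ^ b" using divides_primepow_nat[OF p] by blast
  have "p ^ a > 0" using p prime_gt_0_nat by simp
  then have fixed: "(s ^^ least_power s x) x = x" by (intro least_powerI(1)[of "p ^ a"]) (simp_all add: s)
  have "b \<noteq> 0"
  proof
    assume "b = 0"
    with fixed b have "(s ^^ 1) x = x" by simp
    with s(2) show False by simp
  qed
  then show ?thesis using that b by (cases b) auto
qed

text \<open>Fixing \<open>y\<close> would force \<open>p\<close> to divide \<open>i\<close>, while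
  agreement with \<open>s\<close> at \<open>x\<close> would force \<open>i\<close> to be 1 modulo
  \<open>p\<close>.\<close>

lemma not_power_if_moves_and_fixes:
  assumes p: "Factorial_Ring.prime p" and s: "permutation s" "s ^^ (p ^ a) = id"
    and x: "f x = s x" "s x \<noteq> x" and y: "f y = y" "s y \<noteq> y"
  shows "f \<noteq> s ^^ i"
proof
  assume f: "f = s ^^ i"
  obtain b where b: "least_power s x = p ^ Suc b" by (rule prime_power_period[OF p s(2) x(2)])
  obtain c where c: "least_power s y = p ^ Suc c" by (rule prime_power_period[OF p s(2) y(2)])
  have "p ^ Suc c dvd i" using least_power_minimal[of i s y] f y(1) c by simp
  then have "p dvd i" by (metis dvd_trans dvd_triv_left power_Suc)
  have "(s ^^ i) x = (s ^^ 1) x" using f x(1) by simp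
  then have "i mod p ^ Suc b = 1 mod p ^ Suc b" using funpow_eq_iff[OF s(1)] b by metis
  then have "i mod p = 1 mod p" by (metis dvd_triv_left mod_mod_cancel power_Suc)
  moreover have "1 mod p = (1::nat)" using p prime_gt_1_nat[of p] by simp
  ultimately show False using \<open>p dvd i\<close> by (simp add: dvd_eq_mod_eq_0)
qed

lemma funpow_commute: "(s ^^ k) (s x) = s ((s ^^ k) x)"
  by (simp add: funpow_swap1)

text \<open>A permutation \<open>s\<close> of order a power of \<open>p\<close> for which \<open>\<langle>s\<rangle>\<close> is a radical \<open>p\<close>-subgroup of \<open>A\<^sub>n\<close>.\<close>

definition radical_perm :: "nat \<Rightarrow> nat \<Rightarrow> (nat \<Rightarrow> nat) \<Rightarrow> bool" where
  "radical_perm p n s \<longleftrightarrow> (\<forall>Y. admissible_perms p n s Y \<longrightarrow> (\<forall>f\<in>Y. \<exists>i. f = s ^^ i))"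

lemma radical_perm_orbit_normalizer:
  assumes "Factorial_Ring.prime p" "s permutes {1..n}" "evenperm s" "s ^^ (p ^ a) = id"
    and "radical_perm p n s" "f permutes {1..n}" "evenperm f" "r mod p = 1"
    "\<And>x. f (s x) = (s ^^ r) (f x)" "\<And>x. \<exists>i. f x = (s ^^ i) x"
  obtains i where "f = s ^^ i"
proof -
  have "f \<in> orbit_normalizer p n s" using assms(6-10) unfolding orbit_normalizer_def by blast
  then show ?thesis
    using admissible_orbit_normalizer[OF assms(1-4)] assms(5) that unfolding radical_perm_def by blast
qed

text \<open>The cycle of \<open>s\<close> through \<open>x\<close> is even because its order is odd;
  it commutes with \<open>s\<close> and preserves all orbits. Radicality makes it a power of
  \<open>s\<close>, which is impossible if \<open>s\<close> moves a point that the cycle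
  fixes.\<close>

lemma radical_perm_odd_single_orbit:
  assumes p: "Factorial_Ring.prime p" "odd p" and s: "s permutes {1..n}" "evenperm s" "s ^^ (p ^ a) = id"
    and rad: "radical_perm p n s" and x: "s x \<noteq> x" and y: "s y \<noteq> y"
  shows "y \<in> orbit_of s x"
proof (rule ccontr)
  assume no: "y \<notin> orbit_of s x"
  have ps: "permutation s" by (rule permutes_imp_permutation[OF s(1)])
  note cp = cycle_part[OF ps]
  let ?e = "cycle_part s x"
  have xn: "x \<in> {1..n}" using x s(1) permutes_not_in by metis
  have perm: "?e permutes {1..n}" by (rule cycle_part_permutes[OF s(1) xn])
  have "evenperm (?e ^^ (p ^ a))" using cycle_part_funpow[OF ps s(3)] by simp
  then have even: "evenperm ?e" using evenperm_funpow_odd[OF cp(3), of "p ^ a" x] p(2) by simp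
  have p1: "1 mod p = (1::nat)" using p prime_gt_1_nat[of p] by simp
  have orb: "\<exists>i. ?e z = (s ^^ i) z" for z
  proof (cases "z \<in> orbit_of s x")
    case True
    then show ?thesis using cp(1) by (intro exI[of _ 1]) simp
  next
    case False
    then show ?thesis using cp(2) by (intro exI[of _ 0]) simp
  qed
  obtain i where "?e = s ^^ i"
    by (rule radical_perm_orbit_normalizer[OF p(1) s rad perm even p1]) (use cp(4) orb in auto)
  moreover have "x \<in> orbit_of s x" unfolding orbit_of_def by (rule range_eqI[of _ _ 0]) simp
  ultimately show False
    using not_power_if_moves_and_fixes[OF p(1) ps s(3), of ?e x y i] cp(1,2) no x y by auto
qed

lemma mult_perm_commute:
  assumes ps: "permutation s" and r: "coprime r (least_power s x)"
    and z: "z \<in> orbit_of s x"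
  shows "mult_perm s x r (s z) = (s ^^ r) (mult_perm s x r z)"
proof -
  obtain i where i: "z = (s ^^ i) x" using z by (auto simp: orbit_of_def)
  have "mult_perm s x r (s z) = mult_perm s x r ((s ^^ Suc i) x)" by (simp add: i)
  also have "\<dots> = (s ^^ (r * Suc i)) x" by (rule mult_perm(1)[OF ps r])
  also have "\<dots> = (s ^^ r) ((s ^^ (r * i)) x)" by (simp add: funpow_add)
  finally show ?thesis using mult_perm(1)[OF ps r] by (simp add: i)
qed

lemma mult_perm_orbit:
  assumes ps: "permutation s" and r: "coprime r (least_power s x)"
  shows "\<exists>i. mult_perm s x r z = (s ^^ i) z"
proof (cases "z \<in> orbit_of s x")
  case True
  then obtain i where i: "z = (s ^^ i) x" by (auto simp: orbit_of_def)
  obtain j where "x = (s ^^ j) z" using orbit_of_sym[OF ps True] by (auto simp: orbit_of_def)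
  then have "mult_perm s x r z = (s ^^ (r * i + j)) z"
    using mult_perm(1)[OF ps r, of i] i by (simp add: funpow_add)
  then show ?thesis by blast
next
  case False
  then show ?thesis using mult_perm(2)[OF ps r] by (intro exI[of _ 0]) simp
qed

text \<open>For odd \<open>p\<close> a generator of a radical cyclic \<open>p\<close>-subgroup of \<open>A\<^sub>n\<close> is a single \<open>p\<close>-cycle; it is
  conjugate in \<open>A\<^sub>n\<close> to a power of itself different from itself: to the fourth power if \<open>p \<ge> 5\<close>,
  to the inverse if \<open>p = 3\<close>, where \<open>n \<ge> 5\<close> provides an odd permutation centralizing the \<open>3\<close>-cycle.\<close>

lemma radical_perm_odd:
  assumes p: "Factorial_Ring.prime p" "odd p" and s: "s permutes {1..n}" "evenperm s" "s ^^ (p ^ a) = id"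
    and rad: "radical_perm p n s" and "s \<noteq> id" and n: "n \<ge> 5"
  shows "s ^^ p = id" and "\<exists>f r. f permutes {1..n} \<and> evenperm f \<and> (\<forall>x. f (s x) = (s ^^ r) (f x)) \<and> s ^^ r \<noteq> s"
proof -
  obtain x where x: "s x \<noteq> x" using \<open>s \<noteq> id\<close> by fastforce
  have ps: "permutation s" by (rule permutes_imp_permutation[OF s(1)])
  have xn: "x \<in> {1..n}" using x s(1) permutes_not_in by metis
  have p3: "p \<ge> 3" using p prime_ge_2_nat[of p] by (cases "p = 2") auto
  have single: "y \<in> orbit_of s x" if "s y \<noteq> y" for y
    by (rule radical_perm_odd_single_orbit[OF p s rad x that])
  have outside: "s y = y" if "y \<notin> orbit_of s x" for y using single that by blast
  obtain b where b: "least_power s x = p ^ Suc b" by (rule prime_power_period[OF p(1) s(3) x])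
  have order: "(s ^^ least_power s x) y = y" for y
  proof (cases "y \<in> orbit_of s x")
    case True
    then obtain i where i: "y = (s ^^ i) x" by (auto simp: orbit_of_def)
    have "(s ^^ least_power s x) y = (s ^^ i) ((s ^^ least_power s x) x)"
      unfolding i by (metis add.commute comp_apply funpow_add)
    then show ?thesis using least_power_of_permutation(1)[OF ps, of x] i by simp
  next
    case False
    have "(s ^^ k) y = y" for k by (induction k) (simp_all add: outside[OF False])
    then show ?thesis by simp
  qed
  \<comment> \<open>The parity of \<open>mult_perm s x r\<close> is left undetermined; its square is
    even in any case, at the cost of the multiplier \<open>r * r\<close>.\<close>
  have square: "mult_perm s x r \<circ> mult_perm s x r permutes {1..n}"
      "evenperm (mult_perm s x r \<circ> mult_perm s x r)"
      "(mult_perm s x r \<circ> mult_perm s x r) (s z) = (s ^^ (r * r)) ((mult_perm s x r \<circ> mult_perm s x r) z)"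
      "mult_perm s x r permutes {1..n}"
      "mult_perm s x r (s z) = (s ^^ r) (mult_perm s x r z)"
    if r: "coprime r (least_power s x)" for r z
  proof -
    show perm: "mult_perm s x r permutes {1..n}" by (rule mult_perm(3)[OF ps r s(1) _ xn]) simp
    then show "mult_perm s x r \<circ> mult_perm s x r permutes {1..n}" by (rule permutes_compose[OF _ perm])
    show "evenperm (mult_perm s x r \<circ> mult_perm s x r)"
      using evenperm_comp[of "mult_perm s x r" "mult_perm s x r"] permutes_imp_permutation[OF perm] by simp
    show 1: "mult_perm s x r (s z) = (s ^^ r) (mult_perm s x r z)" for z
    proof (cases "z \<in> orbit_of s x")
      case False
      have "(s ^^ k) z = z" for k by (induction k) (simp_all add: outside[OF False])
      then show ?thesis using False orbit_of_step[OF ps, of z x] mult_perm(2)[OF ps r] outside by simp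
    qed (rule mult_perm_commute[OF ps r])
    show "(mult_perm s x r \<circ> mult_perm s x r) (s z) = (s ^^ (r * r)) ((mult_perm s x r \<circ> mult_perm s x r) z)"
      using 1 funpow_conj[of "mult_perm s x r" s r r, OF 1] by simp
  qed
  have "b = 0"
  proof (rule ccontr)
    assume "b \<noteq> 0"
    then obtain c where c: "b = Suc c" by (cases b) auto
    \<comment> \<open>For \<open>b > 0\<close> this multiplier is 1 modulo \<open>p\<close>, so the
      square of its permutation lies in the orbit normalizer and would be a power of
      \<open>s\<close>, hence commute with \<open>s\<close>. But
      \<open>r * r = 1 + p ^ b * (2 + p ^ b)\<close> is not 1 modulo the orbit length
      \<open>p ^ Suc b\<close>, as \<open>p\<close> is odd.\<close>
    define r where "r = 1 + p ^ b"
    have rp: "r mod p = 1"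
    proof -
      have "r = 1 + p * p ^ c" by (simp add: r_def c)
      then show ?thesis using p3 by (simp only: mod_mult_self2) simp
    qed
    then have "coprime r p" using p3 by (metis coprime_mod_left_iff coprime_1_left not_numeral_le_zero)
    then have cop: "coprime r (least_power s x)" unfolding b by (simp add: coprime_power_right_iff)
    let ?f = "mult_perm s x r \<circ> mult_perm s x r"
    have rr: "(r * r) mod p = 1" using mod_mult_eq[of r p r] rp p3 by simp
    have orb: "\<exists>i. ?f z = (s ^^ i) z" for z
    proof -
      obtain i where i: "mult_perm s x r z = (s ^^ i) z" using mult_perm_orbit[OF ps cop] by blast
      obtain j where "mult_perm s x r ((s ^^ i) z) = (s ^^ j) ((s ^^ i) z)" using mult_perm_orbit[OF ps cop] by blast
      then have "?f z = (s ^^ (j + i)) z" using i by (simp add: funpow_add)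
      then show ?thesis by blast
    qed
    obtain k where k: "?f = s ^^ k"
      by (rule radical_perm_orbit_normalizer[OF p(1) s rad square(1,2)[OF cop] rr square(3)[OF cop] orb])
    have fx: "?f x = x" using mult_perm(1)[OF ps cop, of 0] by simp
    have "?f (s x) = s (?f x)" unfolding k by (rule funpow_commute)
    then have "(s ^^ (r * r)) x = (s ^^ 1) x" using square(3)[OF cop, of x] fx by simp
    then have "(r * r) mod p ^ Suc b = 1 mod p ^ Suc b" using funpow_eq_iff[OF ps] b by metis
    moreover have "1 \<le> r * r" by (simp add: r_def)
    ultimately have "p ^ Suc b dvd r * r - 1" using mod_eq_dvd_iff_nat[of 1 "r * r" "p ^ Suc b"] by auto
    moreover have "r * r - 1 = p ^ b * (2 + p ^ b)" by (simp add: r_def algebra_simps)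
    ultimately have "p ^ b * p dvd p ^ b * (2 + p ^ b)" by (simp add: mult.commute)
    then have "p dvd 2 + p ^ b" using p3 dvd_times_left_cancel_iff[of "p ^ b" p "2 + p ^ b"] by simp
    moreover have "p dvd p ^ b" using c by simp
    ultimately have "p dvd 2" by (metis dvd_add_left_iff)
    then show False using p3 by (auto dest: dvd_imp_le)
  qed
  then have period: "least_power s x = p" using b by simp
  show "s ^^ p = id" using order period by auto
  have ne: "s ^^ r \<noteq> s" if "r mod p \<noteq> 1" for r
  proof
    assume "s ^^ r = s"
    then have "(s ^^ r) x = (s ^^ 1) x" by simp
    then have "r mod p = 1 mod p" using funpow_eq_iff[OF ps] period by metis
    then show False using that p3 by simp
  qed
  have cop2: "coprime 2 (least_power s x)" unfolding period using p(2) by simp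
  show "\<exists>f r. f permutes {1..n} \<and> evenperm f \<and> (\<forall>x. f (s x) = (s ^^ r) (f x)) \<and> s ^^ r \<noteq> s"
  \<comment> \<open>Squaring the multiplier 2 gives 4, which is 1 modulo 3. So for
    \<open>p = 3\<close> the multiplier 2 has to be used itself, and its parity corrected
    separately.\<close>
  proof (cases "p = 3")
    case False
    have "p \<noteq> 4" using p(2) by auto
    then have "p \<ge> 5" using p3 False by linarith
    then have "(2 * 2) mod p \<noteq> 1" by simp
    then show ?thesis using square(1-3)[OF cop2] ne by blast
  next
    case True
    have 2: "s ^^ 2 \<noteq> s" using ne[of 2] True by simp
    let ?g = "mult_perm s x 2"
    have gp: "permutation ?g" by (rule permutes_imp_permutation[OF square(4)[OF cop2]])
    show ?thesis
    proof (cases "evenperm ?g")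
      case True
      then show ?thesis using square(4,5)[OF cop2] 2 by blast
    next
      case False
      have "orbit_of s x = (\<lambda>i. (s ^^ i) x) ` {..<3}"
      proof
        show "orbit_of s x \<subseteq> (\<lambda>i. (s ^^ i) x) ` {..<3}"
        proof
          fix y assume "y \<in> orbit_of s x"
          then obtain i where "y = (s ^^ i) x" by (auto simp: orbit_of_def)
          then have "y = (s ^^ (i mod 3)) x" using funpow_eq_iff[OF ps, of i x "i mod 3"] period True by simp
          then show "y \<in> (\<lambda>i. (s ^^ i) x) ` {..<3}" by simp
        qed
      qed (auto simp: orbit_of_def)
      then have "finite (orbit_of s x)" "card (orbit_of s x) \<le> 3"
        using card_image_le[of "{..<3::nat}" "\<lambda>i. (s ^^ i) x"] by auto
      then have "card ({1..n} - orbit_of s x) \<ge> 2"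
        using diff_card_le_card_Diff[of "orbit_of s x" "{1..n}"] n by simp
      then obtain c d where cd: "c \<in> {1..n} - orbit_of s x" "d \<in> {1..n} - orbit_of s x" "c \<noteq> d"
        by (metis card_le_Suc0_iff_eq finite_Diff finite_atLeastAtMost not_less_eq_eq numeral_2_eq_2)
      let ?t = "transpose c d"
      have tp: "?t permutes {1..n}" using cd by (intro permutes_swap_id) auto
      have "\<not> evenperm ?t" using cd by (simp add: evenperm_swap)
      then have "evenperm (?t \<circ> ?g)"
        using False evenperm_comp[OF permutes_imp_permutation[OF tp] gp] by simp
      moreover have "?t \<circ> ?g permutes {1..n}" by (rule permutes_compose[OF square(4)[OF cop2] tp])
      moreover have ts: "?t (s z) = (s ^^ 1) (?t z)" for z
      proof (cases "z \<in> {c, d}")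
        case True
        then show ?thesis using outside cd by auto
      next
        case False
        have "s z \<noteq> c" "s z \<noteq> d"
          using False cd outside permutes_inj[OF s(1)] by (metis DiffD2 injD insertCI)+
        then show ?thesis using False by (simp add: transpose_apply_other)
      qed
      moreover have "(?t \<circ> ?g) (s z) = (s ^^ 2) ((?t \<circ> ?g) z)" for z
        using square(5)[OF cop2, of z] funpow_conj[of ?t s 1 2, OF ts] by simp
      ultimately show ?thesis using 2 by blast
    qed
  qed
qed

text \<open>The set is the centralizer of \<open>s\<close> among the even permutations of its
  support, a Klein four-group. It is invariant because whatever normalizes a group of order 2
  centralizes it. For the orders it is enough that its elements permute the two transposed pairs:
  their squares preserve each pair, so their fourth powers are trivial.\<close>

lemma admissible_two_transpositions:
  assumes s: "s permutes {1..n}" "evenperm s" and x: "s x \<noteq> x" "s (s x) = x" and y: "s y \<noteq> y" "s (s y) = y"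
    and xy: "y \<noteq> x" "y \<noteq> s x" and supp: "\<And>z. s z \<noteq> z \<Longrightarrow> z \<in> {x, s x, y, s y}"
  shows "admissible_perms 2 n s
    {f. f permutes {1..n} \<and> evenperm f \<and> (\<forall>z. f (s z) = s (f z)) \<and> (\<forall>z. s z = z \<longrightarrow> f z = z)}"
    (is "admissible_perms 2 n s ?Y")
proof -
  have s2: "s (s z) = z" for z
    using supp[of z] x y by (cases "s z = z") auto
  have spow: "s ^^ r = (if even r then id else s)" for r
  proof (induction r)
    case (Suc r)
    then show ?case using s2 by (auto simp: fun_eq_iff)
  qed simp
  have ppow: "\<exists>k. f ^^ (2 ^ k) = id" if f: "f \<in> ?Y" for f
  proof -
    have fs: "f (s z) = s (f z)" and fix0: "s z = z \<Longrightarrow> f z = z" and fp: "f permutes {1..n}" for z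
      using f by auto
    have fin: "f u = f v \<longleftrightarrow> u = v" for u v using permutes_inj[OF fp] by (auto dest: injD)
    have moved: "s (f z) \<noteq> f z" if "s z \<noteq> z" for z using fs fin that by metis
    have key: "f (f u) \<in> {u, s u}"
      if u: "s u \<noteq> u" "s v \<noteq> v" "v \<noteq> u" "v \<noteq> s u" "\<And>z. s z \<noteq> z \<Longrightarrow> z \<in> {u, s u, v, s v}" for u v
    proof -
      have fu: "f u \<in> {u, s u, v, s v}" and fv: "f v \<in> {u, s u, v, s v}"
        using u(5) moved u(1,2) by blast+
      have ne: "f v \<noteq> f u" "f v \<noteq> s (f u)" "s (f v) \<noteq> f u"
        using fin fs u s2 by metis+
      show ?thesis
      proof (cases "f u \<in> {u, s u}")
        case True
        then show ?thesis using fs s2 by auto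
      next
        case False
        then have "f u = v \<or> f u = s v" using fu by blast
        moreover have "f v = u \<or> f v = s u" using fv ne calculation s2 by auto
        ultimately show ?thesis using fs s2 by auto
      qed
    qed
    have ffx: "f (f x) \<in> {x, s x}" by (rule key[of x y]) (use x y xy supp in auto)
    have ffy: "f (f y) \<in> {y, s y}"
    proof (rule key[of y x])
      show "x \<noteq> s y" using xy(2) y(2) by auto
      show "z \<in> {y, s y, x, s x}" if "s z \<noteq> z" for z using supp[OF that] by blast
    qed (use x y xy in auto)
    have four: "f (f (f (f z))) = z" if "f (f z) \<in> {z, s z}" for z
      using that fs s2 by auto
    have "f (f (f (f z))) = z" for z
    proof (cases "s z = z")
      case True
      then show ?thesis using fix0 by simp
    next
      case False
      then have "z \<in> {x, s x, y, s y}" by (rule supp)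
      then show ?thesis using four[OF ffx] four[OF ffy] fs by auto
    qed
    then have "f ^^ 4 = id" by (auto simp: numeral_eq_Suc)
    then show ?thesis by (intro exI[of _ 2]) simp
  qed
  have conj: "g \<in> ?Y"
    if t: "t permutes {1..n}" "\<And>z. t (s z) = (s ^^ r) (t z)" and f: "f \<in> ?Y"
      and g: "g permutes {1..n}" "evenperm g" "\<And>z. g (t z) = t (f z)" for t f g r
  proof -
    have "odd r"
    proof
      assume "even r"
      then have "t (s x) = t x" using t(2)[of x] by (simp add: spow)
      then show False using x(1) permutes_inj[OF t(1)] by (auto dest: injD)
    qed
    then have ts: "t (s z) = s (t z)" for z using t(2)[of z] by (simp add: spow)
    have fs: "f (s z) = s (f z)" and fix0: "s z = z \<Longrightarrow> f z = z" for z using f by auto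
    have "g (s z) = s (g z) \<and> (s z = z \<longrightarrow> g z = z)" for z
    proof -
      obtain w where w: "z = t w" using t(1) permutes_surj by blast
      have "g (s z) = s (g z)" using w ts g(3) fs by metis
      moreover have "g z = z" if "s z = z"
      proof -
        have "t (s w) = t w" using that w ts by simp
        then have "s w = w" using permutes_inj[OF t(1)] by (auto dest: injD)
        then show ?thesis using fix0 g(3) w by simp
      qed
      ultimately show ?thesis by blast
    qed
    then show ?thesis using g(1,2) by blast
  qed
  have comp: "f \<circ> g \<in> ?Y" if "f \<in> ?Y" "g \<in> ?Y" for f g
    using that evenperm_comp[of f g] permutes_imp_permutation permutes_compose[of g _ f] by auto
  have sY: "s \<in> ?Y" using s by simp
  have nor: "\<exists>r. \<forall>z. f (s z) = (s ^^ r) (f z)" if "f \<in> ?Y" for f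
    using that by (intro exI[of _ 1]) simp
  show ?thesis
  proof (rule admissible_permsI)
    show "f permutes {1..n}" "evenperm f" if "f \<in> ?Y" for f using that by blast+
  qed (fact ppow nor sY comp conj)+
qed

text \<open>Here \<open>s\<close> has exactly two nontrivial orbits, one of them of length 2. The
  transposition on the short orbit commutes with \<open>s\<close> and can correct the parity of a
  permutation of the other orbit. Only if both orbits have length 2 is there nothing suitable that
  preserves them, and a double transposition interchanging them is taken.\<close>

lemma radical_perm_two_aux:
  assumes s: "s permutes {1..n}" "evenperm s" "s ^^ (2 ^ a) = id"
    and rad: "radical_perm 2 n s" and x: "s x \<noteq> x" and y: "s y \<noteq> y" "y \<notin> orbit_of s x"
    and supp: "\<And>z. s z \<noteq> z \<Longrightarrow> z \<in> orbit_of s x \<union> orbit_of s y"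
    and y2: "least_power s y = 2"
  shows False
proof -
  have two: "Factorial_Ring.prime (2 :: nat)" by (rule two_is_prime_nat)
  have ps: "permutation s" by (rule permutes_imp_permutation[OF s(1)])
  have xn: "x \<in> {1..n}" and yn: "y \<in> {1..n}" using x y s(1) permutes_not_in by metis+
  have xy: "x \<notin> orbit_of s y" using orbit_of_sym[OF ps, of x y] y(2) by blast
  have disj: "z \<notin> orbit_of s x" if z: "z \<in> orbit_of s y" for z
  proof
    assume "z \<in> orbit_of s x"
    obtain j where "y = (s ^^ j) z" using orbit_of_sym[OF ps z] by (auto simp: orbit_of_def)
    moreover obtain i where "z = (s ^^ i) x" using \<open>z \<in> orbit_of s x\<close> by (auto simp: orbit_of_def)
    ultimately have "y = (s ^^ (j + i)) x" by (simp add: funpow_add)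
    then show False using y(2) by (auto simp: orbit_of_def)
  qed
  have orb2: "orbit_of s z = {z, s z}" "s (s z) = z" if z2: "least_power s z = 2" for z
  proof -
    have "(s ^^ 2) z = z" using least_power_of_permutation(1)[OF ps, of z] z2 by simp
    then show ss: "s (s z) = z" by (simp add: numeral_2_eq_2)
    have "(s ^^ i) z \<in> {z, s z}" for i by (induction i) (use ss in auto)
    then have "orbit_of s z \<subseteq> {z, s z}" unfolding orbit_of_def by blast
    moreover have "z \<in> orbit_of s z" unfolding orbit_of_def by (rule range_eqI[of _ _ 0]) simp
    moreover have "s z \<in> orbit_of s z" unfolding orbit_of_def by (rule range_eqI[of _ _ 1]) simp
    ultimately show "orbit_of s z = {z, s z}" by blast
  qed
  obtain b where b: "least_power s x = 2 ^ Suc b" by (rule prime_power_period[OF two s(3) x])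
  show False
  proof (cases b)
    case 0
    then have x2: "least_power s x = 2" using b by simp
    note ox = orb2[OF x2] and oy = orb2[OF y2]
    have ne: "y \<noteq> x" "y \<noteq> s x" using y(2) ox by auto
    then have ne': "s y \<noteq> x" "s y \<noteq> s x" using oy(2) ox(2) by metis+
    \<comment> \<open>This element of the Klein four-group interchanges the two orbits, whereas
      powers of \<open>s\<close> preserve them.\<close>
    let ?f = "transpose x y \<circ> transpose (s x) (s y)"
    let ?Y = "{f. f permutes {1..n} \<and> evenperm f \<and> (\<forall>z. f (s z) = s (f z)) \<and> (\<forall>z. s z = z \<longrightarrow> f z = z)}"
    have adm: "admissible_perms 2 n s ?Y"
      by (rule admissible_two_transpositions[OF s(1,2) x ox(2) y(1) oy(2) ne]) (use supp ox(1) oy(1) in blast)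
    have sn: "s x \<in> {1..n}" "s y \<in> {1..n}" using xn yn s(1) by (simp_all only: permutes_in_image)
    have "?f permutes {1..n}" by (intro permutes_compose permutes_swap_id xn yn sn)
    moreover have "evenperm ?f"
      using evenperm_comp[OF permutation_swap_id permutation_swap_id, of x y "s x" "s y"] ne ne'
      by (simp add: evenperm_swap)
    moreover have "?f (s z) = s (?f z)" for z
    proof (cases "z \<in> {x, s x, y, s y}")
      case True
      then show ?thesis using ne ne' x y(1) ox(2) oy(2) by (auto simp: transpose_def)
    next
      case False
      have "s z \<noteq> x" "s z \<noteq> s x" "s z \<noteq> y" "s z \<noteq> s y"
        using False ox(2) oy(2) permutes_inj[OF s(1)] by (metis injD insertCI)+
      then show ?thesis using False by (simp add: transpose_apply_other)
    qed
    moreover have "?f z = z" if "s z = z" for z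
      using that ne ne' x y(1) ox(2) oy(2) by (auto simp: transpose_def)
    ultimately have "?f \<in> ?Y" by blast
    then obtain i where i: "?f = s ^^ i" using rad adm unfolding radical_perm_def by blast
    have "(s ^^ i) x \<in> {x, s x}" using ox(1) unfolding orbit_of_def by blast
    moreover have "?f x = y" using ne ne' x by (simp add: transpose_def)
    ultimately show False using i ne by simp
  next
    case (Suc c)
    \<comment> \<open>The multiplier is odd but not 1 modulo the orbit length
      \<open>2 ^ Suc b\<close>, so the permutation \<open>f\<close> built from it cannot commute
      with \<open>s\<close> and is no power of \<open>s\<close>.\<close>
    define r where "r = 1 + (2 :: nat) ^ b"
    have r1: "r mod 2 = 1" using Suc by (simp add: r_def)
    then have oddr: "odd r" by presburger
    have cop: "coprime r (least_power s x)" unfolding b using oddr by simp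
    let ?g = "mult_perm s x r" and ?e = "cycle_part s y"
    define f where "f = (if evenperm ?g then ?g else ?g \<circ> ?e)"
    note cp = cycle_part[OF ps] and mp = mult_perm[OF ps cop]
    have gp: "?g permutes {1..n}" by (rule mp(3)[OF s(1) _ xn]) simp
    have ep: "?e permutes {1..n}" by (rule cycle_part_permutes[OF s(1) yn])
    have fp: "f permutes {1..n}" unfolding f_def using gp permutes_compose[OF ep gp] by simp
    have "\<not> evenperm ?e" using cp(5)[of y] y2 by simp
    then have fe: "evenperm f"
      unfolding f_def using evenperm_comp[OF permutes_imp_permutation[OF gp] permutes_imp_permutation[OF ep]] by simp
    note oy = orb2[OF y2]
    have fx: "f z = ?g z" if "z \<notin> orbit_of s y" for z
      using cp(2)[OF that] by (simp add: f_def)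
    have fy: "f z \<in> {z, s z} \<and> f (s z) = s (f z) \<and> f z \<in> orbit_of s y" if z: "z \<in> orbit_of s y" for z
    proof -
      have sz: "s z \<in> orbit_of s y" using z orbit_of_step[OF ps] by blast
      then have ssz: "s (s z) \<in> orbit_of s y" using orbit_of_step[OF ps] by blast
      show ?thesis
        using mp(2)[OF disj[OF z]] mp(2)[OF disj[OF sz]] mp(2)[OF disj[OF ssz]] cp(1)[OF z] cp(1)[OF sz] z sz
        by (auto simp: f_def)
    qed
    have fs: "f (s z) = (s ^^ r) (f z)" for z
    proof (cases "z \<in> orbit_of s y")
      case True
      have "(s ^^ r) w = s w" if "w \<in> orbit_of s y" for w
      proof -
        have ww: "s (s w) = w" using that oy by auto
        have "(s ^^ k) w = (if even k then w else s w)" for k by (induction k) (use ww in auto)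
        then show ?thesis using oddr by simp
      qed
      then show ?thesis using fy[OF True] by simp
    next
      case False
      then have False': "s z \<notin> orbit_of s y" using orbit_of_step[OF ps] by blast
      show ?thesis
      proof (cases "z \<in> orbit_of s x")
        case True
        then show ?thesis using fx[OF False] fx[OF False'] mult_perm_commute[OF ps cop True] by simp
      next
        case no: False
        then have sz: "s z = z" using supp[of z] False by blast
        have "(s ^^ k) z = z" for k by (induction k) (simp_all add: sz)
        then show ?thesis using fx[OF False] mp(2)[OF no] sz by simp
      qed
    qed
    have orb: "\<exists>i. f z = (s ^^ i) z" for z
    proof (cases "z \<in> orbit_of s y")
      case True
      then have "f z = z \<or> f z = s z" using fy by blast
      then have "f z = (s ^^ 0) z \<or> f z = (s ^^ 1) z" by simp
      then show ?thesis by blast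
    next
      case False
      then show ?thesis using fx mult_perm_orbit[OF ps cop] by metis
    qed
    obtain k where k: "f = s ^^ k"
      by (rule radical_perm_orbit_normalizer[OF two s rad fp fe r1 fs orb])
    have fxx: "f x = x" using fx[OF xy] mp(1)[of 0] by simp
    have "f (s x) = s (f x)" unfolding k by (rule funpow_commute)
    then have "(s ^^ r) x = (s ^^ 1) x" using fs[of x] fxx by simp
    then have "r mod 2 ^ Suc b = 1 mod 2 ^ Suc b" using funpow_eq_iff[OF ps] b by metis
    moreover have "(1 :: nat) < 2 ^ b" using Suc by (intro one_less_power) simp_all
    then have "r < 2 ^ Suc b" by (simp add: r_def)
    ultimately show False using Suc by (simp add: r_def)
  qed
qed

text \<open>Every nontrivial cycle of \<open>s\<close> has even length and so is an odd permutation;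
  as \<open>s\<close> is even, there are at least two. The product of two cycles must be a power of
  \<open>s\<close>, which excludes a third; the square of one cycle must be a power of
  \<open>s\<close>, which excludes that both lengths exceed 2.\<close>

lemma radical_perm_two:
  assumes s: "s permutes {1..n}" "evenperm s" "s ^^ (2 ^ a) = id" and rad: "radical_perm 2 n s"
  shows "s = id"
proof (rule ccontr)
  assume "s \<noteq> id"
  then obtain x where x: "s x \<noteq> x" by fastforce
  have two: "Factorial_Ring.prime (2 :: nat)" by (rule two_is_prime_nat)
  have ps: "permutation s" by (rule permutes_imp_permutation[OF s(1)])
  note cp = cycle_part[OF ps]
  have moved: "z \<in> {1..n}" if "s z \<noteq> z" for z using that s(1) permutes_not_in by metis
  have self: "z \<in> orbit_of s z" for z unfolding orbit_of_def by (rule range_eqI[of _ _ 0]) simp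
  have odd: "\<not> evenperm (cycle_part s z)" if z: "s z \<noteq> z" for z
  proof -
    obtain b where "least_power s z = 2 ^ Suc b" by (rule prime_power_period[OF two s(3) z])
    then show ?thesis using cp(5)[of z] by simp
  qed
  have corb: "\<exists>i. cycle_part s w z = (s ^^ i) z" for w z
  proof (cases "z \<in> orbit_of s w")
    case True
    then show ?thesis using cp(1) by (intro exI[of _ 1]) simp
  next
    case False
    then show ?thesis using cp(2) by (intro exI[of _ 0]) simp
  qed
  have pair: "\<exists>i. cycle_part s w \<circ> cycle_part s w' = s ^^ i" if w: "s w \<noteq> w" "s w' \<noteq> w'" for w w'
  proof -
    let ?f = "cycle_part s w \<circ> cycle_part s w'"
    have fp: "?f permutes {1..n}"
      by (intro permutes_compose cycle_part_permutes[OF s(1)] moved w)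
    have fe: "evenperm ?f" using evenperm_comp[OF cp(3) cp(3), of w w'] odd w by simp
    have orb: "\<exists>i. ?f z = (s ^^ i) z" for z
    proof -
      obtain i where i: "cycle_part s w' z = (s ^^ i) z" using corb by blast
      obtain j where "cycle_part s w ((s ^^ i) z) = (s ^^ j) ((s ^^ i) z)" using corb by blast
      then have "?f z = (s ^^ (j + i)) z" using i by (simp add: funpow_add)
      then show ?thesis by blast
    qed
    have comm: "?f (s z) = (s ^^ 1) (?f z)" for z using cp(4) by simp
    obtain i where "?f = s ^^ i"
      by (rule radical_perm_orbit_normalizer[OF two s rad fp fe _ comm orb]) simp
    then show ?thesis by blast
  qed
  have "\<exists>y. s y \<noteq> y \<and> y \<notin> orbit_of s x"
  proof (rule ccontr)
    assume no: "\<nexists>y. s y \<noteq> y \<and> y \<notin> orbit_of s x"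
    have "cycle_part s x z = s z" for z
    proof (cases "z \<in> orbit_of s x")
      case True
      then show ?thesis by (rule cp(1))
    next
      case False
      then have "s z = z" using no by blast
      then show ?thesis using cp(2)[OF False] by simp
    qed
    then have "cycle_part s x = s" by blast
    then show False using odd[OF x] s(2) by simp
  qed
  then obtain y where y: "s y \<noteq> y" "y \<notin> orbit_of s x" by blast
  have xy: "x \<notin> orbit_of s y" using orbit_of_sym[OF ps, of x y] y(2) by blast
  have supp: "z \<in> orbit_of s x \<union> orbit_of s y" if z: "s z \<noteq> z" for z
  proof (rule ccontr)
    assume no: "z \<notin> orbit_of s x \<union> orbit_of s y"
    obtain i where i: "cycle_part s x \<circ> cycle_part s y = s ^^ i" using pair[OF x y(1)] by blast
    have "(cycle_part s x \<circ> cycle_part s y) x = s x" using cp(1)[OF self] cp(2)[OF xy] by simp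
    moreover have "(cycle_part s x \<circ> cycle_part s y) z = z" using cp(2) no by simp
    ultimately show False
      using not_power_if_moves_and_fixes[OF two ps s(3) _ x _ z, of "cycle_part s x \<circ> cycle_part s y" i] i by blast
  qed
  obtain b where b: "least_power s x = 2 ^ Suc b" by (rule prime_power_period[OF two s(3) x])
  obtain c where c: "least_power s y = 2 ^ Suc c" by (rule prime_power_period[OF two s(3) y(1)])
  show False
  proof (cases "c = 0")
    case True
    then show False using radical_perm_two_aux[OF s rad x y supp] c by simp
  next
    case c0: False
    show False
    proof (cases "b = 0")
      case True
      have "z \<in> orbit_of s y \<union> orbit_of s x" if "s z \<noteq> z" for z using supp[OF that] by blast
      then show False using radical_perm_two_aux[OF s rad y(1) x xy] b True by simp
    next
      case b0: False
      \<comment> \<open>Comparison on the orbit of \<open>x\<close> makes \<open>i\<close> congruent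
        to 2 modulo 4, and on the orbit of \<open>y\<close> it makes \<open>i\<close> divisible by
        4.\<close>
      obtain i where i: "cycle_part s x \<circ> cycle_part s x = s ^^ i" using pair[OF x x] by blast
      have "s x \<in> orbit_of s x" using self orbit_of_step[OF ps] by blast
      then have "(cycle_part s x \<circ> cycle_part s x) x = (s ^^ 2) x"
        using cp(1)[of "s x" x] cp(1)[OF self] by (simp add: numeral_2_eq_2)
      then have "i mod 2 ^ Suc b = 2 mod 2 ^ Suc b" using i funpow_eq_iff[OF ps] b by metis
      moreover have four: "(4 :: nat) dvd 2 ^ Suc k" if "k \<noteq> 0" for k
        using that by (cases k) auto
      ultimately have i4: "i mod 4 = 2 mod 4" using b0 by (metis mod_mod_cancel)
      have "(cycle_part s x \<circ> cycle_part s x) y = y" using cp(2) y(2) by simp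
      then have "(s ^^ i) y = y" using i by simp
      then have "2 ^ Suc c dvd i" using least_power_minimal[of i s y] c by simp
      then have "4 dvd i" using four[OF c0] dvd_trans by blast
      then show False using i4 by auto
    qed
  qed
qed

section \<open>Radical subgroups modulo the center\<close>

text \<open>Equivalent to \<open>D\<close> being the largest normal \<open>p\<close>-subgroup of its
  normalizer, in a form that does not require that subgroup to be constructed.\<close>

definition radical_p_subgroup :: "nat \<Rightarrow> 'g set \<Rightarrow> ('g, 'x) monoid_scheme \<Rightarrow> bool" where
  "radical_p_subgroup p D G \<longleftrightarrow> p_subgroup p D G \<and>
     (\<forall>Q. p_subgroup p Q G \<and> D \<subseteq> Q \<and> Q \<subseteq> normalizer G D \<and>
        (\<forall>g\<in>normalizer G D. \<forall>h\<in>Q. g \<otimes>\<^bsub>G\<^esub> h \<otimes>\<^bsub>G\<^esub> inv\<^bsub>G\<^esub> g \<in> Q) \<longrightarrow> Q = D)"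

context finite_group begin

lemma defect_group_radical_p_subgroup:
  fixes B :: "'a \<Rightarrow> 'k::field"
  assumes "is_block G B" "is_defect_group G B D" "Factorial_Ring.prime p" "CHAR('k) = p"
  shows "radical_p_subgroup p D G"
  unfolding radical_p_subgroup_def
proof (intro conjI allI impI)
  show "p_subgroup p D G" using assms by (simp add: is_defect_group_def)
  fix Q
  assume Q: "p_subgroup p Q G \<and> D \<subseteq> Q \<and> Q \<subseteq> normalizer G D \<and>
    (\<forall>g\<in>normalizer G D. \<forall>h\<in>Q. g \<otimes> h \<otimes> inv g \<in> Q)"
  then obtain m where "card Q = p ^ m" "subgroup Q G" by (auto simp: p_subgroup_def)
  then show "Q = D" using defect_group_radical[OF assms, of Q m] Q by blast
qed

lemma center_iff: "z \<in> center G \<longleftrightarrow> z \<in> carrier G \<and> (\<forall>x\<in>carrier G. z \<otimes> x = x \<otimes> z)"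
  by (simp add: center_def)

lemma center_closed: "z \<in> center G \<Longrightarrow> z \<in> carrier G"
  by (simp add: center_def)

lemma center_comm: "z \<in> center G \<Longrightarrow> x \<in> carrier G \<Longrightarrow> z \<otimes> x = x \<otimes> z"
  by (simp add: center_def)

lemma conj_center: "z \<in> center G \<Longrightarrow> x \<in> carrier G \<Longrightarrow> x \<otimes> z \<otimes> inv x = z"
  using center_comm[of z x, symmetric] center_closed[of z] by (simp add: m_assoc)

lemma conj_mult_center:
  assumes "a \<in> carrier G" "z \<in> center G" "x \<in> carrier G"
  shows "x \<otimes> (a \<otimes> z) \<otimes> inv x = x \<otimes> a \<otimes> inv x \<otimes> z"
  using assms center_closed[of z] center_comm[of z "inv x"] by (simp add: m_assoc)

lemma subgroup_center: "subgroup (center G) G"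
proof
  show "center G \<subseteq> carrier G" using center_closed by blast
  show "x \<otimes> y \<in> center G" if h: "x \<in> center G" "y \<in> center G" for x y
  proof -
    have c: "x \<in> carrier G" "y \<in> carrier G" using h center_closed by blast+
    have "x \<otimes> y \<otimes> w = w \<otimes> (x \<otimes> y)" if w: "w \<in> carrier G" for w
    proof -
      have "x \<otimes> y \<otimes> w = x \<otimes> w \<otimes> y" using c w center_comm[OF h(2) w] by (simp add: m_assoc)
      also have "x \<otimes> w = w \<otimes> x" by (rule center_comm[OF h(1) w])
      finally show ?thesis using c w by (simp add: m_assoc)
    qed
    then show ?thesis using c by (simp add: center_iff)
  qed
  show "\<one> \<in> center G" by (simp add: center_iff)
  show "inv x \<in> center G" if x: "x \<in> center G" for x
  proof -
    have "inv x \<otimes> y = y \<otimes> inv x" if y: "y \<in> carrier G" for y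
      using center_comm[OF x, of "inv y"] center_closed[OF x] y
      by (metis inv_mult_group inv_closed inv_inv)
    then show ?thesis using center_closed[OF x] by (simp add: center_iff)
  qed
qed

lemma normal_center: "center G \<lhd> G"
  using subgroup_center conj_center by (simp add: normal_inv_iff)

lemma subgroup_mult_center:
  assumes "subgroup H G"
  shows "subgroup {a \<otimes> z | a z. a \<in> H \<and> z \<in> center G} G" (is "subgroup ?K G")
proof
  interpret H: subgroup H G by fact
  interpret Z: subgroup "center G" G by (rule subgroup_center)
  show "?K \<subseteq> carrier G" using H.subset Z.subset by auto
  have "\<one> = \<one> \<otimes> \<one>" by simp
  then show "\<one> \<in> ?K" using H.one_closed Z.one_closed by blast
  show "x \<otimes> y \<in> ?K" if x: "x \<in> ?K" and y: "y \<in> ?K" for x y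
  proof -
    obtain a z b w where e: "x = a \<otimes> z" "y = b \<otimes> w" "a \<in> H" "b \<in> H" "z \<in> center G" "w \<in> center G"
      using x y by blast
    then have "x \<otimes> y = (a \<otimes> b) \<otimes> (z \<otimes> w)"
      using center_comm[of z b] by (simp add: m_assoc H.mem_carrier Z.mem_carrier)
        (metis H.mem_carrier Z.mem_carrier m_assoc)
    then show ?thesis using e H.m_closed Z.m_closed by blast
  qed
  show "inv x \<in> ?K" if x: "x \<in> ?K" for x
  proof -
    obtain a z where e: "x = a \<otimes> z" "a \<in> H" "z \<in> center G" using x by blast
    then have "inv x = inv a \<otimes> inv z"
      using center_comm[of "inv z" "inv a"] by (simp add: inv_mult_group H.mem_carrier Z.mem_carrier)
    then show ?thesis using e H.m_inv_closed Z.m_inv_closed by blast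
  qed
qed

lemma pow_card_subgroup:
  assumes "subgroup H G" "x \<in> H"
  shows "x [^] card H = \<one>"
proof -
  interpret K: group "G\<lparr>carrier := H\<rparr>" by (rule subgroup_imp_group[OF assms(1)])
  have "x [^]\<^bsub>G\<lparr>carrier := H\<rparr>\<^esub> card H = \<one>"
    using K.pow_order_eq_1[of x] assms(2) by (simp add: Coset.order_def)
  then show ?thesis by (simp add: nat_pow_def)
qed

lemma subgroup_pow_closed: "subgroup H G \<Longrightarrow> x \<in> H \<Longrightarrow> x [^] (k :: nat) \<in> H"
  by (induction k) (auto intro: subgroup.m_closed subgroup.one_closed)

lemma inv_as_pow: "x \<in> carrier G \<Longrightarrow> inv x = x [^] (card (carrier G) - 1)"
proof -
  assume x: "x \<in> carrier G"
  have pos: "card (carrier G) > 0" using card_gt_0_iff by (metis empty_iff finite_carrier one_closed)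
  have "x [^] (card (carrier G) - 1) \<otimes> x = x [^] Suc (card (carrier G) - 1)" by simp
  also have "\<dots> = \<one>" using pos pow_card_subgroup[OF subgroup_self x] by simp
  finally show ?thesis using x by (simp add: inv_equality)
qed

lemma generate_singleton:
  assumes "x \<in> carrier G"
  shows "generate G {x} = range (\<lambda>k :: nat. x [^] k)"
proof -
  have "ord x \<noteq> 0" using ord_ge_1[OF finite_carrier assms] by simp
  then show ?thesis using generate_pow_nat[OF assms] by blast
qed

text \<open>The cyclic group generated by \<open>x\<close> has order a power of \<open>p\<close>, so
  a conjugate of it lies in \<open>P\<close>, and \<open>P\<close> is normal.\<close>

lemma p_element_in_normal_sylow:
  assumes p: "Factorial_Ring.prime p" and Y: "subgroup Y G" and P: "subgroup P G" "P \<subseteq> Y" "\<not> p dvd card Y div card P"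
    and normal: "\<And>y h. y \<in> Y \<Longrightarrow> h \<in> P \<Longrightarrow> y \<otimes> h \<otimes> inv y \<in> P"
    and x: "x \<in> Y" "x [^] (p ^ k) = \<one>"
  shows "x \<in> P"
proof -
  interpret Y: subgroup Y G by fact
  have xc: "x \<in> carrier G" using x Y.mem_carrier by blast
  have "card (generate G {x}) dvd p ^ k" using x(2) xc generate_pow_card pow_eq_id by metis
  then obtain j where j: "card (generate G {x}) = p ^ j" using p divides_primepow_nat by blast
  have gen: "subgroup (generate G {x}) G" using xc by (intro generate_is_subgroup) simp
  have genY: "generate G {x} \<subseteq> Y" using generate_singleton[OF xc] subgroup_pow_closed[OF Y x(1)] by auto
  obtain y where y: "y \<in> Y" "\<And>r. r \<in> generate G {x} \<Longrightarrow> inv y \<otimes> r \<otimes> y \<in> P"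
    by (rule sylow_conj[OF finite_carrier Y P(1,2) gen genY j p P(3)]) blast
  have yc: "y \<in> carrier G" using y Y.mem_carrier by blast
  have "inv y \<otimes> x \<otimes> y \<in> P" using y(2) generate.incl[of x "{x}" G] by blast
  then have "y \<otimes> (inv y \<otimes> x \<otimes> y) \<otimes> inv y \<in> P" using normal y(1) by blast
  then show ?thesis using conj_inv_conj[of "inv y" x] yc xc by simp
qed

text \<open>A group that is a \<open>p\<close>-group modulo a central subgroup has a central Sylow \<open>q\<close>-subgroup for each
  prime \<open>q \<noteq> p\<close>.\<close>

lemma p_group_modulo_center:
  assumes p: "Factorial_Ring.prime p" and Y: "subgroup Y G" "center G \<subseteq> Y"
    and ppow: "\<And>y. y \<in> Y \<Longrightarrow> \<exists>k. y [^] (p ^ k) \<in> center G"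
  obtains P m where "subgroup P G" "P \<subseteq> Y" "card P = p ^ m" "\<not> p dvd card Y div card P"
    "\<forall>y\<in>Y. \<exists>a\<in>P. \<exists>z\<in>center G. y = a \<otimes> z" "\<forall>y\<in>Y. \<forall>h\<in>P. y \<otimes> h \<otimes> inv y \<in> P"
proof -
  interpret Y: subgroup Y G by fact
  interpret Z: subgroup "center G" G by (rule subgroup_center)
  obtain P where P: "subgroup P G" "P \<subseteq> Y" "\<exists>n. card P = p ^ n" "card P dvd card Y"
    "\<not> p dvd card Y div card P"
    by (rule subgroup_sylow_exists[OF finite_carrier Y(1) p])
  interpret P: subgroup P G by (rule P(1))
  define H where "H = {a \<otimes> z | a z. a \<in> P \<and> z \<in> center G}"
  have H: "subgroup H G" unfolding H_def by (rule subgroup_mult_center[OF P(1)])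
  have HY: "H \<subseteq> Y" using P(2) Y unfolding H_def by blast
  have Hc: "a \<otimes> z \<in> H" if "a \<in> P" "z \<in> center G" for a z using that unfolding H_def by blast
  have PH: "P \<subseteq> H" using Hc[OF _ Z.one_closed] P.mem_carrier by auto
  have ZH: "center G \<subseteq> H" using Hc[OF P.one_closed] Z.mem_carrier by auto
  define i where "i = card ((\<lambda>y. y <# H) ` Y)"
  have i: "i * card H = card Y" unfolding i_def by (rule card_lcosets[OF finite_carrier Y(1) H HY])
  have ip: "card ((\<lambda>y. y <# P) ` H) * card P = card H" by (rule card_lcosets[OF finite_carrier H P(1) PH])
  have pos: "card P > 0" "card H > 0" "card Y > 0" using P(1) H Y(1) card_subgroup_pos by blast+
  \<comment> \<open>A prime divisor \<open>q\<close> of the index of \<open>H\<close>, the product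
    of \<open>P\<close> with the center, differs from \<open>p\<close>. A Sylow
    \<open>q\<close>-subgroup \<open>S\<close> is central and so lies in \<open>H\<close>; then
    \<open>q\<close> would divide the index of \<open>S\<close> in \<open>Y\<close>.\<close>
  have "i = 1"
  proof (rule ccontr)
    assume "i \<noteq> 1"
    then obtain q where q: "Factorial_Ring.prime q" "q dvd i" using prime_factor_nat by blast
    have "card Y div card P = i * card ((\<lambda>y. y <# P) ` H)"
      unfolding i[symmetric] ip[symmetric] using pos(1) by (simp add: mult.assoc[symmetric])
    then have "q \<noteq> p" using P(5) q(2) by auto
    obtain S where S: "subgroup S G" "S \<subseteq> Y" "\<exists>e. card S = q ^ e" "card S dvd card Y" "\<not> q dvd card Y div card S"
      by (rule subgroup_sylow_exists[OF finite_carrier Y(1) q(1)])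
    obtain e where e: "card S = q ^ e" using S(3) by blast
    have "S \<subseteq> center G"
    proof
      fix s assume s: "s \<in> S"
      have sc: "s \<in> carrier G" using s S(2) Y.mem_carrier by blast
      have s1: "s [^] (q ^ e) = \<one>" using pow_card_subgroup[OF S(1) s] e by simp
      obtain k where k: "s [^] (p ^ k) \<in> center G" using ppow s S(2) by blast
      have "coprime p q" using p q(1) \<open>q \<noteq> p\<close> primes_coprime by blast
      then have "coprime (p ^ k) (q ^ e)" by simp
      moreover have "p ^ k \<noteq> 0" using p by (auto simp: not_prime_0)
      \<comment> \<open>By Bezout's identity \<open>s\<close> is a power of the central element
        \<open>s [^] (p ^ k)\<close>.\<close>
      ultimately obtain u v where uv: "p ^ k * u = q ^ e * v + 1"
        using bezout_nat[of "p ^ k" "q ^ e"] by (auto simp: coprime_iff_gcd_eq_1)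
      have "(s [^] (p ^ k)) [^] u = (s [^] (q ^ e)) [^] v \<otimes> s"
        using sc by (simp add: nat_pow_pow uv nat_pow_mult[symmetric])
      then have "(s [^] (p ^ k)) [^] u = s" using s1 sc by simp
      then show "s \<in> center G" using subgroup_pow_closed[OF subgroup_center k] by metis
    qed
    then have SH: "S \<subseteq> H" using ZH by blast
    have iS: "card ((\<lambda>y. y <# S) ` H) * card S = card H" by (rule card_lcosets[OF finite_carrier H S(1) SH])
    have "card S > 0" using card_subgroup_pos[OF S(1)] .
    then have "card Y div card S = i * card ((\<lambda>y. y <# S) ` H)"
      unfolding i[symmetric] iS[symmetric] by (simp add: mult.assoc[symmetric])
    then show False using S(5) q(2) by simp
  qed
  then have "H = Y" using i HY by (intro card_subset_eq finite_subgroup[OF Y(1)]) simp_all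
  then have dec: "\<exists>a\<in>P. \<exists>z\<in>center G. y = a \<otimes> z" if "y \<in> Y" for y using that unfolding H_def by blast
  have "y \<otimes> h \<otimes> inv y \<in> P" if y: "y \<in> Y" and h: "h \<in> P" for y h
  proof -
    obtain a z where e: "a \<in> P" "z \<in> center G" "y = a \<otimes> z" using dec[OF y] by blast
    have c: "a \<in> carrier G" "z \<in> carrier G" "h \<in> carrier G" using e h P.mem_carrier Z.mem_carrier by blast+
    have "y \<otimes> h \<otimes> inv y = a \<otimes> (z \<otimes> h \<otimes> inv z) \<otimes> inv a"
      using c e(3) by (simp add: inv_mult_group m_assoc)
    also have "z \<otimes> h \<otimes> inv z = h" using center_comm[OF e(2) c(3)] c by (simp add: m_assoc)
    finally show ?thesis using e(1) h by simp
  qed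
  then show ?thesis using that[OF P(1,2) _ P(5)] dec P(3) by blast
qed

text \<open>A Sylow \<open>p\<close>-subgroup of \<open>Y\<close> is normal in \<open>Y\<close> and
  hence consists of all \<open>p\<close>-elements of \<open>Y\<close>. This description makes it
  contain \<open>D\<close> and be invariant under the normalizer of \<open>D\<close>, so radicality
  identifies it with \<open>D\<close>.\<close>

lemma radical_absorbs:
  assumes p: "Factorial_Ring.prime p" and D: "radical_p_subgroup p D G"
    and Y: "subgroup Y G" "center G \<subseteq> Y" "D \<subseteq> Y" "Y \<subseteq> normalizer G D"
    and ppow: "\<And>y. y \<in> Y \<Longrightarrow> \<exists>k. y [^] (p ^ k) \<in> center G"
    and conj: "\<And>g y. g \<in> normalizer G D \<Longrightarrow> y \<in> Y \<Longrightarrow> g \<otimes> y \<otimes> inv g \<in> Y"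
  shows "y \<in> Y \<Longrightarrow> \<exists>d\<in>D. \<exists>z\<in>center G. y = d \<otimes> z"
    and "y \<in> Y \<Longrightarrow> y [^] (p ^ k) = \<one> \<Longrightarrow> y \<in> D"
proof -
  interpret Y: subgroup Y G by fact
  obtain P m where P: "subgroup P G" "P \<subseteq> Y" "card P = p ^ m" "\<not> p dvd card Y div card P"
    "\<forall>y\<in>Y. \<exists>a\<in>P. \<exists>z\<in>center G. y = a \<otimes> z" "\<forall>y\<in>Y. \<forall>h\<in>P. y \<otimes> h \<otimes> inv y \<in> P"
    by (rule p_group_modulo_center[OF p Y(1,2) ppow])
  have pel: "x \<in> P" if "x \<in> Y" "x [^] (p ^ k) = \<one>" for x k
    using p_element_in_normal_sylow[OF p Y(1) P(1,2,4) _ that] P(6) by blast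
  obtain a where a: "subgroup D G" "card D = p ^ a"
    using D by (auto simp: radical_p_subgroup_def p_subgroup_def)
  have DP: "D \<subseteq> P"
  proof
    fix d assume d: "d \<in> D"
    show "d \<in> P" by (rule pel[of d a]) (use d Y(3) pow_card_subgroup[OF a(1) d] a(2) in auto)
  qed
  have inv: "g \<otimes> h \<otimes> inv g \<in> P" if g: "g \<in> normalizer G D" and h: "h \<in> P" for g h
  proof -
    have gc: "g \<in> carrier G" "h \<in> carrier G"
      using g subgroup_normalizer[OF subgroup.subset[OF a(1)]] subgroup.subset h P(1) by blast+
    have "(g \<otimes> h \<otimes> inv g) [^] k = g \<otimes> (h [^] k) \<otimes> inv g" for k :: nat
      using gc by (induction k) (simp_all add: m_assoc)
    then have "(g \<otimes> h \<otimes> inv g) [^] (p ^ m) = \<one>" using gc pow_card_subgroup[OF P(1) h] P(3) by simp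
    moreover have "g \<otimes> h \<otimes> inv g \<in> Y" using conj[OF g] h P(2) by blast
    ultimately show ?thesis by (intro pel)
  qed
  have "P = D"
    using D P(1-3) DP Y(4) inv unfolding radical_p_subgroup_def p_subgroup_def by blast
  then show "y \<in> Y \<Longrightarrow> \<exists>d\<in>D. \<exists>z\<in>center G. y = d \<otimes> z"
    "y \<in> Y \<Longrightarrow> y [^] (p ^ k) = \<one> \<Longrightarrow> y \<in> D"
    using P(5) pel by blast+
qed

text \<open>The product of \<open>D\<close> with the center is one of the groups \<open>Y\<close> to
  which \<open>radical_absorbs\<close> applies, and its \<open>p\<close>-elements include the
  central ones.\<close>

lemma p_element_center_in_radical:
  assumes p: "Factorial_Ring.prime p" and D: "radical_p_subgroup p D G"
    and z: "z \<in> center G" "z [^] (p ^ k) = \<one>"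
  shows "z \<in> D"
proof -
  obtain a where a: "subgroup D G" "card D = p ^ a"
    using D by (auto simp: radical_p_subgroup_def p_subgroup_def)
  interpret D: subgroup D G by (rule a(1))
  interpret Z: subgroup "center G" G by (rule subgroup_center)
  interpret N: subgroup "normalizer G D" G by (rule subgroup_normalizer[OF D.subset])
  define Y where "Y = {d \<otimes> w | d w. d \<in> D \<and> w \<in> center G}"
  have Yc: "d \<otimes> w \<in> Y" if "d \<in> D" "w \<in> center G" for d w using that unfolding Y_def by blast
  have ZN: "center G \<subseteq> normalizer G D"
  proof
    fix w assume w: "w \<in> center G"
    have "w \<otimes> d \<otimes> inv w = d" if "d \<in> D" for d
      using center_comm[OF w, of d] D.mem_carrier[OF that] center_closed[OF w] by (simp add: m_assoc)
    then show "w \<in> normalizer G D" using center_closed[OF w] by (simp add: normalizer_iff_closed[OF D.subset])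
  qed
  have DY: "d \<in> Y" if "d \<in> D" for d using Yc[OF that Z.one_closed] that D.mem_carrier by simp
  have ZY: "w \<in> Y" if "w \<in> center G" for w using Yc[OF D.one_closed that] that Z.mem_carrier by simp
  show ?thesis
  proof (rule radical_absorbs(2)[OF p D, of Y])
    show "subgroup Y G" unfolding Y_def by (rule subgroup_mult_center[OF a(1)])
    show "Y \<subseteq> normalizer G D"
      using subgroup_self_normalizer[OF a(1)] ZN N.m_closed unfolding Y_def by blast
    show "\<exists>k. y [^] (p ^ k) \<in> center G" if y: "y \<in> Y" for y
    proof -
      obtain d w where e: "d \<in> D" "w \<in> center G" "y = d \<otimes> w" using y unfolding Y_def by blast
      have "y [^] (p ^ a) = d [^] (p ^ a) \<otimes> w [^] (p ^ a)"
        unfolding e(3) using e center_comm[OF e(2), of d] D.mem_carrier Z.mem_carrier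
        by (intro pow_mult_distrib) simp_all
      also have "\<dots> = w [^] (p ^ a)" using pow_card_subgroup[OF a(1) e(1)] a(2) e(2) Z.mem_carrier by simp
      finally show ?thesis using subgroup_pow_closed[OF subgroup_center e(2)] by metis
    qed
    show "g \<otimes> y \<otimes> inv g \<in> Y" if g: "g \<in> normalizer G D" and y: "y \<in> Y" for g y
    proof -
      obtain d w where e: "d \<in> D" "w \<in> center G" "y = d \<otimes> w" using y unfolding Y_def by blast
      show ?thesis
        using Yc[OF normalizer_conj[OF a(1) g e(1)] e(2)] conj_mult_center[of d w g] e g N.mem_carrier D.mem_carrier
        by simp
    qed
  qed (use DY ZY z in auto)
qed

text \<open>The description by powers serves to show that the subgroup is central, the description
  by exponents to show that an element belongs to it.\<close>

lemma unique_subgroup_of_order_p: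
  assumes p: "Factorial_Ring.prime p" and D: "subgroup D G" "card D = p ^ Suc a"
    and u: "u \<in> D" "D = range (\<lambda>i :: nat. u [^] i)"
  shows "order_p_subgroup G p D = range (\<lambda>i :: nat. (u [^] (p ^ a)) [^] i)"
    and "order_p_subgroup G p D = {x \<in> D. x [^] p = \<one>}"
    and "card (order_p_subgroup G p D) = p"
proof -
  interpret D: subgroup D G by fact
  have uc: "u \<in> carrier G" using u(1) D.mem_carrier by blast
  define v where "v = u [^] (p ^ a)"
  have vD: "v \<in> D" unfolding v_def by (rule subgroup_pow_closed[OF D(1) u(1)])
  then have vc: "v \<in> carrier G" by (rule D.mem_carrier)
  have ordu: "ord u = p ^ Suc a" using generate_pow_card[OF uc] generate_singleton[OF uc] u(2) D(2) by simp
  have p0: "p > 0" "p > 1" using p prime_gt_0_nat prime_gt_1_nat by blast+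
  have "v [^] p = \<one>" unfolding v_def using uc ordu by (simp add: nat_pow_pow pow_eq_id mult.commute)
  then have "ord v dvd p" using vc pow_eq_id by blast
  moreover have "v \<noteq> \<one>"
  proof
    assume "v = \<one>"
    then have "p ^ Suc a dvd p ^ a" unfolding v_def using uc ordu pow_eq_id by metis
    then show False using p0 by (auto dest!: dvd_imp_le)
  qed
  ultimately have "ord v = p" using p vc by (metis ord_eq_1 prime_nat_iff)
  then have cardV: "card (generate G {v}) = p" using generate_pow_card[OF vc] by simp
  define E where "E = {x \<in> D. x [^] p = \<one>}"
  have genE: "generate G {v} = E"
  proof
    show "generate G {v} \<subseteq> E"
    proof
      fix x assume "x \<in> generate G {v}"
      then obtain i :: nat where i: "x = v [^] i" using generate_singleton[OF vc] by blast
      have "x [^] p = (v [^] p) [^] i" unfolding i using vc by (simp add: nat_pow_pow mult.commute)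
      then show "x \<in> E" unfolding E_def using \<open>v [^] p = \<one>\<close> i subgroup_pow_closed[OF D(1) vD] by simp
    qed
    show "E \<subseteq> generate G {v}"
    proof
      fix x assume "x \<in> E"
      then obtain i :: nat where i: "x = u [^] i" "x [^] p = \<one>" unfolding E_def using u(2) by blast
      then have "p ^ Suc a dvd i * p" using uc ordu by (simp add: nat_pow_pow pow_eq_id)
      then have "p ^ a dvd i" using p0 by (simp add: mult.commute)
      then obtain j where "i = p ^ a * j" by blast
      then have "x = v [^] j" unfolding v_def using i(1) uc by (simp add: nat_pow_pow)
      then show "x \<in> generate G {v}" using generate_singleton[OF vc] by blast
    qed
  qed
  have E: "subgroup E G" "E \<subseteq> D" "card E = p"
    using generate_is_subgroup[of "{v}"] vc genE cardV unfolding E_def by auto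
  have "order_p_subgroup G p D = E"
    unfolding order_p_subgroup_def
  proof (rule the_equality)
    show "subgroup E G \<and> E \<subseteq> D \<and> card E = p" using E by blast
    fix Q assume Q: "subgroup Q G \<and> Q \<subseteq> D \<and> card Q = p"
    then have "Q \<subseteq> E" unfolding E_def using pow_card_subgroup[of Q] by auto
    then show "Q = E" using Q E finite_subgroup card_subset_eq by metis
  qed
  then show "order_p_subgroup G p D = range (\<lambda>i :: nat. (u [^] (p ^ a)) [^] i)"
    "order_p_subgroup G p D = {x \<in> D. x [^] p = \<one>}" "card (order_p_subgroup G p D) = p"
    using E genE generate_singleton[OF vc] unfolding E_def v_def by simp_all
qed

lemma normalizer_central:
  assumes "H \<subseteq> center G"
  shows "normalizer G H = carrier G"
proof -
  have "H \<subseteq> carrier G" using assms center_closed by blast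
  then show ?thesis using assms conj_center by (auto simp: normalizer_iff_closed subset_iff)
qed

end

section \<open>Transfer from central extensions to alternating groups\<close>

lemma alt_group_pow: "f [^]\<^bsub>alt_group n\<^esub> (k :: nat) = f ^^ k"
  by (induction k) (simp_all add: alt_group_one alt_group_mult funpow_Suc_right del: funpow.simps(2))

text \<open>The isomorphism of \<open>G Mod center G\<close> with \<open>alt_group n\<close> enters
  only as a surjection whose kernel is the center, which avoids cosets.\<close>

locale alt_quotient = finite_group +
  fixes n :: nat and \<pi> :: "'a \<Rightarrow> nat \<Rightarrow> nat"
  assumes hom: "\<pi> \<in> hom G (alt_group n)"
    and surj: "\<pi> ` carrier G = carrier (alt_group n)"
    and ker: "\<And>x. x \<in> carrier G \<Longrightarrow> \<pi> x = id \<longleftrightarrow> x \<in> center G"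
begin

sublocale \<pi>: group_hom G "alt_group n" \<pi>
  by (intro group_hom.intro group_hom_axioms.intro group_axioms alt_group_is_group hom)

lemma perm: "x \<in> carrier G \<Longrightarrow> \<pi> x permutes {1..n}" "x \<in> carrier G \<Longrightarrow> evenperm (\<pi> x)"
  using \<pi>.hom_closed alt_group_carrier by blast+

lemma perm_mult: "x \<in> carrier G \<Longrightarrow> y \<in> carrier G \<Longrightarrow> \<pi> (x \<otimes> y) = \<pi> x \<circ> \<pi> y"
  using \<pi>.hom_mult by (simp add: alt_group_mult)

lemma perm_pow: "x \<in> carrier G \<Longrightarrow> \<pi> (x [^] (k :: nat)) = \<pi> x ^^ k"
  using \<pi>.hom_nat_pow by (simp add: alt_group_pow)

lemma perm_one: "\<pi> \<one> = id"
  using \<pi>.hom_one by (simp add: alt_group_one)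

lemma lift:
  assumes "f permutes {1..n}" "evenperm f"
  obtains g where "g \<in> carrier G" "\<pi> g = f"
proof -
  have "f \<in> \<pi> ` carrier G" using assms surj alt_group_carrier by simp
  then show ?thesis using that by blast
qed

lemma perm_eq_imp_center:
  assumes "x \<in> carrier G" "y \<in> carrier G" "\<pi> x = \<pi> y"
  shows "inv x \<otimes> y \<in> center G"
proof -
  have "\<pi> (inv x \<otimes> y) = \<pi> (inv x \<otimes> x)" using assms perm_mult by (metis inv_closed)
  then show ?thesis using ker[of "inv x \<otimes> y"] assms perm_one by simp
qed

end

locale cyclic_radical = alt_quotient +
  fixes p a :: nat and D and u
  assumes p: "Factorial_Ring.prime p" and D: "radical_p_subgroup p D G"
    and cardD: "card D = p ^ a"
    and uD: "u \<in> D" and D_powers: "D = range (\<lambda>i :: nat. u [^] i)"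
begin

abbreviation "s \<equiv> \<pi> u"

lemma subgroup_D: "subgroup D G"
  using D by (simp add: radical_p_subgroup_def p_subgroup_def)

lemma u_carrier: "u \<in> carrier G"
  using uD subgroup.mem_carrier[OF subgroup_D] by blast

lemma D_subset: "D \<subseteq> carrier G"
  using subgroup_D subgroup.subset by blast

lemma s_perm: "s permutes {1..n}" "evenperm s" "s ^^ (p ^ a) = id"
proof -
  show "s permutes {1..n}" "evenperm s" using perm u_carrier by blast+
  have "u [^] (p ^ a) = \<one>" using pow_card_subgroup[OF subgroup_D uD] cardD by simp
  then show "s ^^ (p ^ a) = id" using perm_pow[OF u_carrier, of "p ^ a"] perm_one by simp
qed

lemma conj_pow:
  assumes "g \<in> carrier G" "x \<in> carrier G"
  shows "g \<otimes> x [^] (k :: nat) \<otimes> inv g = (g \<otimes> x \<otimes> inv g) [^] k"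
proof (induction k)
  case (Suc k)
  have "g \<otimes> x [^] Suc k \<otimes> inv g = (g \<otimes> x [^] k \<otimes> inv g) \<otimes> (g \<otimes> x \<otimes> inv g)"
    using assms by (simp add: m_assoc)
  then show ?case using Suc by simp
qed (use assms in simp)

text \<open>The factor \<open>z\<close> is a central \<open>p\<close>-element and therefore lies in the radical subgroup \<open>D\<close>.\<close>

lemma lift_normalizes:
  assumes g: "g \<in> carrier G" and r: "\<And>x. \<pi> g (s x) = (s ^^ r) (\<pi> g x)"
  shows "g \<in> normalizer G D" and "\<exists>z\<in>center G \<inter> D. g \<otimes> u \<otimes> inv g = u [^] r \<otimes> z"
proof -
  interpret D: subgroup D G by (rule subgroup_D)
  define c where "c = g \<otimes> u \<otimes> inv g"
  have cc: "c \<in> carrier G" using g u_carrier by (simp add: c_def)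
  have urc: "u [^] r \<in> carrier G" using u_carrier by simp
  have "\<pi> (c \<otimes> g) = \<pi> (g \<otimes> u)" using g u_carrier by (simp add: c_def m_assoc)
  also have "\<dots> = \<pi> (u [^] r \<otimes> g)" using g u_carrier r by (simp add: perm_mult perm_pow fun_eq_iff del: \<pi>.hom_mult)
  finally have "inv (c \<otimes> g) \<otimes> (u [^] r \<otimes> g) \<in> center G"
    using g cc u_carrier by (intro perm_eq_imp_center) simp_all
  \<comment> \<open>A central element is unchanged by conjugation with \<open>g\<close>; this
    removes the trailing factor \<open>g\<close> from both terms.\<close>
  then have z0: "g \<otimes> (inv (c \<otimes> g) \<otimes> (u [^] r \<otimes> g)) \<otimes> inv g = inv (c \<otimes> g) \<otimes> (u [^] r \<otimes> g)"
    and z0c: "inv (c \<otimes> g) \<otimes> (u [^] r \<otimes> g) \<in> center G"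
    using conj_center g by blast+
  have "g \<otimes> (inv (c \<otimes> g) \<otimes> (u [^] r \<otimes> g)) \<otimes> inv g = inv c \<otimes> u [^] r"
    using g cc urc by (simp add: inv_mult_group m_assoc)
  then have "inv c \<otimes> u [^] r \<in> center G" using z0 z0c by simp
  then have "inv (inv c \<otimes> u [^] r) \<in> center G" using subgroup.m_inv_closed[OF subgroup_center] by blast
  moreover define z where "z = inv (u [^] r) \<otimes> c"
  ultimately have zZ: "z \<in> center G" using cc urc by (simp add: inv_mult_group)
  then have zc: "z \<in> carrier G" by (rule center_closed)
  have cz: "c = u [^] r \<otimes> z" using cc urc by (simp add: z_def)
  \<comment> \<open>Being conjugate to \<open>u\<close>, the element \<open>c\<close> is a
    \<open>p\<close>-element; a central factor splits off its powers, so \<open>z\<close> is a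
    \<open>p\<close>-element as well.\<close>
  have "c [^] (p ^ a) = g \<otimes> u [^] (p ^ a) \<otimes> inv g" unfolding c_def using conj_pow[OF g u_carrier] by simp
  also have "\<dots> = \<one>" using pow_card_subgroup[OF subgroup_D uD] cardD g by simp
  finally have "(u [^] r \<otimes> z) [^] (p ^ a) = \<one>" unfolding cz .
  moreover have "(u [^] r \<otimes> z) [^] (p ^ a) = (u [^] r) [^] (p ^ a) \<otimes> z [^] (p ^ a)"
    using center_comm[OF zZ urc] urc zc by (intro pow_mult_distrib) simp_all
  moreover have "(u [^] r) [^] (p ^ a) = \<one>"
    using pow_card_subgroup[OF subgroup_D subgroup_pow_closed[OF subgroup_D uD, of r]] cardD by simp
  ultimately have "z [^] (p ^ a) = \<one>" using zc by simp
  then have zD: "z \<in> D" by (rule p_element_center_in_radical[OF p D zZ])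
  then show "\<exists>z\<in>center G \<inter> D. g \<otimes> u \<otimes> inv g = u [^] r \<otimes> z" using zZ cz unfolding c_def by blast
  have cD: "c \<in> D" unfolding cz using subgroup_pow_closed[OF subgroup_D uD] zD by simp
  have "g \<otimes> d \<otimes> inv g \<in> D" if d: "d \<in> D" for d
  proof -
    obtain i :: nat where "d = u [^] i" using d D_powers by blast
    then show ?thesis using conj_pow[OF g u_carrier, of i] subgroup_pow_closed[OF subgroup_D cD] c_def by simp
  qed
  then show "g \<in> normalizer G D" using g by (simp add: normalizer_iff_closed[OF D_subset])
qed

lemma normalizer_perm:
  assumes g: "g \<in> normalizer G D"
  shows "g \<in> carrier G" "\<exists>r. \<forall>x. \<pi> g (s x) = (s ^^ r) (\<pi> g x)"
proof -
  show gc: "g \<in> carrier G" using g by (simp add: normalizer_iff_closed[OF D_subset])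
  obtain r :: nat where r: "g \<otimes> u \<otimes> inv g = u [^] r"
    using normalizer_conj[OF subgroup_D g uD] D_powers by blast
  have "g \<otimes> u = u [^] r \<otimes> g" using r gc u_carrier by (metis inv_solve_right' m_closed nat_pow_closed)
  then have "\<pi> g \<circ> s = (s ^^ r) \<circ> \<pi> g" using gc u_carrier perm_mult perm_pow by (metis nat_pow_closed)
  then show "\<exists>r. \<forall>x. \<pi> g (s x) = (s ^^ r) (\<pi> g x)" by (metis comp_apply)
qed

text \<open>The conditions in \<open>admissible_perms\<close> are made for this step: the preimage
  \<open>W\<close> of such a set is a subgroup that contains the center and \<open>D\<close>, is a
  \<open>p\<close>-group modulo the center, and is invariant under the normalizer of
  \<open>D\<close>. Hence \<open>W\<close> lies in the product of \<open>D\<close> with the center,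
  whose image consists of the powers of \<open>s\<close>.\<close>

lemma radical_perm_image: "radical_perm p n s"
  unfolding radical_perm_def
proof (intro allI impI ballI)
  fix Y f
  assume adm: "admissible_perms p n s Y" and fY: "f \<in> Y"
  have Y: "g permutes {1..n}" "evenperm g" "\<exists>k. g ^^ (p ^ k) = id" "\<exists>r. \<forall>x. g (s x) = (s ^^ r) (g x)"
    if "g \<in> Y" for g
    using adm that unfolding admissible_perms_def by blast+
  have sY: "s \<in> Y" and comp: "\<And>g h. g \<in> Y \<Longrightarrow> h \<in> Y \<Longrightarrow> g \<circ> h \<in> Y"
    using adm unfolding admissible_perms_def by blast+
  have conj: "h \<in> Y"
    if "t permutes {1..n}" "evenperm t" "\<exists>r. \<forall>x. t (s x) = (s ^^ r) (t x)" "g \<in> Y"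
      "h permutes {1..n}" "evenperm h" "\<forall>x. h (t x) = t (g x)" for t g h
    using adm that unfolding admissible_perms_def by blast
  have Suc_pow: "g ^^ Suc k \<in> Y" if "g \<in> Y" for g k
    using that comp by (induction k) simp_all
  have id: "id \<in> Y"
  proof -
    have "p ^ a > 0" using p prime_gt_0_nat by simp
    then have "s ^^ (p ^ a) \<in> Y" using Suc_pow[OF sY, of "p ^ a - 1"] by simp
    then show ?thesis using s_perm(3) by simp
  qed
  have pow: "g ^^ k \<in> Y" if "g \<in> Y" for g k
    using Suc_pow[OF that, of "k - 1"] id by (cases k) (simp_all add: id_def)
  define W where "W = {y \<in> carrier G. \<pi> y \<in> Y}"
  have W: "subgroup W G"
  proof
    show "W \<subseteq> carrier G" by (auto simp: W_def)
    show "x \<otimes> y \<in> W" if "x \<in> W" "y \<in> W" for x y using that comp by (auto simp: W_def perm_mult simp del: \<pi>.hom_mult)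
    show "\<one> \<in> W" using id by (simp add: W_def alt_group_one)
    show "inv x \<in> W" if x: "x \<in> W" for x
    proof -
      have xc: "x \<in> carrier G" "\<pi> x \<in> Y" using x by (auto simp: W_def)
      then show ?thesis
        unfolding inv_as_pow[OF xc(1)] using pow[OF xc(2)] perm_pow[OF xc(1)] by (simp add: W_def)
    qed
  qed
  have uW: "u \<in> W" using u_carrier sY by (simp add: W_def)
  obtain y where y: "y \<in> carrier G" "\<pi> y = f" by (rule lift[OF Y(1,2)[OF fY]])
  have "\<exists>d\<in>D. \<exists>z\<in>center G. y = d \<otimes> z"
  proof (rule radical_absorbs(1)[OF p D W])
    show "center G \<subseteq> W"
    proof
      fix z assume "z \<in> center G"
      then have "z \<in> carrier G" "\<pi> z = id" using center_closed ker by blast+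
      then show "z \<in> W" using id by (simp add: W_def)
    qed
    show "D \<subseteq> W" using D_powers subgroup_pow_closed[OF W uW] by auto
    show "W \<subseteq> normalizer G D"
    proof
      fix w assume "w \<in> W"
      then have w: "w \<in> carrier G" "\<pi> w \<in> Y" by (auto simp: W_def)
      obtain r where "\<And>x. \<pi> w (s x) = (s ^^ r) (\<pi> w x)" using Y(4)[OF w(2)] by blast
      then show "w \<in> normalizer G D" by (rule lift_normalizes(1)[OF w(1)])
    qed
    show "\<exists>k. w [^] (p ^ k) \<in> center G" if "w \<in> W" for w
    proof -
      have w: "w \<in> carrier G" "\<pi> w \<in> Y" using that by (auto simp: W_def)
      obtain k where "\<pi> w ^^ (p ^ k) = id" using Y(3)[OF w(2)] by blast
      then have "\<pi> (w [^] (p ^ k)) = id" using perm_pow[OF w(1)] by simp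
      then show ?thesis using ker[of "w [^] (p ^ k)"] w by auto
    qed
    show "g \<otimes> w \<otimes> inv g \<in> W" if g: "g \<in> normalizer G D" and wW: "w \<in> W" for g w
    proof -
      have w: "w \<in> carrier G" "\<pi> w \<in> Y" using wW by (auto simp: W_def)
      note gc = normalizer_perm[OF g]
      have c: "g \<otimes> w \<otimes> inv g \<in> carrier G" using gc w by simp
      have "g \<otimes> w \<otimes> inv g \<otimes> g = g \<otimes> w" using gc w by (simp add: m_assoc)
      then have "\<pi> (g \<otimes> w \<otimes> inv g) \<circ> \<pi> g = \<pi> g \<circ> \<pi> w" using perm_mult c gc w by metis
      then have "\<forall>x. \<pi> (g \<otimes> w \<otimes> inv g) (\<pi> g x) = \<pi> g (\<pi> w x)" by (metis comp_apply)
      then have "\<pi> (g \<otimes> w \<otimes> inv g) \<in> Y"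
        by (rule conj[OF perm[OF gc(1)] gc(2) w(2) perm[OF c]])
      then show ?thesis using c by (simp add: W_def)
    qed
    show "y \<in> W" using y fY by (simp add: W_def)
  qed
  then obtain d z where dz: "d \<in> D" "z \<in> center G" "y = d \<otimes> z" by blast
  then obtain i :: nat where "d = u [^] i" using D_powers by blast
  then have "f = s ^^ i"
    using y dz perm_mult[of d z] center_closed[OF dz(2)] ker[of z] perm_pow[OF u_carrier] u_carrier by simp
  then show "\<exists>i. f = s ^^ i" by blast
qed

text \<open>If \<open>D\<close> is not central, then its image has order \<open>p\<close> and is moved by an element of its
  normalizer, which yields an element of order \<open>p\<close> of \<open>D\<close> outside the center. Since \<open>D\<close> is cyclic, it
  meets the center trivially.\<close>

lemma normalizer_order_p_subgroup:
  assumes n: "n \<ge> 5" and "D \<noteq> {\<one>}"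
  shows "normalizer G (order_p_subgroup G p D) = normalizer G D"
proof -
  interpret D: subgroup D G by (rule subgroup_D)
  have "a \<noteq> 0"
  proof
    assume "a = 0"
    then have "D = {\<one>}" using cardD D.one_closed card_1_singletonE by (metis power_0 singletonD)
    then show False using assms by simp
  qed
  then obtain b where b: "a = Suc b" using not0_implies_Suc by blast
  note D1 = unique_subgroup_of_order_p[OF p subgroup_D cardD[unfolded b] uD D_powers]
  let ?D1 = "order_p_subgroup G p D"
  have D1D: "?D1 \<subseteq> D" unfolding D1(2) by blast
  show ?thesis
  proof (cases "s = id")
    case True
    then have "u \<in> center G" using ker u_carrier by blast
    then have "D \<subseteq> center G" using D_powers subgroup_pow_closed[OF subgroup_center] by auto
    then show ?thesis using normalizer_central D1D by (metis order_trans)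
  next
    case False
    have "odd p"
    proof
      assume "even p"
      then have "p = 2" using p primes_dvd_imp_eq[of 2 p] two_is_prime_nat by simp
      then show False using radical_perm_two[OF s_perm(1,2), of a] s_perm(3) radical_perm_image False by simp
    qed
    note odd = radical_perm_odd[OF p this s_perm radical_perm_image False n]
    obtain f r where f: "f permutes {1..n}" "evenperm f" "\<And>x. f (s x) = (s ^^ r) (f x)" "s ^^ r \<noteq> s"
      using odd(2) by blast
    obtain g where g: "g \<in> carrier G" "\<pi> g = f" by (rule lift[OF f(1,2)])
    obtain z where z: "z \<in> center G" "z \<in> D" "g \<otimes> u \<otimes> inv g = u [^] r \<otimes> z"
      using lift_normalizes(2)[OF g(1), of r] f(3) g(2) by blast
    have upZ: "u [^] p \<in> center G"
      using ker[of "u [^] p"] u_carrier perm_pow[OF u_carrier] odd(1) by simp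
    have zc: "z \<in> carrier G" using z(1) center_closed by blast
    define c where "c = u [^] r \<otimes> z"
    have cD: "c \<in> D" unfolding c_def using subgroup_pow_closed[OF subgroup_D uD] z(2) by simp
    have cc: "c \<in> carrier G" using cD by simp
    \<comment> \<open>A commutator of \<open>u\<close> and \<open>g\<close>. Since
      \<open>u [^] p\<close> is central, conjugation by \<open>g\<close> leaves it fixed, so
      \<open>w\<close> has order dividing \<open>p\<close>; its image is the quotient of
      \<open>s ^^ r\<close> by \<open>s\<close>, which is not trivial.\<close>
    define w where "w = inv u \<otimes> c"
    have wD: "w \<in> D" unfolding w_def using cD uD by simp
    have cu: "inv u \<otimes> c = c \<otimes> inv u"
    proof -
      obtain i :: nat where i: "c = u [^] i" using cD D_powers by blast
      have "c \<otimes> u = u \<otimes> c" unfolding i using u_carrier nat_pow_Suc2[OF u_carrier, of i] by simp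
      then show ?thesis using u_carrier cc by (metis inv_closed inv_solve_left inv_solve_right m_assoc m_closed)
    qed
    have "c [^] p = g \<otimes> u [^] p \<otimes> inv g"
      unfolding c_def z(3)[symmetric] using conj_pow[OF g(1) u_carrier] by simp
    also have "\<dots> = u [^] p" by (rule conj_center[OF upZ g(1)])
    finally have "c [^] p = u [^] p" .
    moreover have "w [^] p = inv u [^] p \<otimes> c [^] p"
      unfolding w_def using cu cc u_carrier by (intro pow_mult_distrib) simp_all
    ultimately have "w [^] p = \<one>" using u_carrier by (simp add: nat_pow_inv)
    then have wD1: "w \<in> ?D1" unfolding D1(2) using wD by simp
    have "w \<notin> center G"
    proof
      assume "w \<in> center G"
      then have "\<pi> w = id" using ker wD by simp
      have "c = u \<otimes> w" unfolding w_def using cc u_carrier by simp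
      then have "\<pi> c = s" using perm_mult[of u w] u_carrier wD \<open>\<pi> w = id\<close> by simp
      moreover have "\<pi> c = s ^^ r"
        unfolding c_def using perm_mult[of "u [^] r" z] ker[OF zc] z(1) perm_pow[OF u_carrier] u_carrier zc by simp
      ultimately show False using f(4) by simp
    qed
    \<comment> \<open>If the order of \<open>D\<close> exceeded \<open>p\<close>, its subgroup of
      order \<open>p\<close> would consist of powers of the central element \<open>u [^] p\<close>,
      but it contains \<open>w\<close>.\<close>
    have "b = 0"
    proof (rule ccontr)
      assume "b \<noteq> 0"
      then obtain b' where b': "b = Suc b'" using not0_implies_Suc by blast
      have "u [^] (p ^ b) = (u [^] p) [^] (p ^ b')" using u_carrier by (simp add: nat_pow_pow b')
      then have "u [^] (p ^ b) \<in> center G" using subgroup_pow_closed[OF subgroup_center upZ] by metis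
      then have "?D1 \<subseteq> center G" unfolding D1(1) using subgroup_pow_closed[OF subgroup_center] by auto
      then show False using wD1 \<open>w \<notin> center G\<close> by blast
    qed
    then have "?D1 = D" using D1(3) cardD b D1D finite_subgroup[OF subgroup_D] by (intro card_subset_eq) simp_all
    then show ?thesis by simp
  qed
qed

end

lemma alt_quotientI:
  assumes G: "group G" "finite (carrier G)" and iso: "(G Mod center G) \<cong> alt_group n"
  obtains \<pi> where "alt_quotient G n \<pi>"
proof -
  interpret finite_group G using G by (simp add: finite_group_def finite_group_axioms_def)
  interpret Z: normal "center G" G by (rule normal_center)
  obtain \<psi> where \<psi>: "\<psi> \<in> iso (G Mod center G) (alt_group n)" using iso by (auto simp: is_iso_def)
  define \<pi> where "\<pi> = \<psi> \<circ> (\<lambda>a. center G #>\<^bsub>G\<^esub> a)"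
  have carr: "carrier (G Mod center G) = (\<lambda>a. center G #>\<^bsub>G\<^esub> a) ` carrier G"
    by (auto simp: FactGroup_def RCOSETS_def)
  have bij: "bij_betw \<psi> (carrier (G Mod center G)) (carrier (alt_group n))"
    and \<psi>hom: "\<psi> \<in> hom (G Mod center G) (alt_group n)" using \<psi> by (auto simp: iso_def)
  have "alt_quotient G n \<pi>"
  proof (intro alt_quotient.intro finite_group_axioms alt_quotient_axioms.intro)
    show "\<pi> \<in> hom G (alt_group n)" unfolding \<pi>_def by (rule Group.hom_compose[OF Z.r_coset_hom_Mod \<psi>hom])
    show "\<pi> ` carrier G = carrier (alt_group n)"
      using bij unfolding bij_betw_def carr \<pi>_def by (simp add: image_comp)
    fix x assume x: "x \<in> carrier G"
    have one: "\<psi> (center G #>\<^bsub>G\<^esub> \<one>\<^bsub>G\<^esub>) = id"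
      using hom_one[OF \<psi>hom Z.factorgroup_is_group alt_group_is_group] Z.subset
      by (simp add: FactGroup_def alt_group_one coset_mult_one)
    have "\<pi> x = id \<longleftrightarrow> \<psi> (center G #>\<^bsub>G\<^esub> x) = \<psi> (center G #>\<^bsub>G\<^esub> \<one>\<^bsub>G\<^esub>)"
      by (simp add: one \<pi>_def)
    also have "\<dots> \<longleftrightarrow> center G #>\<^bsub>G\<^esub> x = center G #>\<^bsub>G\<^esub> \<one>\<^bsub>G\<^esub>"
      by (rule inj_on_eq_iff[OF bij_betw_imp_inj_on[OF bij]]) (use x in \<open>auto simp: carr\<close>)
    also have "\<dots> \<longleftrightarrow> x \<in> center G"
    proof
      assume "center G #>\<^bsub>G\<^esub> x = center G #>\<^bsub>G\<^esub> \<one>\<^bsub>G\<^esub>"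
      then show "x \<in> center G" using rcos_self[OF x Z.subgroup_axioms] coset_mult_one[OF Z.subset] by simp
    next
      assume "x \<in> center G"
      then show "center G #>\<^bsub>G\<^esub> x = center G #>\<^bsub>G\<^esub> \<one>\<^bsub>G\<^esub>"
        using Z.rcos_const[OF group_axioms] coset_mult_one[OF Z.subset] by simp
    qed
    finally show "\<pi> x = id \<longleftrightarrow> x \<in> center G" .
  qed
  then show ?thesis by (rule that)
qed

theorem proposition6p2:
  fixes p n :: nat
    and G :: "'g monoid"
    and B :: "'g \<Rightarrow> 'k::alg_closed_field"
    and D :: "'g set"
  assumes "Factorial_Ring.prime p"
    and "CHAR('k) = p"
    and "finite (carrier G)"
    and "quasisimple G"
    and "is_block G B"
    and "is_defect_group G B D"
    and "D \<noteq> {\<one>\<^bsub>G\<^esub>}"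
    and "cyclic_group (G\<lparr>carrier := D\<rparr>)"
    and "n \<ge> 5"
    and "(G Mod center G) \<cong> alt_group n"
  shows "module_iso (group_algebra (G\<lparr>carrier := D\<rparr>)) (W_module G B D)
           (trivial_module (G\<lparr>carrier := D\<rparr>))"
proof -
  have G: "group G" using assms(4) by (simp add: quasisimple_def)
  interpret finite_group G using G assms(3) by (simp add: finite_group_def finite_group_axioms_def)
  obtain \<pi> where "alt_quotient G n \<pi>" by (rule alt_quotientI[OF G assms(3,10)])
  then interpret alt_quotient G n \<pi> .
  have D: "radical_p_subgroup p D G" by (rule defect_group_radical_p_subgroup[OF assms(5,6,1,2)])
  then obtain a where a: "subgroup D G" "card D = p ^ a"
    by (auto simp: radical_p_subgroup_def p_subgroup_def)
  interpret K: group "G\<lparr>carrier := D\<rparr>" by (rule subgroup_imp_group[OF a(1)])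
  obtain u where u: "u \<in> D" "D = range (\<lambda>i :: int. u [^]\<^bsub>G\<lparr>carrier := D\<rparr>\<^esub> i)"
    using assms(8) K.cyclic_group by auto
  have fin: "finite D" by (rule finite_subgroup[OF a(1)])
  \<comment> \<open>Cyclicity is given with integer exponents; finiteness of \<open>D\<close> allows
    natural exponents, which match iterates of permutations.\<close>
  have "D = generate (G\<lparr>carrier := D\<rparr>) {u}" using K.generate_pow[of u] u by auto
  also have "\<dots> = {u [^]\<^bsub>G\<lparr>carrier := D\<rparr>\<^esub> k | k :: nat. k \<in> UNIV}"
    using K.generate_pow_nat[of u] K.ord_ge_1[of u] u(1) fin by simp
  also have "\<dots> = range (\<lambda>i :: nat. u [^]\<^bsub>G\<^esub> i)" by (auto simp: nat_pow_def)
  finally have Du: "D = range (\<lambda>i :: nat. u [^]\<^bsub>G\<^esub> i)" .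
  interpret cyclic_radical G n \<pi> p a D u
    by unfold_locales (use assms(1) D a(2) u(1) Du in auto)
  show ?thesis
    by (rule W_module_trivial[OF assms(5,6,1,2) normalizer_order_p_subgroup[OF assms(9,7)]])
qed

end
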